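(* In quantitative reachability games, the subgame-perfect rational verification problem and the deterministic subgame-perfect rational verification problem are both $\mathsf{PSPACE}$-complete.
   Context: Games. A game $G=(\Pi,V,(V_i)_{i\in\Pi},E,\mu)$ consists of a finite set $\Pi$ of players, a finite directed graph $(V,E)$ in which every vertex has at least one outgoing edge, a partition $(V_i)_{i\in\Pi}$ of $V$ (parts may be empty; $V_i$ is controlled by $i$), and a payoff function $\mu=(\mu_i)_{i\in\Pi}$ mapping plays (infinite paths) to $\mathbb R^\Pi$. Histories are finite paths. $G_{\upharpoonright v_0}$ denotes the game with initial vertex $v_0$ (plays and histories start at $v_0$). It is a quantitative reachability game if each player $i$ has a target set $T_i\subseteq V$ such that $\mu_i(\pi)=\frac1{1+\inf\{n\in\mathbb N:\pi_n\in T_i\}}$ for every play $\pi$ (with $\inf\emptyset=+\infty$ and $\frac1{+\infty}=0$). Strategies and equilibria. A strategy $\sigma_i$ of player $i$ maps each history $hv$ from $v_0$ with $v\in V_i$ to a successor of $v$; a profile $\bar\sigma=(\sigma_i)_{i\in\Pi}$ has a unique compatible play, its outcome $\langle\bar\sigma\rangle$. A distinguished player, Leader, is denoted $\mathbb L\in\Pi$. $\bar\sigma$ is an $\mathbb L$-fixed NE if $\mu_i(\langle\sigma'_i,\bar\sigma_{-i}\rangle)\le\mu_i(\langle\bar\sigma\rangle)$ for all players $i\ne\mathbb L$ and all strategies $\sigma'_i$. For a history $hv$, the subgame after $hv$ is the game on the same arena from $v$ with payoff $\pi\mapsto\mu(h\pi)$, and $\bar\sigma_{\upharpoonright hv}(h')=\bar\sigma(hh')$.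 $\bar\sigma$ is an $\mathbb L$-fixed SPE if $\bar\sigma_{\upharpoonright h}$ is an $\mathbb L$-fixed NE in the subgame after $h$ for every history $h$ from $v_0$ compatible with $\sigma_{\mathbb L}$. Mealy machines. A Mealy machine for Leader on $G$ is $M=(Q,q_0,\Delta)$ with $Q$ finite, $q_0\in Q$, $\Delta\subseteq(Q\times(V\setminus V_{\mathbb L})\times Q)\cup(Q\times V_{\mathbb L}\times Q\times V)$ with $uv\in E$ for every $(p,u,q,v)\in\Delta$, such that for all $p\in Q,u\in V$ there is at least one transition $(p,u,q)$ or $(p,u,q,v)$ in $\Delta$; it is deterministic if there is exactly one for all $p,u$. $\sigma_{\mathbb L}\in\mathrm{Comp}_{\upharpoonright v_0}(M)$ if there is a map $h\mapsto q_h\in Q$ (on histories from $v_0$ and the empty history, the latter mapped to $q_0$) such that, for each history $hv$ from $v_0$, $(q_h,v,q_{hv})\in\Delta$ if $v\notin V_{\mathbb L}$ and $(q_h,v,q_{hv},\sigma_{\mathbb L}(hv))\in\Delta$ if $v\in V_{\mathbb L}$. Problem. The (deterministic) subgame-perfect rational verification problem in a class $\mathcal C$: given $G_{\upharpoonright v_0}\in\mathcal C$, $t\in\mathbb Q$ and a (deterministic) Mealy machine $M$ for Leader on $G$, does every $\mathbb L$-fixed SPE $\bar\sigma$ with $\sigma_{\mathbb L}\in\mathrm{Comp}_{\upharpoonright v_0}(M)$ satisfy $\mu_{\mathbb L}(\langle\bar\sigma\rangle)>t$? *)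

theory Defs
  imports
    "HOL-Analysis.Analysis"
    "HOL-Library.Omega_Words_Fun"
begin

section \<open>Games on graphs\<close>

record ('p, 'v) game =
  players :: "'p set"
  verts :: "'v set"
  controlled :: "'p \<Rightarrow> 'v set"
  edges :: "('v \<times> 'v) set"
  payoff :: "'p \<Rightarrow> (nat \<Rightarrow> 'v) \<Rightarrow> real"

definition wf_game :: "('p, 'v) game \<Rightarrow> bool" where
  "wf_game G \<longleftrightarrow>
     finite (players G) \<and> finite (verts G) \<and> edges G \<subseteq> verts G \<times> verts G \<and>
     (\<forall>v\<in>verts G. \<exists>w. (v, w) \<in> edges G) \<and>
     (\<Union>i\<in>players G. controlled G i) = verts G \<and>
     (\<forall>i\<in>players G. \<forall>j\<in>players G. i \<noteq> j \<longrightarrow> controlled G i \<inter> controlled G j = {})"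

definition play :: "('p, 'v) game \<Rightarrow> (nat \<Rightarrow> 'v) \<Rightarrow> bool" where
  "play G \<pi> \<longleftrightarrow> (\<forall>n. \<pi> n \<in> verts G \<and> (\<pi> n, \<pi> (Suc n)) \<in> edges G)"

definition play_from :: "('p, 'v) game \<Rightarrow> 'v \<Rightarrow> (nat \<Rightarrow> 'v) \<Rightarrow> bool" where
  "play_from G v0 \<pi> \<longleftrightarrow> play G \<pi> \<and> \<pi> 0 = v0"

definition history_from :: "('p, 'v) game \<Rightarrow> 'v \<Rightarrow> 'v list \<Rightarrow> bool" where
  "history_from G v0 h \<longleftrightarrow>
     h \<noteq> [] \<and> hd h = v0 \<and> set h \<subseteq> verts G \<and> successively (\<lambda>u v. (u, v) \<in> edges G) h"

definition reach_payoff :: "'v set \<Rightarrow> (nat \<Rightarrow> 'v) \<Rightarrow> real" where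
  "reach_payoff T \<pi> = real_of_ereal (1 / (1 + (INF n\<in>{n. \<pi> n \<in> T}. ereal (real n))))"

definition quantitative_reachability_game :: "('p, 'v) game \<Rightarrow> ('p \<Rightarrow> 'v set) \<Rightarrow> bool" where
  "quantitative_reachability_game G T \<longleftrightarrow> wf_game G \<and>
     (\<forall>i\<in>players G. T i \<subseteq> verts G \<and> (\<forall>\<pi>. play G \<pi> \<longrightarrow> payoff G i \<pi> = reach_payoff (T i) \<pi>))"


section \<open>Strategies and equilibria\<close>

text \<open>Strategies are total functions on lists; their values on lists that are not histories from
  the initial vertex ending in a vertex of the player are never used.\<close>

definition strategy :: "('p, 'v) game \<Rightarrow> 'v \<Rightarrow> 'p \<Rightarrow> ('v list \<Rightarrow> 'v) \<Rightarrow> bool" where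
  "strategy G v0 i s \<longleftrightarrow>
     (\<forall>h v. history_from G v0 (h @ [v]) \<and> v \<in> controlled G i \<longrightarrow> (v, s (h @ [v])) \<in> edges G)"

definition profile :: "('p, 'v) game \<Rightarrow> 'v \<Rightarrow> ('p \<Rightarrow> 'v list \<Rightarrow> 'v) \<Rightarrow> bool" where
  "profile G v0 \<sigma> \<longleftrightarrow> (\<forall>i\<in>players G. strategy G v0 i (\<sigma> i))"

definition compatible_play ::
    "('p, 'v) game \<Rightarrow> 'p \<Rightarrow> ('v list \<Rightarrow> 'v) \<Rightarrow> (nat \<Rightarrow> 'v) \<Rightarrow> bool" where
  "compatible_play G i s \<pi> \<longleftrightarrow>
     (\<forall>n. \<pi> n \<in> controlled G i \<longrightarrow> \<pi> (Suc n) = s (prefix (Suc n) \<pi>))"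

definition compatible_history ::
    "('p, 'v) game \<Rightarrow> 'p \<Rightarrow> ('v list \<Rightarrow> 'v) \<Rightarrow> 'v list \<Rightarrow> bool" where
  "compatible_history G i s h \<longleftrightarrow>
     (\<forall>k. Suc k < length h \<and> h ! k \<in> controlled G i \<longrightarrow> h ! Suc k = s (take (Suc k) h))"

text \<open>The description is proper for strategy profiles of well-formed games: see
  \<open>ex1_outcome\<close> below.\<close>

definition outcome :: "('p, 'v) game \<Rightarrow> 'v \<Rightarrow> ('p \<Rightarrow> 'v list \<Rightarrow> 'v) \<Rightarrow> nat \<Rightarrow> 'v" where
  "outcome G v0 \<sigma> =
     (THE \<pi>. play_from G v0 \<pi> \<and> (\<forall>i\<in>players G. compatible_play G i (\<sigma> i) \<pi>))"

definition fixed_NE ::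
    "('p, 'v) game \<Rightarrow> 'v \<Rightarrow> 'p \<Rightarrow> ('p \<Rightarrow> 'v list \<Rightarrow> 'v) \<Rightarrow> bool" where
  "fixed_NE G v0 L \<sigma> \<longleftrightarrow> profile G v0 \<sigma> \<and>
     (\<forall>i\<in>players G - {L}. \<forall>s. strategy G v0 i s \<longrightarrow>
        payoff G i (outcome G v0 (\<sigma>(i := s))) \<le> payoff G i (outcome G v0 \<sigma>))"

text \<open>For a history \<open>h @ [v]\<close>, the subgame and the restricted profile take \<open>h\<close> only: plays and
  histories of the subgame start with \<open>v\<close> again.\<close>

definition subgame :: "('p, 'v) game \<Rightarrow> 'v list \<Rightarrow> ('p, 'v) game" where
  "subgame G h = G\<lparr>payoff := (\<lambda>i \<pi>. payoff G i (h \<frown> \<pi>))\<rparr>"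

definition subprofile ::
    "('p \<Rightarrow> 'v list \<Rightarrow> 'v) \<Rightarrow> 'v list \<Rightarrow> 'p \<Rightarrow> 'v list \<Rightarrow> 'v" where
  "subprofile \<sigma> h = (\<lambda>i h'. \<sigma> i (h @ h'))"

definition fixed_SPE ::
    "('p, 'v) game \<Rightarrow> 'v \<Rightarrow> 'p \<Rightarrow> ('p \<Rightarrow> 'v list \<Rightarrow> 'v) \<Rightarrow> bool" where
  "fixed_SPE G v0 L \<sigma> \<longleftrightarrow> profile G v0 \<sigma> \<and>
     (\<forall>h v. history_from G v0 (h @ [v]) \<and> compatible_history G L (\<sigma> L) (h @ [v]) \<longrightarrow>
        fixed_NE (subgame G h) v L (subprofile \<sigma> h))"


section \<open>Mealy machines\<close>

text \<open>A transition \<open>(p, u, q)\<close> is represented by \<open>(p, u, q, None)\<close>, a transition \<open>(p, u, q, v)\<close>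
  by \<open>(p, u, q, Some v)\<close>.\<close>

record ('q, 'v) mealy =
  mstates :: "'q set"
  mstart :: "'q"
  mtrans :: "('q \<times> 'v \<times> 'q \<times> 'v option) set"

definition wf_mealy :: "('p, 'v) game \<Rightarrow> 'p \<Rightarrow> ('q, 'v) mealy \<Rightarrow> bool" where
  "wf_mealy G L M \<longleftrightarrow>
     finite (mstates M) \<and> mstart M \<in> mstates M \<and>
     mtrans M \<subseteq>
       {(p, u, q, None) |p u q. p \<in> mstates M \<and> u \<in> verts G - controlled G L \<and> q \<in> mstates M} \<union>
       {(p, u, q, Some v) |p u q v. p \<in> mstates M \<and> u \<in> controlled G L \<and> q \<in> mstates M \<and>
          v \<in> verts G \<and> (u, v) \<in> edges G} \<and>
     (\<forall>p\<in>mstates M. \<forall>u\<in>verts G. \<exists>q a. (p, u, q, a) \<in> mtrans M)"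

definition deterministic_mealy :: "('p, 'v) game \<Rightarrow> ('q, 'v) mealy \<Rightarrow> bool" where
  "deterministic_mealy G M \<longleftrightarrow>
     (\<forall>p\<in>mstates M. \<forall>u\<in>verts G. \<exists>!(q, a). (p, u, q, a) \<in> mtrans M)"

definition Comp ::
    "('p, 'v) game \<Rightarrow> 'v \<Rightarrow> 'p \<Rightarrow> ('q, 'v) mealy \<Rightarrow> ('v list \<Rightarrow> 'v) set" where
  "Comp G v0 L M = {s. strategy G v0 L s \<and>
     (\<exists>st. st [] = mstart M \<and>
        (\<forall>h v. history_from G v0 (h @ [v]) \<longrightarrow>
           (st h, v, st (h @ [v]), if v \<in> controlled G L then Some (s (h @ [v])) else None)
             \<in> mtrans M))}"

definition all_fixed_SPE_above ::
    "('p, 'v) game \<Rightarrow> 'v \<Rightarrow> 'p \<Rightarrow> rat \<Rightarrow> ('q, 'v) mealy \<Rightarrow> bool" where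
  "all_fixed_SPE_above G v0 L t M \<longleftrightarrow>
     (\<forall>\<sigma>. fixed_SPE G v0 L \<sigma> \<and> \<sigma> L \<in> Comp G v0 L M \<longrightarrow>
        payoff G L (outcome G v0 \<sigma>) > of_rat t)"


section \<open>Turing machines, PSPACE and polynomial-time reductions\<close>

text \<open>Deterministic multi-tape machines with two-way infinite tapes. States and symbols are initial
  segments of the naturals. State 0 is initial, state 1 accepts, state 2 rejects; symbol 0 is the
  blank, symbols 1 and 2 are the input bits. Tape 0 holds the input, the last tape the output.\<close>

record machine =
  num_tapes :: nat
  num_symbols :: nat
  num_states :: nat
  delta :: "nat \<Rightarrow> nat list \<Rightarrow> nat \<times> (nat \<times> int) list"

type_synonym config = "nat \<times> ((int \<Rightarrow> nat) \<times> int) list"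

definition wf_machine :: "machine \<Rightarrow> bool" where
  "wf_machine M \<longleftrightarrow> num_tapes M \<ge> 1 \<and> num_symbols M \<ge> 3 \<and> num_states M \<ge> 3 \<and>
     (\<forall>q < num_states M. \<forall>ss. length ss = num_tapes M \<and> set ss \<subseteq> {..<num_symbols M} \<longrightarrow>
        (case delta M q ss of (q', acts) \<Rightarrow> q' < num_states M \<and> length acts = num_tapes M \<and>
           set acts \<subseteq> {..<num_symbols M} \<times> {- 1, 0, 1}))"

definition halted :: "config \<Rightarrow> bool" where
  "halted c \<longleftrightarrow> fst c = 1 \<or> fst c = 2"

definition step :: "machine \<Rightarrow> config \<Rightarrow> config" where
  "step M c = (if halted c then c else
     (case delta M (fst c) (map (\<lambda>(tp, z). tp z) (snd c)) of (q', acts) \<Rightarrow>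
        (q', map2 (\<lambda>(tp, z) (s, d). (tp(z := s), z + d)) (snd c) acts)))"

definition tape_of :: "bool list \<Rightarrow> int \<Rightarrow> nat" where
  "tape_of x z = (if 0 \<le> z \<and> z < int (length x) then (if x ! nat z then 2 else 1) else 0)"

definition init_config :: "machine \<Rightarrow> bool list \<Rightarrow> config" where
  "init_config M x = (0, (tape_of x, 0) # replicate (num_tapes M - 1) ((\<lambda>_. 0), 0))"

definition run :: "machine \<Rightarrow> bool list \<Rightarrow> nat \<Rightarrow> config" where
  "run M x n = (step M ^^ n) (init_config M x)"

text \<open>Bounding the distance of every head from the origin by \<open>s\<close> amounts, up to a constant factor
  depending on the number of tapes, to bounding the number of visited cells by \<open>s\<close>.\<close>

definition uses_space :: "machine \<Rightarrow> bool list \<Rightarrow> nat \<Rightarrow> bool" where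
  "uses_space M x s \<longleftrightarrow> (\<forall>n. \<forall>(tp, z)\<in>set (snd (run M x n)). \<bar>z\<bar> \<le> int s)"

definition PSPACE :: "bool list set set" where
  "PSPACE = {A. \<exists>M (p :: nat poly). wf_machine M \<and>
     (\<forall>x. uses_space M x (poly p (length x)) \<and>
        (\<exists>n. halted (run M x n) \<and> (fst (run M x n) = 1 \<longleftrightarrow> x \<in> A)))}"

definition polytime_computable :: "(bool list \<Rightarrow> bool list) \<Rightarrow> bool" where
  "polytime_computable f \<longleftrightarrow> (\<exists>M (p :: nat poly). wf_machine M \<and>
     (\<forall>x. \<exists>n \<le> poly p (length x). halted (run M x n) \<and>
        fst (last (snd (run M x n))) = tape_of (f x)))"

definition polytime_reducible :: "bool list set \<Rightarrow> bool list set \<Rightarrow> bool" where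
  "polytime_reducible A B \<longleftrightarrow> (\<exists>f. polytime_computable f \<and> (\<forall>x. x \<in> A \<longleftrightarrow> f x \<in> B))"

definition PSPACE_hard :: "bool list set \<Rightarrow> bool" where
  "PSPACE_hard B \<longleftrightarrow> (\<forall>A\<in>PSPACE. polytime_reducible A B)"

definition PSPACE_complete :: "bool list set \<Rightarrow> bool" where
  "PSPACE_complete B \<longleftrightarrow> B \<in> PSPACE \<and> PSPACE_hard B"


section \<open>Problem instances and their binary encoding\<close>

text \<open>Players, vertices and Mealy states are initial segments of the naturals. There are as many
  vertices as entries in the list of owners, and as many players as entries in the list of target
  sets; the remaining sets are listed explicitly.\<close>

record reach_instance =
  owner_list :: "nat list"
  edge_list :: "(nat \<times> nat) list"
  target_lists :: "nat list list"
  leader :: nat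
  init_vertex :: nat
  threshold :: rat
  num_mstates :: nat
  mstart_state :: nat
  mtrans_list :: "(nat \<times> nat \<times> nat \<times> nat option) list"

definition targets :: "reach_instance \<Rightarrow> nat \<Rightarrow> nat set" where
  "targets I i = set (target_lists I ! i)"

definition game_of :: "reach_instance \<Rightarrow> (nat, nat) game" where
  "game_of I =
     \<lparr>players = {..<length (target_lists I)},
      verts = {..<length (owner_list I)},
      controlled = (\<lambda>i. {v. v < length (owner_list I) \<and> owner_list I ! v = i}),
      edges = set (edge_list I),
      payoff = (\<lambda>i. reach_payoff (targets I i))\<rparr>"

definition mealy_of :: "reach_instance \<Rightarrow> (nat, nat) mealy" where
  "mealy_of I =
     \<lparr>mstates = {..<num_mstates I}, mstart = mstart_state I, mtrans = set (mtrans_list I)\<rparr>"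

definition valid_instance :: "reach_instance \<Rightarrow> bool" where
  "valid_instance I \<longleftrightarrow>
     quantitative_reachability_game (game_of I) (targets I) \<and>
     leader I \<in> players (game_of I) \<and> init_vertex I \<in> verts (game_of I) \<and>
     wf_mealy (game_of I) (leader I) (mealy_of I)"

text \<open>Instances become trees, which are written over the symbols 0, 1, opening and closing bracket,
  each symbol taking two bits. Numbers are in binary, least significant bit first.\<close>

datatype tree = Num nat | Node "tree list"

fun binary :: "nat \<Rightarrow> bool list" where
  "binary n = (if n < 2 then [n = 1] else odd n # binary (n div 2))"

declare binary.simps [simp del]

fun serialize :: "tree \<Rightarrow> bool list" where
  "serialize (Num n) =
     [True, False] @ concat (map (\<lambda>b. [False, b]) (binary n)) @ [True, True]"
| "serialize (Node ts) = [True, False] @ concat (map serialize ts) @ [True, True]"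

definition nats_tree :: "nat list \<Rightarrow> tree" where
  "nats_tree ns = Node (map Num ns)"

definition rat_tree :: "rat \<Rightarrow> tree" where
  "rat_tree r = (case quotient_of r of (a, b) \<Rightarrow>
     nats_tree [if a < 0 then 1 else 0, nat \<bar>a\<bar>, nat b])"

definition trans_tree :: "nat \<times> nat \<times> nat \<times> nat option \<Rightarrow> tree" where
  "trans_tree = (\<lambda>(p, u, q, a). case a of
     None \<Rightarrow> nats_tree [p, u, q] | Some v \<Rightarrow> nats_tree [p, u, q, v])"

definition instance_tree :: "reach_instance \<Rightarrow> tree" where
  "instance_tree I = Node
     [nats_tree (owner_list I),
      Node (map (\<lambda>(u, v). nats_tree [u, v]) (edge_list I)),
      Node (map nats_tree (target_lists I)),
      Num (leader I),
      Num (init_vertex I),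
      rat_tree (threshold I),
      Num (num_mstates I),
      Num (mstart_state I),
      Node (map trans_tree (mtrans_list I))]"

definition encode :: "reach_instance \<Rightarrow> bool list" where
  "encode I = serialize (instance_tree I)"

definition reach_SP_verification :: "bool list set" where
  "reach_SP_verification = {encode I |I. valid_instance I \<and>
     all_fixed_SPE_above (game_of I) (init_vertex I) (leader I) (threshold I) (mealy_of I)}"

definition reach_det_SP_verification :: "bool list set" where
  "reach_det_SP_verification = {encode I |I. valid_instance I \<and>
     deterministic_mealy (game_of I) (mealy_of I) \<and>
     all_fixed_SPE_above (game_of I) (init_vertex I) (leader I) (threshold I) (mealy_of I)}"


section \<open>Sanity checks for the definitions\<close>

lemma reach_payoff_alt:
  "reach_payoff T \<pi> = (if \<exists>n. \<pi> n \<in> T then 1 / (1 + real (LEAST n. \<pi> n \<in> T)) else 0)"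
proof (cases "\<exists>n. \<pi> n \<in> T")
  case True
  define m where "m = (LEAST n. \<pi> n \<in> T)"
  have m: "\<pi> m \<in> T" "\<And>n. \<pi> n \<in> T \<Longrightarrow> m \<le> n"
    unfolding m_def using True by (auto intro: LeastI_ex Least_le)
  have "(INF n\<in>{n. \<pi> n \<in> T}. ereal (real n)) = ereal (real m)"
    by (rule antisym) (use m in \<open>auto intro!: INF_lower2 INF_greatest\<close>)
  then show ?thesis
    using True by (simp add: reach_payoff_def m_def one_ereal_def)
next
  case False
  then show ?thesis by (simp add: reach_payoff_def top_ereal_def)
qed

primrec outcome_history ::
    "('p, 'v) game \<Rightarrow> 'v \<Rightarrow> ('p \<Rightarrow> 'v list \<Rightarrow> 'v) \<Rightarrow> nat \<Rightarrow> 'v list" where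
  "outcome_history G v0 \<sigma> 0 = [v0]"
| "outcome_history G v0 \<sigma> (Suc n) = (let h = outcome_history G v0 \<sigma> n in
     h @ [\<sigma> (SOME i. i \<in> players G \<and> last h \<in> controlled G i) h])"

lemma ex1_outcome:
  assumes wf: "wf_game G" and v0: "v0 \<in> verts G" and prof: "profile G v0 \<sigma>"
  shows "\<exists>!\<pi>. play_from G v0 \<pi> \<and> (\<forall>i\<in>players G. compatible_play G i (\<sigma> i) \<pi>)"
proof -
  define H where "H = outcome_history G v0 \<sigma>"
  define ow where "ow v = (SOME i. i \<in> players G \<and> v \<in> controlled G i)" for v
  define \<pi> where "\<pi> n = last (H n)" for n
  have H0: "H 0 = [v0]" and HS: "H (Suc n) = H n @ [\<sigma> (ow (last (H n))) (H n)]" for n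
    by (simp_all add: H_def ow_def Let_def)
  have ow: "ow v \<in> players G" "v \<in> controlled G (ow v)" if "v \<in> verts G" for v
  proof -
    have "\<exists>i. i \<in> players G \<and> v \<in> controlled G i"
      using wf that unfolding wf_game_def by blast
    from someI_ex[OF this] show "ow v \<in> players G" "v \<in> controlled G (ow v)"
      by (auto simp: ow_def)
  qed
  have ow_unique: "ow v = i" if "i \<in> players G" "v \<in> controlled G i" for i v
  proof -
    have "v \<in> verts G" using wf that unfolding wf_game_def by blast
    with ow[of v] that wf show ?thesis unfolding wf_game_def by blast
  qed
  have \<pi>0: "\<pi> 0 = v0" by (simp add: \<pi>_def H0)
  have H_prefix: "H n = prefix (Suc n) \<pi>" for n
  proof (induction n)
    case (Suc n)
    have "prefix (Suc (Suc n)) \<pi> = prefix (Suc n) \<pi> @ [\<pi> (Suc n)]"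
      by (simp add: subsequence_def)
    moreover have "H (Suc n) = H n @ [\<pi> (Suc n)]"
      by (simp add: HS \<pi>_def)
    ultimately show ?case by (simp only: Suc)
  qed (simp add: H0 \<pi>_def)
  have step_edge: "(last h, \<sigma> (ow (last h)) h) \<in> edges G"
    if h: "history_from G v0 h" and v: "last h \<in> verts G" for h
  proof -
    have "strategy G v0 (ow (last h)) (\<sigma> (ow (last h)))"
      using prof ow(1)[OF v] by (simp add: profile_def)
    moreover have "butlast h @ [last h] = h" using h by (simp add: history_from_def)
    ultimately show ?thesis
      using h ow(2)[OF v] unfolding strategy_def by (metis (no_types))
  qed
  have hist: "history_from G v0 (H n) \<and> last (H n) \<in> verts G" for n
  proof (induction n)
    case 0
    then show ?case using v0 by (simp add: H0 history_from_def)
  next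
    case (Suc n)
    let ?v = "last (H n)"
    from Suc have ne: "H n \<noteq> []" by (simp add: history_from_def)
    have e: "(?v, \<sigma> (ow ?v) (H n)) \<in> edges G"
      using step_edge[of "H n"] Suc by simp
    moreover have "edges G \<subseteq> verts G \<times> verts G" using wf by (simp add: wf_game_def)
    ultimately have "\<sigma> (ow ?v) (H n) \<in> verts G" by blast
    with Suc ne e show ?case by (simp add: HS history_from_def successively_append_iff)
  qed
  have \<pi>S: "\<pi> (Suc n) = \<sigma> (ow (\<pi> n)) (prefix (Suc n) \<pi>)" for n
  proof -
    have "\<pi> (Suc n) = \<sigma> (ow (\<pi> n)) (H n)" by (simp add: HS \<pi>_def)
    then show ?thesis by (simp only: H_prefix)
  qed
  have "play_from G v0 \<pi>"
    unfolding play_from_def play_def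
  proof (intro conjI allI)
    fix n
    show v: "\<pi> n \<in> verts G" using hist by (simp add: \<pi>_def)
    have "(\<pi> n, \<sigma> (ow (\<pi> n)) (H n)) \<in> edges G"
      using step_edge hist[of n] by (simp add: \<pi>_def)
    then show "(\<pi> n, \<pi> (Suc n)) \<in> edges G" by (simp only: \<pi>S H_prefix)
  qed (simp add: \<pi>_def H0)
  moreover have "compatible_play G i (\<sigma> i) \<pi>" if "i \<in> players G" for i
    unfolding compatible_play_def using \<pi>S ow_unique[OF that] by metis
  moreover have "\<rho> = \<pi>"
    if \<rho>: "play_from G v0 \<rho>" "\<forall>i\<in>players G. compatible_play G i (\<sigma> i) \<rho>" for \<rho>
  proof -
    have "prefix (Suc n) \<rho> = prefix (Suc n) \<pi>" for n
    proof (induction n)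
      case 0
      then show ?case using \<rho>(1) \<pi>0 by (simp add: play_from_def)
    next
      case (Suc n)
      have "\<rho> n \<in> verts G" using \<rho>(1) by (simp add: play_from_def play_def)
      then have "\<rho> (Suc n) = \<sigma> (ow (\<rho> n)) (prefix (Suc n) \<rho>)"
        using \<rho>(2) ow unfolding compatible_play_def by blast
      moreover have "\<rho> n = \<pi> n" using Suc by (simp add: subsequence_def)
      ultimately have "\<rho> (Suc n) = \<pi> (Suc n)" using \<pi>S Suc by simp
      with Suc show ?case by (simp add: subsequence_def)
    qed
    then show ?thesis by (simp add: subsequence_def fun_eq_iff)
  qed
  ultimately show ?thesis by blast
qed

lemma binary_eq_iff: "binary m = binary n \<longleftrightarrow> m = n"
proof
  show "binary m = binary n \<Longrightarrow> m = n"
  proof (induction m arbitrary: n rule: binary.induct)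
    case (1 m)
    have ne: "binary k \<noteq> []" for k by (subst binary.simps) simp
    show ?case
    proof (cases "m < 2 \<or> n < 2")
      case True
      then show ?thesis
        using 1(2) ne[of "m div 2"] ne[of "n div 2"]
        by (subst (asm) binary.simps[of m], subst (asm) binary.simps[of n])
           (auto split: if_splits)
    next
      case False
      then have "odd m = odd n" "binary (m div 2) = binary (n div 2)"
        using 1(2) by (simp_all add: binary.simps[of m] binary.simps[of n])
      then have "m div 2 = n div 2" using 1(1) False by simp
      with \<open>odd m = odd n\<close> show ?thesis
        by presburger
    qed
  qed
qed simp

lemma binary_nonempty: "binary n \<noteq> []"
  by (subst binary.simps) simp

lemma serialize_append_eq:
  "serialize t @ r = serialize t' @ r' \<Longrightarrow> t = t' \<and> r = r'"
proof (induction t arbitrary: r t' r')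
  case (Num n)
  have digits: "concat (map (\<lambda>b. [False, b]) xs) @ True # True # r =
      concat (map (\<lambda>b. [False, b]) ys) @ True # True # r' \<Longrightarrow> xs = ys \<and> r = r'" for xs ys r r'
  proof (induction xs arbitrary: ys)
    case Nil then show ?case by (cases ys) auto
  next
    case (Cons a xs) then show ?case by (cases ys) auto
  qed
  show ?case
  proof (cases t')
    case (Num m)
    then show ?thesis using Num.prems digits[of "binary n" r "binary m" r']
      by (simp add: binary_eq_iff)
  next
    case (Node ts)
    then show ?thesis using Num.prems binary_nonempty[of n]
      by (cases "binary n"; cases ts; cases "hd ts") auto
  qed
next
  case (Node ts)
  show ?case
  proof (cases t')
    case (Num m)
    then show ?thesis using Node.prems binary_nonempty[of m]
      by (cases "binary m"; cases ts; cases "hd ts") auto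
  next
    case (Node ts')
    have "concat (map serialize us) @ True # True # r =
        concat (map serialize us') @ True # True # r' \<Longrightarrow> set us \<subseteq> set ts \<Longrightarrow> us = us' \<and> r = r'"
      for us us'
    proof (induction us arbitrary: us')
      case Nil
      then show ?case by (cases us'; cases "hd us'") auto
    next
      case (Cons u us)
      show ?case
      proof (cases us')
        case Nil
        then show ?thesis using Cons.prems by (cases u) auto
      next
        case (Cons u' vs)
        with Cons.prems Node.IH[of u "concat (map serialize us) @ True # True # r" u'
            "concat (map serialize vs) @ True # True # r'"] Cons.IH[of vs]
        show ?thesis by simp
      qed
    qed
    then show ?thesis using Node.prems Node by auto
  qed
qed

lemma inj_serialize: "inj serialize"
  using serialize_append_eq[of _ "[]" _ "[]"] by (auto intro: injI)

lemma inj_nats_tree: "inj nats_tree"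
  by (auto simp: nats_tree_def inj_def inj_map_eq_map)

lemma inj_rat_tree: "inj rat_tree"
proof (rule injI)
  fix r s assume eq: "rat_tree r = rat_tree s"
  obtain a b where r: "quotient_of r = (a, b)" by force
  obtain c d where s: "quotient_of s = (c, d)" by force
  have "b > 0" "d > 0" using quotient_of_denom_pos r s by auto
  with eq r s have "a = c \<and> b = d"
    by (auto simp: rat_tree_def nats_tree_def split: if_splits)
  with r s show "r = s" by (simp add: quotient_of_inject)
qed

lemma inj_trans_tree: "inj trans_tree"
  by (rule injI) (auto simp: trans_tree_def nats_tree_def split: option.splits)

lemma inj_encode: "inj encode"
proof (rule injI)
  fix I J :: reach_instance
  assume "encode I = encode J"
  then have eq: "instance_tree I = instance_tree J"
    using inj_serialize by (auto simp: encode_def dest: injD)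
  have inj_edge: "inj (\<lambda>(u, v). nats_tree [u, v])"
    by (auto simp: inj_def nats_tree_def)
  show "I = J"
    by (rule reach_instance.equality)
       (use eq in \<open>simp_all add: instance_tree_def inj_map_eq_map[OF inj_edge]
          inj_map_eq_map[OF inj_nats_tree] inj_map_eq_map[OF inj_trans_tree]
          inj_eq[OF inj_nats_tree] inj_eq[OF inj_rat_tree]\<close>)
qed

lemma quantitative_reachability_game_of:
  assumes "wf_game (game_of I)" "\<forall>ts\<in>set (target_lists I). set ts \<subseteq> verts (game_of I)"
  shows "quantitative_reachability_game (game_of I) (targets I)"
  using assms by (auto simp: quantitative_reachability_game_def game_of_def targets_def)

end

theory Submission
 imports Defs
begin

text \<open>Membership. A play of the product of the arena with Leader's Mealy machine, together with arrival
 times \<open>c\<close>, is an equilibrium outcome if after every deviation of a player \<open>j\<close> at time \<open>n\<close> there is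
 again such a play in which \<open>j\<close> needs at least \<open>c j - (n + 1)\<close> steps. So equilibria amount to a
 greatest fixed point of promises that depend on the node, the players that have already reached
 their targets, the deviating player and a time. While no target is reached, a long play repeats a
 node and may loop; hence promises beyond an exponential bound can be replaced by infinity. Prover can
 therefore present a table of all promises for the current set of players, the path behind an entry
 has exponential length and is verified by repeated halving, and new tables are needed only when the
 set of players grows. This is a game with polynomially many rounds, and such games are solved in
 polynomial space by depth-first search.

 Hardness. The configurations of a machine with polynomial space are sets of polynomially many facts
 that evolve under monotone Horn rules. Savitch's halving turns the exponential iteration of these
 rules into a quantified Boolean formula in conjunctive normal form. In the game of a formula, two
 players choose literals, and then the owner of a clause without a chosen literal leaves for
 the exit, which is the target of Leader and of the player of the universal quantifiers.

 Polynomial-time functions are obtained from a class of functions on binary trees that is closed under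
 folds of bounded growth; its members are computed by structured programs, which are compiled to
 machines.\<close>

section \<open>Structured programs for tapes\<close>

text \<open>A bound on promised times cannot come from counting positions alone, because a promise
  itself carries a number. It comes from a gap: among thresholds growing by the factor
  \<open>Kb\<close>, more of them than pairs of a node and a player, there is one such that every
  pair that is promised this threshold is also promised the next one. Beyond such a gap all promises
  can be raised to infinity simultaneously: each play has room for a loop that leaves later
  deviators at least the lower threshold. For a fixed set of reached players only the best promise
  of each pair matters, which keeps tables polynomial.

  In the hardness proof, subgame perfection does the work of a referee: once the literals are
  chosen, an owner whose clause has none of them can reach a target only through the exit, so the
  threat to leave is credible. Horn rules are chosen because their monotonicity turns the equations
  of a halving argument into inclusions, and inclusions between sets of variables are
  clauses.\<close>

text \<open>\<open>IfS r s\<close> tests whether the symbol under head \<open>r\<close> is \<open>s\<close>; \<open>WhileN r s\<close> loops while it is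
 different from \<open>s\<close>.\<close>

datatype com =
 Wr nat nat
| Mv nat bool
| Seq com com (infixr ";;" 60)
| IfS nat nat com com
| WhileN nat nat com

type_synonym tapes = "nat => (int => nat) \<times> int"

definition rd :: "tapes => nat => nat" where
 "rd T r = fst (T r) (snd (T r))"

definition wr :: "tapes => nat => nat => tapes" where
 "wr T r s = T(r := ((fst (T r))(snd (T r) := s), snd (T r)))"

definition shift :: "bool => int" where
 "shift b = (if b then 1 else - 1)"

definition mv :: "tapes => nat => bool => tapes" where
 "mv T r b = T(r := (fst (T r), snd (T r) + shift b))"

text \<open>The time of an execution is that of the compiled program below, jumps included; \<open>I\<close> holds
 throughout the execution.\<close>

inductive ex :: "(tapes => bool) => com => tapes => nat => tapes => bool" for I where
 Wr: "I T ==> I (wr T r s) ==> ex I (Wr r s) T (Suc 0) (wr T r s)"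
| Mv: "I T ==> I (mv T r b) ==> ex I (Mv r b) T (Suc 0) (mv T r b)"
| Seq: "ex I c T t T' ==> ex I c' T' t' T'' ==> ex I (c ;; c') T (t + t') T''"
| IfT: "rd T r = s ==> ex I c T t T' ==> ex I (IfS r s c c') T (Suc (Suc t)) T'"
| IfF: "rd T r ~= s ==> ex I c' T t T' ==> ex I (IfS r s c c') T (Suc t) T'"
| WhF: "I T ==> rd T r = s ==> ex I (WhileN r s c) T (Suc 0) T"
| WhT: "rd T r ~= s ==> ex I c T t T' ==> ex I (WhileN r s c) T' t' T'' ==>
  ex I (WhileN r s c) T (Suc (Suc (t + t'))) T''"

lemma ex_inv: "ex I c T t T' ==> I T & I T'"
 by (induction rule: ex.induct) auto

lemma ex_mono: "ex I c T t T' ==> (!!T. I T ==> J T) ==> ex J c T t T'"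
 by (induction rule: ex.induct) (auto intro: ex.intros)

text \<open>A head moves by at most one cell per unit of time, so a time bound is also a space
  bound, at the end and (first conclusion) at every intermediate point. Thus polynomial-time pieces
  of a program never need a separate space analysis.\<close>

lemma ex_head_bound:
 assumes "ex I c T t T'" "!!r. \<bar>snd (T r)\<bar> \<le> int b"
 shows "ex (%T. \<forall>r. \<bar>snd (T r)\<bar> \<le> int (b + t)) c T t T'" and "\<bar>snd (T' r)\<bar> \<le> int (b + t)"
proof -
 note mono = ex_mono
 have up: "\<forall>r. \<bar>snd (T r)\<bar> \<le> int k'" if "\<forall>r. \<bar>snd (T r)\<bar> \<le> int k" "k \<le> k'" for T :: tapes and k k'
  using that by (meson of_nat_mono order_trans)
 have "ex (%T. \<forall>r. \<bar>snd (T r)\<bar> \<le> int (b + t)) c T t T' & (\<forall>r. \<bar>snd (T' r)\<bar> \<le> int (b + t))"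
  using assms
 proof (induction arbitrary: b rule: ex.induct)
  case (Wr T r s)
  have snds: "snd (wr T r s r') = snd (T r')" for r' by (simp add: wr_def)
  have "\<forall>r'. \<bar>snd (T r')\<bar> \<le> int (b + Suc 0)"
   using Wr(3) by (meson le_add1 of_nat_mono order_trans)
  thus ?case using snds by (intro conjI ex.Wr) metis+
 next
  case (Mv T r d)
  have "\<bar>snd (mv T r d r')\<bar> \<le> int (b + Suc 0)" for r'
   using Mv(3)[of r'] by (auto simp: mv_def shift_def)
  moreover have "\<forall>r'. \<bar>snd (T r')\<bar> \<le> int (b + Suc 0)"
   using Mv(3) by (meson le_add1 of_nat_mono order_trans)
  ultimately show ?case by (intro conjI ex.Mv) blast+
 next
  case (Seq c T t T' c' t' T'')
  have 1: "ex (%T. \<forall>r. \<bar>snd (T r)\<bar> \<le> int (b + t)) c T t T'" "!!r. \<bar>snd (T' r)\<bar> \<le> int (b + t)"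
   using Seq.IH(1)[OF Seq.prems] by auto
  have 2: "ex (%T. \<forall>r. \<bar>snd (T r)\<bar> \<le> int (b + t + t')) c' T' t' T''"
   "\<forall>r. \<bar>snd (T'' r)\<bar> \<le> int (b + t + t')"
   using Seq.IH(2)[OF 1(2)] by auto
  have "ex (%T. \<forall>r. \<bar>snd (T r)\<bar> \<le> int (b + t + t')) c T t T'"
   by (rule mono[OF 1(1)], erule up) simp
  from ex.Seq[OF this 2(1)] show ?case using 2(2) by (simp only: add.assoc) blast
 next
  case (IfT T r s c t T' c')
  have 1: "ex (%T. \<forall>r. \<bar>snd (T r)\<bar> \<le> int (b + t)) c T t T'" "!!r. \<bar>snd (T' r)\<bar> \<le> int (b + t)"
   using IfT.IH[OF IfT.prems] by auto
  have "ex (%T. \<forall>r. \<bar>snd (T r)\<bar> \<le> int (b + Suc (Suc t))) c T t T'"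
   by (rule mono[OF 1(1)], erule up) simp
  moreover have "\<bar>snd (T' r)\<bar> \<le> int (b + Suc (Suc t))" for r using 1(2)[of r] by simp
  ultimately show ?case using ex.IfT[OF IfT.hyps(1)] by blast
 next
  case (IfF T r s c' t T' c)
  have 1: "ex (%T. \<forall>r. \<bar>snd (T r)\<bar> \<le> int (b + t)) c' T t T'" "!!r. \<bar>snd (T' r)\<bar> \<le> int (b + t)"
   using IfF.IH[OF IfF.prems] by auto
  have "ex (%T. \<forall>r. \<bar>snd (T r)\<bar> \<le> int (b + Suc t)) c' T t T'"
   by (rule mono[OF 1(1)], erule up) simp
  moreover have "\<bar>snd (T' r)\<bar> \<le> int (b + Suc t)" for r using 1(2)[of r] by simp
  ultimately show ?case using ex.IfF[OF IfF.hyps(1)] by blast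
 next
  case (WhF T r s c)
  have "\<forall>r'. \<bar>snd (T r')\<bar> \<le> int (b + Suc 0)"
   using WhF(3) by (meson le_add1 of_nat_mono order_trans)
  thus ?case by (intro conjI ex.WhF WhF.hyps)
 next
  case (WhT T r s c t T' t' T'')
  have 1: "ex (%T. \<forall>r. \<bar>snd (T r)\<bar> \<le> int (b + t)) c T t T'" "!!r. \<bar>snd (T' r)\<bar> \<le> int (b + t)"
   using WhT.IH(1)[OF WhT.prems] by auto
  have 2: "ex (%T. \<forall>r. \<bar>snd (T r)\<bar> \<le> int (b + t + t')) (WhileN r s c) T' t' T''"
   "!!r. \<bar>snd (T'' r)\<bar> \<le> int (b + t + t')"
   using WhT.IH(2)[OF 1(2)] by auto
  have "ex (%T. \<forall>r. \<bar>snd (T r)\<bar> \<le> int (b + Suc (Suc (t + t')))) c T t T'"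
   by (rule mono[OF 1(1)], erule up) simp
  moreover have "ex (%T. \<forall>r. \<bar>snd (T r)\<bar> \<le> int (b + Suc (Suc (t + t')))) (WhileN r s c) T' t' T''"
   by (rule mono[OF 2(1)], erule up) simp
  moreover have "\<bar>snd (T'' r)\<bar> \<le> int (b + Suc (Suc (t + t')))" for r using 2(2)[of r] by simp
  ultimately show ?case using ex.WhT[OF WhT.hyps(1)] by blast
 qed
 thus "ex (%T. \<forall>r. \<bar>snd (T r)\<bar> \<le> int (b + t)) c T t T'" "\<bar>snd (T' r)\<bar> \<le> int (b + t)"
  by auto
qed

section \<open>Jump code and the correctness of compilation\<close>

datatype instr = IW nat nat | IM nat bool | IJ nat nat nat | IN nat nat nat | IG nat

fun istep :: "instr => nat \<times> tapes => nat \<times> tapes" where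
 "istep (IW r s) (pc, T) = (Suc pc, wr T r s)"
| "istep (IM r b) (pc, T) = (Suc pc, mv T r b)"
| "istep (IJ r s n) (pc, T) = (if rd T r = s then n else Suc pc, T)"
| "istep (IN r s n) (pc, T) = (if rd T r ~= s then n else Suc pc, T)"
| "istep (IG n) (pc, T) = (n, T)"

inductive isteps ::
  "(tapes => bool) => instr list => nat => nat \<times> tapes => nat \<times> tapes => bool" for I P where
 refl: "I T ==> isteps I P 0 (pc, T) (pc, T)"
| step: "I T ==> pc < length P ==> isteps I P n (istep (P ! pc) (pc, T)) s ==>
  isteps I P (Suc n) (pc, T) s"

lemma isteps_trans:
 "isteps I P n s s' ==> isteps I P m s' s'' ==> isteps I P (n + m) s s''"
proof (induction rule: isteps.induct)
 case (step T pc n s)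
 thus ?case using isteps.step[of I T pc P "n + m" s''] by simp
qed simp

lemma isteps_one:
 "I T ==> pc < length P ==> istep (P ! pc) (pc, T) = (pc', T') ==> I T' ==> isteps I P 1 (pc, T) (pc', T')"
 using isteps.step[of I T pc P 0 "(pc', T')"] isteps.refl[of I T' P pc'] by simp

fun csz :: "com => nat" where
 "csz (Wr r s) = 1"
| "csz (Mv r b) = 1"
| "csz (c ;; c') = csz c + csz c'"
| "csz (IfS r s c c') = csz c + csz c' + 2"
| "csz (WhileN r s c) = csz c + 2"

text \<open>Jump targets are absolute, hence the start address as second argument.\<close>

fun compile :: "com => nat => instr list" where
 "compile (Wr r s) i = [IW r s]"
| "compile (Mv r b) i = [IM r b]"
| "compile (c ;; c') i = compile c i @ compile c' (i + csz c)"
| "compile (IfS r s c c') i = IN r s (i + csz c + 2) # compile c (Suc i) @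
   IG (i + csz c + 2 + csz c') # compile c' (i + csz c + 2)"
| "compile (WhileN r s c) i = IJ r s (i + csz c + 2) # compile c (Suc i) @ [IG i]"

lemma length_compile [simp]: "length (compile c i) = csz c"
 by (induction c arbitrary: i) auto

definition code_at :: "instr list => nat => instr list => bool" where
 "code_at P i xs \<longleftrightarrow> (\<forall>j<length xs. i + j < length P & P ! (i + j) = xs ! j)"

lemma code_at_Cons [simp]:
 "code_at P i (x # xs) \<longleftrightarrow> i < length P & P ! i = x & code_at P (Suc i) xs"
proof -
 have "(\<forall>j<Suc n. Q j) \<longleftrightarrow> Q 0 & (\<forall>j<n. Q (Suc j))" for n and Q :: "nat => bool"
  using less_Suc_eq_0_disj by auto
 thus ?thesis by (simp add: code_at_def)
qed

lemma code_at_Nil [simp]: "code_at P i []"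
 by (simp add: code_at_def)

lemma code_at_append [simp]:
 "code_at P i (xs @ ys) \<longleftrightarrow> code_at P i xs & code_at P (i + length xs) ys"
 by (induction xs arbitrary: i) simp_all

text \<open>The rules of \<open>ex\<close> charge for exactly the jumps that the generated code
  performs, so the simulation takes exactly \<open>t\<close> steps. \<open>code_at\<close> permits
  the code to be part of a larger program, as the induction requires.\<close>

lemma compile_correct:
 "ex I c T t T' ==> code_at P i (compile c i) ==> isteps I P t (i, T) (i + csz c, T')"
proof (induction arbitrary: i rule: ex.induct)
 case (Wr T r s)
 thus ?case by (auto intro!: isteps_one[simplified])
next
 case (Mv T r b)
 thus ?case by (auto intro!: isteps_one[simplified])
next
 case (Seq c T t T' c' t' T'')
 thus ?case by (auto intro: isteps_trans simp flip: add.assoc)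
next
 case (IfT T r s c t T' c')
 have "isteps I P 1 (i, T) (Suc i, T)"
  using IfT ex_inv[OF IfT(2)] by (intro isteps_one) auto
 moreover have "isteps I P t (Suc i, T) (Suc i + csz c, T')"
  using IfT.IH[of "Suc i"] IfT.prems by simp
 moreover have "isteps I P 1 (Suc i + csz c, T') (i + csz (IfS r s c c'), T')"
  using IfT ex_inv[OF IfT(2)] by (intro isteps_one) auto
 ultimately have "isteps I P (1 + t + 1) (i, T) (i + csz (IfS r s c c'), T')"
  by (blast intro: isteps_trans)
 thus ?case by simp
next
 case (IfF T r s c' t T' c)
 have "isteps I P 1 (i, T) (i + csz c + 2, T)"
  using IfF ex_inv[OF IfF(2)] by (intro isteps_one) auto
 moreover have "isteps I P t (i + csz c + 2, T) (i + csz c + 2 + csz c', T')"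
  using IfF.IH[of "i + csz c + 2"] IfF.prems by simp
 ultimately have "isteps I P (1 + t) (i, T) (i + csz c + 2 + csz c', T')"
  by (blast intro: isteps_trans)
 thus ?case by (simp add: ac_simps)
next
 case (WhF T r s c)
 thus ?case by (auto intro!: isteps_one[simplified])
next
 case (WhT T r s c t T' t' T'')
 have "isteps I P 1 (i, T) (Suc i, T)"
  using WhT ex_inv[OF WhT(2)] by (intro isteps_one) auto
 moreover have "isteps I P t (Suc i, T) (Suc i + csz c, T')"
  using WhT.IH(1)[of "Suc i"] WhT.prems by simp
 moreover have "isteps I P 1 (Suc i + csz c, T') (i, T')"
  using WhT ex_inv[OF WhT(2)] by (intro isteps_one) auto
 moreover have "isteps I P t' (i, T') (i + csz (WhileN r s c), T'')"
  using WhT by auto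
 ultimately have "isteps I P (1 + t + 1 + t') (i, T) (i + csz (WhileN r s c), T'')"
  by (blast intro: isteps_trans)
 thus ?case by simp
qed

section \<open>Simulation of jump code by a Turing machine\<close>

text \<open>Program tape 1 is the output tape, so it becomes the last tape of the machine.\<close>

definition lg :: "nat => nat => nat" where
 "lg K i = (if i = 0 then 0 else if i = K - 1 then 1 else Suc i)"

definition ph :: "nat => nat => nat" where
 "ph K r = (if r = 0 then 0 else if r = 1 then K - 1 else r - 1)"

lemma lg_ph: "2 \<le> K ==> r < K ==> lg K (ph K r) = r & ph K r < K"
 by (auto simp: lg_def ph_def)

lemma ph_lg: "2 \<le> K ==> i < K ==> ph K (lg K i) = i"
 by (auto simp: lg_def ph_def)

definition phl :: "nat => tapes => ((int => nat) \<times> int) list" where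
 "phl K T = map (%i. T (lg K i)) [0..<K]"

text \<open>States 1 and 2 are reserved for halting, so a program counter \<open>pc > 0\<close>
  becomes state \<open>pc + 2\<close>, while 0 stays the initial state.\<close>

definition pc_of :: "nat => nat" where "pc_of q = (if q = 0 then 0 else q - 2)"

definition state_of :: "nat => nat" where "state_of pc = (if pc = 0 then 0 else pc + 2)"

lemma pc_of_state_of [simp]: "pc_of (state_of pc) = pc"
 by (simp add: pc_of_def state_of_def)

definition idelta :: "nat => instr => nat => nat list => nat \<times> (nat \<times> int) list" where
 "idelta K i pc ss = (let stay = map (%s. (s, 0)) ss in
   case i of
    IW r s => (Suc pc, stay[ph K r := (s, 0)])
   | IM r b => (Suc pc, stay[ph K r := (ss ! ph K r, shift b)])
   | IJ r s n => (if ss ! ph K r = s then n else Suc pc, stay)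
   | IN r s n => (if ss ! ph K r ~= s then n else Suc pc, stay)
   | IG n => (n, stay))"

fun itape :: "instr => nat" where
 "itape (IW r s) = r" | "itape (IM r b) = r" | "itape (IJ r s n) = r" | "itape (IN r s n) = r"
| "itape (IG n) = 0"

fun isym :: "instr => nat" where
 "isym (IW r s) = s" | "isym _ = 0"

fun itarget :: "instr => nat" where
 "itarget (IJ r s n) = n" | "itarget (IN r s n) = n" | "itarget (IG n) = n" | "itarget _ = 0"

text \<open>At the end of the program the machine accepts iff tape \<open>v\<close> shows the symbol 2.\<close>

definition machine_of :: "nat => nat => instr list => machine" where
 "machine_of K v P = \<lparr>num_tapes = K, num_symbols = Max (set (map isym P) \<union> {0}) + 3,
   num_states = length P + 3,
   delta = (%q ss. if pc_of q < length P
    then (case idelta K (P ! pc_of q) (pc_of q) ss of (pc, acts) => (state_of pc, acts))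
    else (if ss ! ph K v = 2 then 1 else 2, map (%s. (s, 0)) ss))\<rparr>"

lemma wf_machine_of:
 assumes K: "2 \<le> K" "\<forall>i\<in>set P. itape i < K" "\<forall>i\<in>set P. itarget i \<le> length P"
 shows "wf_machine (machine_of K v P)"
proof -
 let ?M = "machine_of K v P"
 have sym: "isym i < num_symbols ?M" if "i \<in> set P" for i
 proof -
  have "isym i \<le> Max (set (map isym P) \<union> {0})" using that by (intro Max_ge) auto
  thus ?thesis by (simp add: machine_of_def)
 qed
 have "case delta ?M q ss of (q', acts) => q' < num_states ?M & length acts = num_tapes ?M &
      set acts \<subseteq> {..<num_symbols ?M} \<times> {- 1, 0, 1}"
  if "q < num_states ?M" and ss: "length ss = num_tapes ?M" "set ss \<subseteq> {..<num_symbols ?M}" for q ss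
 proof (cases "pc_of q < length P")
  case True
  let ?i = "P ! pc_of q"
  have i: "?i \<in> set P" using True by simp
  have rK: "ph K (itape ?i) < length ss"
   using lg_ph[of K "itape ?i"] K i ss by (auto simp: machine_of_def)
  have g: "set ((map (%s. (s, 0)) ss)[j := (a, d)]) \<subseteq> {..<num_symbols ?M} \<times> {- 1, 0, 1}"
   if "a < num_symbols ?M" "d \<in> {-1,0,1}" for a j and d :: int
   using ss that set_update_subset_insert[of "map (%s. (s, 0)) ss" j "(a, d)"] by auto
  have stay: "set (map (%s. (s, 0)) ss) \<subseteq> {..<num_symbols ?M} \<times> {- 1, 0, 1 :: int}"
   using ss by auto
  have at: "ss ! ph K (itape ?i) < num_symbols ?M" using rK ss nth_mem by blast
  have tgt: "itarget ?i \<le> length P" using K i by auto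
  obtain pc acts where e: "idelta K ?i (pc_of q) ss = (pc, acts)" by force
  have len: "length acts = K"
   using e ss(1) by (auto simp: idelta_def Let_def machine_of_def split: instr.splits if_splits)
  have pc: "pc \<le> length P"
   using e tgt True by (auto simp: idelta_def Let_def split: instr.splits if_splits)
  have "set acts \<subseteq> {..<num_symbols ?M} \<times> {- 1, 0, 1}"
  proof (cases ?i)
   case (IW r s)
   hence "acts = (map (%s. (s, 0)) ss)[ph K r := (s, 0)]" using e by (simp add: idelta_def Let_def)
   moreover have "s < num_symbols ?M" using sym[OF i] IW by simp
   ultimately show ?thesis using g[of s 0] by simp
  next
   case (IM r b)
   hence "acts = (map (%s. (s, 0)) ss)[ph K r := (ss ! ph K r, shift b)]"
    using e by (simp add: idelta_def Let_def)
   moreover have "ss ! ph K r < num_symbols ?M" using at IM by simp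
   ultimately show ?thesis using g[of "ss ! ph K r" "shift b"] by (simp add: shift_def)
  qed (use e stay in \<open>simp_all add: idelta_def Let_def\<close>)
  with len pc have "pc \<le> length P & length acts = K & set acts \<subseteq> {..<num_symbols ?M} \<times> {- 1, 0, 1}"
   by simp
  thus ?thesis using True e by (auto simp: machine_of_def state_of_def)
 next
  case False
  thus ?thesis using ss by (auto simp: machine_of_def)
 qed
 thus ?thesis unfolding wf_machine_def using K by (auto simp: machine_of_def)
qed

lemma phl_update:
 assumes "2 \<le> K" "r < K"
 shows "phl K (T(r := x)) = (phl K T)[ph K r := x]"
 using assms lg_ph[OF assms] ph_lg[OF assms(1)]
 by (intro nth_equalityI) (auto simp: phl_def nth_list_update)

lemma nth_phl: "2 \<le> K ==> r < K ==> phl K T ! ph K r = T r"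
 using lg_ph[of K r] by (simp add: phl_def)

lemma step_machine_of:
 assumes K: "2 \<le> K" "\<forall>i\<in>set P. itape i < K" and pc: "pc < length P"
  and s: "istep (P ! pc) (pc, T) = (pc', T')"
 shows "step (machine_of K v P) (state_of pc, phl K T) = (state_of pc', phl K T')"
proof -
 define ss where "ss = map (%(tp, z). tp z) (phl K T)"
 have nh: "\<not> halted (state_of pc, phl K T)" by (auto simp: halted_def state_of_def)
 have i: "itape (P ! pc) < K" using K pc by simp
 have l: "length (phl K T) = K" by (simp add: phl_def)
 have rdss: "ss ! ph K r = rd T r" if "r < K" for r
  using nth_phl[OF K(1) that, of T] lg_ph[OF K(1) that] l
  by (simp add: ss_def rd_def case_prod_beta)
 have stay: "map2 (%(tp, z) (s, d). (tp(z := s), z + d)) (phl K T) (map (%s. (s, 0)) ss) = phl K T"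
  by (intro nth_equalityI) (auto simp: l ss_def case_prod_beta)
 have upd: "map2 (%(tp, z) (s, d). (tp(z := s), z + d)) (phl K T)
   ((map (%s. (s, 0)) ss)[ph K r := (a, d)]) =
   phl K (T(r := ((fst (T r))(snd (T r) := a), snd (T r) + d)))" if r: "r < K" for r a d
  unfolding phl_update[OF K(1) r]
 proof (intro nth_equalityI)
  fix j assume "j < length (map2 (%(tp, z) (s, d). (tp(z := s), z + d)) (phl K T)
   ((map (%s. (s, 0)) ss)[ph K r := (a, d)]))"
  hence j: "j < K" by (simp add: l ss_def)
  show "map2 (%(tp, z) (s, d). (tp(z := s), z + d)) (phl K T)
   ((map (%s. (s, 0)) ss)[ph K r := (a, d)]) ! j =
   (phl K T)[ph K r := ((fst (T r))(snd (T r) := a), snd (T r) + d)] ! j"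
   using j nth_phl[OF K(1) r, of T] by (cases "j = ph K r") (auto simp: l ss_def case_prod_beta)
 qed (simp add: l ss_def)
 have self: "(fst (T r))(snd (T r) := rd T r) = fst (T r)" for r
  by (simp add: rd_def)
 have "(case idelta K (P ! pc) pc ss of (q, acts) =>
   (q, map2 (%(tp, z) (s, d). (tp(z := s), z + d)) (phl K T) acts)) = (pc', phl K T')"
 proof (cases "P ! pc")
  case (IW r a)
  hence "r < K" using i by simp
  thus ?thesis using s IW upd[of r a 0] by (simp add: idelta_def wr_def)
 next
  case (IM r b)
  hence r: "r < K" using i by simp
  thus ?thesis using s IM upd[of r "rd T r" "shift b"] rdss[OF r] self
   by (simp add: idelta_def mv_def)
 qed (use s i stay in \<open>auto simp: idelta_def rdss split: if_splits\<close>)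
 thus ?thesis
  using nh pc unfolding step_def
  by (simp add: machine_of_def ss_def split: prod.splits)
qed

text \<open>The second conjunct transports the invariant to every intermediate configuration; with
  an invariant that bounds the heads this is the space bound of the machine.\<close>

lemma isteps_machine_of:
 assumes K: "2 \<le> K" "\<forall>i\<in>set P. itape i < K"
 shows "isteps I P n (pc, T) (pc', T') ==>
  (step (machine_of K v P) ^^ n) (state_of pc, phl K T) = (state_of pc', phl K T') &
  (\<forall>k\<le>n. \<exists>q T''. (step (machine_of K v P) ^^ k) (state_of pc, phl K T) = (q, phl K T'') & I T'')"
proof (induction n "(pc, T)" "(pc', T')" arbitrary: pc T rule: isteps.induct)
 case refl
 thus ?case by auto
next
 case (step T pc n)
 obtain pc1 T1 where s: "istep (P ! pc) (pc, T) = (pc1, T1)" by force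
 have s': "step (machine_of K v P) (state_of pc, phl K T) = (state_of pc1, phl K T1)"
  by (rule step_machine_of[OF K step(2) s])
 note IH = step(4)[OF s]
 have "\<exists>q T''. (step (machine_of K v P) ^^ k) (state_of pc, phl K T) = (q, phl K T'') & I T''"
  if "k \<le> Suc n" for k
 proof (cases k)
  case 0
  thus ?thesis using step(1) by auto
 next
  case (Suc k')
  thus ?thesis using IH that s' by (simp add: funpow_Suc_right del: funpow.simps)
 qed
 thus ?case using IH s' by (simp add: funpow_Suc_right del: funpow.simps)
qed

fun mtape :: "com => nat" where
 "mtape (Wr r s) = r"
| "mtape (Mv r b) = r"
| "mtape (c ;; c') = max (mtape c) (mtape c')"
| "mtape (IfS r s c c') = max r (max (mtape c) (mtape c'))"
| "mtape (WhileN r s c) = max r (mtape c)"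

lemma compile_instrs:
 "i \<in> set (compile c a) ==> itarget i \<le> a + csz c & itape i \<le> mtape c"
 by (induction c arbitrary: a) (fastforce simp: ac_simps le_max_iff_disj)+

text \<open>The machine is obtained before input, run and invariant are fixed, so a single machine
  serves all inputs. The additional step decides between acceptance and rejection after the last
  instruction; from then on the configuration is constant, which extends the invariant to all
  times.\<close>

theorem program_machine:
 assumes K: "2 \<le> K" "mtape c < K" and v: "v < K"
 obtains M where "wf_machine M" "num_tapes M = K"
  "!!x T t T' I. ex I c T t T' ==> phl K T = snd (init_config M x) ==>
   (\<forall>k. \<exists>q T''. run M x k = (q, phl K T'') & I T'') &
   run M x (Suc t) = (if rd T' v = 2 then 1 else 2, phl K T') &
   halted (run M x (Suc t))"
proof -
  let ?P = "compile c 0"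
  have K': "\<forall>i\<in>set ?P. itape i < K" using compile_instrs K le_less_trans by blast
  define M where "M = machine_of K v ?P"
  have wf: "wf_machine M" unfolding M_def
   by (rule wf_machine_of[OF K(1) K']) (use compile_instrs[of _ c 0] in auto)
  note K = K(1)
  have "(\<forall>k. \<exists>q T''. run M x k = (q, phl K T'') & I T'') &
   run M x (Suc t) = (if rd T' v = 2 then 1 else 2, phl K T') & halted (run M x (Suc t))"
   if e: "ex I c T t T'" and init: "phl K T = snd (init_config M x)" for x T t T' I
  proof -
   have st: "isteps I ?P t (0, T) (csz c, T')"
    using compile_correct[OF e, of ?P 0] by (simp add: code_at_def)
   have init': "init_config M x = (state_of 0, phl K T)"
    using init by (simp add: init_config_def state_of_def)
   note sim = isteps_machine_of[OF K K' st, where v = v, folded M_def, folded init', folded run_def]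
   have run_t: "run M x t = (state_of (csz c), phl K T')" using sim by simp
   have nh: "\<not> halted (run M x t)" unfolding run_t by (auto simp: halted_def state_of_def)
   have stay: "map2 (%(tp, z) (s, d). (tp(z := s), z + d)) (phl K T')
     (map (%s. (s, 0)) (map (%(tp, z). tp z) (phl K T'))) = phl K T'"
    by (intro nth_equalityI) (auto simp: case_prod_beta)
   have "map (%(tp, z). tp z) (phl K T') ! ph K v = rd T' v"
    using nth_phl[OF K v, of T'] lg_ph[OF K v]
    by (simp add: rd_def case_prod_beta phl_def)
   hence S: "run M x (Suc t) = (if rd T' v = 2 then 1 else 2, phl K T')"
    using nh stay run_t unfolding run_def
    by (simp add: step_def M_def machine_of_def)
   hence h: "halted (run M x (Suc t))" by (simp add: halted_def)
   have later: "run M x (Suc t + k) = run M x (Suc t)" for k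
   proof (induction k)
    case (Suc k)
    thus ?case using h by (simp add: run_def step_def)
   qed simp
   have "\<exists>q T''. run M x k = (q, phl K T'') & I T''" for k
   proof (cases "k \<le> t")
    case True thus ?thesis using sim by auto
   next
    case False
    hence "run M x k = run M x (Suc t)" using later[of "k - Suc t"] by simp
    thus ?thesis using S ex_inv[OF e] by auto
   qed
   thus ?thesis using S h by blast
  qed
  moreover have "num_tapes M = K" by (simp add: M_def machine_of_def)
  ultimately show thesis using wf that by blast
qed

section \<open>Binary trees on tapes\<close>

datatype dt = N | C dt dt

text \<open>Trees are written in postfix order with the head on the last symbol, so that the root is
 visible and a subtree is delimited by scanning to the left.\<close>

fun ser :: "dt => nat list" where
 "ser N = [1]"
| "ser (C a b) = ser a @ ser b @ [2]"

fun sz :: "dt => nat" where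
 "sz N = 1"
| "sz (C a b) = Suc (sz a + sz b)"

lemma length_ser [simp]: "length (ser d) = sz d"
 by (induction d) auto

lemma sz_pos [simp]: "0 < sz d"
 by (induction d) auto

lemma set_ser: "set (ser d) \<subseteq> {1, 2}"
 by (induction d) auto

lemma ser_nonempty [simp]: "ser d ~= []"
 by (induction d) auto

definition tp :: "nat list => int => (int => nat) \<times> int" where
 "tp xs z = (%y. if 0 \<le> y & y < int (length xs) then xs ! nat y else 0, z)"

text \<open>The head of an empty stack is on cell -1 and reads a blank, so the symbol 0 signals
  emptiness.\<close>

definition stk :: "nat list => (int => nat) \<times> int" where
 "stk xs = tp xs (int (length xs) - 1)"

definition exq :: "com => tapes => nat => tapes => bool" where
 "exq c T t T' \<longleftrightarrow> (\<exists>\<tau>\<le>t. ex (%_. True) c T \<tau> T')"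

lemma exq_weaken: "exq c T t T' ==> t \<le> t' ==> exq c T t' T'"
 unfolding exq_def by (meson order_trans)

lemma exq_Seq: "exq c T t T' ==> exq c' T' t' T'' ==> exq (c ;; c') T (t + t') T''"
 unfolding exq_def by (meson add_mono ex.Seq)

lemma exq_Wr: "exq (Wr r s) T 1 (wr T r s)"
 unfolding exq_def using ex.Wr[of "%_. True"] by auto

lemma exq_Mv: "exq (Mv r b) T 1 (mv T r b)"
 unfolding exq_def using ex.Mv[of "%_. True"] by auto

lemma exq_If:
 assumes "rd T r = s ==> exq c T t T'" "rd T r ~= s ==> exq c' T t T'"
 shows "exq (IfS r s c c') T (t + 2) T'"
proof (cases "rd T r = s")
 case True
 with assms(1) obtain \<tau> where "\<tau> \<le> t" "ex (%_. True) c T \<tau> T'" unfolding exq_def by blast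
 thus ?thesis unfolding exq_def by (intro exI[of _ "Suc (Suc \<tau>)"]) (simp add: ex.IfT[OF True])
next
 case False
 with assms(2) obtain \<tau> where "\<tau> \<le> t" "ex (%_. True) c' T \<tau> T'" unfolding exq_def by blast
 thus ?thesis unfolding exq_def by (intro exI[of _ "Suc \<tau>"]) (simp add: ex.IfF[OF False])
qed

lemma exq_WhF: "rd T r = s ==> 0 < t ==> exq (WhileN r s c) T t T"
 unfolding exq_def using ex.WhF[of "%_. True" T r s c] by (auto intro!: exI[of _ "Suc 0"] simp: Suc_le_eq)

lemma exq_WhT:
 assumes "rd T r ~= s" "exq c T t T'" "exq (WhileN r s c) T' t' T''"
 shows "exq (WhileN r s c) T (t + 2 + t') T''"
proof -
 obtain a b where "a \<le> t" "ex (%_. True) c T a T'" "b \<le> t'" "ex (%_. True) (WhileN r s c) T' b T''"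
  using assms unfolding exq_def by blast
 thus ?thesis unfolding exq_def using assms(1)
  by (intro exI[of _ "Suc (Suc (a + b))"]) (simp add: ex.WhT)
qed

lemma rd_tp: "T r = tp xs z ==> rd T r = (if 0 \<le> z & z < int (length xs) then xs ! nat z else 0)"
 by (simp add: rd_def tp_def)

lemma rd_stk: "T r = stk xs ==> rd T r = (if xs = [] then 0 else last xs)"
proof -
 have "nat (int n - 1) = n - Suc 0" for n by arith
 thus "T r = stk xs ==> rd T r = (if xs = [] then 0 else last xs)"
  by (auto simp: stk_def rd_tp last_conv_nth)
qed

lemma exq_Mv_tp: "T r = tp xs z ==> exq (Mv r b) T 1 (T(r := tp xs (z + shift b)))"
 using exq_Mv[of r b T] by (simp add: mv_def tp_def)

section \<open>Stacks, copying and scanning on tapes\<close>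

definition push :: "nat => nat => com" where
 "push r s = Mv r True ;; Wr r s"

definition pop :: "nat => com" where
 "pop r = Wr r 0 ;; Mv r False"

lemma exq_push:
 assumes "T r = stk xs"
 shows "exq (push r s) T 2 (T(r := stk (xs @ [s])))"
proof -
 have "wr (mv T r True) r s = T(r := stk (xs @ [s]))"
  using assms by (auto simp: wr_def mv_def stk_def tp_def shift_def nth_append fun_eq_iff)
 thus ?thesis unfolding push_def using exq_Seq[OF exq_Mv[of r True T] exq_Wr[of r s]] by (simp add: numeral_2_eq_2)
qed

lemma exq_pop:
 assumes "T r = stk (xs @ [s])"
 shows "exq (pop r) T 2 (T(r := stk xs))"
proof -
 have "mv (wr T r 0) r False = T(r := stk xs)"
  using assms by (auto simp: wr_def mv_def stk_def tp_def shift_def nth_append fun_eq_iff)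
 thus ?thesis unfolding pop_def using exq_Seq[OF exq_Wr[of r 0 T] exq_Mv[of r False]] by (simp add: numeral_2_eq_2)
qed

definition clear :: "nat => com" where
 "clear r = WhileN r 0 (pop r)"

lemma exq_clear:
 "T r = stk xs ==> 0 \<notin> set xs ==> exq (clear r) T (4 * length xs + 1) (T(r := stk []))"
proof (induction xs arbitrary: T rule: rev_induct)
 case Nil
 have "exq (clear r) T 1 T" unfolding clear_def using Nil by (intro exq_WhF) (simp_all add: rd_stk)
 moreover have "T(r := stk []) = T" using Nil by auto
 ultimately show ?case by simp
next
 case (snoc x xs)
 have IH: "exq (clear r) (T(r := stk xs)) (4 * length xs + 1) (T(r := stk []))"
 proof -
  have "exq (clear r) (T(r := stk xs)) (4 * length xs + 1) ((T(r := stk xs))(r := stk []))"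
   by (rule snoc.IH) (use snoc.prems in simp_all)
  thus ?thesis by (simp only: fun_upd_upd)
 qed
 have "exq (clear r) T (2 + 2 + (4 * length xs + 1)) (T(r := stk []))"
  unfolding clear_def
  using snoc.prems IH[unfolded clear_def]
  by (intro exq_WhT[OF _ exq_pop[of T r xs x, OF snoc.prems(1)]]) (simp_all add: rd_stk)
 thus ?case by (rule exq_weaken) simp
qed

definition rewind :: "nat => com" where
 "rewind r = WhileN r 0 (Mv r False)"

lemma exq_rewind:
 "T r = tp xs (int i - 1) ==> i \<le> length xs ==> 0 \<notin> set xs ==>
  exq (rewind r) T (3 * i + 1) (T(r := tp xs (- 1)))"
proof (induction i arbitrary: T)
 case 0
 have "exq (rewind r) T 1 T" unfolding rewind_def using 0 by (intro exq_WhF) (simp_all add: rd_tp)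
 moreover have "T(r := tp xs (- 1)) = T" using 0 by auto
 ultimately show ?case by simp
next
 case (Suc i)
 have "rd T r ~= 0" using Suc.prems by (auto simp: rd_tp in_set_conv_nth)
 moreover have IH: "exq (rewind r) (T(r := tp xs (int i - 1))) (3 * i + 1) (T(r := tp xs (- 1)))"
 proof -
  have "exq (rewind r) (T(r := tp xs (int i - 1))) (3 * i + 1) ((T(r := tp xs (int i - 1)))(r := tp xs (- 1)))"
   by (rule Suc.IH) (use Suc.prems in simp_all)
  thus ?thesis by (simp only: fun_upd_upd)
 qed
 ultimately have "exq (rewind r) T (1 + 2 + (3 * i + 1)) (T(r := tp xs (- 1)))"
  unfolding rewind_def
  using IH[unfolded rewind_def]
  by (intro exq_WhT[OF _ exq_Mv_tp[of T r xs "int (Suc i) - 1" False, OF Suc.prems(1)]]) (simp_all add: shift_def)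
 thus ?case by (rule exq_weaken) simp
qed

definition forward :: "nat => com" where
 "forward r = WhileN r 0 (Mv r True) ;; Mv r False"

lemma exq_forward:
 assumes "T r = tp xs (int i)" "i \<le> length xs" "0 \<notin> set xs"
 shows "exq (forward r) T (3 * (length xs - i) + 2) (T(r := stk xs))"
proof -
 have "T r = tp xs (int i) ==> i \<le> length xs ==>
  exq (WhileN r 0 (Mv r True)) T (3 * (length xs - i) + 1) (T(r := tp xs (int (length xs))))"
  for T i
 proof (induction "length xs - i" arbitrary: i T)
  case 0
  hence "i = length xs" by simp
  hence "exq (WhileN r 0 (Mv r True)) T 1 T" "T(r := tp xs (int (length xs))) = T"
   using 0 by (auto intro!: exq_WhF simp: rd_tp)
  thus ?case using \<open>i = length xs\<close> by simp
 next
  case (Suc k)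
  have i: "i < length xs" using Suc by simp
  have "rd T r ~= 0" using Suc.prems assms(3) i by (auto simp: rd_tp in_set_conv_nth)
  moreover have "exq (WhileN r 0 (Mv r True)) (T(r := tp xs (int (Suc i)))) (3 * (length xs - Suc i) + 1) (T(r := tp xs (int (length xs))))"
  proof -
   have "exq (WhileN r 0 (Mv r True)) (T(r := tp xs (int (Suc i)))) (3 * (length xs - Suc i) + 1)
     ((T(r := tp xs (int (Suc i))))(r := tp xs (int (length xs))))"
    by (rule Suc.hyps(1)) (use Suc.prems Suc.hyps(2) i in simp_all)
   thus ?thesis by (simp only: fun_upd_upd)
  qed
  ultimately have "exq (WhileN r 0 (Mv r True)) T (1 + 2 + (3 * (length xs - Suc i) + 1))
    (T(r := tp xs (int (length xs))))"
   by (intro exq_WhT[OF _ exq_Mv_tp[of T r xs "int i" True, OF Suc.prems(1)]]) (simp_all add: shift_def ac_simps)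
  thus ?case by (rule exq_weaken) (use i in simp)
 qed
 note loop = this[of T i, OF assms(1,2)]
 from exq_Seq[OF loop exq_Mv_tp[of _ r xs "int (length xs)" False]]
 have "exq (forward r) T (3 * (length xs - i) + 1 + 1) (T(r := stk xs))"
  unfolding forward_def by (simp add: stk_def shift_def)
 thus ?thesis by (rule exq_weaken) simp
qed

definition copyr :: "nat => nat => com" where
 "copyr x y = WhileN y 0 (IfS y 1 (push x 1) (push x 2) ;; Mv y True) ;; Mv y False"

lemma exq_copyr:
 assumes "x ~= y" "T x = stk u" "T y = tp v (int i)" "i \<le> length v" "set v \<subseteq> {1, 2}"
 shows "exq (copyr x y) T (7 * (length v - i) + 2) (T(x := stk (u @ drop i v), y := stk v))"
proof -
 let ?c = "WhileN y 0 (IfS y 1 (push x 1) (push x 2) ;; Mv y True)"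
 have "T x = stk u ==> T y = tp v (int i) ==> i \<le> length v ==>
  exq ?c T (7 * (length v - i) + 1) (T(x := stk (u @ drop i v), y := tp v (int (length v))))" for u i T
 proof (induction "length v - i" arbitrary: i u T)
  case 0
  hence i: "i = length v" by simp
  hence "exq ?c T 1 T" using 0 by (auto intro!: exq_WhF simp: rd_tp)
  moreover have eq: "T(x := stk (u @ drop i v), y := tp v (int (length v))) = T" using 0 i by auto
  ultimately show ?case unfolding eq using i by simp
 next
  case (Suc k)
  have i: "i < length v" using Suc by simp
  hence vi: "v ! i \<in> {1, 2}" using assms(5) nth_mem by blast
  have rd: "rd T y = v ! i" using Suc.prems i by (simp add: rd_tp)
  have 1: "exq (IfS y 1 (push x 1) (push x 2)) T (2 + 2) (T(x := stk (u @ [v ! i])))"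
   using exq_push[of T x u, OF Suc.prems(1)] vi rd by (intro exq_If) force+
  let ?T = "T(x := stk (u @ [v ! i]))"
  have 2: "exq (Mv y True) ?T 1 (?T(y := tp v (int (Suc i))))"
   using exq_Mv_tp[of ?T y v "int i" True] Suc.prems assms(1) by (simp add: shift_def ac_simps)
  have 3: "exq ?c (?T(y := tp v (int (Suc i)))) (7 * (length v - Suc i) + 1)
   (T(x := stk (u @ drop i v), y := tp v (int (length v))))"
   using Suc.hyps(1)[of "Suc i" "?T(y := tp v (int (Suc i)))" "u @ [v ! i]"] Suc.hyps(2) assms(1) i
   by (simp add: fun_upd_twist Cons_nth_drop_Suc)
  have "rd T y ~= 0" using rd vi by auto
  from exq_WhT[OF this exq_Seq[OF 1 2] 3] show ?case by (rule exq_weaken) (use i in simp)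
 qed
 note loop = this[of T u i, OF assms(2-4)]
 from exq_Seq[OF loop exq_Mv_tp[of _ y v "int (length v)" False]]
 have "exq (copyr x y) T (7 * (length v - i) + 1 + 1) (T(x := stk (u @ drop i v), y := stk v))"
  unfolding copyr_def by (simp add: stk_def shift_def)
 thus ?thesis by (rule exq_weaken) simp
qed

definition append_to :: "nat => nat => com" where
 "append_to x y = rewind y ;; Mv y True ;; copyr x y"

lemma exq_append_to:
 assumes "x ~= y" "T x = stk u" "T y = stk v" "set v \<subseteq> {1, 2}"
 shows "exq (append_to x y) T (10 * length v + 4) (T(x := stk (u @ v)))"
proof -
 have 0: "0 \<notin> set v" using assms(4) by auto
 have 1: "exq (rewind y) T (3 * length v + 1) (T(y := tp v (- 1)))"
  using assms 0 by (intro exq_rewind) (auto simp: stk_def)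
 let ?T = "T(y := tp v (- 1))"
 have 2: "exq (Mv y True) ?T 1 (T(y := tp v 0))"
  using exq_Mv_tp[of ?T y v "- 1" True] by (simp add: shift_def)
 have 3: "exq (copyr x y) (T(y := tp v 0)) (7 * length v + 2) (T(x := stk (u @ v)))"
  using exq_copyr[of x y "T(y := tp v 0)" u v 0] assms by (simp add: fun_upd_twist fun_upd_idem)
 from exq_Seq[OF 1 exq_Seq[OF 2 3]] show ?thesis
  unfolding append_to_def by (rule exq_weaken) simp
qed

text \<open>Tape 3 counts, in unary, the subtrees that remain to be scanned.\<close>

definition scan :: "nat => com => com" where
 "scan r body = WhileN 3 0 (IfS r 2 (push 3 1) (pop 3) ;; body)"

text \<open>Read from the right, the symbol 2 replaces one pending subtree by two and the symbol 1
  completes one. The statement takes the remaining execution as a premise, because one and the same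
  loop goes on with the other \<open>n\<close> pending subtrees after \<open>d\<close>.
  \<open>g i\<close> is the tape with \<open>i\<close> symbols to the left of the scan position;
  \<open>body\<close> may move the head or erase.\<close>

lemma exq_scan:
 fixes g :: "nat => (int => nat) \<times> int"
 assumes r: "r ~= 3"
  and body: "!!T i. T r = g (Suc i) ==> i < length w ==> exq body T 2 (T(r := g i))"
  and g: "!!T i. T r = g (Suc i) ==> i < length w ==> rd T r = w ! i"
 shows "take (length u + sz d) w = u @ ser d ==>
  exq (scan r body) (T(3 := stk (replicate n 1), r := g (length u))) t T' ==>
  exq (scan r body) (T(3 := stk (replicate (Suc n) 1), r := g (length u + sz d)))
   (8 * sz d + t) T'"
proof (induction d arbitrary: u n t)
 case N
 let ?T = "T(3 := stk (replicate (Suc n) 1), r := g (length u + sz N))"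
 have l: "length u < length w" using arg_cong[OF N(1), of length] by auto
 have "take (length u + sz N) w ! length u = 1" unfolding N(1) by simp
 hence w: "w ! length u = 1" using l by simp
 have rd: "rd ?T r = 1" using g[of ?T "length u"] l w by simp
 have 1: "exq (IfS r 2 (push 3 1) (pop 3)) ?T (2 + 2) (?T(3 := stk (replicate n 1)))"
  using rd r exq_pop[of ?T 3 "replicate n 1" 1]
  by (intro exq_If) (auto simp flip: replicate_append_same)
 have 2: "exq body (?T(3 := stk (replicate n 1))) 2 (T(3 := stk (replicate n 1), r := g (length u)))"
  using body[of "?T(3 := stk (replicate n 1))" "length u"] l r by (simp add: fun_upd_twist)
 have "rd ?T 3 ~= 0" using r by (simp add: rd_stk)
 from exq_WhT[OF this exq_Seq[OF 1 2] N(2)[unfolded scan_def]]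
 show ?case unfolding scan_def by (rule exq_weaken) simp
next
 case (C a b)
 let ?T = "T(3 := stk (replicate (Suc n) 1), r := g (length u + sz (C a b)))"
 let ?k = "length u + sz a + sz b"
 have tk: "take (Suc ?k) w = u @ ser a @ ser b @ [2]" using C.prems(1) by (simp add: ac_simps)
 have l: "?k < length w" using arg_cong[OF tk, of length] by auto
 have "take (Suc ?k) w ! ?k = 2" unfolding tk by (simp add: nth_append)
 hence w: "w ! ?k = 2" using l by simp
 have gk: "g (length u + sz (C a b)) = g (Suc ?k)" by (simp add: ac_simps)
 have rd: "rd ?T r = 2" unfolding gk using g[of "T(3 := stk (replicate (Suc n) 1), r := g (Suc ?k))" ?k] l w by simp
 have 1: "exq (IfS r 2 (push 3 1) (pop 3)) ?T (2 + 2) (?T(3 := stk (replicate (Suc (Suc n)) 1)))"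
 proof (rule exq_If)
  have "exq (push 3 1) ?T 2 (?T(3 := stk (replicate (Suc n) 1 @ [1])))"
   by (rule exq_push) (use r in simp)
  moreover have "replicate (Suc n) 1 @ [1 :: nat] = replicate (Suc (Suc n)) 1"
   by (simp add: replicate_append_same)
  ultimately show "exq (push 3 1) ?T 2 (?T(3 := stk (replicate (Suc (Suc n)) 1)))"
   by (simp only:)
 qed (use rd in simp)
 have 2: "exq body (?T(3 := stk (replicate (Suc (Suc n)) 1))) 2
   (T(3 := stk (replicate (Suc (Suc n)) 1), r := g ?k))"
  using body[of "?T(3 := stk (replicate (Suc (Suc n)) 1))" ?k] l r
  by (simp add: fun_upd_twist gk del: sz.simps)
 have ta: "take (length u + sz a) w = u @ ser a"
  using arg_cong[OF tk, of "take (length u + sz a)"] by (simp add: min_def)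
 have tb: "take (length (u @ ser a) + sz b) w = (u @ ser a) @ ser b"
  using arg_cong[OF tk, of "take ?k"] by (simp add: min_def)
 have 3: "exq (scan r body) (T(3 := stk (replicate (Suc n) 1), r := g (length u + sz a))) (8 * sz a + t) T'"
  by (rule C.IH(1)[OF ta C.prems(2)])
 have 4: "exq (scan r body) (T(3 := stk (replicate (Suc (Suc n)) 1), r := g ?k)) (8 * sz b + (8 * sz a + t)) T'"
 proof -
  have "exq (scan r body) (T(3 := stk (replicate (Suc n) 1), r := g (length (u @ ser a)))) (8 * sz a + t) T'"
   using 3 by simp
  from C.IH(2)[OF tb this] show ?thesis by (simp only: length_append length_ser)
 qed
 have "rd ?T 3 ~= 0" using r by (simp add: rd_stk)
 from exq_WhT[OF this exq_Seq[OF 1 2] 4[unfolded scan_def]]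
 show ?case unfolding scan_def by (rule exq_weaken) simp
qed

section \<open>Register programs for the operations on trees\<close>

text \<open>Tapes 2 and 3 are empty between commands; register \<open>r\<close> is tape \<open>r + 4\<close>.\<close>

definition tst :: "tapes => (nat => dt) => tapes" where
 "tst T0 \<sigma> i = (if i < 2 then T0 i else if i < 4 then stk [] else stk (ser (\<sigma> (i - 4))))"

lemma tst_simps [simp]:
 "tst T0 \<sigma> 2 = stk []" "tst T0 \<sigma> 3 = stk []" "tst T0 \<sigma> (x + 4) = stk (ser (\<sigma> x))"
 by (simp_all add: tst_def)

lemma tst_update: "(tst T0 \<sigma>)(x + 4 := stk (ser d)) = tst T0 (\<sigma>(x := d))"
 by (auto simp: tst_def fun_eq_iff)

lemma tst_same: "(tst T0 \<sigma>)(2 := stk []) = tst T0 \<sigma>"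
 by (auto simp: tst_def fun_eq_iff)

text \<open>Results are assembled on tape 2 and moved only at the end, so that the destination may
  also be an operand.\<close>

definition cmove :: "nat => com" where
 "cmove x = clear (x + 4) ;; append_to (x + 4) 2 ;; clear 2"

lemma ser_no_0 [simp]: "0 \<notin> set (ser d)"
 using set_ser[of d] by auto

lemma exq_cmove:
 "exq (cmove x) ((tst T0 \<sigma>)(2 := stk (ser d))) (4 * sz (\<sigma> x) + 14 * sz d + 6) (tst T0 (\<sigma>(x := d)))"
proof -
 let ?T = "(tst T0 \<sigma>)(2 := stk (ser d))"
 have 1: "exq (clear (x + 4)) ?T (4 * sz (\<sigma> x) + 1) (?T(x + 4 := stk []))"
  using exq_clear[of ?T "x + 4" "ser (\<sigma> x)"] by simp
 have 2: "exq (append_to (x + 4) 2) (?T(x + 4 := stk [])) (10 * sz d + 4) (?T(x + 4 := stk (ser d)))"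
  using exq_append_to[of "x + 4" 2 "?T(x + 4 := stk [])" "[]" "ser d"] set_ser by simp
 have 3: "exq (clear 2) (?T(x + 4 := stk (ser d))) (4 * sz d + 1) (tst T0 (\<sigma>(x := d)))"
  using exq_clear[of "?T(x + 4 := stk (ser d))" 2 "ser d"]
  by (simp add: fun_upd_twist tst_same tst_update)
 from exq_Seq[OF 1 exq_Seq[OF 2 3]] show ?thesis
  unfolding cmove_def by (rule exq_weaken) simp
qed

definition cnil :: "nat => com" where
 "cnil x = clear (x + 4) ;; push (x + 4) 1"

lemma exq_cnil: "exq (cnil x) (tst T0 \<sigma>) (4 * sz (\<sigma> x) + 3) (tst T0 (\<sigma>(x := N)))"
proof -
 have 1: "exq (clear (x + 4)) (tst T0 \<sigma>) (4 * sz (\<sigma> x) + 1) ((tst T0 \<sigma>)(x + 4 := stk []))"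
  using exq_clear[of "tst T0 \<sigma>" "x + 4" "ser (\<sigma> x)"] by simp
 have 2: "exq (push (x + 4) 1) ((tst T0 \<sigma>)(x + 4 := stk [])) 2 (tst T0 (\<sigma>(x := N)))"
  using exq_push[of "(tst T0 \<sigma>)(x + 4 := stk [])" "x + 4" "[]" 1] tst_update[of T0 \<sigma> x N] by simp
 from exq_Seq[OF 1 2] show ?thesis unfolding cnil_def by (rule exq_weaken) simp
qed

definition ccopy :: "nat => nat => com" where
 "ccopy x y = append_to 2 (y + 4) ;; cmove x"

lemma exq_ccopy:
 "exq (ccopy x y) (tst T0 \<sigma>) (24 * (sz (\<sigma> x) + sz (\<sigma> y)) + 10) (tst T0 (\<sigma>(x := \<sigma> y)))"
proof -
 have 1: "exq (append_to 2 (y + 4)) (tst T0 \<sigma>) (10 * sz (\<sigma> y) + 4) ((tst T0 \<sigma>)(2 := stk (ser (\<sigma> y))))"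
  using exq_append_to[of 2 "y + 4" "tst T0 \<sigma>" "[]" "ser (\<sigma> y)"] set_ser by simp
 from exq_Seq[OF 1 exq_cmove] show ?thesis unfolding ccopy_def by (rule exq_weaken) simp
qed

definition ccons :: "nat => nat => nat => com" where
 "ccons x y z = append_to 2 (y + 4) ;; append_to 2 (z + 4) ;; push 2 2 ;; cmove x"

lemma exq_ccons:
 "exq (ccons x y z) (tst T0 \<sigma>) (24 * (sz (\<sigma> x) + sz (\<sigma> y) + sz (\<sigma> z)) + 30)
  (tst T0 (\<sigma>(x := C (\<sigma> y) (\<sigma> z))))"
proof -
 let ?T = "tst T0 \<sigma>"
 have 1: "exq (append_to 2 (y + 4)) ?T (10 * sz (\<sigma> y) + 4) (?T(2 := stk (ser (\<sigma> y))))"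
  using exq_append_to[of 2 "y + 4" "tst T0 \<sigma>" "[]" "ser (\<sigma> y)"] set_ser by simp
 have 2: "exq (append_to 2 (z + 4)) (?T(2 := stk (ser (\<sigma> y)))) (10 * sz (\<sigma> z) + 4)
   (?T(2 := stk (ser (\<sigma> y) @ ser (\<sigma> z))))"
  using exq_append_to[of 2 "z + 4" "?T(2 := stk (ser (\<sigma> y)))" "ser (\<sigma> y)" "ser (\<sigma> z)"] set_ser by simp
 have 3: "exq (push 2 2) (?T(2 := stk (ser (\<sigma> y) @ ser (\<sigma> z)))) 2
   (?T(2 := stk (ser (C (\<sigma> y) (\<sigma> z)))))"
  using exq_push[of "?T(2 := stk (ser (\<sigma> y) @ ser (\<sigma> z)))" 2 "ser (\<sigma> y) @ ser (\<sigma> z)" 2] by simp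
 from exq_Seq[OF 1 exq_Seq[OF 2 exq_Seq[OF 3 exq_cmove]]] show ?thesis
  unfolding ccons_def by (rule exq_weaken) simp
qed

fun hdD :: "dt => dt" where "hdD N = N" | "hdD (C a b) = a"
fun tlD :: "dt => dt" where "tlD N = N" | "tlD (C a b) = b"

text \<open>In postfix order the second subtree stands directly before the root symbol. The scan
  finds its left end; copying from there to the end of the tape includes the root symbol, which is
  popped afterwards.\<close>

definition ctl :: "nat => nat => com" where
 "ctl x y = IfS (y + 4) 1 (push 2 1) (push 3 1 ;; Mv (y + 4) False ;;
   scan (y + 4) (Mv (y + 4) False) ;; Mv (y + 4) True ;; copyr 2 (y + 4) ;; pop 2) ;; cmove x"

lemma exq_ctl:
 "exq (ctl x y) (tst T0 \<sigma>) (50 * (sz (\<sigma> x) + sz (\<sigma> y)) + 50) (tst T0 (\<sigma>(x := tlD (\<sigma> y))))"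
proof -
 let ?T = "tst T0 \<sigma>"
 have rd: "rd ?T (y + 4) = 1 \<longleftrightarrow> \<sigma> y = N"
  by (cases "\<sigma> y") (simp_all add: rd_stk[of _ _ "ser (\<sigma> y)"])
 have "exq (IfS (y + 4) 1 (push 2 1) (push 3 1 ;; Mv (y + 4) False ;;
   scan (y + 4) (Mv (y + 4) False) ;; Mv (y + 4) True ;; copyr 2 (y + 4) ;; pop 2)) ?T
   (20 * sz (\<sigma> y) + 20 + 2) (?T(2 := stk (ser (tlD (\<sigma> y)))))"
 proof (rule exq_If)
  assume "rd ?T (y + 4) = 1"
  hence "\<sigma> y = N" using rd by simp
  thus "exq (push 2 1) ?T (20 * sz (\<sigma> y) + 20) (?T(2 := stk (ser (tlD (\<sigma> y)))))"
   using exq_push[of ?T 2 "[]" 1] by (auto elim!: exq_weaken)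
 next
  assume "rd ?T (y + 4) ~= 1"
  then obtain a b where ab: "\<sigma> y = C a b" using rd by (cases "\<sigma> y") auto
  let ?w = "ser a @ ser b @ [2]"
  let ?y = "y + 4"
  have Ty: "?T ?y = stk ?w" using ab by simp
  have 1: "exq (push 3 1) ?T 2 (?T(3 := stk [1]))" using exq_push[of ?T 3 "[]" 1] by simp
  have 2: "exq (Mv ?y False) (?T(3 := stk [1])) 1 (?T(3 := stk [1], ?y := tp ?w (int (sz a + sz b) - 1)))"
   using exq_Mv_tp[of "?T(3 := stk [1])" ?y ?w "int (length ?w) - 1" False] ab
   by (simp add: stk_def shift_def)
  have "exq (scan ?y (Mv ?y False)) (?T(3 := stk (replicate (Suc 0) 1), ?y := (%i. tp ?w (int i - 1)) (length (ser a) + sz b)))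
   (8 * sz b + 1) (?T(3 := stk (replicate 0 1), ?y := tp ?w (int (sz a) - 1)))"
  proof (rule exq_scan[where w = ?w])
   show "exq (Mv ?y False) T 2 (T(?y := tp ?w (int i - 1)))" if "T ?y = tp ?w (int (Suc i) - 1)" for T i
    using exq_Mv_tp[of T ?y ?w "int (Suc i) - 1" False, OF that] by (auto simp: shift_def elim: exq_weaken)
   show "rd T ?y = ?w ! i" if "T ?y = tp ?w (int (Suc i) - 1)" "i < length ?w" for T i
    using that by (simp add: rd_tp)
   show "exq (scan ?y (Mv ?y False)) (?T(3 := stk (replicate 0 1), ?y := tp ?w (int (length (ser a)) - 1))) 1
     (?T(3 := stk (replicate 0 1), ?y := tp ?w (int (sz a) - 1)))"
    unfolding scan_def length_ser by (rule exq_WhF) (simp_all add: rd_stk)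
  qed auto
  hence 3: "exq (scan ?y (Mv ?y False)) (?T(3 := stk [1], ?y := tp ?w (int (sz a + sz b) - 1)))
   (8 * sz b + 1) (?T(?y := tp ?w (int (sz a) - 1)))"
   by (simp add: fun_upd_idem)
  have 4: "exq (Mv ?y True) (?T(?y := tp ?w (int (sz a) - 1))) 1 (?T(?y := tp ?w (int (sz a))))"
   using exq_Mv_tp[of "?T(?y := tp ?w (int (sz a) - 1))" ?y ?w "int (sz a) - 1" True] by (simp add: shift_def)
  have 5: "exq (copyr 2 ?y) (?T(?y := tp ?w (int (sz a)))) (7 * (length ?w - sz a) + 2)
    (?T(2 := stk (ser b @ [2])))"
   using exq_copyr[of 2 ?y "?T(?y := tp ?w (int (sz a)))" "[]" ?w "sz a"] set_ser[of a] set_ser[of b] Ty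
   by (simp add: fun_upd_twist fun_upd_idem)
  have 6: "exq (pop 2) (?T(2 := stk (ser b @ [2]))) 2 (?T(2 := stk (ser b)))"
   using exq_pop[of "?T(2 := stk (ser b @ [2]))" 2 "ser b" 2] by simp
  show "exq (push 3 1 ;; Mv ?y False ;; scan ?y (Mv ?y False) ;; Mv ?y True ;; copyr 2 ?y ;; pop 2) ?T
   (20 * sz (\<sigma> y) + 20) (?T(2 := stk (ser (tlD (\<sigma> y)))))"
   using exq_Seq[OF 1 exq_Seq[OF 2 exq_Seq[OF 3 exq_Seq[OF 4 exq_Seq[OF 5 6]]]]] ab
   by (auto elim!: exq_weaken)
 qed
 from exq_Seq[OF this exq_cmove] show ?thesis unfolding ctl_def
  by (rule exq_weaken) (cases "\<sigma> y"; simp)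
qed

text \<open>The whole tree is copied; after the root symbol is popped, the scan erases the second
  subtree and leaves the first.\<close>

definition chd :: "nat => nat => com" where
 "chd x y = append_to 2 (y + 4) ;;
   IfS 2 1 (Wr 2 1) (pop 2 ;; push 3 1 ;; scan 2 (pop 2)) ;; cmove x"

lemma exq_chd:
 "exq (chd x y) (tst T0 \<sigma>) (50 * (sz (\<sigma> x) + sz (\<sigma> y)) + 50) (tst T0 (\<sigma>(x := hdD (\<sigma> y))))"
proof -
 let ?T = "tst T0 \<sigma>"
 have 0: "exq (append_to 2 (y + 4)) ?T (10 * sz (\<sigma> y) + 4) (?T(2 := stk (ser (\<sigma> y))))"
  using exq_append_to[of 2 "y + 4" "tst T0 \<sigma>" "[]" "ser (\<sigma> y)"] set_ser by simp
 let ?U = "?T(2 := stk (ser (\<sigma> y)))"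
 have rd: "rd ?U 2 = 1 \<longleftrightarrow> \<sigma> y = N"
  by (cases "\<sigma> y") (simp_all add: rd_stk[of _ _ "ser (\<sigma> y)"])
 have "exq (IfS 2 1 (Wr 2 1) (pop 2 ;; push 3 1 ;; scan 2 (pop 2))) ?U
   (20 * sz (\<sigma> y) + 10 + 2) (?T(2 := stk (ser (hdD (\<sigma> y)))))"
 proof (rule exq_If)
  assume "rd ?U 2 = 1"
  hence "\<sigma> y = N" using rd by simp
  moreover have "wr (?T(2 := stk [1])) 2 1 = ?T(2 := stk [1])"
   by (auto simp: wr_def stk_def tp_def fun_eq_iff)
  ultimately show "exq (Wr 2 1) ?U (20 * sz (\<sigma> y) + 10) (?T(2 := stk (ser (hdD (\<sigma> y)))))"
   using exq_Wr[of 2 1 ?U] by (auto elim!: exq_weaken)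
 next
  assume "rd ?U 2 ~= 1"
  then obtain a b where ab: "\<sigma> y = C a b" using rd by (cases "\<sigma> y") auto
  let ?w = "ser a @ ser b"
  have 1: "exq (pop 2) ?U 2 (?T(2 := stk ?w))" using exq_pop[of ?U 2 ?w 2] ab by simp
  have 2: "exq (push 3 1) (?T(2 := stk ?w)) 2 (?T(3 := stk [1], 2 := stk ?w))"
   using exq_push[of "?T(2 := stk ?w)" 3 "[]" 1] by (simp add: fun_upd_twist)
  have "exq (scan 2 (pop 2)) (?T(3 := stk (replicate (Suc 0) 1), 2 := (%i. stk (take i ?w)) (length (ser a) + sz b)))
   (8 * sz b + 1) (?T(3 := stk (replicate 0 1), 2 := stk (ser a)))"
  proof (rule exq_scan[where w = ?w])
   show "exq (pop 2) T 2 (T(2 := stk (take i ?w)))" if "T 2 = stk (take (Suc i) ?w)" "i < length ?w" for T i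
    by (rule exq_pop) (use that in \<open>simp add: take_Suc_conv_app_nth del: take_append\<close>)
   show "rd T 2 = ?w ! i" if "T 2 = stk (take (Suc i) ?w)" "i < length ?w" for T i
    using that by (simp add: rd_stk take_Suc_conv_app_nth del: take_append)
   show "exq (scan 2 (pop 2)) (?T(3 := stk (replicate 0 1), 2 := stk (take (length (ser a)) ?w))) 1
     (?T(3 := stk (replicate 0 1), 2 := stk (ser a)))"
    unfolding scan_def by (simp, rule exq_WhF) (simp_all add: rd_stk)
  qed auto
  hence 3: "exq (scan 2 (pop 2)) (?T(3 := stk [1], 2 := stk ?w)) (8 * sz b + 1) (?T(2 := stk (ser a)))"
   by (simp add: fun_upd_idem)
  show "exq (pop 2 ;; push 3 1 ;; scan 2 (pop 2)) ?U
   (20 * sz (\<sigma> y) + 10) (?T(2 := stk (ser (hdD (\<sigma> y)))))"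
   using exq_Seq[OF 1 exq_Seq[OF 2 3]] ab by (auto elim!: exq_weaken)
 qed
 from exq_Seq[OF 0 exq_Seq[OF this exq_cmove]] show ?thesis unfolding chd_def
  by (rule exq_weaken) (cases "\<sigma> y"; simp)
qed

text \<open>A mismatch is recorded on tape 3, and rewinding \<open>r\<close> lets its head read a
  blank, which ends the loop.\<close>

definition cmp_loop :: "nat => nat => com" where
 "cmp_loop r s = WhileN r 0 (IfS r 1
   (IfS s 1 (Mv r False ;; Mv s False) (push 3 1 ;; rewind r))
   (IfS s 2 (Mv r False ;; Mv s False) (push 3 1 ;; rewind r)))"

text \<open>The words are compared from their right ends. Tape \<open>r\<close> is exhausted in any
  case at the end; equality shows in tape \<open>s\<close> being exhausted too
  (\<open>j' = 0\<close>) and tape 3 carrying no mark.\<close>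

lemma exq_cmp_loop:
 assumes rs: "r ~= s" "r ~= 3" "s ~= 3" and v: "set v \<subseteq> {1, 2}" and w: "set w \<subseteq> {1, 2}"
 shows "T r = tp v (int i - 1) ==> i \<le> length v ==> T s = tp w (int j - 1) ==> j \<le> length w ==>
  T 3 = stk [] ==> \<exists>j' k. j' \<le> length w & set k \<subseteq> {1} & length k \<le> 1 &
   (k = [] & j' = 0 \<longleftrightarrow> take i v = take j w) &
   exq (cmp_loop r s) T (15 * i + 15) (T(r := tp v (- 1), s := tp w (int j' - 1), 3 := stk k))"
proof (induction i arbitrary: j T)
 case 0
 have eq: "T(r := tp v (- 1), s := tp w (int j - 1), 3 := stk []) = T"
  using 0 rs by (auto simp: fun_eq_iff)
 have "exq (cmp_loop r s) T (15 * 0 + 15) T"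
  unfolding cmp_loop_def by (rule exq_WhF) (use 0 in \<open>auto simp: rd_tp\<close>)
 hence e: "exq (cmp_loop r s) T (15 * 0 + 15) (T(r := tp v (- 1), s := tp w (int j - 1), 3 := stk []))"
  by (simp only: eq)
 show ?case using 0 by (intro exI[of _ j] exI[of _ "[]"] conjI e) auto
next
 case (Suc i)
 have i: "i < length v" using Suc.prems by simp
 have rdr: "rd T r = v ! i" using Suc.prems(1) i by (simp add: rd_tp)
 have rds: "rd T s = (if j = 0 then 0 else w ! (j - 1))"
  using Suc.prems by (auto simp: rd_tp nat_diff_distrib)
 have vi: "v ! i \<in> {1, 2}" using i v nth_mem by blast
 have wj: "w ! (j - 1) \<in> {1, 2}" if "j ~= 0"
 proof -
  have "w ! (j - 1) \<in> set w" using that Suc.prems(4) by (intro nth_mem) simp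
  thus ?thesis using w by blast
 qed
 have ne: "rd T r ~= 0" using rdr vi by auto
 have body: "exq (IfS r 1 (IfS s 1 A B) (IfS s 2 A B)) T (t + 2 + 2) T'"
  if "rd T r = rd T s ==> exq A T t T'" "rd T r ~= rd T s ==> exq B T t T'" for A B t T'
  using that vi rdr by (intro exq_If) auto
 show ?case
 proof (cases "rd T r = rd T s")
  case True
  hence j: "j ~= 0" using ne rds by (cases j) simp_all
  have m1: "exq (Mv r False) T 1 (T(r := tp v (int i - 1)))"
   using exq_Mv_tp[of T r v "int (Suc i) - 1" False, OF Suc.prems(1)] by (simp add: shift_def)
  have "(T(r := tp v (int i - 1))) s = tp w (int j - 1)" using Suc.prems(3) rs by simp
  from exq_Mv_tp[of "T(r := tp v (int i - 1))" s w "int j - 1" False, OF this]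
  have m2: "exq (Mv s False) (T(r := tp v (int i - 1))) 1 (T(r := tp v (int i - 1), s := tp w (int (j - 1) - 1)))"
   using j by (simp add: shift_def of_nat_diff)
  let ?T = "T(r := tp v (int i - 1), s := tp w (int (j - 1) - 1))"
  have "\<exists>j' k. j' \<le> length w & set k \<subseteq> {1} & length k \<le> 1 &
   (k = [] & j' = 0 \<longleftrightarrow> take i v = take (j - 1) w) &
   exq (cmp_loop r s) ?T (15 * i + 15) (?T(r := tp v (- 1), s := tp w (int j' - 1), 3 := stk k))"
   by (rule Suc.IH) (use Suc.prems rs i in auto)
  then obtain j' k where k: "j' \<le> length w" "set k \<subseteq> {1}" "length k \<le> 1"
   "k = [] & j' = 0 \<longleftrightarrow> take i v = take (j - 1) w"
   and e: "exq (cmp_loop r s) ?T (15 * i + 15) (?T(r := tp v (- 1), s := tp w (int j' - 1), 3 := stk k))"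
   by blast
  have "?T(r := tp v (- 1), s := tp w (int j' - 1), 3 := stk k) =
    T(r := tp v (- 1), s := tp w (int j' - 1), 3 := stk k)"
   using rs by (auto simp: fun_eq_iff)
  note e = e[unfolded this]
  have e': "exq (cmp_loop r s) T ((1 + 1) + 2 + 2 + 2 + (15 * i + 15))
    (T(r := tp v (- 1), s := tp w (int j' - 1), 3 := stk k))"
   unfolding cmp_loop_def
   by (rule exq_WhT[OF ne body[OF exq_Seq[OF m1 m2]] e[unfolded cmp_loop_def]]) (use True in simp_all)
  have tk: "take (Suc i) v = take j w \<longleftrightarrow> take i v = take (j - 1) w"
  proof -
   have "take (Suc i) v = take i v @ [v ! i]" using i by (simp add: take_Suc_conv_app_nth)
   moreover have "take (Suc (j - 1)) w = take (j - 1) w @ [w ! (j - 1)]"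
    using j Suc.prems(4) by (intro take_Suc_conv_app_nth) simp
   ultimately show ?thesis using True rdr rds j by simp
  qed
  show ?thesis using k
   by (intro exI[of _ j'] exI[of _ k] conjI exq_weaken[OF e']) (simp_all add: tk)
 next
  case False
  have p: "exq (push 3 1) T 2 (T(3 := stk [1]))" using exq_push[of T 3 "[]" 1, OF Suc.prems(5)] by simp
  have rw: "exq (rewind r) (T(3 := stk [1])) (3 * Suc i + 1) (T(3 := stk [1], r := tp v (- 1)))"
   by (rule exq_rewind) (use Suc.prems rs v in auto)
  have e: "exq (cmp_loop r s) (T(3 := stk [1], r := tp v (- 1))) 1 (T(3 := stk [1], r := tp v (- 1)))"
   unfolding cmp_loop_def by (rule exq_WhF) (use rs in \<open>auto simp: rd_tp\<close>)
  have e': "exq (cmp_loop r s) T ((2 + (3 * Suc i + 1)) + 2 + 2 + 2 + 1) (T(3 := stk [1], r := tp v (- 1)))"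
   unfolding cmp_loop_def
   by (rule exq_WhT[OF ne body[OF _ exq_Seq[OF p rw]] e[unfolded cmp_loop_def]]) (use False in simp_all)
  have eq: "T(3 := stk [1], r := tp v (- 1)) = T(r := tp v (- 1), s := tp w (int j - 1), 3 := stk [1])"
   using rs Suc.prems by (auto simp: fun_eq_iff)
  have tk: "take (Suc i) v ~= take j w"
  proof
   assume eq: "take (Suc i) v = take j w"
   have "length (take (Suc i) v) = length (take j w)" by (rule arg_cong[OF eq])
   hence "j = Suc i" using i Suc.prems(4) by simp
   moreover have "take (Suc i) v ! i = take j w ! i" using eq by simp
   ultimately show False using False rdr rds by simp
  qed
  show ?thesis using Suc.prems(4) tk
   by (intro exI[of _ j] exI[of _ "[1]"] conjI exq_weaken[OF e'[unfolded eq]]) simp_all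
 qed
qed

text \<open>Postfix words are decoded from the right: the last symbol determines the root, and no
  word of a tree is a proper suffix of another.\<close>

lemma ser_inj: "ser a @ r = ser b @ r' ==> length r = length r' ==> a = b"
proof -
 have "r @ ser a = r' @ ser b ==> a = b & r = r'" for r r'
 proof (induction a arbitrary: b r r')
  case N
  show ?case
  proof (cases b)
   case (C b1 b2)
   hence "r @ [1] = (r' @ ser b1 @ ser b2) @ [2]" using N by simp
   thus ?thesis by (simp only: append1_eq_conv) simp
  qed (use N in simp)
 next
  case (C a1 a2)
  have "b ~= N"
  proof
   assume "b = N"
   hence "(r @ ser a1 @ ser a2) @ [2] = r' @ [1]" using C.prems by simp
   thus False by (simp only: append1_eq_conv) simp
  qed
  then obtain b1 b2 where b: "b = C b1 b2" by (cases b) simp_all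
  have "((r @ ser a1) @ ser a2) @ [2] = ((r' @ ser b1) @ ser b2) @ [2]" using C.prems b by simp
  hence "(r @ ser a1) @ ser a2 = (r' @ ser b1) @ ser b2" by (simp only: append1_eq_conv)
  hence "a2 = b2 & r @ ser a1 = r' @ ser b1" by (rule C.IH(2))
  thus ?case using C.IH(1) b by blast
 qed
 from this[of "[]" "[]"]
 show "ser a @ r = ser b @ r' ==> length r = length r' ==> a = b" by simp
qed

definition boolD :: "bool => dt" where
 "boolD b = (if b then C N N else N)"

definition ceq :: "nat => nat => nat => com" where
 "ceq x y z = cmp_loop (y + 4) (z + 4) ;;
   IfS (z + 4) 0 (IfS 3 0 (push 2 1 ;; push 2 1 ;; push 2 2) (push 2 1)) (push 2 1) ;;
   clear 3 ;; Mv (y + 4) True ;; forward (y + 4) ;; Mv (z + 4) True ;; forward (z + 4) ;; cmove x"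

lemma exq_ceq:
 assumes "y ~= z"
 shows "exq (ceq x y z) (tst T0 \<sigma>) (100 * (sz (\<sigma> x) + sz (\<sigma> y) + sz (\<sigma> z)) + 100)
  (tst T0 (\<sigma>(x := boolD (\<sigma> y = \<sigma> z))))"
proof -
 let ?T = "tst T0 \<sigma>" and ?y = "y + 4" and ?z = "z + 4"
 let ?v = "ser (\<sigma> y)" and ?w = "ser (\<sigma> z)"
 have Ty: "?T ?y = stk ?v" and Tz: "?T ?z = stk ?w" by simp_all
 have "\<exists>j' k. j' \<le> length ?w & set k \<subseteq> {1} & length k \<le> 1 &
   (k = [] & j' = 0 \<longleftrightarrow> take (length ?v) ?v = take (length ?w) ?w) &
   exq (cmp_loop ?y ?z) ?T (15 * length ?v + 15) (?T(?y := tp ?v (- 1), ?z := tp ?w (int j' - 1), 3 := stk k))"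
  by (rule exq_cmp_loop) (use assms set_ser Ty Tz in \<open>auto simp: stk_def\<close>)
 then obtain j' k where k: "j' \<le> length ?w" "set k \<subseteq> {1}" "length k \<le> 1"
  "k = [] & j' = 0 \<longleftrightarrow> ?v = ?w"
  and e1: "exq (cmp_loop ?y ?z) ?T (15 * sz (\<sigma> y) + 15) (?T(?y := tp ?v (- 1), ?z := tp ?w (int j' - 1), 3 := stk k))"
  by (auto simp: take_all)
 let ?d = "boolD (\<sigma> y = \<sigma> z)"
 have eq: "?v = ?w \<longleftrightarrow> \<sigma> y = \<sigma> z" using ser_inj[of "\<sigma> y" "[]" "\<sigma> z" "[]"] by auto
 let ?U = "?T(?y := tp ?v (- 1), ?z := tp ?w (int j' - 1), 3 := stk k)"
 have U2: "?U 2 = stk []" by simp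
 have rz: "rd ?U ?z = 0 \<longleftrightarrow> j' = 0"
 proof (cases "j' = 0")
  case False
  hence "?w ! (j' - 1) \<in> set ?w" using k(1) by (intro nth_mem) simp
  hence "?w ! (j' - 1) ~= 0" using ser_no_0[of "\<sigma> z"] by metis
  thus ?thesis using k(1) False by (simp add: rd_tp nat_diff_distrib)
 qed (simp add: rd_tp)
 have "last k = 1" if "k ~= []" using last_in_set[OF that] k(2) by auto
 hence r3: "rd ?U 3 = 0 \<longleftrightarrow> k = []" by (auto simp: rd_stk)
 have pF: "exq (push 2 1) ?U 10 (?U(2 := stk (ser N)))"
  using exq_push[of ?U 2 "[]" 1, OF U2] by (auto elim: exq_weaken)
 have pT: "exq (push 2 1 ;; push 2 1 ;; push 2 2) ?U 10 (?U(2 := stk (ser (C N N))))"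
 proof -
  have 1: "exq (push 2 1) ?U 2 (?U(2 := stk [1]))" using exq_push[of ?U 2 "[]" 1, OF U2] by simp
  have 2: "exq (push 2 1) (?U(2 := stk [1])) 2 (?U(2 := stk [1, 1]))"
   using exq_push[of "?U(2 := stk [1])" 2 "[1]" 1] by simp
  have 3: "exq (push 2 2) (?U(2 := stk [1, 1])) 2 (?U(2 := stk [1, 1, 2]))"
   using exq_push[of "?U(2 := stk [1, 1])" 2 "[1, 1]" 2] by simp
  from exq_Seq[OF 1 exq_Seq[OF 2 3]] show ?thesis by (auto elim: exq_weaken)
 qed
 have e2: "exq (IfS ?z 0 (IfS 3 0 (push 2 1 ;; push 2 1 ;; push 2 2) (push 2 1)) (push 2 1)) ?U 14
   (?U(2 := stk (ser ?d)))"
 proof -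
  have "exq (IfS ?z 0 (IfS 3 0 (push 2 1 ;; push 2 1 ;; push 2 2) (push 2 1)) (push 2 1)) ?U (10 + 2 + 2)
   (?U(2 := stk (ser ?d)))"
   by (rule exq_If, rule exq_If)
    (use k(4) eq rz r3 pT exq_weaken[OF pF, of "10 + 2"] pF in \<open>auto simp: boolD_def\<close>)
  thus ?thesis by simp
 qed
 let ?V = "?T(?y := tp ?v (- 1), ?z := tp ?w (int j' - 1), 2 := stk (ser ?d))"
 have e3: "exq (clear 3) (?U(2 := stk (ser ?d))) 5 ?V"
 proof -
  have "exq (clear 3) (?U(2 := stk (ser ?d))) (4 * length k + 1) (?U(2 := stk (ser ?d), 3 := stk []))"
   by (rule exq_clear) (use k(2) in auto)
  moreover have "?U(2 := stk (ser ?d), 3 := stk []) = ?V"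
   by (auto simp: fun_eq_iff tst_def)
  ultimately show ?thesis using k(3) by (auto elim: exq_weaken)
 qed
 have e4: "exq (Mv ?y True) ?V 1 (?V(?y := tp ?v 0))"
  using exq_Mv_tp[of ?V ?y ?v "- 1" True] assms by (simp add: shift_def)
 have "exq (forward ?y) (?V(?y := tp ?v 0)) (3 * (length ?v - 0) + 2) (?V(?y := tp ?v 0, ?y := stk ?v))"
  by (rule exq_forward) auto
 hence e5: "exq (forward ?y) (?V(?y := tp ?v 0)) (3 * sz (\<sigma> y) + 2) (?V(?y := stk ?v))" by simp
 let ?W = "?V(?y := stk ?v)"
 have e6: "exq (Mv ?z True) ?W 1 (?W(?z := tp ?w (int j')))"
  using exq_Mv_tp[of ?W ?z ?w "int j' - 1" True] assms by (simp add: shift_def)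
 have e7: "exq (forward ?z) (?W(?z := tp ?w (int j'))) (3 * sz (\<sigma> z) + 2) (?T(2 := stk (ser ?d)))"
 proof -
  have "exq (forward ?z) (?W(?z := tp ?w (int j'))) (3 * (length ?w - j') + 2) (?W(?z := tp ?w (int j'), ?z := stk ?w))"
   by (rule exq_forward) (use k in auto)
  moreover have "?W(?z := tp ?w (int j'), ?z := stk ?w) = ?T(2 := stk (ser ?d))"
   using Ty Tz by (auto simp: fun_eq_iff)
  ultimately show ?thesis by (auto elim: exq_weaken)
 qed
 have d: "14 * sz ?d \<le> 42" by (simp add: boolD_def)
 from exq_Seq[OF e1 exq_Seq[OF e2 exq_Seq[OF e3 exq_Seq[OF e4 exq_Seq[OF e5 exq_Seq[OF e6 exq_Seq[OF e7 exq_cmove]]]]]]]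
 show ?thesis unfolding ceq_def
  by (rule exq_weaken) (use d in \<open>simp del: sz.simps\<close>)
qed

section \<open>Polynomial-time functions on trees\<close>

definition pb :: "(nat => nat) => bool" where
 "pb f \<longleftrightarrow> (\<exists>p :: nat poly. \<forall>n. f n \<le> poly p n)"

lemma poly_nat_mono: "x \<le> y ==> poly (p :: nat poly) x \<le> poly p y"
 by (induction p) (auto intro!: add_mono mult_mono)

lemma pb_const [intro]: "pb (%_. c)"
 unfolding pb_def by (intro exI[of _ "[:c:]"]) simp

lemma pb_id [intro]: "pb (%n. n)"
 unfolding pb_def by (intro exI[of _ "[:0, 1:]"]) simp

lemma pb_poly [intro]: "pb (poly p)"
 unfolding pb_def by blast

lemma pb_add [intro]: "pb f ==> pb g ==> pb (%n. f n + g n)"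
 unfolding pb_def by (metis add_mono poly_add)

lemma pb_mult [intro]: "pb f ==> pb g ==> pb (%n. f n * g n)"
 unfolding pb_def by (metis mult_le_mono poly_mult)

lemma pb_comp: "pb f ==> pb (%n. poly p (f n))"
 unfolding pb_def by (metis poly_nat_mono poly_pcompose)

definition exs :: "com => (nat => dt) => nat => (nat => dt) => bool" where
 "exs c \<sigma> t \<sigma>' \<longleftrightarrow> (\<forall>T0. exq c (tst T0 \<sigma>) t (tst T0 \<sigma>'))"

lemma exs_Seq: "exs c \<sigma> t \<sigma>' ==> exs c' \<sigma>' t' \<sigma>'' ==> exs (c ;; c') \<sigma> (t + t') \<sigma>''"
 unfolding exs_def using exq_Seq by blast

lemma exs_weaken: "exs c \<sigma> t \<sigma>' ==> t \<le> t' ==> exs c \<sigma> t' \<sigma>'"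
 unfolding exs_def using exq_weaken by blast

lemma exs_nil: "exs (cnil x) \<sigma> (4 * sz (\<sigma> x) + 3) (\<sigma>(x := N))"
 unfolding exs_def using exq_cnil by blast

lemma exs_copy: "exs (ccopy x y) \<sigma> (24 * (sz (\<sigma> x) + sz (\<sigma> y)) + 10) (\<sigma>(x := \<sigma> y))"
 unfolding exs_def using exq_ccopy by blast

lemma exs_cons:
 "exs (ccons x y z) \<sigma> (24 * (sz (\<sigma> x) + sz (\<sigma> y) + sz (\<sigma> z)) + 30) (\<sigma>(x := C (\<sigma> y) (\<sigma> z)))"
 unfolding exs_def using exq_ccons by blast

lemma exs_hd: "exs (chd x y) \<sigma> (50 * (sz (\<sigma> x) + sz (\<sigma> y)) + 50) (\<sigma>(x := hdD (\<sigma> y)))"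
 unfolding exs_def using exq_chd by blast

lemma exs_tl: "exs (ctl x y) \<sigma> (50 * (sz (\<sigma> x) + sz (\<sigma> y)) + 50) (\<sigma>(x := tlD (\<sigma> y)))"
 unfolding exs_def using exq_ctl by blast

lemma exs_eq:
 "y ~= z ==> exs (ceq x y z) \<sigma> (100 * (sz (\<sigma> x) + sz (\<sigma> y) + sz (\<sigma> z)) + 100)
   (\<sigma>(x := boolD (\<sigma> y = \<sigma> z)))"
 unfolding exs_def using exq_ceq by blast

lemma rd_tst: "rd (tst T0 \<sigma>) (r + 4) = (if \<sigma> r = N then 1 else 2)"
 by (cases "\<sigma> r") (simp_all add: rd_stk[of _ _ "ser (\<sigma> r)"])

lemma exs_If:
 assumes "\<sigma> r = N ==> exs c \<sigma> t \<sigma>'" "\<sigma> r ~= N ==> exs c' \<sigma> t \<sigma>'"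
 shows "exs (IfS (r + 4) 1 c c') \<sigma> (t + 2) \<sigma>'"
 unfolding exs_def by (intro allI exq_If) (use assms in \<open>auto simp: rd_tst exs_def split: if_splits\<close>)

lemma exs_WhF: "\<sigma> r = N ==> 0 < t ==> exs (WhileN (r + 4) 1 c) \<sigma> t \<sigma>"
 unfolding exs_def by (intro allI exq_WhF) (simp_all add: rd_tst)

lemma exs_WhT:
 assumes "\<sigma> r ~= N" "exs c \<sigma> t \<sigma>'" "exs (WhileN (r + 4) 1 c) \<sigma>' t' \<sigma>''"
 shows "exs (WhileN (r + 4) 1 c) \<sigma> (t + 2 + t') \<sigma>''"
 unfolding exs_def
 by (intro allI exq_WhT[OF _ assms(2)[unfolded exs_def, rule_format] assms(3)[unfolded exs_def, rule_format]])
   (use assms(1) in \<open>simp add: rd_tst\<close>)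

text \<open>A program for register \<open>b\<close> may use the registers above it as workspace, if it clears them.\<close>

definition FPDt :: "(dt => dt) => (nat => nat) => bool" where
 "FPDt F t \<longleftrightarrow> (\<forall>b. \<exists>c. \<forall>\<sigma>. (\<forall>r>b. \<sigma> r = N) --> exs c \<sigma> (t (sz (\<sigma> b))) (\<sigma>(b := F (\<sigma> b))))"

definition FPD :: "(dt => dt) => bool" where
 "FPD F \<longleftrightarrow> (\<exists>t. pb t & FPDt F t)"

text \<open>The size bound is a consequence of the time bound: the final head of the register stands
  on the last symbol of the result, and heads move one cell per step.\<close>

lemma FPDE:
 assumes "FPD F"
 obtains p :: "nat poly" where "FPDt F (poly p)" "!!d. sz (F d) \<le> poly p (sz d)"
proof -
 obtain t and p :: "nat poly" where t: "FPDt F t" "!!n. t n \<le> poly p n"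
  using assms unfolding FPD_def pb_def by blast
 have p: "FPDt F (poly p)" unfolding FPDt_def
 proof
  fix b
  from t(1) obtain c where "\<forall>\<sigma>. (\<forall>r>b. \<sigma> r = N) --> exs c \<sigma> (t (sz (\<sigma> b))) (\<sigma>(b := F (\<sigma> b)))"
   unfolding FPDt_def by blast
  thus "\<exists>c. \<forall>\<sigma>. (\<forall>r>b. \<sigma> r = N) --> exs c \<sigma> (poly p (sz (\<sigma> b))) (\<sigma>(b := F (\<sigma> b)))"
   using exs_weaken t(2) by blast
 qed
 let ?q = "[:1, 1:] + p :: nat poly"
 have "FPDt F (poly ?q)" unfolding FPDt_def
 proof
  fix b
  from p obtain c where c: "!!\<sigma>. (\<forall>r>b. \<sigma> r = N) ==> exs c \<sigma> (poly p (sz (\<sigma> b))) (\<sigma>(b := F (\<sigma> b)))"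
   unfolding FPDt_def by blast
  have "exs c \<sigma> (poly ?q (sz (\<sigma> b))) (\<sigma>(b := F (\<sigma> b)))" if "\<forall>r>b. \<sigma> r = N" for \<sigma>
   by (rule exs_weaken[OF c[OF that]]) simp
  thus "\<exists>c. \<forall>\<sigma>. (\<forall>r>b. \<sigma> r = N) --> exs c \<sigma> (poly ?q (sz (\<sigma> b))) (\<sigma>(b := F (\<sigma> b)))"
   by blast
 qed
 moreover have "sz (F d) \<le> poly ?q (sz d)" for d
 proof -
  let ?\<sigma> = "(%_. N)(0 := d)"
  let ?T = "tst (%_. stk [])"
  obtain c where c: "!!\<sigma>. (\<forall>r>0. \<sigma> r = N) ==> exs c \<sigma> (poly p (sz (\<sigma> 0))) (\<sigma>(0 := F (\<sigma> 0)))"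
   using p unfolding FPDt_def by blast
  have "exs c ?\<sigma> (poly p (sz d)) ((%_. N)(0 := F d))" using c[of ?\<sigma>] by simp
  then obtain \<tau> where \<tau>: "\<tau> \<le> poly p (sz d)" "ex (%_. True) c (?T ?\<sigma>) \<tau> (?T ((%_. N)(0 := F d)))"
   unfolding exs_def exq_def by auto
  have "\<bar>snd (?T ?\<sigma> r)\<bar> \<le> int (sz d)" for r
   using Suc_leI[OF sz_pos[of d]] by (auto simp: tst_def stk_def tp_def)
  from ex_head_bound(2)[OF \<tau>(2) this, of "0 + 4"]
  have "\<bar>snd (stk (ser (F d)))\<bar> \<le> int (sz d + \<tau>)" by (simp only: tst_simps fun_upd_same)
  hence "int (sz (F d)) \<le> int (sz d + \<tau>) + 1" by (simp add: stk_def tp_def)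
  with \<tau>(1) show ?thesis by simp
 qed
 ultimately show ?thesis by (rule that)
qed

lemma FPDI:
 assumes "pb t" "!!b. \<exists>c. \<forall>\<sigma>. (\<forall>r>b. \<sigma> r = N) --> exs c \<sigma> (t (sz (\<sigma> b))) (\<sigma>(b := F (\<sigma> b)))"
 shows "FPD F"
 using assms unfolding FPD_def FPDt_def by blast

lemma FPD_hd: "FPD hdD"
proof (rule FPDI)
 show "pb (%n. 50 * (n + n) + 50)" by (intro pb_add pb_mult pb_id pb_const)
 show "\<exists>c. \<forall>\<sigma>. (\<forall>r>b. \<sigma> r = N) --> exs c \<sigma> (50 * (sz (\<sigma> b) + sz (\<sigma> b)) + 50) (\<sigma>(b := hdD (\<sigma> b)))" for b
  using exs_hd[of b b] by blast
qed

lemma FPD_tl: "FPD tlD"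
proof (rule FPDI)
 show "pb (%n. 50 * (n + n) + 50)" by (intro pb_add pb_mult pb_id pb_const)
 show "\<exists>c. \<forall>\<sigma>. (\<forall>r>b. \<sigma> r = N) --> exs c \<sigma> (50 * (sz (\<sigma> b) + sz (\<sigma> b)) + 50) (\<sigma>(b := tlD (\<sigma> b)))" for b
  using exs_tl[of b b] by blast
qed

lemma FPD_N: "FPD (%_. N)"
proof (rule FPDI)
 show "pb (%n. 4 * n + 3)" by (intro pb_add pb_mult pb_id pb_const)
 show "\<exists>c. \<forall>\<sigma>. (\<forall>r>b. \<sigma> r = N) --> exs c \<sigma> (4 * sz (\<sigma> b) + 3) (\<sigma>(b := N))" for b
  using exs_nil[of b] by blast
qed

lemma FPD_id: "FPD (%d. d)"
proof (rule FPDI)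
 show "pb (%n. 7)" by blast
 show "\<exists>c. \<forall>\<sigma>. (\<forall>r>b. \<sigma> r = N) --> exs c \<sigma> 7 (\<sigma>(b := \<sigma> b))" for b
 proof (intro exI allI impI)
  fix \<sigma> assume "\<forall>r>b. \<sigma> r = N"
  hence "\<sigma> (Suc b) = N" by simp
  with exs_nil[of "Suc b" \<sigma>] show "exs (cnil (Suc b)) \<sigma> 7 (\<sigma>(b := \<sigma> b))"
   by (simp add: fun_upd_idem)
 qed
qed

lemma FPD_comp:
 assumes "FPD F" "FPD G"
 shows "FPD (%d. F (G d))"
proof -
 obtain p where p: "FPDt F (poly p)" by (rule FPDE[OF assms(1)])
 obtain q where q: "FPDt G (poly q)" "!!d. sz (G d) \<le> poly q (sz d)" by (rule FPDE[OF assms(2)]) blast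
 show ?thesis
 proof (rule FPDI)
  show "pb (%n. poly q n + poly p (poly q n))" by (intro pb_add pb_comp pb_poly)
  fix b
  obtain c where c: "!!\<sigma>. (\<forall>r>b. \<sigma> r = N) ==> exs c \<sigma> (poly p (sz (\<sigma> b))) (\<sigma>(b := F (\<sigma> b)))"
   using p unfolding FPDt_def by blast
  obtain c' where c': "!!\<sigma>. (\<forall>r>b. \<sigma> r = N) ==> exs c' \<sigma> (poly q (sz (\<sigma> b))) (\<sigma>(b := G (\<sigma> b)))"
   using q unfolding FPDt_def by blast
  have "exs (c' ;; c) \<sigma> (poly q (sz (\<sigma> b)) + poly p (poly q (sz (\<sigma> b)))) (\<sigma>(b := F (G (\<sigma> b))))"
   if "\<forall>r>b. \<sigma> r = N" for \<sigma>
  proof -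
   have "exs c (\<sigma>(b := G (\<sigma> b))) (poly p (sz ((\<sigma>(b := G (\<sigma> b))) b)))
     ((\<sigma>(b := G (\<sigma> b)))(b := F ((\<sigma>(b := G (\<sigma> b))) b)))"
    by (rule c) (use that in simp)
   hence "exs c (\<sigma>(b := G (\<sigma> b))) (poly p (sz (G (\<sigma> b)))) (\<sigma>(b := F (G (\<sigma> b))))"
    by (simp only: fun_upd_same fun_upd_upd)
   from exs_Seq[OF c'[OF that] this] show ?thesis
    by (rule exs_weaken) (intro add_mono order_refl poly_nat_mono q(2))
  qed
  thus "\<exists>c. \<forall>\<sigma>. (\<forall>r>b. \<sigma> r = N) -->
    exs c \<sigma> (poly q (sz (\<sigma> b)) + poly p (poly q (sz (\<sigma> b)))) (\<sigma>(b := F (G (\<sigma> b))))" by blast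
 qed
qed

lemma FPD_Cons:
 assumes "FPD F" "FPD G"
 shows "FPD (%d. C (F d) (G d))"
proof -
 obtain p where p: "FPDt F (poly p)" "!!d. sz (F d) \<le> poly p (sz d)" by (rule FPDE[OF assms(1)]) blast
 obtain q where q: "FPDt G (poly q)" "!!d. sz (G d) \<le> poly q (sz d)" by (rule FPDE[OF assms(2)]) blast
 let ?t = "%n. 200 + 100 * n + 100 * poly p n + 100 * poly q n"
 show ?thesis
 proof (rule FPDI)
  show "pb ?t" by (intro pb_add pb_mult pb_poly pb_id pb_const)
  fix b
  obtain c where c: "!!\<sigma>. (\<forall>r>b+1. \<sigma> r = N) ==> exs c \<sigma> (poly p (sz (\<sigma> (b+1)))) (\<sigma>(b+1 := F (\<sigma> (b+1))))"
   using p unfolding FPDt_def by blast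
  obtain c' where c': "!!\<sigma>. (\<forall>r>b+2. \<sigma> r = N) ==> exs c' \<sigma> (poly q (sz (\<sigma> (b+2)))) (\<sigma>(b+2 := G (\<sigma> (b+2))))"
   using q unfolding FPDt_def by blast
  have "exs (ccopy (b+1) b ;; c ;; ccopy (b+2) b ;; c' ;; ccons b (b+1) (b+2) ;; cnil (b+1) ;; cnil (b+2))
    \<sigma> (?t (sz (\<sigma> b))) (\<sigma>(b := C (F (\<sigma> b)) (G (\<sigma> b))))"
   if N: "\<forall>r>b. \<sigma> r = N" for \<sigma>
  proof -
   define d where "d = \<sigma> b"
   define s1 where "s1 = \<sigma>(b+1 := d)"
   define s2 where "s2 = s1(b+1 := F d)"
   define s3 where "s3 = s2(b+2 := d)"
   define s4 where "s4 = s3(b+2 := G d)"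
   define s5 where "s5 = s4(b := C (F d) (G d))"
   define s6 where "s6 = s5(b+1 := N)"
   note defs = d_def s1_def s2_def s3_def s4_def s5_def s6_def
   have 1: "exs (ccopy (b+1) b) \<sigma> (24 * (1 + sz d) + 10) s1"
    using exs_copy[of "b+1" b \<sigma>] N by (simp add: defs)
   have 2: "exs c s1 (poly p (sz d)) s2"
    using c[of s1] N by (simp add: defs)
   have 3: "exs (ccopy (b+2) b) s2 (24 * (1 + sz d) + 10) s3"
    using exs_copy[of "b+2" b s2] N by (simp add: defs)
   have 4: "exs c' s3 (poly q (sz d)) s4"
    using c'[of s3] N by (simp add: defs)
   have 5: "exs (ccons b (b+1) (b+2)) s4 (24 * (sz d + sz (F d) + sz (G d)) + 30) s5"
    using exs_cons[of b "b+1" "b+2" s4] N by (simp add: defs)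
   have 6: "exs (cnil (b+1)) s5 (4 * sz (F d) + 3) s6"
    using exs_nil[of "b+1" s5] N by (simp add: defs)
   have 7: "exs (cnil (b+2)) s6 (4 * sz (G d) + 3) (s6(b+2 := N))"
    using exs_nil[of "b+2" s6] N by (simp add: defs)
   have eq: "s6(b+2 := N) = \<sigma>(b := C (F d) (G d))"
    using N by (auto simp: defs fun_eq_iff)
   from exs_Seq[OF 1 exs_Seq[OF 2 exs_Seq[OF 3 exs_Seq[OF 4 exs_Seq[OF 5 exs_Seq[OF 6 7]]]]]]
   show ?thesis unfolding eq unfolding d_def
    by (rule exs_weaken) (use p(2)[of "\<sigma> b"] q(2)[of "\<sigma> b"] in simp)
  qed
  thus "\<exists>c. \<forall>\<sigma>. (\<forall>r>b. \<sigma> r = N) --> exs c \<sigma> (?t (sz (\<sigma> b))) (\<sigma>(b := C (F (\<sigma> b)) (G (\<sigma> b))))" by blast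
 qed
qed

lemma FPD_If:
 assumes "FPD P" "FPD F" "FPD G"
 shows "FPD (%d. if P d ~= N then F d else G d)"
proof -
 obtain p where p: "FPDt F (poly p)" by (rule FPDE[OF assms(2)]) blast
 obtain q where q: "FPDt G (poly q)" by (rule FPDE[OF assms(3)]) blast
 obtain s where s: "FPDt P (poly s)" "!!d. sz (P d) \<le> poly s (sz d)" by (rule FPDE[OF assms(1)]) blast
 let ?t = "%n. 100 + 100 * n + poly p n + poly q n + 10 * poly s n"
 show ?thesis
 proof (rule FPDI)
  show "pb ?t" by (intro pb_add pb_mult pb_poly pb_id pb_const)
  fix b
  obtain c where c: "!!\<sigma>. (\<forall>r>b. \<sigma> r = N) ==> exs c \<sigma> (poly p (sz (\<sigma> b))) (\<sigma>(b := F (\<sigma> b)))"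
   using p unfolding FPDt_def by blast
  obtain c' where c': "!!\<sigma>. (\<forall>r>b. \<sigma> r = N) ==> exs c' \<sigma> (poly q (sz (\<sigma> b))) (\<sigma>(b := G (\<sigma> b)))"
   using q unfolding FPDt_def by blast
  obtain e where e: "!!\<sigma>. (\<forall>r>b+1. \<sigma> r = N) ==> exs e \<sigma> (poly s (sz (\<sigma> (b+1)))) (\<sigma>(b+1 := P (\<sigma> (b+1))))"
   using s unfolding FPDt_def by blast
  have "exs (ccopy (b+1) b ;; e ;; IfS (b+1 + 4) 1 (cnil (b+1) ;; c') (cnil (b+1) ;; c))
    \<sigma> (?t (sz (\<sigma> b))) (\<sigma>(b := if P (\<sigma> b) ~= N then F (\<sigma> b) else G (\<sigma> b)))"
   if N: "\<forall>r>b. \<sigma> r = N" for \<sigma>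
  proof -
   define d where "d = \<sigma> b"
   define s1 where "s1 = \<sigma>(b+1 := d)"
   define s2 where "s2 = s1(b+1 := P d)"
   note defs = d_def s1_def s2_def
   have 1: "exs (ccopy (b+1) b) \<sigma> (24 * (1 + sz d) + 10) s1"
    using exs_copy[of "b+1" b \<sigma>] N by (simp add: defs)
   have 2: "exs e s1 (poly s (sz d)) s2"
    using e[of s1] N by (simp add: defs)
   have eq: "s2(b+1 := N) = \<sigma>" using N by (auto simp: defs fun_eq_iff)
   have 3: "exs (cnil (b+1)) s2 (4 * sz (P d) + 3) \<sigma>"
    using exs_nil[of "b+1" s2] unfolding eq by (simp add: defs)
   have 4: "exs (IfS (b+1 + 4) 1 (cnil (b+1) ;; c') (cnil (b+1) ;; c)) s2
     ((4 * sz (P d) + 3) + (poly p (sz d) + poly q (sz d)) + 2) (\<sigma>(b := if P d ~= N then F d else G d))"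
   proof (rule exs_If)
    show "exs (cnil (b+1) ;; c') s2 ((4 * sz (P d) + 3) + (poly p (sz d) + poly q (sz d)))
     (\<sigma>(b := if P d ~= N then F d else G d))" if "s2 (b+1) = N"
     using exs_Seq[OF 3 c'[OF N]] that by (auto simp: defs elim!: exs_weaken)
    show "exs (cnil (b+1) ;; c) s2 ((4 * sz (P d) + 3) + (poly p (sz d) + poly q (sz d)))
     (\<sigma>(b := if P d ~= N then F d else G d))" if "s2 (b+1) ~= N"
     using exs_Seq[OF 3 c[OF N]] that by (auto simp: defs elim!: exs_weaken)
   qed
   from exs_Seq[OF 1 exs_Seq[OF 2 4]] show ?thesis unfolding d_def
    by (rule exs_weaken) (use s(2)[of "\<sigma> b"] in simp)
  qed
  thus "\<exists>c. \<forall>\<sigma>. (\<forall>r>b. \<sigma> r = N) --> exs c \<sigma> (?t (sz (\<sigma> b)))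
   (\<sigma>(b := if P (\<sigma> b) ~= N then F (\<sigma> b) else G (\<sigma> b)))" by blast
 qed
qed

lemma sz_hdD: "sz (hdD d) \<le> sz d" and sz_tlD: "sz (tlD d) \<le> sz d"
 by (cases d; simp)+

lemma FPD_eq0: "FPD (%d. boolD (hdD d = tlD d))"
proof (rule FPDI)
 let ?t = "%n. 1000 + 1000 * n :: nat"
 show "pb ?t" by (intro pb_add pb_mult pb_poly pb_id pb_const)
 fix b
 have "exs (chd (b+1) b ;; ctl (b+2) b ;; ceq b (b+1) (b+2) ;; cnil (b+1) ;; cnil (b+2))
   \<sigma> (?t (sz (\<sigma> b))) (\<sigma>(b := boolD (hdD (\<sigma> b) = tlD (\<sigma> b))))"
  if N: "\<forall>r>b. \<sigma> r = N" for \<sigma>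
 proof -
  define d where "d = \<sigma> b"
  define s1 where "s1 = \<sigma>(b+1 := hdD d)"
  define s2 where "s2 = s1(b+2 := tlD d)"
  define s3 where "s3 = s2(b := boolD (hdD d = tlD d))"
  define s4 where "s4 = s3(b+1 := N)"
  note defs = d_def s1_def s2_def s3_def s4_def
  have 1: "exs (chd (b+1) b) \<sigma> (50 * (1 + sz d) + 50) s1"
   using exs_hd[of "b+1" b \<sigma>] N by (simp add: defs)
  have 2: "exs (ctl (b+2) b) s1 (50 * (1 + sz d) + 50) s2"
   using exs_tl[of "b+2" b s1] N by (simp add: defs)
  have 3: "exs (ceq b (b+1) (b+2)) s2 (100 * (sz d + sz (hdD d) + sz (tlD d)) + 100) s3"
   using exs_eq[of "b+1" "b+2" b s2] N by (simp add: defs)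
  have 4: "exs (cnil (b+1)) s3 (4 * sz (hdD d) + 3) s4"
   using exs_nil[of "b+1" s3] N by (simp add: defs)
  have 5: "exs (cnil (b+2)) s4 (4 * sz (tlD d) + 3) (s4(b+2 := N))"
   using exs_nil[of "b+2" s4] N by (simp add: defs)
  have eq: "s4(b+2 := N) = \<sigma>(b := boolD (hdD d = tlD d))"
   using N by (auto simp: defs fun_eq_iff)
  from exs_Seq[OF 1 exs_Seq[OF 2 exs_Seq[OF 3 exs_Seq[OF 4 5]]]]
  show ?thesis unfolding eq unfolding d_def
   by (rule exs_weaken) (use sz_hdD[of "\<sigma> b"] sz_tlD[of "\<sigma> b"] in simp)
 qed
 thus "\<exists>c. \<forall>\<sigma>. (\<forall>r>b. \<sigma> r = N) --> exs c \<sigma> (?t (sz (\<sigma> b)))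
   (\<sigma>(b := boolD (hdD (\<sigma> b) = tlD (\<sigma> b))))" by blast
qed

lemma FPD_eq: "FPD F ==> FPD G ==> FPD (%d. boolD (F d = G d))"
 using FPD_comp[OF FPD_eq0 FPD_Cons] by simp

fun foldD :: "(dt => dt) => dt => dt => dt => dt" where
 "foldD F x N a = a"
| "foldD F x (C h l) a = foldD F x l (F (C x (C h a)))"

text \<open>Folding over \<open>takeD k l\<close> gives the accumulator after \<open>k\<close>
  rounds, so a bound for all \<open>k\<close> bounds all intermediate results.\<close>

fun takeD :: "nat => dt => dt" where
 "takeD 0 l = N"
| "takeD (Suc k) N = N"
| "takeD (Suc k) (C h l) = C h (takeD k l)"

text \<open>Bounded recursion in the style of Cobham: if all accumulators stay polynomial in the
  input, each round costs polynomial time, and there are at most \<open>sz (L d)\<close> rounds.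
  Register \<open>b\<close> holds the accumulator, \<open>b+1\<close> the parameter,
  \<open>b+2\<close> the rest of the list, and \<open>b+3\<close> is where \<open>F\<close> is
  evaluated.\<close>

lemma FPD_fold:
 assumes F: "FPD F" and X: "FPD X" and L: "FPD L" and A: "FPD A"
  and B: "!!d k. sz (foldD F (X d) (takeD k (L d)) (A d)) \<le> poly B (sz d)"
 shows "FPD (%d. foldD F (X d) (L d) (A d))"
proof -
 obtain p where p: "FPDt F (poly p)" by (rule FPDE[OF F]) blast
 let ?H = "%d. C (X d) (C (L d) (A d))"
 have "FPD ?H" by (intro FPD_Cons X L A)
 then obtain h where h: "FPDt ?H (poly h)" "!!d. sz (?H d) \<le> poly h (sz d)" by (rule FPDE) blast
 let ?m = "%n. 2 * poly h n + poly B n + 2"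
 let ?W = "%n. 500 * ?m n + poly p (?m n)"
 let ?t = "%n. poly h n * ?W n + (1000 * poly h n + 1000) + poly h n"
 show ?thesis
 proof (rule FPDI)
  show "pb ?t" by (intro pb_add pb_mult pb_poly pb_id pb_const pb_comp)
  fix b
  obtain c where c: "!!\<sigma>. (\<forall>r>b+3. \<sigma> r = N) ==> exs c \<sigma> (poly p (sz (\<sigma> (b+3)))) (\<sigma>(b+3 := F (\<sigma> (b+3))))"
   using p unfolding FPDt_def by blast
  obtain e where e: "!!\<sigma>. (\<forall>r>b. \<sigma> r = N) ==> exs e \<sigma> (poly h (sz (\<sigma> b))) (\<sigma>(b := ?H (\<sigma> b)))"
   using h(1) unfolding FPDt_def by blast
  define body where "body = chd (b+3) (b+2) ;; ctl (b+2) (b+2) ;; ccons (b+3) (b+3) b ;;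
   ccons (b+3) (b+1) (b+3) ;; c ;; ccopy b (b+3) ;; cnil (b+3)"
  have loop: "(\<forall>r>b+2. \<sigma> r = N) ==> \<sigma> b = a ==> \<sigma> (b+1) = x ==> \<sigma> (b+2) = l ==>
   (!!k. sz (foldD F x (takeD k l) a) \<le> poly B n) ==> sz x \<le> poly h n ==> sz l \<le> poly h n ==>
   exs (WhileN (b+2 + 4) 1 body) \<sigma> (sz l * ?W n) (\<sigma>(b := foldD F x l a, b+2 := N))"
   for \<sigma> a x l n
  proof (induction l arbitrary: \<sigma> a)
   case N
   have eq: "\<sigma>(b := foldD F x N a, b+2 := N) = \<sigma>" using N by (auto simp: fun_eq_iff)
   show ?case unfolding eq by (rule exs_WhF) (use N in auto)
  next
   case (C h l)
   let ?e = "C x (C h a)"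
   define s1 where "s1 = \<sigma>(b+3 := h)"
   define s2 where "s2 = s1(b+2 := l)"
   define s3 where "s3 = s2(b+3 := C h a)"
   define s4 where "s4 = s3(b+3 := ?e)"
   define s5 where "s5 = s4(b+3 := F ?e)"
   define s6 where "s6 = s5(b := F ?e)"
   define s7 where "s7 = s6(b+3 := N)"
   note defs = s1_def s2_def s3_def s4_def s5_def s6_def s7_def
   note N = C.prems(1-4)
   have sa: "sz a \<le> poly B n" using C.prems(5)[of 0] by simp
   have sF: "sz (F ?e) \<le> poly B n" using C.prems(5)[of 1] by simp
   have 1: "exs (chd (b+3) (b+2)) \<sigma> (50 * (1 + sz (C h l)) + 50) s1"
    using exs_hd[of "b+3" "b+2" \<sigma>] N by (simp add: defs)
   have 2: "exs (ctl (b+2) (b+2)) s1 (50 * (sz (C h l) + sz (C h l)) + 50) s2"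
    using exs_tl[of "b+2" "b+2" s1] N by (simp add: defs)
   have 3: "exs (ccons (b+3) (b+3) b) s2 (24 * (sz h + sz h + sz a) + 30) s3"
    using exs_cons[of "b+3" "b+3" b s2] N by (simp add: defs)
   have 4: "exs (ccons (b+3) (b+1) (b+3)) s3 (24 * (sz (C h a) + sz x + sz (C h a)) + 30) s4"
    using exs_cons[of "b+3" "b+1" "b+3" s3] N by (simp add: defs)
   have 5: "exs c s4 (poly p (sz ?e)) s5"
    using c[of s4] N by (simp add: defs)
   have 6: "exs (ccopy b (b+3)) s5 (24 * (sz a + sz (F ?e)) + 10) s6"
    using exs_copy[of b "b+3" s5] N by (simp add: defs)
   have 7: "exs (cnil (b+3)) s6 (4 * sz (F ?e) + 3) s7"
    using exs_nil[of "b+3" s6] N by (simp add: defs)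
   have pm: "poly p (sz ?e) \<le> poly p (?m n)"
    by (rule poly_nat_mono) (use sa C.prems(6,7) in simp)
   \<comment> \<open>Two units are kept back for the jumps of the loop.\<close>
   have 8: "exs body \<sigma> (?W n - 2) s7" unfolding body_def
    by (rule exs_weaken[OF exs_Seq[OF 1 exs_Seq[OF 2 exs_Seq[OF 3 exs_Seq[OF 4 exs_Seq[OF 5 exs_Seq[OF 6 7]]]]]]])
     (use sa sF pm C.prems(6,7) in simp)
   have 9: "exs (WhileN (b+2 + 4) 1 body) s7 (sz l * ?W n) (s7(b := foldD F x l (F ?e), b+2 := N))"
   proof (rule C.IH(2))
    show "sz (foldD F x (takeD k l) (F ?e)) \<le> poly B n" for k
     using C.prems(5)[of "Suc k"] by simp
   qed (use N C.prems(6,7) in \<open>auto simp: defs\<close>)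
   have eq: "s7(b := foldD F x l (F ?e), b+2 := N) = \<sigma>(b := foldD F x (C h l) a, b+2 := N)"
    using N by (auto simp: defs fun_eq_iff)
   have ne: "\<sigma> (b+2) ~= N" using N by simp
   from exs_WhT[OF ne 8 9] show ?case unfolding eq
    by (rule exs_weaken) (simp add: algebra_simps)
  qed
  have "exs (e ;; chd (b+1) b ;; ctl b b ;; chd (b+2) b ;; ctl b b ;; WhileN (b+2 + 4) 1 body ;; cnil (b+1))
    \<sigma> (?t (sz (\<sigma> b))) (\<sigma>(b := foldD F (X (\<sigma> b)) (L (\<sigma> b)) (A (\<sigma> b))))"
   if N: "\<forall>r>b. \<sigma> r = N" for \<sigma>
  proof -
   define d0 where "d0 = \<sigma> b"
   define d where "d = ?H d0"
   let ?x = "X d0" and ?l = "L d0" and ?a = "A d0"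
   define s0 where "s0 = \<sigma>(b := d)"
   define s1 where "s1 = s0(b+1 := ?x)"
   define s2 where "s2 = s1(b := C ?l ?a)"
   define s3 where "s3 = s2(b+2 := ?l)"
   define s4 where "s4 = s3(b := ?a)"
   define s5 where "s5 = s4(b := foldD F ?x ?l ?a, b+2 := N)"
   note defs = s0_def s1_def s2_def s3_def s4_def s5_def
   have dx: "sz ?x \<le> sz d" "sz (C ?l ?a) \<le> sz d" "sz ?l \<le> sz d" by (simp_all add: d_def)
   have dh: "sz d \<le> poly h (sz d0)" using h(2) unfolding d_def .
   have 0: "exs e \<sigma> (poly h (sz d0)) s0"
    using e[OF N] by (simp only: defs d_def d0_def)
   have 1: "exs (chd (b+1) b) s0 (50 * (1 + sz d) + 50) s1"
    using exs_hd[of "b+1" b s0] N by (simp add: defs d_def)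
   have 2: "exs (ctl b b) s1 (50 * (sz d + sz d) + 50) s2"
    using exs_tl[of b b s1] N by (simp add: defs d_def)
   have 3: "exs (chd (b+2) b) s2 (50 * (1 + sz (C ?l ?a)) + 50) s3"
    using exs_hd[of "b+2" b s2] N by (simp add: defs)
   have 4: "exs (ctl b b) s3 (50 * (sz (C ?l ?a) + sz (C ?l ?a)) + 50) s4"
    using exs_tl[of b b s3] N by (simp add: defs)
   define W where "W = ?W (sz d0)"
   have 5: "exs (WhileN (b+2 + 4) 1 body) s4 (sz ?l * W) s5"
    unfolding s5_def W_def
    by (rule loop) (use N B dx dh in \<open>auto simp: defs\<close>)
   have 6: "exs (cnil (b+1)) s5 (4 * sz ?x + 3) (s5(b+1 := N))"
    using exs_nil[of "b+1" s5] N by (simp add: defs)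
   have eq: "s5(b+1 := N) = \<sigma>(b := foldD F ?x ?l ?a)"
    using N by (auto simp: defs fun_eq_iff)
   define V where "V = poly h (sz d0) * W"
   have "sz ?l * W \<le> V" unfolding V_def
    by (intro mult_le_mono1) (use dx dh in linarith)
   note 5 = exs_weaken[OF 5 this]
   have "exs (e ;; chd (b+1) b ;; ctl b b ;; chd (b+2) b ;; ctl b b ;; WhileN (b+2 + 4) 1 body ;; cnil (b+1))
    \<sigma> (V + (1000 * poly h (sz d0) + 1000) + poly h (sz d0)) (\<sigma>(b := foldD F ?x ?l ?a))"
    unfolding eq[symmetric]
    by (rule exs_weaken[OF exs_Seq[OF 0 exs_Seq[OF 1 exs_Seq[OF 2 exs_Seq[OF 3 exs_Seq[OF 4 exs_Seq[OF 5 6]]]]]]])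
     (use dx dh in \<open>simp del: sz.simps\<close>)
   thus ?thesis unfolding V_def W_def d0_def .
  qed
  thus "\<exists>c. \<forall>\<sigma>. (\<forall>r>b. \<sigma> r = N) --> exs c \<sigma> (?t (sz (\<sigma> b)))
    (\<sigma>(b := foldD F (X (\<sigma> b)) (L (\<sigma> b)) (A (\<sigma> b))))" by blast
 qed
qed

section \<open>Polynomial-time functions on typed data\<close>

lemma FPD_const: "FPD (%_. d)"
 by (induction d) (auto intro: FPD_N FPD_Cons)

text \<open>The growth in a round does not depend on the accumulator, so it adds up over the rounds
  instead of compounding.\<close>

lemma foldD_growth:
 assumes "!!x h a. sz (F (C x (C h a))) \<le> sz a + poly q (sz x + sz h)"
 shows "sz (foldD F x l a) \<le> sz a + sz l * poly q (sz x + sz l)"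
proof (induction l arbitrary: a)
 case (C h l)
 have "sz (foldD F x (C h l) a) \<le> sz (F (C x (C h a))) + sz l * poly q (sz x + sz l)"
  using C.IH(2)[of "F (C x (C h a))"] by simp
 also have "\<dots> \<le> (sz a + poly q (sz x + sz h)) + sz l * poly q (sz x + sz l)"
  using assms by simp
 also have "\<dots> \<le> (sz a + poly q (sz x + sz (C h l))) + sz l * poly q (sz x + sz (C h l))"
  by (intro add_mono mult_mono poly_nat_mono) auto
 finally show ?case by (simp add: algebra_simps)
qed simp

lemma sz_takeD: "sz (takeD k l) \<le> sz l"
 by (induction k l rule: takeD.induct) (auto simp: Suc_le_eq)

lemma FPD_fold_add:
 assumes F: "FPD F" and X: "FPD X" and L: "FPD L" and A: "FPD A"
  and q: "!!x h a. sz (F (C x (C h a))) \<le> sz a + poly q (sz x + sz h)"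
 shows "FPD (%d. foldD F (X d) (L d) (A d))"
proof -
 obtain x where x: "!!d. sz (X d) \<le> poly x (sz d)" using FPDE[OF X] by metis
 obtain l where l: "!!d. sz (L d) \<le> poly l (sz d)" using FPDE[OF L] by metis
 obtain a where a: "!!d. sz (A d) \<le> poly a (sz d)" using FPDE[OF A] by metis
 have "pb (%n. poly a n + poly l n * poly q (poly x n + poly l n))"
  by (intro pb_add pb_mult pb_comp pb_poly)
 then obtain B where B: "!!n. poly a n + poly l n * poly q (poly x n + poly l n) \<le> poly B n"
  unfolding pb_def by blast
 show ?thesis
 proof (rule FPD_fold[OF F X L A])
  fix d k
  have "sz (foldD F (X d) (takeD k (L d)) (A d)) \<le>
    sz (A d) + sz (takeD k (L d)) * poly q (sz (X d) + sz (takeD k (L d)))"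
   by (rule foldD_growth[OF q])
  also have "\<dots> \<le> poly a (sz d) + poly l (sz d) * poly q (poly x (sz d) + poly l (sz d))"
   using order_trans[OF sz_takeD l]
   by (intro add_mono mult_mono poly_nat_mono x a) auto
  also have "\<dots> \<le> poly B (sz d)" by (rule B)
  finally show "sz (foldD F (X d) (takeD k (L d)) (A d)) \<le> poly B (sz d)" .
 qed
qed

text \<open>\<open>dec\<close> is total, and by \<open>FPD_norm\<close> any tree can be replaced in
  polynomial time by the code of the value it decodes to. Hence functions on types become functions
  on all trees, and guessed trees can be decoded without validity checks.\<close>

class rep =
 fixes enc :: "'a => dt" and dec :: "dt => 'a"
 assumes dec_enc [simp]: "dec (enc a) = a"
  and FPD_norm: "FPD (%d. enc (dec d))"

lemma enc_inj [simp]: "enc a = enc b \<longleftrightarrow> a = b"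
 using dec_enc by metis

definition fp :: "('a::rep => 'b::rep) => bool" where
 "fp f \<longleftrightarrow> FPD (%d. enc (f (dec d)))"

definition vs :: "'a::rep => nat" where
 "vs a = sz (enc a)"

named_theorems fp_intros

instantiation dt :: rep
begin
definition enc_dt :: "dt => dt" where [simp]: "enc_dt d = d"
definition dec_dt :: "dt => dt" where [simp]: "dec_dt d = d"
instance by standard (simp_all add: FPD_id)
end

instantiation bool :: rep
begin
definition enc_bool :: "bool => dt" where "enc_bool = boolD"
definition dec_bool :: "dt => bool" where "dec_bool d \<longleftrightarrow> d ~= N"
instance
proof
 have "FPD (%d. if d ~= N then C N N else N)" by (intro FPD_If FPD_id FPD_const)
 thus "FPD (%d. enc (dec d :: bool))"
  by (simp add: enc_bool_def dec_bool_def boolD_def)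
qed (simp add: enc_bool_def dec_bool_def boolD_def)
end

text \<open>Numbers are unary: arithmetic is polynomial in the value, and numbers can drive folds.
  Quantities that may be exponential are kept as bit lists instead.\<close>

instantiation nat :: rep
begin
primrec enc_nat :: "nat => dt" where
 "enc_nat 0 = N" | "enc_nat (Suc n) = C N (enc_nat n)"
primrec dec_nat :: "dt => nat" where
 "dec_nat N = 0" | "dec_nat (C a b) = Suc (dec_nat b)"
instance
proof
 show "dec (enc n) = n" for n :: nat by (induction n) auto
 let ?F = "%d. C N (tlD (tlD d))"
 have eq: "foldD ?F N d (enc n) = enc (dec d + n)" for d and n :: nat
 proof (induction d arbitrary: n)
  case (C h l)
  show ?case using C.IH(2)[of "Suc n"] by simp
 qed simp
 have "FPD (%d. foldD ?F N d N)"
  by (rule FPD_fold_add[where q = "[:2:]"]) (auto intro!: FPD_const FPD_id FPD_Cons FPD_comp[OF FPD_tl FPD_tl])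
 thus "FPD (%d. enc (dec d :: nat))" using eq[of _ 0] by simp
qed
end

fun mapD :: "(dt => dt) => dt => dt" where
 "mapD f N = N" | "mapD f (C h l) = C (f h) (mapD f l)"

fun appD :: "dt => dt => dt" where
 "appD N r = r" | "appD (C h l) r = C h (appD l r)"

fun revD :: "dt => dt => dt" where
 "revD N a = a" | "revD (C h l) a = revD l (C h a)"

lemma FPD_rev:
 assumes "FPD L" "FPD A" shows "FPD (%d. revD (L d) (A d))"
proof -
 have eq: "foldD tlD N l a = revD l a" for l a
  by (induction l arbitrary: a) auto
 have "FPD (%d. foldD tlD N (L d) (A d))"
  by (rule FPD_fold_add[where q = "[:1, 1:]"]) (auto intro: assms FPD_const FPD_tl)
 thus ?thesis by (simp add: eq)
qed

text \<open>Folding collects the images in reverse order; a second reversal restores it.\<close>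

lemma FPD_mapD:
 assumes "FPD f" "FPD L" shows "FPD (%d. mapD f (L d))"
proof -
 let ?F = "%d. C (f (hdD (tlD d))) (tlD (tlD d))"
 obtain p where p: "!!d. sz (f d) \<le> poly p (sz d)" using FPDE[OF assms(1)] by metis
 have F: "FPD ?F"
  using FPD_comp[OF assms(1) FPD_comp[OF FPD_hd FPD_tl]] FPD_comp[OF FPD_tl FPD_tl]
  by (intro FPD_Cons)
 have eq: "foldD ?F N l a = revD (mapD f l) a" for l a
  by (induction l arbitrary: a) auto
 have rr: "revD (revD l a) r = revD a (appD l r)" for l a r
  by (induction l arbitrary: a) auto
 have "revD (revD l N) N = l" for l
 proof -
  have "appD l N = l" by (induction l) auto
  thus ?thesis using rr[of l N N] by simp
 qed
 moreover have "FPD (%d. foldD ?F N (L d) N)"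
 proof (rule FPD_fold_add[where q = "[:1:] + p"])
  show "sz (?F (C x (C h a))) \<le> sz a + poly ([:1:] + p) (sz x + sz h)" for x h a
   using order_trans[OF p[of h] poly_nat_mono[of "sz h" "sz x + sz h" p]] by simp
 qed (auto intro: F assms FPD_const)
 ultimately show ?thesis using FPD_rev[OF _ FPD_const[of N]] by (fastforce simp: eq)
qed

instantiation list :: (rep) rep
begin
primrec enc_list :: "'a list => dt" where
 "enc_list [] = N" | "enc_list (a # l) = C (enc a) (enc_list l)"
primrec dec_list :: "dt => 'a list" where
 "dec_list N = []" | "dec_list (C a b) = dec a # dec_list b"
instance
proof
 show "dec (enc l) = l" for l :: "'a list" by (induction l) auto
 have "mapD (%d. enc (dec d :: 'a)) d = enc (dec d :: 'a list)" for d
  by (induction d) auto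
 thus "FPD (%d. enc (dec d :: 'a list))"
  using FPD_mapD[OF FPD_norm[where 'a = 'a] FPD_id] by simp
qed
end

instantiation prod :: (rep, rep) rep
begin
definition enc_prod :: "'a \<times> 'b => dt" where "enc_prod p = C (enc (fst p)) (enc (snd p))"
definition dec_prod :: "dt => 'a \<times> 'b" where "dec_prod d = (dec (hdD d), dec (tlD d))"
instance
proof
 show "FPD (%d. enc (dec d :: 'a \<times> 'b))"
  unfolding enc_prod_def dec_prod_def fst_conv snd_conv
  by (intro FPD_Cons FPD_comp[OF FPD_norm FPD_hd] FPD_comp[OF FPD_norm FPD_tl])
qed (simp add: enc_prod_def dec_prod_def)
end

section \<open>Closure properties of polynomial-time functions on typed data\<close>

lemma fp_id [fp_intros]: "fp (%x. x)"
 unfolding fp_def by (rule FPD_norm)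

lemma fp_const: "fp (%_. c)"
 unfolding fp_def by (rule FPD_const)

lemma fp_comp: "fp f ==> fp g ==> fp (%x. f (g x))"
 unfolding fp_def by (drule (1) FPD_comp) simp

lemma fp_Pair [fp_intros]: "fp f ==> fp g ==> fp (%x. (f x, g x))"
 unfolding fp_def enc_prod_def fst_conv snd_conv by (rule FPD_Cons)

lemma fp_fst [fp_intros]: "fp f ==> fp (%x. fst (f x))"
 unfolding fp_def by (drule FPD_comp[OF FPD_hd]) (simp add: enc_prod_def)

lemma fp_snd [fp_intros]: "fp f ==> fp (%x. snd (f x))"
 unfolding fp_def by (drule FPD_comp[OF FPD_tl]) (simp add: enc_prod_def)

lemma fp_Cons [fp_intros]: "fp f ==> fp g ==> fp (%x. f x # g x)"
 unfolding fp_def enc_list.simps by (rule FPD_Cons)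

lemma fp_tl [fp_intros]:
 assumes "fp f" shows "fp (%x. tl (f x))"
proof -
 have "tlD (enc l) = enc (tl l)" for l :: "'b list" by (cases l) auto
 thus ?thesis using assms unfolding fp_def by (drule_tac FPD_comp[OF FPD_tl]) simp
qed

definition hd0 :: "'a::rep list => 'a" where
 "hd0 l = (case l of [] => dec N | a # _ => a)"

lemma hd0_Cons [simp]: "hd0 (a # l) = a"
 by (simp add: hd0_def)

lemma fp_hd0 [fp_intros]:
 assumes "fp f" shows "fp (%x. hd0 (f x))"
proof -
 have "enc (dec (hdD (enc l)) :: 'b) = enc (hd0 l)" for l :: "'b list" by (cases l) (auto simp: hd0_def)
 thus ?thesis using assms unfolding fp_def
  by (drule_tac FPD_comp[OF FPD_comp[OF FPD_norm[where 'a = 'b] FPD_hd]]) simp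
qed

lemma fp_If [fp_intros]:
 assumes "fp P" "fp f" "fp g" shows "fp (%x. if P x then f x else g x)"
proof -
 have "enc (P d) ~= N \<longleftrightarrow> P d" for d by (simp add: enc_bool_def boolD_def)
 moreover have "FPD (%d. if enc (P (dec d)) ~= N then enc (f (dec d)) else enc (g (dec d)))"
  using assms unfolding fp_def by (rule FPD_If)
 ultimately show ?thesis unfolding fp_def by (simp add: if_distrib[of enc])
qed

lemma fp_True: "fp (%_. True)" and fp_False: "fp (%_. False)" and fp_Nil: "fp (%_. [])"
 and fp_0: "fp (%_. 0 :: nat)" and fp_1: "fp (%_. 1 :: nat)" and fp_numeral: "fp (%_. numeral w :: nat)"
 by (rule fp_const)+

declare fp_True [fp_intros] fp_False [fp_intros] fp_Nil [fp_intros] fp_0 [fp_intros] fp_1 [fp_intros]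
 fp_numeral [fp_intros]

lemma fp_not [fp_intros]: "fp P ==> fp (%x. \<not> P x)"
proof -
 have "(%x. \<not> P x) = (%x. if P x then False else True)" by auto
 thus "fp P ==> fp (%x. \<not> P x)" by (simp only: fp_If[OF _ fp_False fp_True])
qed

lemma fp_conj [fp_intros]: "fp P ==> fp Q ==> fp (%x. P x & Q x)"
proof -
 have "(%x. P x & Q x) = (%x. if P x then Q x else False)" by auto
 thus "fp P ==> fp Q ==> fp (%x. P x & Q x)" by (simp only: fp_If[OF _ _ fp_False])
qed

lemma fp_disj [fp_intros]: "fp P ==> fp Q ==> fp (%x. P x \<or> Q x)"
proof -
 have "(%x. P x \<or> Q x) = (%x. if P x then True else Q x)" by auto
 thus "fp P ==> fp Q ==> fp (%x. P x \<or> Q x)" by (simp only: fp_If[OF _ fp_True])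
qed

lemma fp_imp [fp_intros]: "fp P ==> fp Q ==> fp (%x. P x --> Q x)"
 unfolding imp_conv_disj by (intro fp_disj fp_not)

lemma fp_eq [fp_intros]: "fp f ==> fp g ==> fp (%x. f x = g x)"
 unfolding fp_def enc_bool_def by (drule (1) FPD_eq) simp

lemma fp_Suc [fp_intros]: "fp f ==> fp (%x. Suc (f x))"
 unfolding fp_def enc_nat.simps by (intro FPD_Cons FPD_const)

lemma vs_pos [simp]: "0 < vs a"
 by (simp add: vs_def)

lemma vs_nat [simp]: "vs (n :: nat) = 2 * n + 1"
 by (induction n) (auto simp: vs_def)

lemma vs_Pair [simp]: "vs (a, b) = Suc (vs a + vs b)"
 by (simp add: vs_def enc_prod_def)

lemma vs_Nil [simp]: "vs [] = 1" and vs_Cons [simp]: "vs (a # l) = Suc (vs a + vs l)"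
 by (simp_all add: vs_def)

lemma vs_bool: "vs (b :: bool) \<le> 3"
 by (simp add: vs_def enc_bool_def boolD_def)

lemma vs_list_mem: "a \<in> set l ==> vs a \<le> vs l"
 by (induction l) auto

lemma vs_length: "length l \<le> vs l"
 by (induction l) auto

lemma vs_append: "vs (a @ b) \<le> vs a + vs b"
 by (induction a) auto

lemma vs_list_le: "(!!a. a \<in> set l ==> vs a \<le> k) ==> vs l \<le> 1 + length l * (k + 1)"
 by (induction l) fastforce+

definition bnd :: "('a::rep => nat) => bool" where
 "bnd g \<longleftrightarrow> (\<exists>p :: nat poly. \<forall>x. g x \<le> poly p (vs x))"

lemma bnd_const: "bnd (%_. c)"
 unfolding bnd_def by (intro exI[of _ "[:c:]"]) simp

lemma bnd_add: "bnd f ==> bnd g ==> bnd (%x. f x + g x)"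
 unfolding bnd_def by (metis add_mono poly_add)

lemma bnd_mult: "bnd f ==> bnd g ==> bnd (%x. f x * g x)"
 unfolding bnd_def by (metis mult_le_mono poly_mult)

lemma bnd_poly: "bnd f ==> bnd (%x. poly p (f x))"
 unfolding bnd_def by (metis poly_nat_mono poly_pcompose order_trans)

lemma fp_bound:
 assumes "fp f" obtains p :: "nat poly" where "!!x. vs (f x) \<le> poly p (vs x)"
proof -
 obtain p :: "nat poly" where p: "!!d. sz (enc (f (dec d))) \<le> poly p (sz d)"
  using FPDE[OF assms[unfolded fp_def]] by metis
 show thesis
 proof (rule that)
  show "vs (f x) \<le> poly p (vs x)" for x using p[of "enc x"] by (simp add: vs_def)
 qed
qed

lemma bnd_vs: "fp f ==> bnd (%x. vs (f x))"
 unfolding bnd_def by (erule fp_bound) blast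

lemma bnd_Suc: "bnd f ==> bnd (%x. Suc (f x))"
 using bnd_add[OF bnd_const[of 1]] by simp

lemmas bnd_intros = bnd_Suc bnd_const bnd_add bnd_mult bnd_vs bnd_poly

text \<open>The bound is required for folds over all prefixes of the list, that is, for all
  intermediate accumulators.\<close>

lemma fp_fold:
 fixes f :: "'x::rep => 'a::rep => 'b::rep => 'b"
 assumes f: "fp (%y. f (fst y) (fst (snd y)) (snd (snd y)))" and xs: "fp xs" and a0: "fp a0"
  and g: "bnd g" "!!x i. vs (fold (f x) (take i (xs x)) (a0 x)) \<le> g x"
 shows "fp (%x. fold (f x) (xs x) (a0 x))"
proof -
 let ?F = "%d. enc (f (dec (hdD d)) (dec (hdD (tlD d))) (dec (tlD (tlD d))))"
 have F: "FPD ?F" using f unfolding fp_def dec_prod_def by simp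
 have eq: "foldD ?F (enc x) (enc l) (enc a) = enc (fold (f x) l a)" for x l a
  by (induction l arbitrary: a) auto
 have take: "takeD k (enc l) = enc (take k l)" for k and l :: "'a list"
 proof (induction l arbitrary: k)
  case Nil
  show ?case by (cases k) auto
 next
  case (Cons a l)
  thus ?case by (cases k) auto
 qed
 let ?n = "%d. enc (dec d :: 'x)"
 obtain p :: "nat poly" where p: "!!d. sz (?n d) \<le> poly p (sz d)"
  using FPDE[OF FPD_norm[where 'a = 'x]] by metis
 obtain q :: "nat poly" where q: "!!x. g x \<le> poly q (vs x)" using g(1) unfolding bnd_def by blast
 have "FPD (%d. foldD ?F (?n d) (enc (xs (dec d))) (enc (a0 (dec d))))"
 proof (rule FPD_fold[OF F FPD_norm xs[unfolded fp_def] a0[unfolded fp_def]])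
  fix d k
  have "sz (foldD ?F (?n d) (takeD k (enc (xs (dec d)))) (enc (a0 (dec d)))) =
    vs (fold (f (dec d)) (take k (xs (dec d))) (a0 (dec d)))"
   unfolding take eq vs_def ..
  also have "\<dots> \<le> poly q (vs (dec d :: 'x))" using g(2) q order_trans by blast
  also have "\<dots> \<le> poly q (poly p (sz d))" using p unfolding vs_def by (rule poly_nat_mono)
  finally show "sz (foldD ?F (?n d) (takeD k (enc (xs (dec d)))) (enc (a0 (dec d)))) \<le> poly (pcompose q p) (sz d)"
   by (simp add: poly_pcompose)
 qed
 thus ?thesis unfolding fp_def eq .
qed

lemma fp_fold_add:
 fixes f :: "'x::rep => 'a::rep => 'b::rep => 'b"
 assumes f: "fp (%y. f (fst y) (fst (snd y)) (snd (snd y)))" and xs: "fp xs" and a0: "fp a0"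
  and g: "bnd g" "!!x a b. vs (f x a b) \<le> vs b + g (x, a)"
 shows "fp (%x. fold (f x) (xs x) (a0 x))"
proof -
 obtain q :: "nat poly" where q: "!!x. g x \<le> poly q (vs x)" using g(1) unfolding bnd_def by blast
 have fold: "vs (fold (f x) l b) \<le> vs b + length l * poly q (1 + vs x + s)"
  if "!!a. a \<in> set l ==> vs a \<le> s" for x l b s
  using that
 proof (induction l arbitrary: b)
  case (Cons a l)
  have "vs (f x a b) \<le> vs b + poly q (vs (x, a))"
   using g(2)[of x a b] q[of "(x, a)"] by simp
  also have "poly q (vs (x, a)) \<le> poly q (1 + vs x + s)"
   by (rule poly_nat_mono) (use Cons.prems in auto)
  finally show ?case using Cons.IH[of "f x a b"] Cons.prems by simp
 qed simp
 show ?thesis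
 proof (rule fp_fold[OF f xs a0])
  show "bnd (%x. vs (a0 x) + vs (xs x) * poly q (1 + vs x + vs (xs x)))"
   by (intro bnd_intros xs a0 fp_id)
  fix x i
  have "vs (fold (f x) (take i (xs x)) (a0 x)) \<le>
    vs (a0 x) + length (take i (xs x)) * poly q (1 + vs x + vs (xs x))"
   by (rule fold) (auto dest: in_set_takeD intro: vs_list_mem)
  also have "\<dots> \<le> vs (a0 x) + vs (xs x) * poly q (1 + vs x + vs (xs x))"
   using vs_length[of "xs x"] by (intro add_left_mono mult_le_mono1) simp
  finally show "vs (fold (f x) (take i (xs x)) (a0 x)) \<le> \<dots>" .
 qed
qed

lemma fp_append [fp_intros]:
 assumes "fp f" "fp g" shows "fp (%x. f x @ g x)"
proof -
 have rev: "fp (%x. fold (%a acc. a # acc) (f x) (g x))" if "fp f" "fp g"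
  for f g :: "'a => 'b list"
  by (rule fp_fold_add[where g = "%y. 1 + vs (snd y)"]) (auto intro!: that fp_intros bnd_intros)
 have eq: "fold (%a acc. a # acc) l r = rev l @ r" for l r :: "'b list"
  by (induction l arbitrary: r) auto
 from rev[OF rev[OF assms(1) fp_Nil] assms(2)] show ?thesis by (simp add: eq)
qed

lemma fp_rev [fp_intros]:
 assumes "fp f" shows "fp (%x. rev (f x))"
proof -
 have "fp (%x. fold (%a acc. a # acc) (f x) [])"
  by (rule fp_fold_add[where g = "%y. 1 + vs (snd y)"]) (auto intro!: assms fp_intros bnd_intros)
 moreover have "fold (%a acc. a # acc) l r = rev l @ r" for l r :: "'b list"
  by (induction l arbitrary: r) auto
 ultimately show ?thesis by simp
qed

lemma fp_map [fp_intros]: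
 assumes "fp (%y. f (fst y) (snd y))" "fp xs" shows "fp (%x. map (f x) (xs x))"
proof -
 have "fp (%y. f (fst y) (fst (snd y)))"
  by (rule fp_comp[OF assms(1), of "%y. (fst y, fst (snd y))", simplified]) (intro fp_intros)
 hence "fp (%x. fold (%a acc. f x a # acc) (xs x) [])"
  by (intro fp_fold_add[where g = "%y. 1 + vs (f (fst y) (snd y))"])
   (auto intro!: assms fp_intros bnd_intros)
 moreover have "fold (%a acc. f x a # acc) l r = rev (map (f x) l) @ r" for x l r
  by (induction l arbitrary: r) auto
 ultimately have "fp (%x. rev (map (f x) (xs x)))" by simp
 from fp_rev[OF this] show ?thesis by simp
qed

lemma fp_filter [fp_intros]:
 assumes "fp (%y. P (fst y) (snd y))" "fp xs" shows "fp (%x. filter (P x) (xs x))"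
proof -
 have "fp (%y. P (fst y) (fst (snd y)))"
  by (rule fp_comp[OF assms(1), of "%y. (fst y, fst (snd y))", simplified]) (intro fp_intros)
 hence "fp (%x. fold (%a acc. if P x a then a # acc else acc) (xs x) [])"
  by (intro fp_fold_add[where g = "%y. 1 + vs (snd y)"])
   (auto intro!: assms fp_intros bnd_intros)
 moreover have "fold (%a acc. if P x a then a # acc else acc) l r = rev (filter (P x) l) @ r" for x l r
  by (induction l arbitrary: r) auto
 ultimately have "fp (%x. rev (filter (P x) (xs x)))" by simp
 from fp_rev[OF this] show ?thesis by simp
qed

lemma fp_concat [fp_intros]:
 assumes "fp xs" shows "fp (%x. concat (xs x))"
proof -
 have "fp (%x. fold (%a acc. acc @ a) (xs x) [])"
 proof (rule fp_fold_add[where g = "%y. vs (snd y)"])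
  show "vs (b @ a) \<le> vs b + vs (snd (x, a))" for x :: 'a and a b :: "'b list"
   using vs_append[of b a] by simp
 qed (auto intro!: assms fp_intros bnd_intros)
 moreover have "fold (%a acc. acc @ a) l r = r @ concat l" for l and r :: "'b list"
  by (induction l arbitrary: r) auto
 ultimately show ?thesis by simp
qed

lemma fp_list_all [fp_intros]:
 assumes "fp (%y. P (fst y) (snd y))" "fp xs" shows "fp (%x. \<forall>a\<in>set (xs x). P x a)"
proof -
 have "fp (%x. filter (%a. \<not> P x a) (xs x) = [])" by (intro fp_intros assms)
 thus ?thesis by (simp add: filter_empty_conv)
qed

lemma fp_list_ex [fp_intros]:
 assumes "fp (%y. P (fst y) (snd y))" "fp xs" shows "fp (%x. \<exists>a\<in>set (xs x). P x a)"
 using fp_not[OF fp_list_all[OF fp_not[OF assms(1)] assms(2)]] by simp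

lemma fp_member [fp_intros]: "fp f ==> fp xs ==> fp (%x. f x \<in> set (xs x))"
proof -
 assume a: "fp f" "fp xs"
 have "fp (%x. \<exists>a\<in>set (xs x). f x = a)"
  by (intro fp_intros a fp_comp[OF a(1)])
 thus ?thesis by simp
qed

lemma fp_length [fp_intros]: "fp xs ==> fp (%x. length (xs x))"
proof -
 assume a: "fp xs"
 have "fp (%x. fold (%_ n. Suc n) (xs x) 0)"
  by (rule fp_fold_add[where g = "%y. 2"]) (auto intro!: a fp_intros bnd_intros)
 moreover have "fold (%_ n. Suc n) l k = k + length l" for l :: "'b list" and k
  by (induction l arbitrary: k) auto
 ultimately show ?thesis by simp
qed

lemma fp_replicate [fp_intros]: "fp n ==> fp a ==> fp (%x. replicate (n x) (a x))"
proof -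
 assume a: "fp n" "fp a"
 \<comment> \<open>The code of a unary number is literally the code of a list of that many
   leaves.\<close>
 have enc: "(dec (enc n) :: dt list) = replicate n N" for n :: nat
  by (induction n) auto
 have u: "fp (%x. replicate (n x) N)"
  using a(1) unfolding fp_def
  by (drule_tac FPD_comp[OF FPD_norm[where 'a = "dt list"]]) (simp add: enc)
 have "fp (%x. map (%_. a x) (replicate (n x) N))"
  by (intro fp_intros u fp_comp[OF a(2)])
 thus ?thesis by simp
qed

lemma fp_upt [fp_intros]: "fp n ==> fp (%x. [0..<n x])"
proof -
 assume a: "fp n"
 have "vs [0..<k] \<le> 1 + k * (2 * k + 2)" for k
  using vs_list_le[of "[0..<k]" "2 * k + 1"] by simp
 have eq: "fold (%_ l. l @ [length l]) (replicate k N) [] = [0..<k]" for k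
  by (induction k) (simp_all flip: replicate_append_same)
 have "fp (%x. fold (%_ l. l @ [length l]) (replicate (n x) N) [])"
 proof (rule fp_fold[where g = "%x. 1 + vs (n x) * (2 * vs (n x) + 2)"])
  fix x i
  have "vs [0..<min i (n x)] \<le> 1 + min i (n x) * (2 * min i (n x) + 2)"
   using vs_list_le[of "[0..<min i (n x)]" "2 * min i (n x) + 1"] by simp
  also have "\<dots> \<le> 1 + vs (n x) * (2 * vs (n x) + 2)"
   by (intro add_mono mult_le_mono) auto
  finally show "vs (fold (%_ l. l @ [length l]) (take i (replicate (n x) N)) []) \<le> \<dots>"
   by (simp only: take_replicate eq)
 qed (intro a fp_intros bnd_intros fp_const)+
 thus ?thesis by (simp only: eq)
qed

lemma fp_add [fp_intros]: "fp f ==> fp g ==> fp (%x. f x + g x :: nat)"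
proof -
 assume a: "fp f" "fp g"
 have "fp (%x. length (replicate (f x) N @ replicate (g x) N))" by (intro fp_intros a fp_const)
 thus ?thesis by simp
qed

lemma fp_mult [fp_intros]: "fp f ==> fp g ==> fp (%x. f x * g x :: nat)"
proof -
 assume a: "fp f" "fp g"
 have "fp (%x. length (concat (replicate (f x) (replicate (g x) N))))" by (intro fp_intros a fp_const)
 moreover have "length (concat (replicate m (replicate n N))) = m * n" for m n
  by (induction m) auto
 ultimately show ?thesis by simp
qed

lemma fp_drop [fp_intros]: "fp n ==> fp l ==> fp (%x. drop (n x) (l x))"
proof -
 assume a: "fp n" "fp l"
 have tl: "vs (tl l) \<le> vs l" for l :: "'b list" by (cases l) auto
 have "fp (%x. fold (%_ l. tl l) (replicate (n x) N) (l x))"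
  by (rule fp_fold_add[where g = "%y. 0"]) (auto intro!: a fp_intros bnd_intros fp_const tl)
 moreover have "fold (%_ l. tl l) (replicate k N) l = drop k l" for l :: "'b list" and k
  by (induction k arbitrary: l) (auto simp: drop_Suc)
 ultimately show ?thesis by simp
qed

lemma fp_minus [fp_intros]: "fp f ==> fp g ==> fp (%x. f x - g x :: nat)"
proof -
 assume a: "fp f" "fp g"
 have "fp (%x. length (drop (g x) (replicate (f x) N)))" by (intro fp_intros a fp_const)
 thus ?thesis by simp
qed

lemma fp_take [fp_intros]: "fp n ==> fp l ==> fp (%x. take (n x) (l x))"
proof -
 assume a: "fp n" "fp l"
 have "fp (%x. rev (drop (length (l x) - n x) (rev (l x))))" by (intro fp_intros a)
 moreover have "take (length l - (length l - k)) l = take k l" for l :: "'b list" and k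
  by (cases "k \<le> length l") auto
 ultimately show ?thesis by (simp add: rev_drop)
qed

lemma fp_le [fp_intros]: "fp f ==> fp g ==> fp (%x. f x \<le> (g x :: nat))"
proof -
 assume a: "fp f" "fp g"
 have "fp (%x. f x - g x = 0)" by (intro fp_intros a)
 thus ?thesis by simp
qed

lemma fp_less [fp_intros]: "fp f ==> fp g ==> fp (%x. f x < (g x :: nat))"
proof -
 assume a: "fp f" "fp g"
 have "fp (%x. Suc (f x) \<le> g x)" by (intro fp_intros a)
 thus ?thesis by (simp add: Suc_le_eq)
qed

text \<open>Total lookup: beyond the end of the list it returns \<open>dec N\<close>, which is
  \<open>0\<close>, \<open>False\<close> or \<open>[]\<close> for the basic types.\<close>

definition lk :: "'a::rep list => nat => 'a" where
 "lk l n = hd0 (drop n l)"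

lemma lk_nth [simp]: "n < length l ==> lk l n = l ! n"
 by (simp add: lk_def flip: Cons_nth_drop_Suc)

lemma fp_lk [fp_intros]: "fp l ==> fp n ==> fp (%x. lk (l x) (n x))"
 unfolding lk_def by (intro fp_intros)

lemma fp_poly [fp_intros]: "fp f ==> fp (%x. poly (p :: nat poly) (f x))"
proof (induction p)
 case (pCons a p)
 have "fp (%x. a + f x * poly p (f x))"
  by (intro fp_add fp_mult fp_const pCons.prems pCons.IH)
 thus ?case by (simp add: algebra_simps)
qed (simp add: fp_0)

section \<open>From programs to complexity classes\<close>

text \<open>A machine starts with blank tapes and heads on cell 0. Moving the heads of tapes 2 and 3
  to the left makes them empty stacks, and writing the symbol 1 makes a register
  \<open>N\<close>.\<close>

fun init_tapes :: "nat => com" where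
 "init_tapes 0 = Mv 2 False ;; Mv 3 False"
| "init_tapes (Suc k) = init_tapes k ;; Wr (k + 4) 1"

definition blank_tape :: "(int => nat) \<times> int" where
 "blank_tape = (%_. 0, 0)"

definition bits :: "bool list => nat list" where
 "bits x = map (%b. if b then 2 else 1) x"

lemma length_bits [simp]: "length (bits x) = length x"
 by (simp add: bits_def)

lemma tp_bits: "tp (bits x) z = (tape_of x, z)"
 by (auto simp: tp_def tape_of_def bits_def fun_eq_iff)

text \<open>Tapes from \<open>K\<close> on do not exist in the machine; they are imagined as
  registers containing \<open>N\<close> already, so that the tapes as a whole fit \<open>tst\<close>
  after initialisation.\<close>

definition start_tapes :: "nat => bool list => tapes" where
 "start_tapes K x i = (if i = 0 then tp (bits x) 0 else if i < K then blank_tape else stk [1])"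

lemma phl_start_tapes:
 assumes "2 \<le> K" "num_tapes M = K"
 shows "phl K (start_tapes K x) = snd (init_config M x)"
proof -
 have "[0..<K] = 0 # [1..<K]" using assms by (simp add: upt_rec)
 moreover have "map (%i. start_tapes K x (lg K i)) [1..<K] = replicate (K - 1) (%_. 0, 0)"
  using assms by (intro nth_equalityI) (auto simp: start_tapes_def lg_def blank_tape_def)
 ultimately show ?thesis using assms
  by (simp add: phl_def init_config_def start_tapes_def lg_def tp_bits)
qed

lemma mtape_init: "mtape (init_tapes k) = k + 3"
 by (induction k) auto

lemma exq_init_tapes:
 assumes "T = start_tapes (k + 4) x"
 shows "exq (init_tapes k) T (k + 2) (tst T (%_. N))"
proof -
 have bl: "blank_tape = tp [] 0" by (simp add: blank_tape_def tp_def fun_eq_iff)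
 have "exq (init_tapes j) T (j + 2) (%i. if i = 2 \<or> i = 3 then stk [] else if 4 \<le> i & i < j + 4 then stk [1] else T i)"
  if "j \<le> k" for j
  using that
 proof (induction j)
  case 0
  have "exq (Mv 2 False) T 1 (T(2 := tp [] (- 1)))"
   using exq_Mv_tp[of T 2 "[]" 0 False] assms by (simp add: start_tapes_def bl shift_def)
  moreover have "exq (Mv 3 False) (T(2 := tp [] (- 1))) 1 (T(2 := tp [] (- 1), 3 := tp [] (- 1)))"
   using exq_Mv_tp[of "T(2 := tp [] (- 1))" 3 "[]" 0 False] assms
   by (simp add: start_tapes_def bl shift_def)
  ultimately have "exq (init_tapes 0) T (1 + 1) (T(2 := tp [] (- 1), 3 := tp [] (- 1)))"
   unfolding init_tapes.simps by (rule exq_Seq)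
  moreover have "T(2 := tp [] (- 1), 3 := tp [] (- 1)) =
    (%i. if i = 2 \<or> i = 3 then stk [] else if 4 \<le> i & i < 0 + 4 then stk [1] else T i)"
   by (auto simp: fun_eq_iff stk_def)
  ultimately show ?case by (simp add: numeral_2_eq_2)
 next
  case (Suc j)
  let ?U = "%j i. if i = 2 \<or> i = 3 then stk [] else if 4 \<le> i & i < j + 4 then stk [1] else T i"
  have "T (j + 4) = blank_tape" using Suc.prems assms by (simp add: start_tapes_def)
  hence "wr (?U j) (j + 4) 1 = ?U (Suc j)"
   by (auto simp: fun_eq_iff wr_def blank_tape_def stk_def tp_def)
  hence "exq (Wr (j + 4) 1) (?U j) 1 (?U (Suc j))" using exq_Wr[of "j + 4" 1 "?U j"] by simp
  from exq_Seq[OF Suc.IH this] Suc.prems show ?case by (simp add: ac_simps)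
 qed
 from this[of k] have "exq (init_tapes k) T (k + 2) (%i. if i = 2 \<or> i = 3 then stk [] else if 4 \<le> i & i < k + 4 then stk [1] else T i)"
  by simp
 moreover have "(%i. if i = 2 \<or> i = 3 then stk [] else if 4 \<le> i & i < k + 4 then stk [1] else T i) = tst T (%_. N)"
  by (auto simp: fun_eq_iff tst_def assms start_tapes_def)
 ultimately show ?thesis by simp
qed

text \<open>Register 2 supplies the code \<open>C N N\<close> of \<open>True\<close>, register 1 the
  code \<open>N\<close> of \<open>False\<close>. Since consing reverses, the input is read from
  right to left.\<close>

definition read_input :: com where
 "read_input = ccons 2 1 1 ;; WhileN 0 0 (Mv 0 True) ;; Mv 0 False ;;
   WhileN 0 0 (IfS 0 2 (ccons 0 2 0) (ccons 0 1 0) ;; Mv 0 False) ;; cnil 2"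

lemma tst_update0: "(tst T \<sigma>)(0 := a) = tst (T(0 := a)) \<sigma>" "(tst T \<sigma>)(1 := a) = tst (T(1 := a)) \<sigma>"
 "(tst T \<sigma>)(Suc 0 := a) = tst (T(Suc 0 := a)) \<sigma>"
 by (auto simp: tst_def fun_eq_iff)

lemma tst_0 [simp]: "tst T \<sigma> 0 = T 0" "tst T \<sigma> 1 = T 1" "tst T \<sigma> (Suc 0) = T 1"
 by (simp_all add: tst_def)

lemma ex_SeqE:
 assumes "ex I (c ;; c') T t T''"
 obtains t1 t2 T' where "ex I c T t1 T'" "ex I c' T' t2 T''" "t = t1 + t2"
 using assms by (cases rule: ex.cases) auto

lemma exsD: "exs c \<sigma> t \<sigma>' ==> exq c (tst T \<sigma>) t (tst T \<sigma>')"
 by (simp add: exs_def)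

lemma enc_bools: "enc (b # l) = C (if b then C N N else N) (enc l)"
 by (simp add: enc_bool_def boolD_def)

lemma sz_bools: "sz (enc (l :: bool list)) \<le> 4 * length l + 1"
 by (induction l) (auto simp: enc_bool_def boolD_def)

lemma exq_read_input:
 assumes T: "T 0 = tp (bits x) 0"
 shows "exq read_input (tst T (%_. N)) (1000 * (length x + 1) * (length x + 1))
  (tst (T(0 := tp (bits x) (- 1))) ((%_. N)(0 := enc x)))"
proof -
 let ?\<sigma> = "%l. (%_. N)(2 := C N N, 0 := enc (l :: bool list)) :: nat => dt"
 let ?n = "length x"
 have 1: "exq (ccons 2 1 1) (tst T (%_. N)) 110 (tst T (?\<sigma> []))"
 proof -
  have "(%_. N)(2 := C N N) = ?\<sigma> []" for z :: nat by (auto simp: fun_eq_iff)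
  thus ?thesis using exsD[OF exs_cons[of 2 1 1 "%_. N"], of T] by (auto elim: exq_weaken)
 qed
 have no0: "0 \<notin> set (bits x)" by (auto simp: bits_def)
 have 2: "exq (WhileN 0 0 (Mv 0 True) ;; Mv 0 False) (tst T (?\<sigma> [])) (3 * ?n + 2)
   (tst (T(0 := stk (bits x))) (?\<sigma> []))"
  using exq_forward[of "tst T (?\<sigma> [])" 0 "bits x" 0, unfolded forward_def] T no0
  by (simp add: tst_update0)
 let ?T = "%i. T(0 := tp (bits x) (int i - 1))"
 let ?W = "WhileN 0 0 (IfS 0 2 (ccons 0 2 0) (ccons 0 1 0) ;; Mv 0 False)"
 have loop: "i \<le> ?n ==> exq ?W (tst (?T i) (?\<sigma> (drop i x))) (i * (200 * ?n + 200) + 1) (tst (?T 0) (?\<sigma> x))" for i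
 proof (induction i)
  case 0
  have "exq ?W (tst (?T 0) (?\<sigma> x)) 1 (tst (?T 0) (?\<sigma> x))"
   by (rule exq_WhF) (simp_all add: rd_tp[of _ _ "bits x" "- 1"])
  thus ?case by (simp only: drop_0 mult_0 add_0)
 next
  case (Suc i)
  hence i: "i < ?n" by simp
  let ?b = "x ! i"
  have rd: "rd (tst (?T (Suc i)) (?\<sigma> (drop (Suc i) x))) 0 = (if ?b then 2 else 1)"
   using i by (simp add: rd_tp[of _ _ "bits x" "int i"]) (simp add: bits_def)
  have d: "drop i x = ?b # drop (Suc i) x" using i by (simp add: Cons_nth_drop_Suc)
  have s: "sz (enc (drop (Suc i) x)) \<le> 4 * ?n + 1" using sz_bools[of "drop (Suc i) x"] by simp
  have c: "exq (ccons 0 r 0) (tst (?T (Suc i)) (?\<sigma> (drop (Suc i) x))) (192 * ?n + 150) (tst (?T (Suc i)) (?\<sigma> (drop i x)))"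
   if "r = (if ?b then 2 else 1)" for r
  proof -
   let ?s = "?\<sigma> (drop (Suc i) x)"
   have eq: "?s(0 := C (?s r) (?s 0)) = ?\<sigma> (drop i x)" unfolding d enc_bools using that by (auto simp: fun_eq_iff)
   have le: "24 * (sz (?s 0) + sz (?s r) + sz (?s 0)) + 30 \<le> 192 * ?n + 150"
    using s that by auto
   show ?thesis
    using exq_weaken[OF exsD[OF exs_cons[of 0 r 0 ?s], of "?T (Suc i)"] le] unfolding eq .
  qed
  have 1: "exq (IfS 0 2 (ccons 0 2 0) (ccons 0 1 0)) (tst (?T (Suc i)) (?\<sigma> (drop (Suc i) x)))
    (192 * ?n + 150 + 2) (tst (?T (Suc i)) (?\<sigma> (drop i x)))"
   by (rule exq_If) (use rd c in \<open>auto split: if_splits\<close>)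
  have 2: "exq (Mv 0 False) (tst (?T (Suc i)) (?\<sigma> (drop i x))) 1 (tst (?T i) (?\<sigma> (drop i x)))"
   using exq_Mv_tp[of "tst (?T (Suc i)) (?\<sigma> (drop i x))" 0 "bits x" "int i" False]
   by (simp add: tst_update0 shift_def)
  have "rd (tst (?T (Suc i)) (?\<sigma> (drop (Suc i) x))) 0 ~= 0" using rd by simp
  have IH: "exq ?W (tst (?T i) (?\<sigma> (drop i x))) (i * (200 * ?n + 200) + 1) (tst (?T 0) (?\<sigma> x))"
   by (rule Suc.IH) (use i in simp)
  have "exq ?W (tst (?T (Suc i)) (?\<sigma> (drop (Suc i) x)))
    (192 * ?n + 150 + 2 + 1 + 2 + (i * (200 * ?n + 200) + 1)) (tst (?T 0) (?\<sigma> x))"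
   by (rule exq_WhT[OF _ exq_Seq[OF 1 2] IH]) fact
  thus ?case by (rule exq_weaken) simp
 qed
 have 3: "exq ?W (tst (T(0 := stk (bits x))) (?\<sigma> [])) (?n * (200 * ?n + 200) + 1) (tst (?T 0) (?\<sigma> x))"
  using loop[of ?n] by (simp add: stk_def)
 have 4: "exq (cnil 2) (tst (?T 0) (?\<sigma> x)) 20 (tst (T(0 := tp (bits x) (- 1))) ((%_. N)(0 := enc x)))"
 proof -
  have "(?\<sigma> x)(2 := N) = (%_. N)(0 := enc x)" by (auto simp: fun_eq_iff)
  thus ?thesis using exsD[OF exs_nil[of 2 "?\<sigma> x"], of "?T 0"] by (auto elim: exq_weaken)
 qed
 from exq_Seq[OF 1 exq_Seq[OF 2 exq_Seq[OF 3 4]]]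
 have "exq (ccons 2 1 1 ;; (WhileN 0 0 (Mv 0 True) ;; Mv 0 False) ;; ?W ;; cnil 2) (tst T (%_. N))
  (1000 * (?n + 1) * (?n + 1)) (tst (T(0 := tp (bits x) (- 1))) ((%_. N)(0 := enc x)))"
  by (rule exq_weaken) (simp add: algebra_simps)
 moreover have assoc: "exq ((a ;; b) ;; c) T t T' ==> exq (a ;; b ;; c) T t T'" for a b c T t T'
 proof -
  assume "exq ((a ;; b) ;; c) T t T'"
  then obtain t1 t2 t3 T1 T2 where "ex (%_. True) a T t1 T1" "ex (%_. True) b T1 t2 T2"
   "ex (%_. True) c T2 t3 T'" "t1 + t2 + t3 \<le> t"
   unfolding exq_def by (auto elim!: ex_SeqE)
  hence "ex (%_. True) (a ;; b ;; c) T (t1 + (t2 + t3)) T'" "t1 + (t2 + t3) \<le> t"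
   by (auto intro: ex.Seq)
  thus ?thesis unfolding exq_def by blast
 qed
 have assoc': "exq (c ;; d) T t T'" if H: "exq (c ;; e) T t T'" "!!T t T'. exq e T t T' ==> exq d T t T'" for c d e T t T'
 proof -
  obtain a b T1 where "ex (%_. True) c T a T1" "ex (%_. True) e T1 b T'" "a + b \<le> t"
   using H(1) unfolding exq_def by (auto elim!: ex_SeqE)
  moreover from this(2) have "exq e T1 b T'" unfolding exq_def by blast
  ultimately show ?thesis using exq_Seq[of c T a T1 d b T'] H(2)[of T1 b T']
   unfolding exq_def by (meson le_refl order_trans)
 qed
 ultimately show ?thesis unfolding read_input_def using assoc'[OF _ assoc] by blast
qed

text \<open>Only the heads are bounded, not the time: a computation in polynomial space may take
  exponentially long.\<close>

definition exb :: "nat => com => tapes => tapes => bool" where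
 "exb B c T T' \<longleftrightarrow> (\<exists>t. ex (%T. \<forall>r. \<bar>snd (T r)\<bar> \<le> int B) c T t T')"

lemma exb_Seq: "exb B c T T' ==> exb B c' T' T'' ==> exb B (c ;; c') T T''"
 unfolding exb_def by (meson ex.Seq)

lemma exb_WhF: "rd T r = s ==> \<forall>r. \<bar>snd (T r)\<bar> \<le> int B ==> exb B (WhileN r s c) T T"
 unfolding exb_def using ex.WhF[of "%T. \<forall>r. \<bar>snd (T r)\<bar> \<le> int B" T r s c] by blast

lemma exb_WhT: "rd T r ~= s ==> exb B c T T' ==> exb B (WhileN r s c) T' T'' ==> exb B (WhileN r s c) T T''"
 unfolding exb_def by (meson ex.WhT)

lemma exb_exq:
 assumes "exq c T t T'" "!!r. \<bar>snd (T r)\<bar> \<le> int b" "b + t \<le> B"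
 shows "exb B c T T'"
proof -
 obtain \<tau> where \<tau>: "\<tau> \<le> t" "ex (%_. True) c T \<tau> T'" using assms(1) unfolding exq_def by blast
 have "ex (%T. \<forall>r. \<bar>snd (T r)\<bar> \<le> int (b + \<tau>)) c T \<tau> T'" by (rule ex_head_bound(1)[OF \<tau>(2) assms(2)])
 hence "ex (%T. \<forall>r. \<bar>snd (T r)\<bar> \<le> int B) c T \<tau> T'"
 proof (rule ex_mono)
  fix T :: tapes assume "\<forall>r. \<bar>snd (T r)\<bar> \<le> int (b + \<tau>)"
  moreover have "int (b + \<tau>) \<le> int B" using \<tau>(1) assms(3) by simp
  ultimately show "\<forall>r. \<bar>snd (T r)\<bar> \<le> int B" by (meson order_trans)
 qed
 thus ?thesis unfolding exb_def by blast
qed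

lemma head_tst:
 assumes "\<bar>snd (T 0)\<bar> \<le> int b" "\<bar>snd (T 1)\<bar> \<le> int b" "!!r. sz (\<sigma> r) \<le> b"
 shows "\<bar>snd (tst T \<sigma> r)\<bar> \<le> int b"
proof -
 have "\<bar>snd (stk (ser (\<sigma> r)))\<bar> \<le> int b" for r
  using Suc_leI[OF sz_pos[of "\<sigma> r"]] assms(3)[of r] by (simp add: stk_def tp_def)
 moreover have "1 \<le> b" using assms(3)[of 0] sz_pos[of "\<sigma> 0"] by linarith
 moreover have "r < 2 ==> r = 0 \<or> r = 1" by auto
 ultimately show ?thesis using assms(1,2) unfolding tst_def
  by (auto simp: stk_def[of "[]"] tp_def[of "[]"])
qed

text \<open>Tape 4 is register 0; its visible root symbol is 2 exactly if the register is not
  \<open>N\<close>, so acceptance corresponds to \<open>True\<close>.\<close>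

lemma program_decides:
 assumes c: "!!T x. T 0 = tp (bits x) 0 ==> T 1 = blank_tape ==>
   \<exists>T'. exb (poly b (length x)) (c :: com) (tst T (%_. N)) T' & (rd T' 4 = 2 \<longleftrightarrow> x \<in> A)"
 shows "A \<in> PSPACE"
proof -
 define k where "k = mtape c + 2"
 define K where "K = k + 4"
 define P where "P = init_tapes k ;; c"
 have K: "2 \<le> K" "4 < K" by (auto simp: K_def k_def)
 have mt: "mtape P < K" by (simp add: P_def K_def k_def mtape_init)
 obtain M where M: "wf_machine M" "num_tapes M = K"
  "!!x T t T' I. ex I P T t T' ==> phl K T = snd (init_config M x) ==>
   (\<forall>k. \<exists>q T''. run M x k = (q, phl K T'') & I T'') &
   run M x (Suc t) = (if rd T' 4 = 2 then 1 else 2, phl K T') &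
   halted (run M x (Suc t))"
  by (rule program_machine[OF K(1) mt K(2)]) blast
 let ?b = "b + [:k + 2:] :: nat poly"
 have "uses_space M x (poly ?b (length x)) & (\<exists>n. halted (run M x n) & (fst (run M x n) = 1 \<longleftrightarrow> x \<in> A))" for x
 proof -
  let ?T = "start_tapes K x"
  let ?B = "poly ?b (length x)"
  have i: "exq (init_tapes k) ?T (k + 2) (tst ?T (%_. N))"
   by (rule exq_init_tapes) (simp add: K_def)
  have "exb ?B (init_tapes k) ?T (tst ?T (%_. N))"
   by (rule exb_exq[OF i, of 0]) (auto simp: start_tapes_def blank_tape_def stk_def tp_def)
  moreover obtain T' where T': "exb (poly b (length x)) c (tst ?T (%_. N)) T'" "rd T' 4 = 2 \<longleftrightarrow> x \<in> A"
   using c[of ?T x] K by (auto simp: start_tapes_def)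
  have "exb ?B c (tst ?T (%_. N)) T'"
  proof -
   obtain t where t: "ex (%T. \<forall>r. \<bar>snd (T r)\<bar> \<le> int (poly b (length x))) c (tst ?T (%_. N)) t T'"
    using T'(1) unfolding exb_def by blast
   have "int (poly b (length x)) \<le> int ?B" by simp
   hence "ex (%T. \<forall>r. \<bar>snd (T r)\<bar> \<le> int ?B) c (tst ?T (%_. N)) t T'"
    by (intro ex_mono[OF t]) (meson order_trans)
   thus ?thesis unfolding exb_def by blast
  qed
  ultimately have "exb ?B P ?T T'" unfolding P_def by (rule exb_Seq)
  then obtain t where "ex (%T. \<forall>r. \<bar>snd (T r)\<bar> \<le> int ?B) P ?T t T'" unfolding exb_def by blast
  note r = M(3)[OF this phl_start_tapes[OF K(1) M(2)]]
  have "uses_space M x ?B" unfolding uses_space_def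
  proof (intro allI ballI)
   fix n p assume p: "p \<in> set (snd (run M x n))"
   obtain q T'' where "run M x n = (q, phl K T'')" "\<forall>r. \<bar>snd (T'' r)\<bar> \<le> int ?B" using r by blast
   with p show "case p of (tq, z) => \<bar>z\<bar> \<le> int ?B" by (auto simp: phl_def) (metis snd_conv)
  qed
  moreover have rs: "run M x (Suc t) = (if rd T' 4 = 2 then 1 else 2, phl K T')" "halted (run M x (Suc t))"
   using r by blast+
  have "halted (run M x (Suc t)) & (fst (run M x (Suc t)) = 1 \<longleftrightarrow> x \<in> A)"
   by (intro conjI rs(2)) (simp add: rs(1) T'(2))
  ultimately show ?thesis by blast
 qed
 thus ?thesis unfolding PSPACE_def using M(1) by blast
qed

lemma program_computes:
 assumes c: "!!T x. T 0 = tp (bits x) 0 ==> T 1 = blank_tape ==>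
   \<exists>T'. exq (c :: com) (tst T (%_. N)) (poly b (length x)) T' & fst (T' 1) = tape_of (f x)"
 shows "polytime_computable f"
proof -
 define k where "k = mtape c + 2"
 define K where "K = k + 4"
 define P where "P = init_tapes k ;; c"
 have K: "2 \<le> K" "4 < K" by (auto simp: K_def k_def)
 have mt: "mtape P < K" by (simp add: P_def K_def k_def mtape_init)
 obtain M where M: "wf_machine M" "num_tapes M = K"
  "!!x T t T' I. ex I P T t T' ==> phl K T = snd (init_config M x) ==>
   (\<forall>k. \<exists>q T''. run M x k = (q, phl K T'') & I T'') &
   run M x (Suc t) = (if rd T' 4 = 2 then 1 else 2, phl K T') &
   halted (run M x (Suc t))"
  by (rule program_machine[OF K(1) mt K(2)]) blast
 let ?b = "b + [:k + 3:] :: nat poly"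
 have "\<exists>n\<le>poly ?b (length x). halted (run M x n) & fst (last (snd (run M x n))) = tape_of (f x)" for x
 proof -
  let ?T = "start_tapes K x"
  have i: "exq (init_tapes k) ?T (k + 2) (tst ?T (%_. N))"
   by (rule exq_init_tapes) (simp add: K_def)
  obtain T' where T': "exq c (tst ?T (%_. N)) (poly b (length x)) T'" "fst (T' 1) = tape_of (f x)"
   using c[of ?T x] K by (auto simp: start_tapes_def)
  obtain t where t: "t \<le> k + 2 + poly b (length x)" "ex (%_. True) P ?T t T'"
   using exq_Seq[OF i T'(1)] unfolding P_def exq_def by blast
  note r = M(3)[OF t(2) phl_start_tapes[OF K(1) M(2)]]
  have "last (phl K T') = T' 1" using K by (simp add: phl_def last_map lg_def)
  thus ?thesis using r T'(2) t(1) by (intro exI[of _ "Suc t"]) auto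
 qed
 thus ?thesis unfolding polytime_computable_def using M(1) by blast
qed

lemma fp_program:
 assumes "fp f"
 obtains c and p :: "nat poly" where
  "!!\<sigma> x. (\<forall>r>b. \<sigma> r = N) ==> \<sigma> b = enc x ==> exs c \<sigma> (poly p (vs x)) (\<sigma>(b := enc (f x)))"
proof -
 obtain p where p: "FPDt (%d. enc (f (dec d))) (poly p)" using FPDE[OF assms[unfolded fp_def]] by metis
 then obtain c where c: "!!\<sigma>. (\<forall>r>b. \<sigma> r = N) ==> exs c \<sigma> (poly p (sz (\<sigma> b))) (\<sigma>(b := enc (f (dec (\<sigma> b)))))"
  unfolding FPDt_def by blast
 show thesis
 proof (rule that[of c p])
  show "exs c \<sigma> (poly p (vs x)) (\<sigma>(b := enc (f x)))" if "\<forall>r>b. \<sigma> r = N" "\<sigma> b = enc x" for \<sigma> x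
   using c[OF that(1)] by (simp add: that(2) vs_def)
 qed
qed

lemma vs_bits: "vs (x :: bool list) \<le> 4 * length x + 1"
 unfolding vs_def by (rule sz_bools)

theorem fp_polytime:
 assumes f: "fp (f :: bool list => bool list)"
 shows "polytime_computable f"
proof -
 obtain c and p :: "nat poly" where c:
  "!!\<sigma> x. (\<forall>r>0. \<sigma> r = N) ==> \<sigma> 0 = enc x ==> exs c \<sigma> (poly p (vs x)) (\<sigma>(0 := enc (f x)))"
  by (rule fp_program[OF f, of 0]) blast
 obtain q where q: "!!x. vs (f x) \<le> poly q (vs x)" using fp_bound[OF f] by metis
 define body where "body = chd 1 0 ;; IfS (1 + 4) 1 (Wr 1 1) (Wr 1 2) ;; Mv 1 True ;; ctl 0 0 ;; cnil 1"
 define out where "out = WhileN (0 + 4) 1 body"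
 have loop: "T 1 = tp (bits u) (int (length u)) ==> vs y \<le> n ==>
  \<exists>T'. exq out (tst T ((%_. N)(0 := enc y))) (length y * (300 * n + 300) + 1) T' & fst (T' 1) = tape_of (u @ y)"
  for y u n T
 proof (induction y arbitrary: T u)
  case Nil
  have e: "exq out (tst T ((%_. N)(0 := enc ([] :: bool list)))) 1 (tst T ((%_. N)(0 := enc ([] :: bool list))))"
  proof -
   have "rd (tst T ((%_. N)(0 := enc ([] :: bool list)))) (0 + 4) = 1" by (subst rd_tst) simp
   thus ?thesis unfolding out_def by (rule exq_WhF) simp
  qed
  have f: "fst (tst T ((%_. N)(0 := enc ([] :: bool list))) 1) = tape_of (u @ [])"
   using Nil by (simp add: tp_bits)
  show ?case by (rule exI, rule conjI, rule exq_weaken[OF e], simp, rule f)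
 next
  case (Cons b y)
  let ?s = "%d. (%_. N)(0 := d) :: nat => dt"
  let ?D = "enc (b # y)" and ?b = "enc b"
  have D: "sz ?D \<le> n" "hdD ?D = ?b" "tlD ?D = enc y" "sz ?b \<le> 3"
   using Cons.prems(2) by (simp_all add: vs_def enc_bool_def boolD_def)
  have 1: "exq (chd 1 0) (tst T (?s ?D)) (50 * (1 + n) + 50) (tst T ((?s ?D)(1 := ?b)))"
   using exsD[OF exs_hd[of 1 0 "?s ?D"], of T] D by (auto elim: exq_weaken)
  have T1: "T 1 = (tape_of u, int (length u))" using Cons.prems(1) by (simp add: tp_bits)
  let ?T1 = "T(1 := ((tape_of u)(int (length u) := if b then 2 else 1), int (length u)))"
  have w: "exq (Wr 1 k) (tst T \<sigma>) 1 (tst (T(1 := ((tape_of u)(int (length u) := k), int (length u)))) \<sigma>)" for k \<sigma>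
   using exq_Wr[of 1 k "tst T \<sigma>"] T1 by (simp add: wr_def tst_update0)
  have 2: "exq (IfS (1 + 4) 1 (Wr 1 1) (Wr 1 2)) (tst T ((?s ?D)(1 := ?b))) (1 + 2) (tst ?T1 ((?s ?D)(1 := ?b)))"
  proof (rule exq_If)
   have rd: "rd (tst T ((?s ?D)(1 := ?b))) (1 + 4) = (if b then 2 else 1)"
    by (subst rd_tst) (simp add: enc_bool_def boolD_def)
   show "exq (Wr 1 1) (tst T ((?s ?D)(1 := ?b))) 1 (tst ?T1 ((?s ?D)(1 := ?b)))"
    if "rd (tst T ((?s ?D)(1 := ?b))) (1 + 4) = 1"
    using w[of 1] that unfolding rd by (cases b) simp_all
   show "exq (Wr 1 2) (tst T ((?s ?D)(1 := ?b))) 1 (tst ?T1 ((?s ?D)(1 := ?b)))"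
    if "rd (tst T ((?s ?D)(1 := ?b))) (1 + 4) ~= 1"
    using w[of 2] that unfolding rd by (cases b) simp_all
  qed
  let ?T2 = "T(1 := tp (bits (u @ [b])) (int (length (u @ [b]))))"
  have tape: "(tape_of u)(int (length u) := if b then 2 else 1) = tape_of (u @ [b])"
   by (auto simp: tape_of_def fun_eq_iff nth_append nat_less_iff)
  have "exq (Mv 1 True) (tst ?T1 ((?s ?D)(1 := ?b))) 1 (tst ?T2 ((?s ?D)(1 := ?b)))"
   using exq_Mv[of 1 True "tst ?T1 ((?s ?D)(1 := ?b))"] tape
   by (simp add: mv_def tst_update0 tp_bits shift_def ac_simps)
  note 3 = this
  have 4: "exq (ctl 0 0) (tst ?T2 ((?s ?D)(1 := ?b))) (50 * (n + n) + 50) (tst ?T2 ((?s (enc y))(1 := ?b)))"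
  proof -
   have "((?s ?D)(1 := ?b))(0 := enc y) = (?s (enc y))(1 := ?b)" by (auto simp: fun_eq_iff)
   thus ?thesis using exsD[OF exs_tl[of 0 0 "(?s ?D)(1 := ?b)"], of ?T2] D
    by (auto elim: exq_weaken)
  qed
  have 5: "exq (cnil 1) (tst ?T2 ((?s (enc y))(1 := ?b))) 15 (tst ?T2 (?s (enc y)))"
  proof -
   have "((?s (enc y))(1 := ?b))(1 := N) = ?s (enc y)" by (auto simp: fun_eq_iff)
   thus ?thesis using exsD[OF exs_nil[of 1 "(?s (enc y))(1 := ?b)"], of ?T2] D
    by (auto elim: exq_weaken)
  qed
  have 6: "exq body (tst T (?s ?D)) (200 * n + 280) (tst ?T2 (?s (enc y)))" unfolding body_def
   by (rule exq_weaken[OF exq_Seq[OF 1 exq_Seq[OF 2 exq_Seq[OF 3 exq_Seq[OF 4 5]]]]]) simp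
  have "\<exists>T'. exq out (tst ?T2 (?s (enc y))) (length y * (300 * n + 300) + 1) T' & fst (T' 1) = tape_of ((u @ [b]) @ y)"
   by (rule Cons.IH) (use Cons.prems(2) in simp_all)
  then obtain T' where T': "exq out (tst ?T2 (?s (enc y))) (length y * (300 * n + 300) + 1) T'"
   "fst (T' 1) = tape_of (u @ b # y)" by auto
  have "rd (tst T (?s ?D)) (0 + 4) ~= 1" by (subst rd_tst) simp
  from exq_WhT[OF this 6 T'(1)[unfolded out_def]]
  have "exq out (tst T (?s ?D)) (length (b # y) * (300 * n + 300) + 1) T'"
   unfolding out_def by (rule exq_weaken) simp
  with T'(2) show ?case by blast
 qed
 let ?h = "[:1, 4:] :: nat poly"
 let ?q = "q \<circ>\<^sub>p ?h" and ?p = "p \<circ>\<^sub>p ?h"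
 let ?b = "[:1000:] * [:1, 1:] * [:1, 1:] + ?p + ?q * ([:300:] * ?q + [:300:]) + [:1:]"
 have "\<exists>T'. exq (read_input ;; c ;; out) (tst T (%_. N)) (poly ?b (length x)) T' & fst (T' 1) = tape_of (f x)"
  if T: "T 0 = tp (bits x) 0" "T 1 = blank_tape" for T x
 proof -
  let ?T = "T(0 := tp (bits x) (- 1))"
  have 1: "exq read_input (tst T (%_. N)) (1000 * (length x + 1) * (length x + 1)) (tst ?T ((%_. N)(0 := enc x)))"
   by (rule exq_read_input[of T x, OF T(1)])
  have vx: "vs x \<le> poly ?h (length x)" using vs_bits[of x] by simp
  have 2: "exq c (tst ?T ((%_. N)(0 := enc x))) (poly ?p (length x)) (tst ?T ((%_. N)(0 := enc (f x))))"
   using exsD[OF c[of "(%_. N)(0 := enc x)" x], of ?T] poly_nat_mono[OF vx, of p]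
   by (auto simp: poly_pcompose elim: exq_weaken)
  have vf: "vs (f x) \<le> poly ?q (length x)"
   using order_trans[OF q poly_nat_mono[OF vx, of q]] by (simp add: poly_pcompose)
  obtain T' where 3: "exq out (tst ?T ((%_. N)(0 := enc (f x)))) (length (f x) * (300 * poly ?q (length x) + 300) + 1) T'"
   "fst (T' 1) = tape_of ([] @ f x)"
  proof -
   have "?T 1 = tp (bits []) (int (length ([] :: bool list)))"
    using T(2) by (simp add: blank_tape_def tp_def bits_def fun_eq_iff)
   from loop[of ?T "[]", OF this vf] show ?thesis using that by blast
  qed
  have pb: "poly ?b (length x) = 1000 * (length x + 1) * (length x + 1) + poly ?p (length x) +
    poly ?q (length x) * (300 * poly ?q (length x) + 300) + 1"
   by (simp add: algebra_simps)
  have le: "length (f x) * (300 * poly ?q (length x) + 300) \<le> poly ?q (length x) * (300 * poly ?q (length x) + 300)"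
   by (rule mult_le_mono1) (use vf vs_length[of "f x"] in linarith)
  have "exq (read_input ;; c ;; out) (tst T (%_. N)) (poly ?b (length x)) T'"
   unfolding pb by (rule exq_weaken[OF exq_Seq[OF 1 exq_Seq[OF 2 3(1)]]]) (use le in linarith)
  thus ?thesis using 3(2) by auto
 qed
 thus ?thesis by (rule program_computes)
qed

lemma exb_exs:
 assumes "exs c \<sigma> t \<sigma>'" "\<bar>snd (T 0)\<bar> \<le> int b" "\<bar>snd (T 1)\<bar> \<le> int b" "!!r. sz (\<sigma> r) \<le> b" "b + t \<le> B"
 shows "exb B c (tst T \<sigma>) (tst T \<sigma>')"
 using exb_exq[OF exsD[OF assms(1)] head_tst[OF assms(2-4)] assms(5)] .

theorem iteration_PSPACE:
 fixes step :: "'s::rep => 's"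
 assumes fp: "fp init" "fp step" "fp go" "fp acc"
  and run: "!!x. \<exists>n. \<not> go ((step ^^ n) (init x)) & (\<forall>k<n. go ((step ^^ k) (init x))) &
   (\<forall>k\<le>n. vs ((step ^^ k) (init x)) \<le> poly q (length x)) & (acc ((step ^^ n) (init x)) \<longleftrightarrow> x \<in> A)"
 shows "A \<in> PSPACE"
proof -
 obtain ci and pi :: "nat poly" where ci:
  "!!\<sigma> x. (\<forall>r>0. \<sigma> r = N) ==> \<sigma> 0 = enc x ==> exs ci \<sigma> (poly pi (vs x)) (\<sigma>(0 := enc (init x)))"
  by (rule fp_program[OF fp(1), of 0]) blast
 obtain cs and ps :: "nat poly" where cs:
  "!!\<sigma> x. (\<forall>r>0. \<sigma> r = N) ==> \<sigma> 0 = enc x ==> exs cs \<sigma> (poly ps (vs x)) (\<sigma>(0 := enc (step x)))"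
  by (rule fp_program[OF fp(2), of 0]) blast
 obtain cg and pg :: "nat poly" where cg:
  "!!\<sigma> x. (\<forall>r>1. \<sigma> r = N) ==> \<sigma> 1 = enc x ==> exs cg \<sigma> (poly pg (vs x)) (\<sigma>(1 := enc (go x)))"
  by (rule fp_program[OF fp(3), of 1]) blast
 obtain ca and pa :: "nat poly" where ca:
  "!!\<sigma> x. (\<forall>r>0. \<sigma> r = N) ==> \<sigma> 0 = enc x ==> exs ca \<sigma> (poly pa (vs x)) (\<sigma>(0 := enc (acc x)))"
  by (rule fp_program[OF fp(4), of 0]) blast
 define test where "test = ccopy 1 0 ;; cg"
 define loop where "loop = WhileN (1 + 4) 1 (cnil 1 ;; cs ;; test)"
 let ?h = "[:1, 4:] :: nat poly"
 let ?b1 = "?h + q + [:10:]"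
 let ?b = "?b1 + [:1000:] * [:1, 1:] * [:1, 1:] + pi \<circ>\<^sub>p ?h + ([:24:] * ([:1:] + q) + [:10:]) + pg \<circ>\<^sub>p q + [:15:] + ps \<circ>\<^sub>p q + pa \<circ>\<^sub>p q"
 have "\<exists>T'. exb (poly ?b (length x)) (read_input ;; ci ;; test ;; loop ;; ca) (tst T (%_. N)) T' & (rd T' 4 = 2 \<longleftrightarrow> x \<in> A)"
  if T: "T 0 = tp (bits x) 0" "T 1 = blank_tape" for T x
 proof -
  define b1 where "b1 = poly ?b1 (length x)"
  define Q where "Q = poly q (length x)"
  define B where "B = poly ?b (length x)"
  obtain n where n: "\<not> go ((step ^^ n) (init x))" "!!k. k < n ==> go ((step ^^ k) (init x))"
   "!!k. k \<le> n ==> vs ((step ^^ k) (init x)) \<le> Q" "acc ((step ^^ n) (init x)) \<longleftrightarrow> x \<in> A"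
   using run[of x] unfolding Q_def by blast
  let ?S = "%k. (step ^^ k) (init x)"
  let ?T = "T(0 := tp (bits x) (- 1))"
  let ?s = "%k. (%_. N)(0 := enc (?S k)) :: nat => dt"
  have vx: "vs x \<le> poly ?h (length x)" using vs_bits[of x] by simp
  have b1: "poly ?h (length x) \<le> b1" "Q + 10 \<le> b1" by (simp_all add: b1_def Q_def)
  have heads: "\<bar>snd (T 0)\<bar> \<le> int b1" "\<bar>snd (?T 0)\<bar> \<le> int b1" "\<bar>snd (?T 1)\<bar> \<le> int b1" "\<bar>snd (T 1)\<bar> \<le> int b1"
   using T by (simp_all add: tp_def blank_tape_def b1_def)
  have B: "b1 + 1000 * (length x + 1) * (length x + 1) \<le> B" "b1 + poly pi (poly ?h (length x)) \<le> B"
   "b1 + (24 * (1 + Q) + 10) \<le> B" "b1 + poly pg Q \<le> B" "b1 + 15 \<le> B" "b1 + poly ps Q \<le> B" "b1 + poly pa Q \<le> B"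
   unfolding B_def b1_def Q_def by (simp_all add: poly_pcompose del: poly_pCons)
    (simp_all add: algebra_simps)
  have mono: "b1 + poly p (vs (?S k)) \<le> B" if "b1 + poly p Q \<le> B" "k \<le> n" for p k
   using poly_nat_mono[OF n(3)[OF that(2)], of p] that(1) by linarith
  have szS: "sz (enc (?S k)) \<le> Q" if "k \<le> n" for k using n(3)[OF that] by (simp add: vs_def)
  have sz1: "1 \<le> b1" using b1 by linarith
  have 1: "exb B read_input (tst T (%_. N)) (tst ?T ((%_. N)(0 := enc x)))"
   by (rule exb_exq[OF exq_read_input[of T x, OF T(1)] head_tst B(1)]) (use heads sz1 in auto)
  have 2: "exb B ci (tst ?T ((%_. N)(0 := enc x))) (tst ?T (?s 0))"
  proof -
   have "exs ci ((%_. N)(0 := enc x)) (poly pi (vs x)) (?s 0)"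
    using ci[of "(%_. N)(0 := enc x)" x] by simp
   thus ?thesis
   proof (rule exb_exs[OF _ heads(2,3)])
    show "sz (((%_. N)(0 := enc x)) r) \<le> b1" for r using vx b1 by (auto simp: vs_def)
    show "b1 + poly pi (vs x) \<le> B" using poly_nat_mono[OF vx, of pi] B(2) by linarith
   qed
  qed
  have test: "exb B test (tst ?T (?s k)) (tst ?T ((?s k)(1 := enc (go (?S k)))))" if k: "k \<le> n" for k
  proof -
   have "exs (ccopy 1 0) (?s k) (24 * (1 + Q) + 10) ((?s k)(1 := enc (?S k)))"
    using exs_copy[of 1 0 "?s k"] szS[OF k] by (auto elim: exs_weaken)
   hence "exb B (ccopy 1 0) (tst ?T (?s k)) (tst ?T ((?s k)(1 := enc (?S k))))"
    by (rule exb_exs[OF _ heads(2,3) _ B(3)]) (use szS[OF k] b1 in auto)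
   moreover have "exs cg ((?s k)(1 := enc (?S k))) (poly pg (vs (?S k))) ((?s k)(1 := enc (go (?S k))))"
    using cg[of "(?s k)(1 := enc (?S k))" "?S k"] by simp
   hence "exb B cg (tst ?T ((?s k)(1 := enc (?S k)))) (tst ?T ((?s k)(1 := enc (go (?S k)))))"
    by (rule exb_exs[OF _ heads(2,3) _ mono[OF B(4) k]]) (use szS[OF k] b1 in auto)
   ultimately show ?thesis unfolding test_def by (rule exb_Seq)
  qed
  have loop: "k \<le> n ==> exb B loop (tst ?T ((?s k)(1 := enc (go (?S k))))) (tst ?T (?s n))" for k
  proof (induction "n - k" arbitrary: k)
   case 0
   hence k: "k = n" by simp
   have eq: "(?s n)(1 := enc (go (?S n))) = ?s n" using n(1) by (auto simp: fun_eq_iff enc_bool_def boolD_def)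
   show ?case unfolding k eq loop_def
   proof (rule exb_WhF)
    show "rd (tst ?T (?s n)) (1 + 4) = 1" by (subst rd_tst) simp
    show "\<forall>r. \<bar>snd (tst ?T (?s n) r)\<bar> \<le> int B"
    proof
     fix r
     have "\<bar>snd (tst ?T (?s n) r)\<bar> \<le> int b1"
      by (rule head_tst[OF heads(2,3)]) (use szS[of n] b1 in auto)
     thus "\<bar>snd (tst ?T (?s n) r)\<bar> \<le> int B" using B(5) by linarith
    qed
   qed
  next
   case (Suc m)
   hence k: "k < n" by simp
   have g: "enc (go (?S k)) = C N N" using n(2)[OF k] by (simp add: enc_bool_def boolD_def)
   have eq: "((?s k)(1 := C N N))(1 := N) = ?s k" by (auto simp: fun_eq_iff)
   have "exs (cnil 1) ((?s k)(1 := C N N)) 15 (?s k)"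
    using exs_nil[of 1 "(?s k)(1 := C N N)"] unfolding eq by simp
   hence a: "exb B (cnil 1) (tst ?T ((?s k)(1 := C N N))) (tst ?T (?s k))"
    by (rule exb_exs[OF _ heads(2,3) _ B(5)]) (use szS[of k] k b1 in auto)
   have "exs cs (?s k) (poly ps (vs (?S k))) (?s (Suc k))"
    using cs[of "?s k" "?S k"] by simp
   hence b: "exb B cs (tst ?T (?s k)) (tst ?T (?s (Suc k)))"
    by (rule exb_exs[OF _ heads(2,3) _ mono[OF B(6)]]) (use szS[of k] k b1 in auto)
   have c: "exb B test (tst ?T (?s (Suc k))) (tst ?T ((?s (Suc k))(1 := enc (go (?S (Suc k))))))"
    by (rule test) (use k in simp)
   have d: "exb B loop (tst ?T ((?s (Suc k))(1 := enc (go (?S (Suc k)))))) (tst ?T (?s n))"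
    by (rule Suc.hyps(1)) (use Suc.hyps(2) k in simp_all)
   have "rd (tst ?T ((?s k)(1 := C N N))) (1 + 4) ~= 1" by (subst rd_tst) simp
   from exb_WhT[OF this exb_Seq[OF a exb_Seq[OF b c]] d[unfolded loop_def]]
   show ?case unfolding g loop_def .
  qed
  have "exs ca (?s n) (poly pa (vs (?S n))) ((%_. N)(0 := enc (acc (?S n))))"
   using ca[of "?s n" "?S n"] by simp
  hence 3: "exb B ca (tst ?T (?s n)) (tst ?T ((%_. N)(0 := enc (acc (?S n)))))"
   by (rule exb_exs[OF _ heads(2,3) _ mono[OF B(7)]]) (use szS[of n] b1 in auto)
  have "rd (tst ?T ((%_. N)(0 := enc (acc (?S n))))) (0 + 4) = 2 \<longleftrightarrow> x \<in> A"
   by (subst rd_tst) (use n(4) in \<open>simp add: enc_bool_def boolD_def\<close>)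
  thus ?thesis
   using exb_Seq[OF 1 exb_Seq[OF 2 exb_Seq[OF test[of 0] exb_Seq[OF loop[of 0] 3]]]]
   unfolding B_def by auto
 qed
 thus ?thesis by (rule program_decides)
qed

section \<open>Alternation and polynomial space\<close>

fun Qp :: "bool list => (bool list => bool) => bool" where
 "Qp [] P \<longleftrightarrow> P []"
| "Qp (e # qs) P \<longleftrightarrow> (if e then \<exists>b. Qp qs (%w. P (b # w)) else \<forall>b. Qp qs (%w. P (b # w)))"

type_synonym dfs_state = "bool list \<times> (bool \<times> bool) list \<times> bool list \<times> bool \<times> bool"

text \<open>Depth-first search through the tree of bit strings: the list of chosen quantifiers and bits,
 innermost first, the remaining quantifiers, and the value of the current subtree once known.\<close>

definition dfs_step :: "(bool list \<times> bool list => bool) => dfs_state => dfs_state" where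
 "dfs_step R s =
  (if \<not> fst (snd (snd (snd s))) then
    (if fst (snd (snd s)) = [] then
     (fst s, fst (snd s), [], True, R (fst s, rev (map snd (fst (snd s)))))
    else (fst s, (hd0 (fst (snd (snd s))), False) # fst (snd s), tl (fst (snd (snd s))), False, False))
   else
    (if snd (snd (snd (snd s))) = fst (hd0 (fst (snd s))) \<or> snd (hd0 (fst (snd s))) then
     (fst s, tl (fst (snd s)), fst (hd0 (fst (snd s))) # fst (snd (snd s)), True, snd (snd (snd (snd s))))
    else (fst s, (fst (hd0 (fst (snd s))), True) # tl (fst (snd s)), fst (snd (snd s)), False, False)))"

definition dfs_go :: "dfs_state => bool" where
 "dfs_go s \<longleftrightarrow> \<not> (fst (snd (snd (snd s))) & fst (snd s) = [])"

definition steps_via :: "('s => 's) => ('s => bool) => 's => 's => bool" where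
 "steps_via f P s s' \<longleftrightarrow> (\<exists>n. (f ^^ n) s = s' & (\<forall>k<n. P ((f ^^ k) s)))"

lemma steps_via_trans:
 assumes "steps_via f P s s'" "steps_via f P s' s''"
 shows "steps_via f P s s''"
proof -
 obtain n m where n: "(f ^^ n) s = s'" "\<forall>k<n. P ((f ^^ k) s)"
  and m: "(f ^^ m) s' = s''" "\<forall>k<m. P ((f ^^ k) s')"
  using assms unfolding steps_via_def by blast
 have "P ((f ^^ k) s)" if "k < m + n" for k
 proof (cases "k < n")
  case False
  have "(f ^^ (k - n + n)) s = (f ^^ (k - n)) s'" by (simp only: funpow_add comp_apply n(1))
  hence "(f ^^ k) s = (f ^^ (k - n)) s'" using False by simp
  thus ?thesis using m(2) that False by simp
 qed (use n in auto)
 thus ?thesis unfolding steps_via_def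
  by (intro exI[of _ "m + n"]) (simp add: funpow_add n(1) m(1))
qed

lemma steps_via_one: "P s ==> f s = s' ==> steps_via f P s s'"
 unfolding steps_via_def by (intro exI[of _ 1]) auto

lemma steps_via_mono: "steps_via f P s s' ==> (!!s. P s ==> P' s) ==> steps_via f P' s s'"
 unfolding steps_via_def by blast

text \<open>The constant total length bounds the size of the state. The last conjunct says that the
  search has not yet returned from the subtree at depth \<open>m\<close>; for \<open>m = 0\<close>
  it implies that the search has not stopped.\<close>

definition dfs_inv :: "bool list => nat => nat => dfs_state => bool" where
 "dfs_inv x l m s \<longleftrightarrow> fst s = x & length (fst (snd s)) + length (fst (snd (snd s))) = l &
   (fst (snd (snd (snd s))) --> m < length (fst (snd s)))"

lemma dfs_correct:
 "steps_via (dfs_step R) (dfs_inv x (length d + length qs) (length d)) (x, d, qs, False, v)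
   (x, d, qs, True, Qp qs (%w. R (x, rev (map snd d) @ w)))"
proof (induction qs arbitrary: d v)
 case Nil
 show ?case by (rule steps_via_one) (simp_all add: dfs_inv_def dfs_step_def)
next
 case (Cons e qs)
 let ?I = "dfs_inv x (length d + length (e # qs)) (length d)"
 let ?V = "%b. Qp qs (%w. R (x, rev (map snd d) @ b # w))"
 have branch: "steps_via (dfs_step R) ?I (x, (e, b) # d, qs, False, v) (x, (e, b) # d, qs, True, ?V b)" for b v
 proof -
  have "steps_via (dfs_step R) ?I (x, (e, b) # d, qs, False, v)
    (x, (e, b) # d, qs, True, Qp qs (%w. R (x, rev (map snd ((e, b) # d)) @ w)))"
   by (rule steps_via_mono[OF Cons.IH]) (auto simp: dfs_inv_def)
  thus ?thesis by simp
 qed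
 have down: "steps_via (dfs_step R) ?I (x, d, e # qs, False, v) (x, (e, False) # d, qs, False, False)"
  by (rule steps_via_one) (simp_all add: dfs_inv_def dfs_step_def)
 have up: "steps_via (dfs_step R) ?I (x, (e, b) # d, qs, True, u) (x, d, e # qs, True, u)" if "u = e \<or> b" for u b
  by (rule steps_via_one) (use that in \<open>auto simp: dfs_inv_def dfs_step_def\<close>)
 have flip: "steps_via (dfs_step R) ?I (x, (e, False) # d, qs, True, u) (x, (e, True) # d, qs, False, False)"
  if "u ~= e" for u
  by (rule steps_via_one) (use that in \<open>auto simp: dfs_inv_def dfs_step_def\<close>)
 \<comment> \<open>A first branch with value \<open>e\<close> decides the quantifier
   (\<open>True\<close> for an existential, \<open>False\<close> for a universal one); otherwise the
   value is that of the second branch.\<close>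
 have val: "Qp (e # qs) (%w. R (x, rev (map snd d) @ w)) = (if ?V False = e then ?V False else ?V True)"
  by (auto simp: ex_bool_eq all_bool_eq)
 note first = steps_via_trans[OF down branch[of False]]
 show ?case
 proof (cases "?V False = e")
  case True
  have "steps_via (dfs_step R) ?I (x, d, e # qs, False, v) (x, d, e # qs, True, ?V False)"
   by (rule steps_via_trans[OF first up]) (use True in simp)
  thus ?thesis unfolding val using True by simp
 next
  case False
  have "steps_via (dfs_step R) ?I (x, d, e # qs, False, v) (x, d, e # qs, True, ?V True)"
   by (rule steps_via_trans[OF first steps_via_trans[OF flip[OF False] steps_via_trans[OF branch[of True] up]]]) simp
  thus ?thesis unfolding val using False by simp
 qed
qed

theorem alternation_PSPACE:
 assumes qs: "fp qs" and R: "fp R" and A: "!!x. x \<in> A \<longleftrightarrow> Qp (qs x) (%w. R (x, w))"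
 shows "A \<in> PSPACE"
proof -
 let ?init = "%x. (x, [], qs x, False, False) :: dfs_state"
 obtain p where p: "!!x. vs (qs x) \<le> poly p (vs x)" using fp_bound[OF qs] by metis
 let ?h = "[:1, 4:] :: nat poly"
 let ?q = "?h + [:20:] * (p \<circ>\<^sub>p ?h) + [:50:]"
 show ?thesis
 proof (rule iteration_PSPACE[where init = ?init and step = "dfs_step R" and go = dfs_go
    and acc = "%s. snd (snd (snd (snd s)))"])
  show "fp ?init" by (intro fp_intros qs)
  show "fp (dfs_step R)" unfolding dfs_step_def by (intro fp_intros fp_comp[OF R])
  show "fp dfs_go" unfolding dfs_go_def by (intro fp_intros)
  show "fp (%s :: dfs_state. snd (snd (snd (snd s))))" by (intro fp_intros)
  fix x
  let ?fin = "(x, [], qs x, True, Qp (qs x) (%w. R (x, w)))"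
  obtain n where n: "(dfs_step R ^^ n) (?init x) = ?fin"
   "!!k. k < n ==> dfs_inv x (length (qs x)) 0 ((dfs_step R ^^ k) (?init x))"
   using dfs_correct[of R x "[]" "qs x" False] unfolding steps_via_def by auto
  have size: "vs s \<le> poly ?q (length x)"
   if "fst s = x" "length (fst (snd s)) + length (fst (snd (snd s))) = length (qs x)" for s :: dfs_state
  proof -
   obtain d q u v where s: "s = (x, d, q, u, v)" using \<open>fst s = x\<close> by (metis prod.collapse)
   have b: "vs (b :: bool) \<le> 3" for b by (rule vs_bool)
   have "vs (d :: (bool \<times> bool) list) \<le> 1 + length d * (7 + 1)"
   proof (rule vs_list_le)
    show "vs a \<le> 7" for a :: "bool \<times> bool"
     by (cases a) (use b[of "fst a"] b[of "snd a"] in simp)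
   qed
   moreover have "vs q \<le> 1 + length q * (3 + 1)" by (rule vs_list_le) (rule b)
   moreover have "vs x \<le> poly ?h (length x)" using vs_bits[of x] by simp
   moreover have "length (qs x) \<le> poly (p \<circ>\<^sub>p ?h) (length x)"
    using order_trans[OF vs_length order_trans[OF p poly_nat_mono[OF calculation(3)]]]
    by (simp add: poly_pcompose)
   ultimately have "vs s \<le> poly ?h (length x) + 8 * length (qs x) + 4 * length (qs x) + 15"
    using that(2) b[of u] b[of v] unfolding s by simp
   also have "\<dots> \<le> poly ?h (length x) + 20 * poly (p \<circ>\<^sub>p ?h) (length x) + 50"
    using \<open>length (qs x) \<le> poly (p \<circ>\<^sub>p ?h) (length x)\<close> by linarith
   also have "\<dots> = poly ?q (length x)" by simp
   finally show ?thesis .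
  qed
  have "vs ((dfs_step R ^^ k) (?init x)) \<le> poly ?q (length x)" if "k \<le> n" for k
  proof (cases "k = n")
   case True
   show ?thesis unfolding True n(1) by (rule size) simp_all
  next
   case False
   thus ?thesis using n(2)[of k] that by (intro size) (auto simp: dfs_inv_def)
  qed
  moreover have "dfs_go ((dfs_step R ^^ k) (?init x))" if "k < n" for k
   using n(2)[OF that] by (auto simp: dfs_inv_def dfs_go_def)
  moreover have "\<not> dfs_go ?fin" by (simp add: dfs_go_def)
  ultimately show "\<exists>n. \<not> dfs_go ((dfs_step R ^^ n) (?init x)) &
    (\<forall>k<n. dfs_go ((dfs_step R ^^ k) (?init x))) &
    (\<forall>k\<le>n. vs ((dfs_step R ^^ k) (?init x)) \<le> poly ?q (length x)) &
    snd (snd (snd (snd ((dfs_step R ^^ n) (?init x))))) = (x \<in> A)"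
   using n(1) A by (intro exI[of _ n]) auto
 qed
qed

section \<open>Subgame-perfect equilibria as consistent plays\<close>

definition fv :: "'v set => (nat => 'v) => enat" where
 "fv A \<pi> = (if \<exists>n. \<pi> n \<in> A then enat (LEAST n. \<pi> n \<in> A) else \<infinity>)"

lemma fv_le: "fv A \<pi> \<le> enat n \<longleftrightarrow> (\<exists>k\<le>n. \<pi> k \<in> A)"
proof (cases "\<exists>n. \<pi> n \<in> A")
 case True
 hence "\<pi> (LEAST n. \<pi> n \<in> A) \<in> A" by (rule LeastI_ex)
 thus ?thesis using True by (auto simp: fv_def intro: Least_le le_trans)
qed (auto simp: fv_def)

definition pay :: "enat => real" where
 "pay c = (case c of enat n => 1 / (1 + real n) | \<infinity> => 0)"

lemma reach_payoff_pay: "reach_payoff A \<pi> = pay (fv A \<pi>)"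
 by (simp add: reach_payoff_alt fv_def pay_def)

lemma pay_le_iff: "pay a \<le> pay b \<longleftrightarrow> b \<le> a"
proof -
 have "(0 :: real) < 1 / (1 + real n)" for n by simp
 moreover have "1 / (1 + real n) \<le> 1 / (1 + real m) \<longleftrightarrow> m \<le> n" for n m
  by (simp add: divide_simps)
 ultimately show ?thesis by (cases a; cases b) (simp_all add: pay_def not_le)
qed

lemma enat_diff_le: "x - enat a \<le> enat n \<longleftrightarrow> x \<le> enat (a + n)"
 by (cases x) auto

lemma enat_leI: "(!!n. b \<le> enat n ==> a \<le> enat n) ==> a \<le> b"
 by (cases b) auto

lemma enat_eqI: "(!!n. a \<le> enat n \<longleftrightarrow> b \<le> enat n) ==> a = b"
 by (rule antisym; rule enat_leI) blast+

lemma enat_diff_diff: "x - enat a - enat b = x - enat (a + b)"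
 by (cases x) auto

lemma enat_diff_mono: "x \<le> y ==> x - enat a \<le> y - enat a"
 by (cases x; cases y) auto

lemma set_conc_prefix: "set (h @ prefix (Suc n) \<pi>) = (h \<frown> \<pi>) ` {..length h + n}"
proof -
 have "h @ prefix (Suc n) \<pi> = prefix (length h + Suc n) (h \<frown> \<pi>)"
  by (intro nth_equalityI) (auto simp: subsequence_def nth_append)
 hence "set (h @ prefix (Suc n) \<pi>) = set (prefix (length h + Suc n) (h \<frown> \<pi>))" by (simp only:)
 also have "\<dots> = (h \<frown> \<pi>) ` {..length h + n}"
  unfolding subsequence_def set_map by (simp add: atLeast0LessThan lessThan_Suc_atMost del: upt_Suc)
 finally show ?thesis .
qed

lemma prefix_Suc: "prefix (Suc n) \<pi> = prefix n \<pi> @ [\<pi> n]"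
 by (simp add: subsequence_def)

lemma prefix_Suc_0: "prefix (Suc n) \<pi> = \<pi> 0 # prefix n (%k. \<pi> (Suc k))"
 by (simp add: subsequence_def upt_conv_Cons map_Suc_upt[symmetric] del: upt_Suc)

lemma prefix_add: "prefix (m + n) \<pi> = prefix m \<pi> @ prefix n (%k. \<pi> (m + k))"
 by (intro nth_equalityI) (auto simp: subsequence_def nth_append)

locale rgame =
 fixes G :: "('p, 'v) game" and T :: "'p => 'v set" and L :: 'p and M :: "('q, 'v) mealy"
 assumes qr: "quantitative_reachability_game G T" and L: "L \<in> players G" and M: "wf_mealy G L M"
begin

lemma wf: "wf_game G"
 using qr by (simp add: quantitative_reachability_game_def)

definition Tg :: "'v => 'p set" where
 "Tg v = {i \<in> players G. v \<in> T i}"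

definition ow :: "'v => 'p" where
 "ow v = (SOME i. i \<in> players G & v \<in> controlled G i)"

lemma ow: "v \<in> verts G ==> ow v \<in> players G & v \<in> controlled G (ow v)"
 unfolding ow_def by (rule someI_ex) (use wf in \<open>auto simp: wf_game_def\<close>)

lemma ow_eq: "i \<in> players G ==> v \<in> controlled G i ==> ow v = i"
proof -
 assume i: "i \<in> players G" "v \<in> controlled G i"
 hence "v \<in> verts G" using wf unfolding wf_game_def by blast
 note o = ow[OF this]
 have "\<forall>i\<in>players G. \<forall>j\<in>players G. i ~= j --> controlled G i \<inter> controlled G j = {}"
  using wf by (simp add: wf_game_def)
 thus ?thesis using i o by (metis disjoint_iff)
qed

lemma edge_verts: "(u, v) \<in> edges G ==> u \<in> verts G & v \<in> verts G"
proof -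
 have "edges G \<subseteq> verts G \<times> verts G" using wf by (simp add: wf_game_def)
 thus "(u, v) \<in> edges G ==> u \<in> verts G & v \<in> verts G" by blast
qed

text \<open>A node pairs a vertex with the Mealy state before this vertex is read. At vertices of
  other players the next state does not depend on the successor, and for this reason a deviation to
  \<open>w\<close> meets the same Mealy state as the prescribed move.\<close>

definition mv :: "'q \<times> 'v => 'q \<times> 'v => bool" where
 "mv s s' \<longleftrightarrow> (snd s, snd s') \<in> edges G &
   (fst s, snd s, fst s', if snd s \<in> controlled G L then Some (snd s') else None) \<in> mtrans M"

definition zero :: "('p => enat) => nat => 'p set" where
 "zero c n = {i \<in> players G. c i \<le> enat n}"

text \<open>The play \<open>snd \<circ> \<rho>\<close> reaches the target of \<open>i\<close> at time \<open>c i\<close>, or \<open>c i = 0\<close> if the target was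
 reached before. \<open>D s Z j k\<close> promises that there is an equilibrium continuation from \<open>s\<close> in which
 \<open>j\<close> needs at least \<open>k\<close> steps, where \<open>Z\<close> is the set of players whose targets have been reached.\<close>

definition cons :: "('q \<times> 'v => 'p set => 'p => enat => bool) => (nat => 'q \<times> 'v) => ('p => enat) => bool" where
 "cons D \<rho> c \<longleftrightarrow> (\<forall>n. mv (\<rho> n) (\<rho> (Suc n)) & zero c (Suc n) = zero c n \<union> Tg (snd (\<rho> (Suc n))) &
   (snd (\<rho> n) \<notin> controlled G L --> (\<forall>w. (snd (\<rho> n), w) \<in> edges G -->
    D (fst (\<rho> (Suc n)), w) (zero c n \<union> Tg w) (ow (snd (\<rho> n))) (c (ow (snd (\<rho> n))) - enat (Suc n)))))"

definition closed :: "('q \<times> 'v => 'p set => 'p => enat => bool) => bool" where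
 "closed D \<longleftrightarrow> (\<forall>s Z j k. D s Z j k --> (\<exists>\<rho> c. \<rho> 0 = s & zero c 0 = Z & k \<le> c j & cons D \<rho> c))"

definition vis :: "'v list => 'p set" where
 "vis h = {i \<in> players G. \<exists>u\<in>set h. u \<in> T i}"

lemma vis_simps [simp]: "vis [] = {}" "vis (w # h) = Tg w \<union> vis h" "vis (h @ h') = vis h \<union> vis h'"
 by (auto simp: vis_def Tg_def)

lemma vis_snoc: "vis (h @ [w]) = vis h \<union> Tg w"
 by simp

text \<open>Truncated subtraction makes the cost 0 if the target was visited in \<open>h\<close>
  already.\<close>

definition cost :: "'v list => (nat => 'v) => 'p => enat" where
 "cost h \<pi> i = fv (T i) (h \<frown> \<pi>) - enat (length h)"

lemma cost_le: "cost h \<pi> i \<le> enat n \<longleftrightarrow> (\<exists>u\<in>set (h @ prefix (Suc n) \<pi>). u \<in> T i)"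
 unfolding cost_def enat_diff_le fv_le set_conc_prefix by auto

lemma zero_cost: "zero (cost h \<pi>) n = vis (h @ prefix (Suc n) \<pi>)"
 unfolding zero_def vis_def by (simp add: cost_le)

text \<open>Profiles are prolonged from a history \<open>h\<close>, the last vertex of the history being the first of
 the play.\<close>

definition follows :: "('p => 'v list => 'v) => 'v list => 'v => (nat => 'v) => bool" where
 "follows \<sigma> h v \<pi> \<longleftrightarrow> play_from G v \<pi> & (\<forall>n. \<pi> (Suc n) = \<sigma> (ow (\<pi> n)) (h @ prefix (Suc n) \<pi>))"

lemma sub_simps [simp]:
 "players (subgame G h) = players G" "verts (subgame G h) = verts G" "controlled (subgame G h) = controlled G"
 "edges (subgame G h) = edges G" "wf_game (subgame G h) = wf_game G" "play (subgame G h) = play G"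
 "play_from (subgame G h) = play_from G" "history_from (subgame G h) = history_from G"
 "strategy (subgame G h) = strategy G" "profile (subgame G h) = profile G"
 by (simp_all add: subgame_def wf_game_def play_def play_from_def history_from_def strategy_def
   profile_def fun_eq_iff)

lemma history_append:
 assumes "history_from G v0 (h @ [v])" "history_from G v h'"
 shows "history_from G v0 (h @ h')"
proof -
 have h': "h' ~= []" "hd h' = v" "set h' \<subseteq> verts G" "successively (%u v. (u, v) \<in> edges G) h'"
  using assms(2) by (auto simp: history_from_def)
 thus ?thesis using assms(1)
  by (cases "h = []") (auto simp: history_from_def successively_append_iff)
qed

lemma profile_sub:
 assumes "profile G v0 \<sigma>" "history_from G v0 (h @ [v])"
 shows "profile G v (subprofile \<sigma> h)"
 using assms history_append[OF assms(2)]
 unfolding profile_def strategy_def subprofile_def by (metis append_assoc)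

lemma history_vert: "history_from G v0 (h @ [v]) ==> v \<in> verts G"
 by (simp add: history_from_def)

lemma outcome_follows:
 assumes "profile G v (subprofile \<sigma> h)" "v \<in> verts G"
 shows "follows \<sigma> h v (outcome (subgame G h) v (subprofile \<sigma> h))"
  and "follows \<sigma> h v \<pi> ==> outcome (subgame G h) v (subprofile \<sigma> h) = \<pi>"
proof -
 have eq: "play_from (subgame G h) v \<pi> & (\<forall>i\<in>players (subgame G h). compatible_play (subgame G h) i (subprofile \<sigma> h i) \<pi>)
  \<longleftrightarrow> follows \<sigma> h v \<pi>" for \<pi>
 proof (cases "play_from G v \<pi>")
  case True
  hence v: "\<pi> n \<in> verts G" for n by (simp add: play_from_def play_def)
  show ?thesis using True ow[OF v] ow_eq
   unfolding follows_def compatible_play_def subprofile_def by auto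
 qed (simp add: follows_def)
 have ex1: "\<exists>!\<pi>. follows \<sigma> h v \<pi>"
  using ex1_outcome[of "subgame G h" v "subprofile \<sigma> h"] assms wf unfolding eq by simp
 have out: "outcome (subgame G h) v (subprofile \<sigma> h) = (THE \<pi>. follows \<sigma> h v \<pi>)"
  unfolding outcome_def eq ..
 show "follows \<sigma> h v (outcome (subgame G h) v (subprofile \<sigma> h))"
  unfolding out by (rule theI'[OF ex1])
 show "follows \<sigma> h v \<pi> ==> outcome (subgame G h) v (subprofile \<sigma> h) = \<pi>"
  unfolding out by (rule the1_equality[OF ex1])
qed

lemma history_play:
 assumes "history_from G v0 (h @ [v])" "play_from G v \<pi>"
 shows "history_from G v0 (h @ prefix (Suc n) \<pi>)"
proof (induction n)
 case 0
 thus ?case using assms by (simp add: subsequence_def play_from_def)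
next
 case (Suc n)
 have "(\<pi> n, \<pi> (Suc n)) \<in> edges G" using assms by (simp add: play_from_def play_def)
 hence "history_from G (\<pi> n) [\<pi> n, \<pi> (Suc n)]" using edge_verts by (auto simp: history_from_def)
 from history_append[OF Suc[unfolded prefix_Suc[where n = n] append_assoc[symmetric]] this]
 show ?case by (simp add: prefix_Suc)
qed

lemma payoff_sub:
 assumes "i \<in> players G" "history_from G v0 (h @ [v])" "play_from G v \<pi>"
 shows "payoff (subgame G h) i \<pi> = pay (fv (T i) (h \<frown> \<pi>))"
proof -
 have "play G (h \<frown> \<pi>)" unfolding play_def
 proof
  fix n
  have "history_from G v0 (h @ prefix (Suc (Suc n)) \<pi>)" by (rule history_play[OF assms(2,3)])
  hence s: "successively (%u v. (u, v) \<in> edges G) (h @ prefix (Suc (Suc n)) \<pi>)"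
   by (simp add: history_from_def)
  have eq: "h @ prefix (Suc (Suc n)) \<pi> = prefix (length h + Suc (Suc n)) (h \<frown> \<pi>)"
   by (intro nth_equalityI) (auto simp: subsequence_def nth_append)
  have "((h \<frown> \<pi>) n, (h \<frown> \<pi>) (Suc n)) \<in> edges G"
   using s[unfolded eq successively_conv_nth, rule_format, of n]
   by (simp add: subsequence_def nth_append del: upt_Suc)
  thus "(h \<frown> \<pi>) n \<in> verts G & ((h \<frown> \<pi>) n, (h \<frown> \<pi>) (Suc n)) \<in> edges G"
   using edge_verts by blast
 qed
 thus ?thesis using qr assms(1)
  by (simp add: quantitative_reachability_game_def subgame_def reach_payoff_pay)
qed

lemma subprofile_Nil [simp]: "subprofile \<sigma> [] = \<sigma>"
 by (simp add: subprofile_def)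

lemma compatible_snoc:
 "compatible_history G i s (h @ [u, w]) \<longleftrightarrow>
   compatible_history G i s (h @ [u]) & (u \<in> controlled G i --> w = s (h @ [u]))"
proof -
 have split: "(\<forall>k. Suc k < Suc (Suc n) --> P k) \<longleftrightarrow> (\<forall>k. Suc k < Suc n --> P k) & P n" for n and P :: "nat => bool"
  by (auto simp: less_Suc_eq)
 have "(h @ [u, w]) ! k = (h @ [u]) ! k" "take (Suc k) (h @ [u, w]) = take (Suc k) (h @ [u])"
  if "k < Suc (length h)" for k
  using that by (auto simp: nth_append less_Suc_eq)
 thus ?thesis
  using split[of "length h" "%k. (h @ [u, w]) ! k \<in> controlled G i --> (h @ [u, w]) ! Suc k = s (take (Suc k) (h @ [u, w]))"]
  unfolding compatible_history_def
  by (auto simp: nth_append)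
qed

lemma compatible_play_history:
 assumes "compatible_history G i s (h @ [v])" "\<pi> 0 = v"
  "!!n. \<pi> n \<in> controlled G i ==> \<pi> (Suc n) = s (h @ prefix (Suc n) \<pi>)"
 shows "compatible_history G i s (h @ prefix (Suc n) \<pi>)"
proof (induction n)
 case 0
 thus ?case using assms by (simp add: subsequence_def)
next
 case (Suc n)
 thus ?case
  using compatible_snoc[of i s "h @ prefix n \<pi>" "\<pi> n" "\<pi> (Suc n)"] assms(3)[of n]
  by (simp add: prefix_Suc)
qed

text \<open>The promises are read off the subgames: \<open>D\<close> holds at a node reached by a
  history compatible with Leader, for every time that the outcome after this history does not
  undercut. Closedness follows from one-shot deviations alone.\<close>

lemma SPE_closed:
 assumes spe: "fixed_SPE G v0 L \<sigma>" and comp: "\<sigma> L \<in> Comp G v0 L M" and v0: "v0 \<in> verts G"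
 shows "\<exists>D \<rho> c. closed D & cons D \<rho> c & \<rho> 0 = (mstart M, v0) & zero c 0 = Tg v0 &
  pay (c L) = payoff G L (outcome G v0 \<sigma>)"
proof -
 have prof: "profile G v0 \<sigma>" using spe by (simp add: fixed_SPE_def)
 obtain st where st0: "st [] = mstart M"
  and st: "!!h v. history_from G v0 (h @ [v]) ==>
   (st h, v, st (h @ [v]), if v \<in> controlled G L then Some (\<sigma> L (h @ [v])) else None) \<in> mtrans M"
  using comp unfolding Comp_def by blast
 define good where "good h v \<longleftrightarrow> history_from G v0 (h @ [v]) & compatible_history G L (\<sigma> L) (h @ [v])" for h v
 define out where "out h v = outcome (subgame G h) v (subprofile \<sigma> h)" for h v
 have out: "follows \<sigma> h v (out h v)" and out_eq: "!!\<pi>. follows \<sigma> h v \<pi> ==> out h v = \<pi>" if "good h v" for h v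
  using outcome_follows[OF profile_sub[OF prof], of h v] that history_vert unfolding good_def out_def by blast+
 define D where "D s Z j k \<longleftrightarrow> (\<exists>h v. good h v & s = (st h, v) & Z = vis (h @ [v]) & k \<le> cost h (out h v) j)"
  for s Z j k
 have main: "cons D (%n. (st (h @ prefix n (out h v)), out h v n)) (cost h (out h v))" if g: "good h v" for h v
  unfolding cons_def
 proof (intro allI conjI impI)
  fix n
  define \<pi> where "\<pi> = out h v"
  define h1 where "h1 = h @ prefix n \<pi>"
  define u where "u = \<pi> n"
  have f: "follows \<sigma> h v \<pi>" unfolding \<pi>_def by (rule out[OF g])
  have pl: "play_from G v \<pi>" and pS: "!!n. \<pi> (Suc n) = \<sigma> (ow (\<pi> n)) (h @ prefix (Suc n) \<pi>)"
   using f by (auto simp: follows_def)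
  have pv: "\<pi> n \<in> verts G" and pe: "(\<pi> n, \<pi> (Suc n)) \<in> edges G" for n
   using pl by (auto simp: play_from_def play_def)
  have h1: "h1 @ [u] = h @ prefix (Suc n) \<pi>" by (simp add: h1_def u_def prefix_Suc)
  have hist: "history_from G v0 (h1 @ [u])" unfolding h1
   by (rule history_play[of v0 h v]) (use g pl in \<open>simp_all add: good_def\<close>)
  have compat: "compatible_history G L (\<sigma> L) (h1 @ [u])" unfolding h1
   using g pl pS ow_eq[OF L] by (intro compatible_play_history[of _ _ _ v]) (auto simp: good_def play_from_def)
  have g1: "good h1 u" using hist compat by (simp add: good_def)
  show "mv (st (h @ prefix n (out h v)), out h v n) (st (h @ prefix (Suc n) (out h v)), out h v (Suc n))"
   using st[OF hist] pe[of n] pS[of n] ow_eq[OF L, of u]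
   unfolding mv_def \<pi>_def[symmetric] h1_def[symmetric] h1[symmetric]
   by (auto simp: u_def h1_def prefix_Suc split: if_splits)
  show "zero (cost h (out h v)) (Suc n) = zero (cost h (out h v)) n \<union>
    Tg (snd (st (h @ prefix (Suc n) (out h v)), out h v (Suc n)))"
   unfolding zero_cost prefix_Suc[where n = "Suc n"] append_assoc[symmetric] vis_snoc by simp
  fix w assume nL: "snd (st (h @ prefix n (out h v)), out h v n) \<notin> controlled G L"
   and "(snd (st (h @ prefix n (out h v)), out h v n), w) \<in> edges G"
  hence uL: "u \<notin> controlled G L" and e: "(u, w) \<in> edges G" by (auto simp: u_def \<pi>_def)
  define j where "j = ow u"
  have j: "j \<in> players G" "u \<in> controlled G j" "j ~= L"
   using ow[of u] pv uL by (auto simp: j_def u_def)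
  have hist2: "history_from G v0 ((h1 @ [u]) @ [w])"
   using history_append[OF hist, of "[u, w]"] e edge_verts[OF e] by (auto simp: history_from_def)
  have g2: "good (h1 @ [u]) w"
   using hist2 compat uL compatible_snoc[of L "\<sigma> L" h1 u w] by (simp add: good_def)
  let ?\<pi>2 = "out (h1 @ [u]) w"
  have f2: "follows \<sigma> (h1 @ [u]) w ?\<pi>2" by (rule out[OF g2])
  \<comment> \<open>A one-shot deviation: \<open>w\<close> is chosen at \<open>u\<close>, and
    afterwards the original strategy is followed. Its outcome is \<open>u\<close> followed by the
    outcome of the subgame after \<open>w\<close>.\<close>
  define s where "s h' = (if h' = [u] then w else \<sigma> j (h1 @ h'))" for h'
  define \<sigma>' where "\<sigma>' = \<sigma>(j := (%h'. if h' = h1 @ [u] then w else \<sigma> j h'))"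
  have sub: "(subprofile \<sigma> h1)(j := s) = subprofile \<sigma>' h1"
   by (auto simp: subprofile_def \<sigma>'_def s_def fun_eq_iff)
  have prof1: "profile G u (subprofile \<sigma> h1)" by (rule profile_sub[OF prof hist])
  have s: "strategy G u j s"
   using prof1 j(1) e unfolding profile_def strategy_def s_def subprofile_def by auto
  have prof': "profile G u (subprofile \<sigma>' h1)"
   using prof1 s unfolding sub[symmetric] profile_def by simp
  have fd: "follows \<sigma>' h1 u (u ## ?\<pi>2)"
  proof -
   have pl2: "play_from G w ?\<pi>2" and pS2: "!!n. ?\<pi>2 (Suc n) = \<sigma> (ow (?\<pi>2 n)) ((h1 @ [u]) @ prefix (Suc n) ?\<pi>2)"
    using f2 by (auto simp: follows_def)
   have "play_from G u (u ## ?\<pi>2)"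
   proof -
    have "(u ## ?\<pi>2) n \<in> verts G & ((u ## ?\<pi>2) n, (u ## ?\<pi>2) (Suc n)) \<in> edges G" for n
     using pl2 e edge_verts[OF e] unfolding play_from_def play_def by (cases n) auto
    thus ?thesis by (simp add: play_from_def play_def)
   qed
   moreover have "(u ## ?\<pi>2) (Suc n) = \<sigma>' (ow ((u ## ?\<pi>2) n)) (h1 @ prefix (Suc n) (u ## ?\<pi>2))" for n
   proof (cases n)
    case 0
    thus ?thesis using pl2 by (simp add: \<sigma>'_def j_def subsequence_def play_from_def)
   next
    case (Suc m)
    have "prefix (Suc n) (u ## ?\<pi>2) = u # prefix (Suc m) ?\<pi>2"
     using prefix_Suc_0[where n = "Suc m" and \<pi> = "u ## ?\<pi>2"] Suc by (simp del: subseq_to_Suc)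
    thus ?thesis using pS2[of m] Suc by (auto simp: \<sigma>'_def prefix_Suc)
   qed
   ultimately show ?thesis by (simp add: follows_def)
  qed
  have f1: "follows \<sigma> h1 u (%k. \<pi> (n + k))"
  proof -
   have "h1 @ prefix (Suc k) (%k. \<pi> (n + k)) = h @ prefix (Suc (n + k)) \<pi>" for k
    using prefix_add[where m = n and n = "Suc k" and \<pi> = \<pi>] by (simp add: h1_def)
   thus ?thesis using pv pe pS unfolding follows_def play_from_def play_def
    by (simp add: u_def del: subseq_to_Suc)
  qed
  have ne: "fixed_NE (subgame G h1) u (L :: 'p) (subprofile \<sigma> h1)" if "True"
   using spe g1 unfolding fixed_SPE_def good_def by blast
  hence "payoff (subgame G h1) j (outcome (subgame G h1) u (subprofile \<sigma>' h1))
    \<le> payoff (subgame G h1) j (outcome (subgame G h1) u (subprofile \<sigma> h1))"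
   using j s unfolding fixed_NE_def sub[symmetric] by auto
  hence "payoff (subgame G h1) j (u ## ?\<pi>2) \<le> payoff (subgame G h1) j (%k. \<pi> (n + k))"
   using outcome_follows(2)[OF prof' _ fd] outcome_follows(2)[OF prof1 _ f1] pv by (simp add: u_def)
  hence "fv (T j) (h1 \<frown> (%k. \<pi> (n + k))) \<le> fv (T j) (h1 \<frown> (u ## ?\<pi>2))"
   using payoff_sub[OF j(1) hist] fd f1 by (auto simp: follows_def pay_le_iff)
  moreover have "h1 \<frown> (%k. \<pi> (n + k)) = h \<frown> \<pi>"
   by (auto simp: h1_def conc_def fun_eq_iff nth_append subsequence_def)
  moreover have "h1 \<frown> (u ## ?\<pi>2) = (h1 @ [u]) \<frown> ?\<pi>2" by simp
  ultimately have "fv (T j) (h \<frown> \<pi>) \<le> fv (T j) ((h1 @ [u]) \<frown> ?\<pi>2)" by metis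
  hence "cost h \<pi> j - enat (Suc n) \<le> cost (h1 @ [u]) ?\<pi>2 j"
   unfolding cost_def enat_diff_diff by (simp add: h1_def enat_diff_mono)
  hence "D (st (h1 @ [u]), w) (vis ((h1 @ [u]) @ [w])) j (cost h \<pi> j - enat (Suc n))"
   unfolding D_def using g2 by blast
  thus "D (fst (st (h @ prefix (Suc n) (out h v)), out h v (Suc n)), w)
   (zero (cost h (out h v)) n \<union> Tg w) (ow (snd (st (h @ prefix n (out h v)), out h v n)))
   (cost h (out h v) (ow (snd (st (h @ prefix n (out h v)), out h v n))) - enat (Suc n))"
   unfolding zero_cost vis_snoc h1 \<pi>_def[symmetric] by (simp add: j_def u_def)
 qed
 have start: "(%n. (st (h @ prefix n (out h v)), out h v n)) 0 = (st h, v)"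
  "zero (cost h (out h v)) 0 = vis (h @ [v])" if "good h v" for h v
  using out[OF that] by (auto simp: follows_def play_from_def subsequence_def zero_cost)
 have "closed D" unfolding closed_def
 proof (intro allI impI)
  fix s Z j k assume "D s Z j k"
  then obtain h v where "good h v" "s = (st h, v)" "Z = vis (h @ [v])" "k \<le> cost h (out h v) j"
   unfolding D_def by blast
  with start main show "\<exists>\<rho> c. \<rho> 0 = s & zero c 0 = Z & k \<le> c j & cons D \<rho> c" by metis
 qed
 moreover have g0: "good [] v0" using v0 by (simp add: good_def history_from_def compatible_history_def)
 moreover have "vis [v0] = Tg v0" by (simp add: vis_def Tg_def)
 moreover have "pay (cost [] (out [] v0) L) = payoff G L (outcome G v0 \<sigma>)"
 proof -
  have "play_from G v0 (out [] v0)" using out[OF g0] by (simp add: follows_def)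
  hence "payoff G L (out [] v0) = pay (fv (T L) (out [] v0))"
   using qr L by (simp add: quantitative_reachability_game_def play_from_def reach_payoff_pay)
  moreover have "out [] v0 = outcome G v0 \<sigma>" by (simp add: out_def subgame_def)
  ultimately show ?thesis by (simp add: cost_def flip: zero_enat_def)
 qed
 ultimately show ?thesis using main[OF g0] start[OF g0] st0
  by (intro exI[of _ D] exI[of _ "%n. (st ([] @ prefix n (out [] v0)), out [] v0 n)"] exI[of _ "cost [] (out [] v0)"]) simp
qed

lemma ex_mv:
 assumes "p \<in> mstates M" "u \<in> verts G"
 shows "\<exists>s'. mv (p, u) s'"
proof -
 have "\<forall>p\<in>mstates M. \<forall>u\<in>verts G. \<exists>q a. (p, u, q, a) \<in> mtrans M"
  using M by (simp add: wf_mealy_def)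
 then obtain q a where qa: "(p, u, q, a) \<in> mtrans M" using assms by blast
 have sub: "mtrans M \<subseteq>
    {(p, u, q, None) |p u q. p \<in> mstates M & u \<in> verts G - controlled G L & q \<in> mstates M} \<union>
    {(p, u, q, Some v) |p u q v. p \<in> mstates M & u \<in> controlled G L & q \<in> mstates M &
     v \<in> verts G & (u, v) \<in> edges G}"
  using M by (simp add: wf_mealy_def)
 show ?thesis
 proof (cases a)
  case None
  obtain w where "(u, w) \<in> edges G" using assms(2) wf by (auto simp: wf_game_def)
  moreover have "u \<notin> controlled G L" using subsetD[OF sub qa] None by auto
  ultimately show ?thesis using qa None by (intro exI[of _ "(q, w)"]) (simp add: mv_def)
 next
  case (Some w)
  hence "u \<in> controlled G L" "(u, w) \<in> edges G" using subsetD[OF sub qa] by auto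
  thus ?thesis using qa Some by (intro exI[of _ "(q, w)"]) (simp add: mv_def)
 qed
qed

lemma mv_state: "mv s s' ==> fst s' \<in> mstates M"
proof -
 have sub: "mtrans M \<subseteq>
    {(p, u, q, None) |p u q. p \<in> mstates M & u \<in> verts G - controlled G L & q \<in> mstates M} \<union>
    {(p, u, q, Some v) |p u q v. p \<in> mstates M & u \<in> controlled G L & q \<in> mstates M &
     v \<in> verts G & (u, v) \<in> edges G}"
  using M by (simp add: wf_mealy_def)
 show "mv s s' ==> fst s' \<in> mstates M" unfolding mv_def by (auto dest!: subsetD[OF sub])
qed

lemma cons_shift:
 assumes "cons D \<rho> c"
 shows "cons D (%n. \<rho> (Suc n)) (%i. c i - enat 1)"
proof -
 have z: "zero (%i. c i - enat 1) n = zero c (Suc n)" for n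
  by (simp add: zero_def enat_diff_le)
 show ?thesis unfolding cons_def z enat_diff_diff
  apply (intro allI)
  subgoal for n
   using spec[OF assms[unfolded cons_def], of "Suc n"] unfolding One_nat_def add_Suc add_0 .
  done
qed

text \<open>All players share one strategy \<open>\<sigma>0\<close> whose memory is a Mealy state
  and a current consistent play. A deviation of the owner of \<open>u\<close> switches to a play
  keeping the promise made for this deviation. If Leader leaves the current play, the memory becomes
  \<open>None\<close>: no equilibrium condition applies to such histories, but the moves must still
  respect the Mealy machine for \<open>Comp\<close>.\<close>

lemma closed_SPE:
 assumes D: "closed D" and \<rho>0: "cons D \<rho>0 c0" "\<rho>0 0 = (mstart M, v0)" "zero c0 0 = Tg v0" and v0: "v0 \<in> verts G"
 shows "\<exists>\<sigma>. fixed_SPE G v0 L \<sigma> & \<sigma> L \<in> Comp G v0 L M & payoff G L (outcome G v0 \<sigma>) = pay (c0 L)"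
proof -
 define nxt where "nxt x u = (case snd x of Some (\<rho>, c) => \<rho> 1 | None => (SOME s'. mv (fst x, u) s'))"
  for x :: "'q \<times> ((nat => 'q \<times> 'v) \<times> ('p => enat)) option" and u
 define rep where "rep s Z j k = (SOME (\<rho>, c). \<rho> 0 = s & zero c 0 = Z & k \<le> c j & cons D \<rho> c)" for s Z j k
 define upd where "upd x u w = (fst (nxt x u), case snd x of None => None | Some (\<rho>, c) =>
   if w = snd (\<rho> 1) then Some (%n. \<rho> (Suc n), %i. c i - enat 1)
   else if u \<in> controlled G L then None
   else Some (rep (fst (\<rho> 1), w) (zero c 0 \<union> Tg w) (ow u) (c (ow u) - enat 1)))" for x u w
 \<comment> \<open>The recursion runs over the reversed history: \<open>w\<close> is its last vertex
   and \<open>hd r\<close> the one before.\<close>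
 define S' where "S' = rec_list (mstart M, Some (\<rho>0, c0)) (%w r x. if r = [] then (mstart M, Some (\<rho>0, c0)) else upd x (hd r) w)"
 define S where "S h = S' (rev h)" for h
 have S1: "S [v] = (mstart M, Some (\<rho>0, c0))" for v by (simp add: S_def S'_def)
 have S2: "S (h @ [u, w]) = upd (S (h @ [u])) u w" for h u w by (simp add: S_def S'_def)
 define \<sigma>0 where "\<sigma>0 h = snd (nxt (S h) (last h))" for h
 define \<sigma> where "\<sigma> = (%i :: 'p. \<sigma>0)"
 define st where "st h = (if h = [] then mstart M else fst (nxt (S h) (last h)))" for h
 define inv where "inv h v \<longleftrightarrow> fst (S (h @ [v])) = st h & fst (S (h @ [v])) \<in> mstates M &
   (\<forall>\<rho> c. snd (S (h @ [v])) = Some (\<rho>, c) --> \<rho> 0 = (st h, v) & cons D \<rho> c & zero c 0 = vis (h @ [v])) &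
   mv (st h, v) (nxt (S (h @ [v])) v)" for h v
 have inv_mv: "mv (p, v) (nxt x v)" if "fst x = p" "p \<in> mstates M" "v \<in> verts G"
   "!!\<rho> c. snd x = Some (\<rho>, c) ==> \<rho> 0 = (p, v) & cons D \<rho> c" for p v x
 proof (cases "snd x")
  case None
  thus ?thesis using someI_ex[OF ex_mv[OF that(2,3)]] that(1) by (simp add: nxt_def)
 next
  case (Some y)
  obtain \<rho> c where y: "y = (\<rho>, c)" by force
  hence a: "\<rho> 0 = (p, v)" "cons D \<rho> c" using that(4) Some by auto
  have "mv (\<rho> 0) (\<rho> (Suc 0))" using a(2) unfolding cons_def by blast
  thus ?thesis using Some y by (simp add: nxt_def a(1))
 qed
 have inv: "history_from G v0 (h @ [v]) ==> inv h v" for h v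
 proof (induction h arbitrary: v rule: rev_induct)
  case Nil
  hence v: "v = v0" by (simp add: history_from_def)
  have "mstart M \<in> mstates M" using M by (simp add: wf_mealy_def)
  thus ?case unfolding inv_def v
   using \<rho>0 v0 S1[of v0] by (auto simp: st_def vis_def Tg_def intro!: inv_mv)
 next
  case (snoc u h)
  have hist: "history_from G v0 (h @ [u])" and e: "(u, v) \<in> edges G" and v: "v \<in> verts G"
   using snoc.prems by (auto simp: history_from_def successively_append_iff hd_append split: if_splits)
  have i: "inv h u" by (rule snoc.IH[OF hist])
  have st: "fst (S ((h @ [u]) @ [v])) = st (h @ [u])"
   using S2[of h u v] by (simp add: st_def upd_def)
  have ms: "st (h @ [u]) \<in> mstates M"
   using i mv_state unfolding inv_def by (fastforce simp: st_def)
  have o: "\<rho> 0 = (st (h @ [u]), v) & cons D \<rho> c & zero c 0 = vis ((h @ [u]) @ [v])"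
   if s: "snd (S ((h @ [u]) @ [v])) = Some (\<rho>, c)" for \<rho> c
  proof -
   obtain \<rho>' c' where s': "snd (S (h @ [u])) = Some (\<rho>', c')"
    using s S2[of h u v] by (auto simp: upd_def split: option.splits)
   have c': "\<rho>' 0 = (st h, u)" "cons D \<rho>' c'" "zero c' 0 = vis (h @ [u])" using i s' by (auto simp: inv_def)
   have st1: "st (h @ [u]) = fst (\<rho>' 1)" using s' by (simp add: st_def nxt_def)
   have cons0: "zero c' (Suc 0) = zero c' 0 \<union> Tg (snd (\<rho>' (Suc 0)))"
    "!!w. u \<notin> controlled G L ==> (u, w) \<in> edges G ==>
      D (fst (\<rho>' (Suc 0)), w) (zero c' 0 \<union> Tg w) (ow u) (c' (ow u) - enat (Suc 0))"
    using c'(2) c'(1) unfolding cons_def by (metis snd_conv)+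
   show ?thesis
   proof (cases "v = snd (\<rho>' 1)")
    case True
    hence "\<rho> = (%n. \<rho>' (Suc n))" "c = (%i. c' i - enat 1)"
     using s S2[of h u v] s' by (auto simp: upd_def)
    moreover have "zero (%i. c' i - enat 1) 0 = zero c' (Suc 0)" by (simp add: zero_def enat_diff_le)
    ultimately show ?thesis using cons_shift[OF c'(2)] cons0(1) c'(3) True st1
     by (simp add: prod_eq_iff Un_assoc)
   next
    case False
    hence uL: "u \<notin> controlled G L" and r: "(\<rho>, c) = rep (fst (\<rho>' 1), v) (zero c' 0 \<union> Tg v) (ow u) (c' (ow u) - enat 1)"
     using s S2[of h u v] s' by (auto simp: upd_def split: if_splits)
    have "\<exists>\<rho> c. \<rho> 0 = (fst (\<rho>' 1), v) & zero c 0 = zero c' 0 \<union> Tg v & c' (ow u) - enat 1 \<le> c (ow u) & cons D \<rho> c"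
     using cons0(2)[OF uL e] D unfolding closed_def by simp
    hence "case rep (fst (\<rho>' 1), v) (zero c' 0 \<union> Tg v) (ow u) (c' (ow u) - enat 1) of (\<rho>, c) =>
      \<rho> 0 = (fst (\<rho>' 1), v) & zero c 0 = zero c' 0 \<union> Tg v & c' (ow u) - enat 1 \<le> c (ow u) & cons D \<rho> c"
     unfolding rep_def by (intro someI_ex[of "%(\<rho>, c). _ \<rho> c"]) auto
    thus ?thesis unfolding r[symmetric] using st1 c'(3) by (simp add: Un_assoc)
   qed
  qed
  show ?case unfolding inv_def
   using st ms o v by (auto intro!: inv_mv)
 qed
 have \<sigma>_mv: "mv (st h, v) (st (h @ [v]), \<sigma> i (h @ [v]))" if "history_from G v0 (h @ [v])" for h v i
  using inv[OF that] by (simp add: inv_def st_def \<sigma>_def \<sigma>0_def)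
 have prof: "profile G v0 \<sigma>"
  unfolding profile_def strategy_def using \<sigma>_mv by (fastforce simp: mv_def)
 have comp: "\<sigma> L \<in> Comp G v0 L M"
 proof -
  have "strategy G v0 L (\<sigma> L)" using prof L by (simp add: profile_def)
  moreover have "(st h, v, st (h @ [v]), if v \<in> controlled G L then Some (\<sigma> L (h @ [v])) else None) \<in> mtrans M"
   if "history_from G v0 (h @ [v])" for h v
   using \<sigma>_mv[OF that, of L] by (simp add: mv_def split: if_splits)
  moreover have "st [] = mstart M" by (simp add: st_def)
  ultimately show ?thesis unfolding Comp_def by blast
 qed
 have S_compat: "snd (S (h @ [v])) ~= None"
  if "history_from G v0 (h @ [v])" "compatible_history G L (\<sigma> L) (h @ [v])" for h v
  using that
 proof (induction h arbitrary: v rule: rev_induct)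
  case Nil
  thus ?case using S1[of v] by simp
 next
  case (snoc u h)
  have hist: "history_from G v0 (h @ [u])"
   using snoc.prems by (auto simp: history_from_def successively_append_iff hd_append split: if_splits)
  have c: "compatible_history G L (\<sigma> L) (h @ [u])" "u \<in> controlled G L --> v = \<sigma> L (h @ [u])"
   using snoc.prems(2) compatible_snoc[of L "\<sigma> L" h u v] by auto
  obtain \<rho> c where "snd (S (h @ [u])) = Some (\<rho>, c)" using snoc.IH[OF hist c(1)] by auto
  thus ?case using S2[of h u v] c(2) by (auto simp: upd_def \<sigma>_def \<sigma>0_def nxt_def)
 qed
 have main: "follows \<sigma> h v (%n. snd (\<rho> n)) & (\<forall>i\<in>players G. cost h (%n. snd (\<rho> n)) i = c i)"
  if hist: "history_from G v0 (h @ [v])" and s: "snd (S (h @ [v])) = Some (\<rho>, c)" for h v \<rho> c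
 proof -
  let ?\<pi> = "%n. snd (\<rho> n)"
  have r: "\<rho> 0 = (st h, v)" "cons D \<rho> c" "zero c 0 = vis (h @ [v])"
   using inv[OF hist] s by (auto simp: inv_def)
  have mv: "mv (\<rho> n) (\<rho> (Suc n))" and z: "zero c (Suc n) = zero c n \<union> Tg (snd (\<rho> (Suc n)))" for n
   using r(2) by (auto simp: cons_def)
  have pl: "play_from G v ?\<pi>" using mv r(1) edge_verts unfolding play_from_def play_def
   by (fastforce simp: mv_def)
  have "snd (S (h @ prefix (Suc n) ?\<pi>)) = Some (%k. \<rho> (n + k), %i. c i - enat n)" for n
  proof (induction n)
   case 0
   thus ?case using s r(1) by (simp add: subsequence_def flip: zero_enat_def)
  next
   case (Suc n)
   have "h @ prefix (Suc (Suc n)) ?\<pi> = (h @ prefix n ?\<pi>) @ [?\<pi> n, ?\<pi> (Suc n)]" by (simp add: prefix_Suc)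
   moreover have "h @ prefix (Suc n) ?\<pi> = (h @ prefix n ?\<pi>) @ [?\<pi> n]" by (simp add: prefix_Suc)
   ultimately show ?case using Suc S2[of "h @ prefix n ?\<pi>" "?\<pi> n" "?\<pi> (Suc n)"]
    by (simp add: upd_def enat_diff_diff del: subseq_to_Suc)
  qed
  hence "\<sigma> i (h @ prefix (Suc n) ?\<pi>) = ?\<pi> (Suc n)" for i n
   by (simp add: \<sigma>_def \<sigma>0_def nxt_def del: subseq_to_Suc)
  hence f: "follows \<sigma> h v ?\<pi>" using pl by (simp add: follows_def)
  have "zero c n = vis (h @ prefix (Suc n) ?\<pi>)" for n
  proof (induction n)
   case 0
   thus ?case using r by (simp add: subsequence_def)
  next
   case (Suc n)
   thus ?case using z[of n] by (simp add: prefix_Suc[where n = "Suc n"] flip: append_assoc del: subseq_to_Suc)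
  qed
  hence "zero c n = zero (cost h ?\<pi>) n" for n by (simp add: zero_cost)
  hence "\<forall>i\<in>players G. cost h ?\<pi> i = c i" by (auto intro!: enat_eqI simp: zero_def set_eq_iff)
  with f show ?thesis by simp
 qed
 have "fixed_NE (subgame G h) v L (subprofile \<sigma> h)"
  if hist: "history_from G v0 (h @ [v])" and compat: "compatible_history G L (\<sigma> L) (h @ [v])" for h v
  unfolding fixed_NE_def
 proof (intro conjI ballI allI impI)
  show "profile (subgame G h) v (subprofile \<sigma> h)" using profile_sub[OF prof hist] by simp
  fix i s assume "i \<in> players (subgame G h) - {L}" and "strategy (subgame G h) v i s"
  hence i: "i \<in> players G" "i ~= L" and s: "strategy G v i s" by auto
  obtain \<rho> c where \<rho>: "snd (S (h @ [v])) = Some (\<rho>, c)" using S_compat[OF hist compat] by auto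
  let ?\<pi> = "%n. snd (\<rho> n)"
  note m = main[OF hist \<rho>]
  define \<sigma>' where "\<sigma>' = \<sigma>(i := (%h'. s (drop (length h) h')))"
  have sub: "(subprofile \<sigma> h)(i := s) = subprofile \<sigma>' h"
   by (auto simp: subprofile_def \<sigma>'_def fun_eq_iff)
  have prof': "profile G v (subprofile \<sigma>' h)"
   using profile_sub[OF prof hist] s unfolding sub[symmetric] profile_def by simp
  have vv: "v \<in> verts G" by (rule history_vert[OF hist])
  define \<pi>' where "\<pi>' = outcome (subgame G h) v (subprofile \<sigma>' h)"
  have f': "follows \<sigma>' h v \<pi>'" unfolding \<pi>'_def by (rule outcome_follows(1)[OF prof' vv])
  have pl': "play_from G v \<pi>'" using f' by (simp add: follows_def)
  have pS': "ow (\<pi>' n) ~= i ==> \<pi>' (Suc n) = \<sigma>0 (h @ prefix (Suc n) \<pi>')" for n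
   using f' by (simp add: follows_def \<sigma>'_def \<sigma>_def)
  \<comment> \<open>Along a play on which \<open>i\<close> deviates repeatedly, the current promise
    to \<open>i\<close> never drops below the original arrival time minus the elapsed time.\<close>
  have "\<exists>\<rho>' c'. snd (S (h @ prefix (Suc n) \<pi>')) = Some (\<rho>', c') & c i - enat n \<le> c' i" for n
  proof (induction n)
   case 0
   thus ?case using \<rho> pl' by (simp add: play_from_def subsequence_def flip: zero_enat_def)
  next
   case (Suc n)
   then obtain \<rho>' c' where c': "snd (S (h @ prefix (Suc n) \<pi>')) = Some (\<rho>', c')" "c i - enat n \<le> c' i" by blast
   let ?h = "h @ prefix n \<pi>'" and ?u = "\<pi>' n" and ?w = "\<pi>' (Suc n)"
   have h: "h @ prefix (Suc n) \<pi>' = ?h @ [?u]" "h @ prefix (Suc (Suc n)) \<pi>' = ?h @ [?u, ?w]"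
    by (simp_all add: prefix_Suc)
   have hist1: "history_from G v0 (?h @ [?u])" "history_from G v0 ((?h @ [?u]) @ [?w])"
    using history_play[OF hist pl', of n] history_play[OF hist pl', of "Suc n"] unfolding h by simp_all
   have e: "(?u, ?w) \<in> edges G" using pl' by (simp add: play_from_def play_def)
   have sc': "snd (S (?h @ [?u])) = Some (\<rho>', c')" using c'(1) unfolding h .
   have le: "c i - enat (Suc n) \<le> c' i - enat 1"
    using enat_diff_mono[OF c'(2), of 1] by (simp add: enat_diff_diff)
   show ?case
   proof (cases "?w = snd (\<rho>' 1)")
    case True
    hence "snd (S (?h @ [?u, ?w])) = Some (%n. \<rho>' (Suc n), %i. c' i - enat 1)"
     using S2[of ?h ?u ?w] sc' by (simp add: upd_def)
    thus ?thesis using le unfolding h by blast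
   next
    case False
    have "\<sigma>0 (?h @ [?u]) = snd (\<rho>' 1)" using sc' by (simp add: \<sigma>0_def nxt_def)
    hence "ow ?u = i" using False pS'[of n] unfolding h by auto
    hence uL: "?u \<notin> controlled G L" using i ow_eq[OF L] by auto
    let ?r = "rep (fst (\<rho>' 1), ?w) (zero c' 0 \<union> Tg ?w) i (c' i - enat 1)"
    have r: "snd (S (?h @ [?u, ?w])) = Some ?r"
     using S2[of ?h ?u ?w] sc' False uL \<open>ow ?u = i\<close> by (simp add: upd_def)
    have r': "\<rho>' 0 = (st ?h, ?u)" "cons D \<rho>' c'" using inv[OF hist1(1)] sc' by (auto simp: inv_def)
    hence "D (fst (\<rho>' (Suc 0)), ?w) (zero c' 0 \<union> Tg ?w) (ow ?u) (c' (ow ?u) - enat (Suc 0))"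
     using uL e unfolding cons_def by (metis snd_conv)
    hence "\<exists>\<rho> c. \<rho> 0 = (fst (\<rho>' 1), ?w) & zero c 0 = zero c' 0 \<union> Tg ?w & c' i - enat 1 \<le> c i & cons D \<rho> c"
     using D \<open>ow ?u = i\<close> unfolding closed_def by simp
    hence "case ?r of (\<rho>, c) => \<rho> 0 = (fst (\<rho>' 1), ?w) & zero c 0 = zero c' 0 \<union> Tg ?w & c' i - enat 1 \<le> c i & cons D \<rho> c"
     unfolding rep_def by (intro someI_ex[of "%(\<rho>, c). _ \<rho> c"]) auto
    thus ?thesis using r le unfolding h by (cases ?r) (auto intro: order_trans)
   qed
  qed
  note dev = this
  have "fv (T i) (h \<frown> ?\<pi>) \<le> fv (T i) (h \<frown> \<pi>')"
  proof (rule enat_leI)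
   fix m assume m': "fv (T i) (h \<frown> \<pi>') \<le> enat m"
   show "fv (T i) (h \<frown> ?\<pi>) \<le> enat m"
   proof (cases "m < length h")
    case True
    obtain k where k: "k \<le> m" "(h \<frown> \<pi>') k \<in> T i" using m' unfolding fv_le by blast
    hence "(h \<frown> ?\<pi>) k \<in> T i" using True by (simp add: conc_def)
    thus ?thesis using k(1) unfolding fv_le by blast
   next
    case False
    define n where "n = m - length h"
    have mn: "m = length h + n" using False by (simp add: n_def)
    obtain \<rho>' c' where c': "snd (S (h @ prefix (Suc n) \<pi>')) = Some (\<rho>', c')" "c i - enat n \<le> c' i"
     using dev by blast
    have hn: "h @ prefix (Suc n) \<pi>' = (h @ prefix n \<pi>') @ [\<pi>' n]" by (simp add: prefix_Suc)
    have "cost h \<pi>' i \<le> enat n" using m' unfolding cost_def enat_diff_le mn .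
    hence "i \<in> zero (cost h \<pi>') n" using i by (simp add: zero_def)
    hence "i \<in> vis ((h @ prefix n \<pi>') @ [\<pi>' n])" unfolding zero_cost hn .
    moreover have "zero c' 0 = vis ((h @ prefix n \<pi>') @ [\<pi>' n])"
     using inv[OF history_play[OF hist pl', of n, unfolded hn]] c'(1) unfolding hn by (simp add: inv_def)
    ultimately have "c' i \<le> enat 0" by (auto simp: zero_def)
    hence "c i - enat n \<le> enat 0" using c'(2) by (rule order_trans[rotated])
    hence "cost h ?\<pi> i \<le> enat n" using m i unfolding enat_diff_le by simp
    thus ?thesis unfolding cost_def enat_diff_le mn .
   qed
  qed
  thus "payoff (subgame G h) i (outcome (subgame G h) v ((subprofile \<sigma> h)(i := s)))
    \<le> payoff (subgame G h) i (outcome (subgame G h) v (subprofile \<sigma> h))"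
   using outcome_follows(2)[OF profile_sub[OF prof hist] vv, of ?\<pi>] m
    payoff_sub[OF i(1) hist pl'] payoff_sub[OF i(1) hist, of ?\<pi>]
   unfolding sub \<pi>'_def[symmetric] by (simp add: follows_def pay_le_iff)
 qed
 hence spe: "fixed_SPE G v0 L \<sigma>" using prof by (simp add: fixed_SPE_def)
 have h0: "history_from G v0 ([] @ [v0])" using v0 by (simp add: history_from_def)
 have m0: "follows \<sigma> [] v0 (%n. snd (\<rho>0 n)) & (\<forall>i\<in>players G. cost [] (%n. snd (\<rho>0 n)) i = c0 i)"
  by (rule main[OF h0]) (simp add: S1)
 have "outcome G v0 \<sigma> = (%n. snd (\<rho>0 n))"
  using outcome_follows(2)[of v0 \<sigma> "[]"] m0 prof v0 by (simp add: subgame_def)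
 moreover have "payoff (subgame G []) L (%n. snd (\<rho>0 n)) = pay (fv (T L) ([] \<frown> (%n. snd (\<rho>0 n))))"
  by (rule payoff_sub[OF L h0]) (use m0 in \<open>simp add: follows_def\<close>)
 moreover have "cost [] (%n. snd (\<rho>0 n)) L = fv (T L) (%n. snd (\<rho>0 n))"
  by (simp add: cost_def flip: zero_enat_def)
 ultimately have "payoff G L (outcome G v0 \<sigma>) = pay (c0 L)"
  using m0 L by (simp add: subgame_def)
 with spe comp show ?thesis by blast
qed

theorem SPE_iff_closed:
 assumes "v0 \<in> verts G"
 shows "(\<exists>\<sigma>. fixed_SPE G v0 L \<sigma> & \<sigma> L \<in> Comp G v0 L M & payoff G L (outcome G v0 \<sigma>) \<le> t) \<longleftrightarrow>
  (\<exists>D \<rho> c. closed D & cons D \<rho> c & \<rho> 0 = (mstart M, v0) & zero c 0 = Tg v0 & pay (c L) \<le> t)"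
 using SPE_closed[OF _ _ assms] closed_SPE[OF _ _ _ _ assms] by metis

end

section \<open>Bounding the promised times\<close>

context rgame
begin

definition stepc :: "('q \<times> 'v => 'p set => 'p => enat => bool) => (nat => 'q \<times> 'v) => ('p => enat) => nat => bool" where
 "stepc D \<rho> c n \<longleftrightarrow> mv (\<rho> n) (\<rho> (Suc n)) & zero c (Suc n) = zero c n \<union> Tg (snd (\<rho> (Suc n))) &
   (snd (\<rho> n) \<notin> controlled G L --> (\<forall>w. (snd (\<rho> n), w) \<in> edges G -->
    D (fst (\<rho> (Suc n)), w) (zero c n \<union> Tg w) (ow (snd (\<rho> n))) (c (ow (snd (\<rho> n))) - enat (Suc n))))"

lemma cons_stepc: "cons D \<rho> c \<longleftrightarrow> (\<forall>n. stepc D \<rho> c n)"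
 unfolding cons_def stepc_def ..

lemma stepc_mono: "stepc D \<rho> c n ==> (!!s Z j k. D s Z j k ==> E s Z j k) ==> stepc E \<rho> c n"
 unfolding stepc_def by blast

lemma cons_mono: "cons D \<rho> c ==> (!!s Z j k. D s Z j k ==> E s Z j k) ==> cons E \<rho> c"
 unfolding cons_stepc using stepc_mono by blast

text \<open>The greatest closed relation: closed relations are preserved under unions.\<close>

definition Dm :: "'q \<times> 'v => 'p set => 'p => enat => bool" where
 "Dm s Z j k \<longleftrightarrow> (\<exists>D. closed D & D s Z j k)"

lemma closed_Dm: "closed Dm"
 unfolding closed_def
proof (intro allI impI)
 fix s Z j k assume "Dm s Z j k"
 then obtain D where D: "closed D" "D s Z j k" unfolding Dm_def by blast
 then obtain \<rho> c where r: "\<rho> 0 = s" "zero c 0 = Z" "k \<le> c j" "cons D \<rho> c" unfolding closed_def by blast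
 have "cons Dm \<rho> c" by (rule cons_mono[OF r(4)]) (use D(1) in \<open>auto simp: Dm_def\<close>)
 with r show "\<exists>\<rho> c. \<rho> 0 = s & zero c 0 = Z & k \<le> c j & cons Dm \<rho> c" by blast
qed

lemma Dm_unfold: "Dm s Z j k ==> \<exists>\<rho> c. \<rho> 0 = s & zero c 0 = Z & k \<le> c j & cons Dm \<rho> c"
 using closed_Dm unfolding closed_def by blast

lemma Dm_intro: "closed D ==> D s Z j k ==> Dm s Z j k"
 unfolding Dm_def by blast

text \<open>Coinduction: \<open>Dm\<close> together with all plays that are consistent with respect
  to \<open>Dm\<close> is closed.\<close>

lemma Dm_fold:
 assumes "cons Dm \<rho> c" "k \<le> c j"
 shows "Dm (\<rho> 0) (zero c 0) j k"
proof (rule Dm_intro)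
 let ?E = "%s Z j k. Dm s Z j k \<or> (\<exists>\<rho> c. cons Dm \<rho> c & s = \<rho> 0 & Z = zero c 0 & k \<le> c j)"
 show "?E (\<rho> 0) (zero c 0) j k" using assms by blast
 show "closed ?E" unfolding closed_def
 proof (intro allI impI)
  fix s Z j k assume "?E s Z j k"
  then obtain \<rho> c where r: "\<rho> 0 = s" "zero c 0 = Z" "k \<le> c j" "cons Dm \<rho> c"
   using Dm_unfold by metis
  have "cons ?E \<rho> c" by (rule cons_mono[OF r(4)]) blast
  with r show "\<exists>\<rho> c. \<rho> 0 = s & zero c 0 = Z & k \<le> c j & cons ?E \<rho> c" by blast
 qed
qed

lemma Dm_down: "Dm s Z j k ==> k' \<le> k ==> Dm s Z j k'"
 using Dm_unfold[of s Z j k] Dm_fold order_trans by metis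

definition nodes :: "('q \<times> 'v) set" where
 "nodes = mstates M \<times> verts G"

lemma finite_nodes: "finite nodes" and finite_players: "finite (players G)"
 using wf M by (auto simp: nodes_def wf_game_def wf_mealy_def)

lemma mv_nodes: "mv s s' ==> snd s \<in> verts G & s' \<in> nodes"
proof -
 assume mv: "mv s s'"
 hence "(snd s, snd s') \<in> edges G" by (simp add: mv_def)
 thus ?thesis using mv_state[OF mv] edge_verts by (simp add: nodes_def mem_Times_iff)
qed

lemma ow_mv: "mv s s' ==> ow (snd s) \<in> players G"
 using mv_nodes ow by blast

lemma zero_const:
 assumes "!!i. i \<in> players G ==> c i \<le> enat a \<or> c i = \<infinity>" "a \<le> n"
 shows "zero c n = zero c a"
 using assms by (fastforce simp: zero_def intro: order_trans)

text \<open>From time \<open>a\<close> on all finite arrivals are over, so every remaining time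
  \<open>c j - (n + 1)\<close> is 0 or infinite and the set of reached players is constant. The
  obligations then depend only on the position within the loop, and the loop may be
  repeated.\<close>

lemma lasso:
 assumes ab: "a < b" "\<rho> a = \<rho> b" and st: "!!n. n < b ==> stepc E \<rho> c n"
  and c: "!!i. i \<in> players G ==> c i \<le> enat a \<or> c i = \<infinity>"
 shows "\<exists>\<rho>'. \<rho>' 0 = \<rho> 0 & cons E \<rho>' c"
proof -
 define f where "f n = (if n < b then n else a + (n - a) mod (b - a))" for n
 define \<rho>' where "\<rho>' n = \<rho> (f n)" for n
 have fb: "f n < b" for n
 proof -
  have "(n - a) mod (b - a) < b - a" using ab(1) by simp
  thus ?thesis using ab(1) by (simp add: f_def less_diff_conv add.commute)
 qed
 have fa: "a \<le> f n" if "b \<le> n" for n using that by (simp add: f_def)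
 have S: "\<rho> (f (Suc n)) = \<rho> (Suc (f n))" for n
 proof (cases "n < b")
  case True
  thus ?thesis using ab by (cases "Suc n = b") (auto simp: f_def)
 next
  case False
  hence n: "Suc n - a = Suc (n - a)" "\<not> n < b" using ab by auto
  show ?thesis
  proof (cases "Suc ((n - a) mod (b - a)) = b - a")
   case True
   hence "Suc (a + (n - a) mod (b - a)) = b" using ab(1) by linarith
   thus ?thesis using ab n True by (simp add: f_def mod_Suc)
  qed (use ab n in \<open>simp add: f_def mod_Suc\<close>)
 qed
 have z: "zero c n = zero c (f n)" "zero c (Suc n) = zero c (Suc (f n))" for n
  using zero_const[of c a n, OF c] zero_const[of c a "f n", OF c] zero_const[of c a "Suc n", OF c]
   zero_const[of c a "Suc (f n)", OF c]
   fa[of n] ab(1) by (cases "n < b"; simp add: f_def)+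
 have "stepc E \<rho>' c n" for n
 proof -
  have st': "stepc E \<rho> c (f n)" by (rule st[OF fb])
  define j where "j = ow (snd (\<rho> (f n)))"
  have "j \<in> players G" using st' ow_mv unfolding stepc_def j_def by blast
  have cj: "c j - enat (Suc n) = c j - enat (Suc (f n))"
  proof (cases "n < b")
   case False
   have "c j \<le> enat a \<or> c j = \<infinity>" by (rule c) fact
   thus ?thesis using fa[of n] False ab(1) by (cases "c j") auto
  qed (simp add: f_def)
  show ?thesis using st' unfolding stepc_def \<rho>'_def S z[of n, symmetric] j_def[symmetric] cj .
 qed
 thus ?thesis using ab by (intro exI[of _ \<rho>']) (simp add: cons_stepc \<rho>'_def f_def)
qed

lemma repeated_node:
 assumes "!!n. n \<le> a + card nodes ==> a \<le> n ==> \<rho> n \<in> nodes"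
 shows "\<exists>a' b. a \<le> a' & a' < b & b \<le> a + card nodes & \<rho> a' = \<rho> b"
proof -
 have "\<not> inj_on \<rho> {a..a + card nodes}"
 proof
  assume "inj_on \<rho> {a..a + card nodes}"
  hence "card {a..a + card nodes} \<le> card nodes"
   using assms by (intro card_inj_on_le[OF _ _ finite_nodes]) auto
  thus False by simp
 qed
 then obtain x y where "x \<in> {a..a + card nodes}" "y \<in> {a..a + card nodes}" "\<rho> x = \<rho> y" "x ~= y"
  unfolding inj_on_def by blast
 thus ?thesis by (cases x y rule: linorder_cases) (auto 4 3)
qed

text \<open>In a window that no player reaches and that is far from the next arrivals, a repeated node
 allows to loop forever: players arriving later are then promised infinity.\<close>

lemma window:
 assumes D: "cons D \<rho> c" "\<rho> 0 \<in> nodes"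
  and DE: "!!s Z j k. D s Z j k ==> E s Z j k"
  and big: "!!s Z j k. s \<in> nodes ==> j \<in> players G ==> zero c 0 \<subseteq> Z ==> Z \<subseteq> players G ==> D s Z j k ==>
   enat \<theta> \<le> k ==> E s Z j \<infinity>"
 obtains a \<rho>' where "a \<le> card (players G) * (card nodes + \<theta>)" "\<rho>' 0 = \<rho> 0"
  "cons E \<rho>' (%i. if c i \<le> enat a then c i else \<infinity>)"
proof -
 let ?N = "card nodes" and ?P = "card (players G)"
 \<comment> \<open>A starting time is bad for \<open>i\<close> if \<open>i\<close> arrives within
   the \<open>card nodes + \<theta>\<close> steps after it. Each player spoils at most that many
   times, so a good \<open>a\<close> exists up to the product with the number of players.\<close>
 define bad where "bad i = {x. x < the_enat (c i) & the_enat (c i) \<le> x + ?N + \<theta>}" for i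
 have card_bad: "finite (bad i) & card (bad i) \<le> ?N + \<theta>" for i
 proof -
  have sub: "bad i \<subseteq> {the_enat (c i) - (?N + \<theta>)..<the_enat (c i)}" by (auto simp: bad_def)
  hence "card (bad i) \<le> card {the_enat (c i) - (?N + \<theta>)..<the_enat (c i)}" by (intro card_mono) auto
  thus ?thesis using finite_subset[OF sub] by simp
 qed
 have "card (\<Union>i\<in>players G. bad i) \<le> (\<Sum>i\<in>players G. card (bad i))"
  by (rule card_UN_le[OF finite_players])
 also have "\<dots> \<le> ?P * (?N + \<theta>)" using sum_bounded_above[of "players G" "%i. card (bad i)" "?N + \<theta>"] card_bad by simp
 finally have "\<not> {..?P * (?N + \<theta>)} \<subseteq> (\<Union>i\<in>players G. bad i)"
  using card_mono[of "\<Union>i\<in>players G. bad i" "{..?P * (?N + \<theta>)}"] card_bad finite_players by fastforce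
 then obtain a where a: "a \<le> ?P * (?N + \<theta>)" "!!i. i \<in> players G ==> a \<notin> bad i" by auto
 have far: "c i \<le> enat a \<or> enat (a + ?N + \<theta>) < c i" if "i \<in> players G" for i
  using a(2)[OF that] by (cases "c i") (auto simp: bad_def)
 let ?c = "%i. if c i \<le> enat a then c i else \<infinity>"
 have mv: "mv (\<rho> n) (\<rho> (Suc n))" and z: "zero c (Suc n) = zero c n \<union> Tg (snd (\<rho> (Suc n)))" for n
  using D(1) by (auto simp: cons_def)
 have nodes: "\<rho> n \<in> nodes" for n using D(2) mv_nodes[OF mv] by (cases n) auto
 obtain a' b where ab: "a \<le> a'" "a' < b" "b \<le> a + ?N" "\<rho> a' = \<rho> b"
  using repeated_node[of a \<rho>] nodes by blast
 \<comment> \<open>No arrival falls into the window, so raising the later ones to infinity does not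
   change who has arrived within it.\<close>
 have zc: "zero ?c n = zero c n" if "n \<le> a + ?N" for n
 proof -
  have "?c i \<le> enat n \<longleftrightarrow> c i \<le> enat n" if i: "i \<in> players G" for i
   using far[OF i] \<open>n \<le> a + ?N\<close> by (cases "c i") auto
  thus ?thesis unfolding zero_def by (intro Collect_cong) blast
 qed
 have zmono: "zero c 0 \<subseteq> zero c n" for n by (auto simp: zero_def zero_enat_def[symmetric])
 have "\<exists>\<rho>'. \<rho>' 0 = \<rho> 0 & cons E \<rho>' ?c"
 proof (rule lasso[OF ab(2,4)])
  fix n assume n: "n < b"
  have st: "stepc D \<rho> c n" using D(1) by (simp add: cons_stepc)
  show "stepc E \<rho> ?c n" unfolding stepc_def
  proof (intro conjI allI impI)
   show "mv (\<rho> n) (\<rho> (Suc n))" by (rule mv)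
   show "zero ?c (Suc n) = zero ?c n \<union> Tg (snd (\<rho> (Suc n)))" using z zc n ab by simp
   fix w assume u: "snd (\<rho> n) \<notin> controlled G L" and e: "(snd (\<rho> n), w) \<in> edges G"
   let ?j = "ow (snd (\<rho> n))"
   have j: "?j \<in> players G" by (rule ow_mv[OF mv])
   have d: "D (fst (\<rho> (Suc n)), w) (zero c n \<union> Tg w) ?j (c ?j - enat (Suc n))"
    using st u e unfolding stepc_def by blast
   have "E (fst (\<rho> (Suc n)), w) (zero c n \<union> Tg w) ?j (?c ?j - enat (Suc n))"
   proof (cases "c ?j \<le> enat a")
    case True
    thus ?thesis using DE[OF d] by simp
   next
    case False
    hence "enat (a + ?N + \<theta>) < c ?j" using far[OF j] by blast
    hence "enat \<theta> \<le> c ?j - enat (Suc n)" using n ab by (cases "c ?j") auto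
    moreover have "(fst (\<rho> (Suc n)), w) \<in> nodes"
     using nodes[of "Suc n"] edge_verts[OF e] by (simp add: nodes_def mem_Times_iff)
    moreover have "zero c n \<union> Tg w \<subseteq> players G" by (auto simp: zero_def Tg_def)
    ultimately have "E (fst (\<rho> (Suc n)), w) (zero c n \<union> Tg w) ?j \<infinity>"
     using zmono[of n] by (intro big[OF _ j _ _ d]) auto
    thus ?thesis using False by simp
   qed
   thus "E (fst (\<rho> (Suc n)), w) (zero ?c n \<union> Tg w) ?j (?c ?j - enat (Suc n))"
    using zc[of n] n ab by simp
  qed
 qed (use ab in \<open>auto intro: order_trans\<close>)
 thus thesis using a(1) that by blast
qed

text \<open>Chosen such that
  \<open>card (players G) * (card nodes + \<theta>) < Kb * \<theta>\<close> for all
  \<open>\<theta> \<ge> 1\<close>: the length of a window with margin \<open>\<theta>\<close> stays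
  below the next threshold.\<close>

definition Kb :: nat where
 "Kb = 2 + card (players G) * (card nodes + 1)"

text \<open>One factor \<open>Kb\<close> for each pair of a node and a player, and this for each
  possible number of players that have not yet arrived, from 0 to all.\<close>

definition Bd :: nat where
 "Bd = Kb ^ (Suc (card (players G)) * (card nodes * card (players G)))"

text \<open>Induction on the number of missing players. For the fixed set \<open>Z\<close> a gap
  between two consecutive thresholds is found. All pairs above the gap can be promised infinity at
  once: a play with arrival time above the upper threshold is cut by \<open>window\<close> to one
  with infinite arrival, and the promises demanded after its deviations are again above the lower
  threshold for the same \<open>Z\<close>, or concern a larger set, where the induction hypothesis
  applies.\<close>

lemma bound_region:
 "Z \<subseteq> players G ==> card (players G - Z) < l ==> s \<in> nodes ==> j \<in> players G ==> Dm s Z j k ==>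
  enat (Kb ^ (l * (card nodes * card (players G)))) \<le> k ==> Dm s Z j \<infinity>"
proof (induction l arbitrary: Z s j k)
 case (Suc l)
 let ?NP = "card nodes * card (players G)"
 define \<theta> where "\<theta> r = Kb ^ (l * ?NP + r)" for r
 have \<theta>1: "1 \<le> \<theta> r" for r by (simp add: \<theta>_def Kb_def)
 have \<theta>mono: "r \<le> r' ==> \<theta> r \<le> \<theta> r'" for r r'
  unfolding \<theta>_def by (rule power_increasing) (auto simp: Kb_def)
 have \<theta>S: "card (players G) * (card nodes + \<theta> r) < \<theta> (Suc r)" for r
 proof -
  have "card nodes + \<theta> r \<le> (card nodes + 1) * \<theta> r" using \<theta>1[of r] by (simp add: algebra_simps)
  hence "card (players G) * (card nodes + \<theta> r) \<le> card (players G) * ((card nodes + 1) * \<theta> r)"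
   by (rule mult_le_mono2)
  also have "\<dots> < Kb * \<theta> r" using \<theta>1[of r] by (simp add: Kb_def algebra_simps)
  finally show ?thesis by (simp add: \<theta>_def)
 qed
 \<comment> \<open>Pigeonhole: if every level lost a pair, these pairs would be distinct, because
   promises are closed downwards, and there are more levels than pairs.\<close>
 have "\<exists>r\<le>?NP. \<forall>s\<in>nodes. \<forall>j\<in>players G. Dm s Z j (enat (\<theta> r)) --> Dm s Z j (enat (\<theta> (Suc r)))"
 proof (rule ccontr)
  assume "\<not> ?thesis"
  hence "\<forall>r. \<exists>x. r \<le> ?NP --> x \<in> nodes \<times> players G & Dm (fst x) Z (snd x) (enat (\<theta> r)) & \<not> Dm (fst x) Z (snd x) (enat (\<theta> (Suc r)))"
   by (metis SigmaI fst_conv snd_conv)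
  then obtain x where x: "!!r. r \<le> ?NP ==> x r \<in> nodes \<times> players G"
   "!!r. r \<le> ?NP ==> Dm (fst (x r)) Z (snd (x r)) (enat (\<theta> r))"
   "!!r. r \<le> ?NP ==> \<not> Dm (fst (x r)) Z (snd (x r)) (enat (\<theta> (Suc r)))"
   by metis
  have ne: "x r ~= x r'" if "r < r'" "r' \<le> ?NP" for r r'
  proof
   assume "x r = x r'"
   hence "Dm (fst (x r)) Z (snd (x r)) (enat (\<theta> r'))" using x(2)[OF that(2)] by simp
   hence "Dm (fst (x r)) Z (snd (x r)) (enat (\<theta> (Suc r)))"
    by (rule Dm_down) (use \<theta>mono[of "Suc r" r'] that in simp)
   thus False using x(3)[of r] that by simp
  qed
  have "inj_on x {..?NP}"
   by (rule linorder_inj_onI) (use ne in auto)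
  moreover have "x ` {..?NP} \<subseteq> nodes \<times> players G" using x(1) by (intro image_subsetI) simp
  ultimately have "card {..?NP} \<le> card (nodes \<times> players G)"
   using finite_nodes finite_players by (intro card_inj_on_le[of x]) auto
  thus False by (simp add: card_cartesian_product)
 qed
 then obtain r where r: "r \<le> ?NP"
  "!!s j. s \<in> nodes ==> j \<in> players G ==> Dm s Z j (enat (\<theta> r)) ==> Dm s Z j (enat (\<theta> (Suc r)))" by blast
 \<comment> \<open>The candidate for coinduction grants every time, infinity included, to all pairs
   above the lower threshold.\<close>
 define E where "E s' Z' j' k' \<longleftrightarrow> Dm s' Z' j' k' \<or> Z' = Z & s' \<in> nodes & j' \<in> players G & Dm s' Z j' (enat (\<theta> r))"
  for s' Z' j' and k' :: enat
 have "closed E" unfolding closed_def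
 proof (intro allI impI)
  fix s Z' j k assume e: "E s Z' j k"
  show "\<exists>\<rho> c. \<rho> 0 = s & zero c 0 = Z' & k \<le> c j & cons E \<rho> c"
  proof (cases "Dm s Z' j k")
   case True
   then obtain \<rho> c where "\<rho> 0 = s" "zero c 0 = Z'" "k \<le> c j" "cons Dm \<rho> c" using Dm_unfold by blast
   moreover from this(4) have "cons E \<rho> c" by (rule cons_mono) (simp add: E_def)
   ultimately show ?thesis by blast
  next
   case False
   hence z: "Z' = Z" "s \<in> nodes" "j \<in> players G" "Dm s Z j (enat (\<theta> (Suc r)))"
    using e r(2) by (auto simp: E_def)
   then obtain \<rho> c where \<rho>: "\<rho> 0 = s" "zero c 0 = Z" "enat (\<theta> (Suc r)) \<le> c j" "cons Dm \<rho> c"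
    using Dm_unfold by blast
   obtain a \<rho>' where a: "a \<le> card (players G) * (card nodes + \<theta> r)" "\<rho>' 0 = \<rho> 0"
    "cons E \<rho>' (%i. if c i \<le> enat a then c i else \<infinity>)"
   proof (rule window[OF \<rho>(4), of E "\<theta> r"])
    show "\<rho> 0 \<in> nodes" using \<rho> z by simp
    show "E s Z j k" if "Dm s Z j k" for s Z j k using that by (simp add: E_def)
    fix s Z2 j k assume b: "s \<in> nodes" "j \<in> players G" "zero c 0 \<subseteq> Z2" "Z2 \<subseteq> players G" "Dm s Z2 j k" "enat (\<theta> r) \<le> k"
    show "E s Z2 j \<infinity>"
    proof (cases "Z2 = Z")
     case True
     thus ?thesis using b Dm_down by (auto simp: E_def)
    next
     case False
     hence "players G - Z2 \<subset> players G - Z" using b \<rho>(2) by blast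
     hence "card (players G - Z2) < card (players G - Z)"
      using finite_players by (intro psubset_card_mono) auto
     hence "card (players G - Z2) < l" using Suc.prems(2) by simp
     moreover have "enat (Kb ^ (l * ?NP)) \<le> k"
      using \<theta>mono[of 0 r] b(6) by (auto simp: \<theta>_def intro: order_trans[rotated])
     ultimately show ?thesis using Suc.IH[OF b(4) _ b(1,2,5)] by (simp add: E_def)
    qed
   qed blast
   \<comment> \<open>The window starts before the upper threshold and hence before \<open>j\<close>
     arrives, so the arrival of \<open>j\<close> is among those raised to infinity.\<close>
   have "\<not> c j \<le> enat a" using \<rho>(3) \<theta>S[of r] a(1) by (cases "c j") auto
   moreover have "zero (%i. if c i \<le> enat a then c i else \<infinity>) 0 = zero c 0"
    by (auto simp: zero_def intro: order_trans split: if_splits)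
   ultimately show ?thesis using a(2,3) \<rho> z
    by (intro exI[of _ \<rho>'] exI[of _ "%i. if c i \<le> enat a then c i else \<infinity>"]) simp
  qed
 qed
 moreover have "enat (\<theta> r) \<le> k"
  using Suc.prems(6) \<theta>mono[OF r(1)] by (auto simp: \<theta>_def ac_simps intro: order_trans[rotated])
 hence "E s Z j \<infinity>" using Suc.prems(3-5) Dm_down by (auto simp: E_def)
 ultimately show ?case by (rule Dm_intro)
qed simp

text \<open>The latest start of a window with margin \<open>Bd\<close>; arrivals after it can be
  postponed forever.\<close>

definition Cb :: nat where
 "Cb = card (players G) * (card nodes + Bd)"

lemma Dm_infinity:
 assumes "Z \<subseteq> players G" "s \<in> nodes" "j \<in> players G" "Dm s Z j k" "enat Bd \<le> k"
 shows "Dm s Z j \<infinity>"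
proof -
 have "card (players G - Z) < Suc (card (players G))"
  using finite_players by (simp add: card_mono less_Suc_eq_le)
 from bound_region[OF assms(1) this assms(2-4)] assms(5) show ?thesis by (simp add: Bd_def)
qed

text \<open>A \<open>window\<close> with margin \<open>Bd\<close> whose promises remain in
  \<open>Dm\<close>, since \<open>Dm\<close> from \<open>Bd\<close> on extends to infinity.\<close>

lemma cons_bounded:
 assumes "cons Dm \<rho> c" "\<rho> 0 \<in> nodes"
 obtains \<rho>' c' where "\<rho>' 0 = \<rho> 0" "zero c' 0 = zero c 0" "cons Dm \<rho>' c'" "!!i. c i \<le> c' i"
  "!!i. c' i = \<infinity> \<or> c' i \<le> enat Cb"
proof -
 obtain a \<rho>' where a: "a \<le> Cb" "\<rho>' 0 = \<rho> 0" "cons Dm \<rho>' (%i. if c i \<le> enat a then c i else \<infinity>)"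
  by (rule window[OF assms, of Dm Bd]) (use Dm_infinity in \<open>auto simp: Cb_def\<close>)
 show thesis
 proof (rule that[OF a(2) _ a(3)])
  show "zero (%i. if c i \<le> enat a then c i else \<infinity>) 0 = zero c 0"
   by (auto simp: zero_def intro: order_trans split: if_splits)
  show "(if c i \<le> enat a then c i else \<infinity>) = \<infinity> \<or> (if c i \<le> enat a then c i else \<infinity>) \<le> enat Cb" for i
   using a(1) by (auto intro: order_trans)
 qed simp
qed

text \<open>The best promise to a deviator. The maximum exists because finite promises that do not
  extend to infinity stay below \<open>Bd\<close>.\<close>

definition promise :: "'p set => (('q \<times> 'v) \<times> 'p) => enat option" where
 "promise Z x = (if Dm (fst x) Z (snd x) 0
   then Some (if Dm (fst x) Z (snd x) \<infinity> then \<infinity> else enat (GREATEST n. Dm (fst x) Z (snd x) (enat n))) else None)"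

lemma promise_le:
 assumes "Z \<subseteq> players G" "s \<in> nodes" "j \<in> players G" "Dm s Z j k"
 shows "\<exists>k'. promise Z (s, j) = Some k' & k \<le> k'"
proof -
 have 0: "Dm s Z j 0" by (rule Dm_down[OF assms(4)]) simp
 show ?thesis
 proof (cases "Dm s Z j \<infinity>")
  case False
  have b: "n \<le> Bd" if "Dm s Z j (enat n)" for n
   using Dm_infinity[OF assms(1-3) that] False by (cases "n \<le> Bd") auto
  obtain n where n: "k = enat n" using assms(4) False by (cases k) auto
  have "n \<le> (GREATEST n. Dm s Z j (enat n))"
   by (rule Greatest_le_nat[of "%n. Dm s Z j (enat n)" n Bd]) (use b assms(4) n in auto)
  thus ?thesis using 0 False n by (simp add: promise_def)
 qed (use 0 in \<open>simp add: promise_def\<close>)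
qed

lemma promise_Dm:
 assumes "Z \<subseteq> players G" "s \<in> nodes" "j \<in> players G" "promise Z (s, j) = Some k"
 shows "Dm s Z j k"
proof (cases "Dm s Z j \<infinity>")
 case False
 have b: "n \<le> Bd" if "Dm s Z j (enat n)" for n
  using Dm_infinity[OF assms(1-3) that] False by (cases "n \<le> Bd") auto
 have "Dm s Z j (enat 0)" using assms(4) by (auto simp: promise_def zero_enat_def split: if_splits)
 from GreatestI_nat[of "%n. Dm s Z j (enat n)", OF this] b
 show ?thesis using assms(4) False by (auto simp: promise_def split: if_splits)
qed (use assms(4) in \<open>auto simp: promise_def split: if_splits\<close>)

end

section \<open>Binary numbers and decoding\<close>

primrec bval :: "bool list => nat" where
 "bval [] = 0" | "bval (b # l) = of_bool b + 2 * bval l"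

lemma bval_append: "bval (a @ b) = bval a + 2 ^ length a * bval b"
 by (induction a) (auto simp: algebra_simps)

lemma bval_less: "bval l < 2 ^ length l"
 by (induction l) auto

lemma ex_bval: "n < 2 ^ k ==> \<exists>l. length l = k & bval l = n"
proof (induction k arbitrary: n)
 case (Suc k)
 hence "n div 2 < 2 ^ k" by auto
 then obtain l where "length l = k" "bval l = n div 2" using Suc.IH[of "n div 2"] by blast
 thus ?case by (intro exI[of _ "odd n # l"]) (auto simp: of_bool_def)
qed simp

definition pad_zip :: "bool list => bool list => (bool \<times> bool) list" where
 "pad_zip a b = map (%i. (lk a i, lk b i)) [0..<length a + length b]"

lemma fp_pad_zip [fp_intros]: "fp f ==> fp g ==> fp (%x. pad_zip (f x) (g x))"
 unfolding pad_zip_def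
 by (intro fp_intros fp_comp[of f fst] fp_comp[of g fst])

lemma lk_beyond: "length a \<le> i ==> lk a i = False"
 by (simp add: lk_def hd0_def dec_bool_def)

lemma lk_bval: "bval (map (lk a) [0..<length a + k]) = bval a"
proof -
 have eq: "map (lk a) [0..<length a + k] = a @ replicate k False"
 proof (rule nth_equalityI)
  fix i assume "i < length (map (lk a) [0..<length a + k])"
  thus "map (lk a) [0..<length a + k] ! i = (a @ replicate k False) ! i"
   by (cases "i < length a") (auto simp: nth_append lk_beyond)
 qed simp
 have "bval (replicate k False) = 0" for k by (induction k) auto
 thus ?thesis unfolding eq by (simp add: bval_append)
qed

text \<open>The bits are scanned from the least significant one, and a later difference overrides
  the comparison so far.\<close>

definition ble :: "bool list => bool list => bool" where
 "ble a b = fold (%p acc. if fst p = snd p then acc else snd p) (pad_zip a b) True"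

lemma fold_cmp:
 "fold (%p acc. if fst p = snd p then acc else snd p) l acc \<longleftrightarrow>
  bval (map fst l) < bval (map snd l) \<or> bval (map fst l) = bval (map snd l) & acc"
proof (induction l arbitrary: acc)
 case (Cons p l)
 show ?case
  unfolding fold.simps o_apply Cons.IH list.map bval.simps by (cases "fst p"; cases "snd p"; simp; linarith)
qed simp

lemma pad_zip_bval: "bval (map fst (pad_zip a b)) = bval a" "bval (map snd (pad_zip a b)) = bval b"
proof -
 have "map fst (pad_zip a b) = map (lk a) [0..<length a + length b]"
  "map snd (pad_zip a b) = map (lk b) [0..<length b + length a]"
  by (simp_all add: pad_zip_def comp_def add.commute)
 thus "bval (map fst (pad_zip a b)) = bval a" "bval (map snd (pad_zip a b)) = bval b"
  using lk_bval by metis+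
qed

lemma ble: "ble a b \<longleftrightarrow> bval a \<le> bval b"
 by (auto simp: ble_def fold_cmp pad_zip_bval)

lemma fp_ble [fp_intros]: "fp f ==> fp g ==> fp (%x. ble (f x) (g x))"
 unfolding ble_def
proof (rule fp_fold[where g = "%_. 3"])
 assume "fp f" "fp g"
 thus "fp (%x. pad_zip (f x) (g x))" by (intro fp_intros)
qed (intro fp_intros bnd_intros vs_bool)+

definition badd :: "bool list => bool list => bool list" where
 "badd a b = (let r = fold (%p acc. (if fst p = snd p then fst p else fst acc, ((fst p ~= snd p) ~= fst acc) # snd acc))
   (pad_zip a b) (False, []) in rev (snd r) @ [fst r])"

lemma fold_add:
 "r = fold (%p acc. (if fst p = snd p then fst p else fst acc, ((fst p ~= snd p) ~= fst acc) # snd acc)) l (c, out) ==>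
  length (snd r) = length out + length l &
  bval (rev (snd r) @ [fst r]) = bval (rev out) + 2 ^ length out * (bval (map fst l) + bval (map snd l) + of_bool c)"
proof (induction l arbitrary: c out)
 case (Cons p l)
 show ?case
  using Cons.IH[of "if fst p = snd p then fst p else c" "((fst p ~= snd p) ~= c) # out"] Cons.prems
  by (cases p; cases c) (auto simp: bval_append algebra_simps of_bool_def)
qed (simp add: bval_append)

lemma bval_badd: "bval (badd a b) = bval a + bval b"
 using fold_add[OF HOL.refl, of "pad_zip a b" False "[]"] by (simp add: badd_def Let_def pad_zip_bval)

lemma length_badd: "length (badd a b) = length a + length b + 1"
 using fold_add[OF HOL.refl, of "pad_zip a b" False "[]"] by (simp add: badd_def Let_def pad_zip_def)

lemma fp_badd [fp_intros]:
 assumes "fp f" "fp g" shows "fp (%x. badd (f x) (g x))"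
proof -
 have b: "vs (b :: bool) \<le> 3" for b by (rule vs_bool)
 have "fp (%x. fold (%p acc. (if fst p = snd p then fst p else fst acc, ((fst p ~= snd p) ~= fst acc) # snd acc))
   (pad_zip (f x) (g x)) (False, []))"
 proof (rule fp_fold_add[where g = "%_. 7"])
  show "vs (if fst p = snd p then fst p else fst acc, ((fst p ~= snd p) ~= fst acc) # snd acc) \<le> vs acc + 7"
   for p :: "bool \<times> bool" and acc :: "bool \<times> bool list"
   using b[of "if fst p = snd p then fst p else fst acc"] b[of "(fst p ~= snd p) ~= fst acc"] vs_pos[of "fst acc"]
   by (cases acc) (simp del: vs_pos)
 qed (intro fp_intros bnd_intros assms fp_const)+
 thus ?thesis unfolding badd_def Let_def by (intro fp_intros)
qed

definition bmul :: "bool list => bool list => bool list" where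
 "bmul a b = fold (%d acc. badd (False # acc) (if d then a else [])) (rev b) []"

lemma bval_bmul: "bval (bmul a b) = bval a * bval b"
proof -
 have "bval (fold (%d acc. badd (False # acc) (if d then a else [])) (rev b) acc) = bval a * bval b + 2 ^ length b * bval acc" for acc
  by (induction b arbitrary: acc) (auto simp: bval_badd algebra_simps)
 thus ?thesis by (simp add: bmul_def)
qed

lemma fp_bmul [fp_intros]:
 assumes "fp f" "fp g" shows "fp (%x. bmul (f x) (g x))"
 unfolding bmul_def
proof (rule fp_fold[where g = "%x. 1 + 4 * (vs (g x) * (vs (f x) + 2))"])
 show "fp (%y. badd (False # snd (snd y)) (if fst (snd y) then f (fst y) else []))"
  by (intro fp_intros fp_comp[OF assms(1)])
 fix x i
 have len: "length (fold (%d acc. badd (False # acc) (if d then a else [])) l acc) \<le> length acc + length l * (length a + 2)"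
  for a l and acc :: "bool list"
 proof (induction l arbitrary: acc)
  case (Cons d l)
  show ?case
   using Cons.IH[of "badd (False # acc) (if d then a else [])"] by (auto simp: length_badd split: if_splits)
 qed simp
 have "vs (l :: bool list) \<le> 1 + length l * (3 + 1)" for l by (rule vs_list_le) (rule vs_bool)
 from this[of "fold (%d acc. badd (False # acc) (if d then f x else [])) (take i (rev (g x))) []"]
 have "vs (fold (%d acc. badd (False # acc) (if d then f x else [])) (take i (rev (g x))) []) \<le>
   1 + 4 * (length (take i (rev (g x))) * (length (f x) + 2))"
  using len[of "f x" "take i (rev (g x))" "[]"] by simp
 also have "length (take i (rev (g x))) * (length (f x) + 2) \<le> vs (g x) * (vs (f x) + 2)"
  using vs_length[of "g x"] vs_length[of "f x"] by (intro mult_le_mono) auto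
 finally show "vs (fold (%d acc. badd (False # acc) (if d then f x else [])) (take i (rev (g x))) []) \<le>
   1 + 4 * (vs (g x) * (vs (f x) + 2))" by simp
qed (intro fp_intros bnd_intros assms)+

definition binc :: "bool list => bool list" where
 "binc l = (let r = fold (%b acc. (fst acc & b, (b ~= fst acc) # snd acc)) l (True, []) in
   rev (snd r) @ (if fst r then [True] else []))"

lemma binc_simps: "binc [] = [True]" "binc (True # l) = False # binc l" "binc (False # l) = True # l"
proof -
 have f: "snd (fold (%b acc. (fst acc & b, (b ~= fst acc) # snd acc)) l (c, out)) =
   snd (fold (%b acc. (fst acc & b, (b ~= fst acc) # snd acc)) l (c, [])) @ out"
  "fst (fold (%b acc. (fst acc & b, (b ~= fst acc) # snd acc)) l (c, out)) =
   fst (fold (%b acc. (fst acc & b, (b ~= fst acc) # snd acc)) l (c, []))" for l c out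
 proof (induction l arbitrary: c out)
  case (Cons b l)
  {
   case 1
   show ?case using Cons(1)[of "c & b" "[b ~= c]"] Cons(1)[of "c & b" "(b ~= c) # out"] by simp
  next
   case 2
   show ?case using Cons(2)[of "c & b" "[b ~= c]"] Cons(2)[of "c & b" "(b ~= c) # out"] by simp
  }
 qed auto
 have g: "fold (%b acc. (fst acc & b, (b ~= fst acc) # snd acc)) l (False, []) = (False, rev l)" for l
 proof -
  have "fold (%b acc. (fst acc & b, (b ~= fst acc) # snd acc)) l (False, out) = (False, rev l @ out)" for out
   by (induction l arbitrary: out) auto
  thus ?thesis by simp
 qed
 show "binc [] = [True]" "binc (True # l) = False # binc l" "binc (False # l) = True # l"
  using f[of l True "[False]"] f[of l False "[True]"] g[of l] by (auto simp: binc_def Let_def)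
qed

lemma binary_Suc: "binary (Suc n) = binc (binary n)"
proof (induction n rule: less_induct)
 case (less n)
 consider "n = 0" | "n = 1" | "n \<ge> 2" by linarith
 thus ?case
 proof cases
  case 1
  thus ?thesis by (simp add: binary.simps binc_simps)
 next
  case 2
  have "binary 2 = [False, True]" by (subst binary.simps, subst binary.simps) simp
  moreover have "binary 1 = [True]" by (subst binary.simps) simp
  ultimately show ?thesis using 2 by (simp add: binc_simps numeral_2_eq_2)
 next
  case 3
  have s: "binary (Suc n) = odd (Suc n) # binary (Suc n div 2)" "binary n = odd n # binary (n div 2)"
   using 3 by (subst binary.simps; simp)+
  show ?thesis
  proof (cases "odd n")
   case True
   hence "Suc n div 2 = Suc (n div 2)" by presburger
   moreover have "n div 2 < n" using 3 by simp
   ultimately show ?thesis using s less.IH[of "n div 2"] True by (simp add: binc_simps)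
  next
   case False
   hence "Suc n div 2 = n div 2" by presburger
   thus ?thesis using s False by (simp add: binc_simps)
  qed
 qed
qed

lemma fp_binc [fp_intros]:
 assumes "fp f" shows "fp (%x. binc (f x))"
proof -
 have b: "vs (c :: bool) \<le> 3" for c by (rule vs_bool)
 have "fp (%x. fold (%b acc. (fst acc & b, (b ~= fst acc) # snd acc)) (f x) (True, []))"
 proof (rule fp_fold_add[where g = "%_. 7"])
  show "vs (fst acc & b, (b ~= fst acc) # snd acc) \<le> vs acc + 7"
   for acc :: "bool \<times> bool list" and b
   using b[of "fst acc & b"] b[of "b ~= fst acc"] vs_pos[of "fst acc"]
   by (cases acc) (simp del: vs_pos)
 qed (intro fp_intros bnd_intros assms fp_const)+
 thus ?thesis unfolding binc_def Let_def by (intro fp_intros)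
qed

lemma length_binc: "length (binc l) \<le> Suc (length l)"
proof (induction l)
 case (Cons b l)
 thus ?case by (cases b) (auto simp: binc_simps)
qed (simp add: binc_simps)

lemma length_binary: "length (binary n) \<le> Suc n"
proof (induction n)
 case (Suc n)
 thus ?case using length_binc[of "binary n"] by (simp add: binary_Suc)
qed (simp add: binary.simps)

lemma fp_binary [fp_intros]:
 assumes "fp f" shows "fp (%x. binary (f x))"
proof -
 have eq: "fold (%_. binc) (replicate n N) [False] = binary n" for n
  by (induction n) (simp_all add: binary.simps[of 0] binary_Suc flip: replicate_append_same)
 have "fp (%x. fold (%_. binc) (replicate (f x) N) [False])"
 proof (rule fp_fold[where g = "%x. 1 + 4 * (vs (f x) + 1)"])
  fix x i
  have "vs (binary (min i (f x))) \<le> 1 + length (binary (min i (f x))) * (3 + 1)"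
   by (rule vs_list_le) (rule vs_bool)
  also have "\<dots> \<le> 1 + 4 * (vs (f x) + 1)" using length_binary[of "min i (f x)"] by simp
  finally show "vs (fold (%_. binc) (take i (replicate (f x) N)) [False]) \<le> 1 + 4 * (vs (f x) + 1)"
   by (simp only: take_replicate eq)
 qed (intro fp_intros bnd_intros assms fp_const)+
 thus ?thesis by (simp only: eq)
qed

text \<open>These are exactly the values of \<open>binary\<close>: the most significant bit, which
  comes last, is 1 except in the word for zero.\<close>

definition canon :: "bool list => bool" where
 "canon l \<longleftrightarrow> l ~= [] & (hd0 (rev l) \<or> l = [False])"

lemma fp_canon [fp_intros]: "fp f ==> fp (%x. canon (f x))"
 unfolding canon_def by (intro fp_intros fp_const)

lemma canon_Cons2: "canon (b # c # l) \<longleftrightarrow> canon (c # l) & c # l ~= [False]"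
proof -
 obtain l' x where "rev (c # l) = x # l'" by (cases "rev (c # l)") auto
 thus ?thesis by (auto simp: canon_def)
qed

lemma canon_binary: "canon l ==> binary (bval l) = l"
proof (induction l rule: induct_list012)
 case (3 b c l)
 hence IH: "binary (bval (c # l)) = c # l" and ne: "c # l ~= [False]" by (auto simp: canon_Cons2)
 have "bval (c # l) ~= 0"
 proof
  assume "bval (c # l) = 0"
  hence "binary 0 = c # l" using IH by simp
  thus False using ne by (simp add: binary.simps)
 qed
 hence "2 \<le> bval (b # c # l)" "bval (b # c # l) div 2 = bval (c # l)" "odd (bval (b # c # l)) = b" by auto
 thus ?case using IH by (subst binary.simps) simp
qed (simp_all add: canon_def binary.simps)

lemma bval_binary: "bval (binary n) = n" and canon_bin: "canon (binary n)"
proof -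
 have "bval (binary n) = n & canon (binary n)"
 proof (induction n rule: less_induct)
  case (less n)
  show ?case
  proof (cases "n < 2")
   case True
   hence "binary n = [n = 1]" by (subst binary.simps) simp
   thus ?thesis using True by (auto simp: canon_def)
  next
   case False
   hence b: "binary n = odd n # binary (n div 2)" by (subst binary.simps) simp
   have IH: "bval (binary (n div 2)) = n div 2" "canon (binary (n div 2))" using less False by auto
   obtain c l where cl: "binary (n div 2) = c # l" using binary_nonempty by (cases "binary (n div 2)") auto
   have "c # l ~= [False]"
   proof
    assume "c # l = [False]"
    hence "n div 2 = 0" using IH(1) cl by simp
    thus False using False by linarith
   qed
   hence "canon (binary n)" using IH(2) unfolding b cl by (simp add: canon_Cons2)
   moreover have "bval (binary n) = n" unfolding b using IH(1) by simp
   ultimately show ?thesis by blast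
  qed
 qed
 thus "bval (binary n) = n" "canon (binary n)" by auto
qed

text \<open>Every bit string of length \<open>k\<close> is read as a tree, and all trees of size at most \<open>k\<close> arise.\<close>

definition pD :: "bool list => dt" where
 "pD w = hd0 (fold (%b st. if b then C (hd0 (tl st)) (hd0 st) # tl (tl st) else N # st) w [])"

lemma fp_dt_C [fp_intros]: "fp f ==> fp g ==> fp (%x. C (f x) (g x))"
 unfolding fp_def enc_dt_def by (rule FPD_Cons)

lemma fp_pD [fp_intros]:
 assumes "fp f" shows "fp (%x. pD (f x))"
proof -
 have "fp (%x. fold (%b st. if b then C (hd0 (tl st)) (hd0 st) # tl (tl st) else N # st) (f x) [])"
 proof (rule fp_fold_add[where g = "%_. 5"])
  show "vs (if b then C (hd0 (tl st)) (hd0 st) # tl (tl st) else N # st) \<le> vs st + 5" for b :: bool and st :: "dt list"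
  proof -
   have "vs (C a c) = Suc (vs a + vs c)" "vs N = 1" for a c by (simp_all add: vs_def)
   thus ?thesis
    by (cases st; cases "tl st") (auto simp: hd0_def)
  qed
 qed (intro fp_intros bnd_intros assms fp_const)+
 thus ?thesis unfolding pD_def by (intro fp_intros)
qed

lemma ex_pD:
 assumes "sz d \<le> k" shows "\<exists>w. length w = k & pD w = d"
proof -
 let ?f = "%b st. if b then C (hd0 (tl st)) (hd0 st) # tl (tl st) else N # st"
 have "fold ?f (map (%s. s = 2) (ser d)) st = d # st" for st :: "dt list"
  by (induction d arbitrary: st) auto
 hence "pD (replicate (k - sz d) False @ map (%s. s = 2) (ser d)) = d"
  by (simp add: pD_def)
 thus ?thesis using assms by (intro exI conjI) auto
qed

lemma fp_dec [fp_intros]: "fp f ==> fp (%x. dec (f x) :: 'b::rep)"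
proof -
 assume "fp f"
 hence "FPD (%d. f (dec d))" unfolding fp_def enc_dt_def .
 from FPD_comp[OF FPD_norm[where 'a = 'b] this] show ?thesis unfolding fp_def .
qed

text \<open>The values over which a block of \<open>k\<close> quantified bits ranges. What matters
  is that every value of size at most \<open>k\<close> is among them (\<open>B_mem\<close>).\<close>

definition B :: "nat => 'a::rep set" where
 "B k = {dec (pD w) | w. length w = k}"

lemma B_mem: "vs a \<le> k ==> a \<in> B k"
 using ex_pD[of "enc a" k] unfolding B_def vs_def by (metis (mono_tags, lifting) dec_enc mem_Collect_eq)

lemma Qp_append:
 "Qp (replicate k e @ qs) P \<longleftrightarrow> (if e then \<exists>w. length w = k & Qp qs (%v. P (w @ v))
   else \<forall>w. length w = k --> Qp qs (%v. P (w @ v)))"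
proof (induction k arbitrary: P)
 case (Suc k)
 have "(\<exists>w. length w = Suc k & R w) \<longleftrightarrow> (\<exists>b w. length w = k & R (b # w))"
  "(\<forall>w. length w = Suc k --> R w) \<longleftrightarrow> (\<forall>b w. length w = k --> R (b # w))" for R :: "bool list => bool"
  by (metis length_Suc_conv)+
 thus ?case using Suc by (cases e) simp_all
qed simp

section \<open>Instances as data\<close>

text \<open>Options become lists, and the threshold is a sign with numerator and denominator in
  binary. All other numbers may be unary, because those of a valid instance are at most the length
  of its encoding (\<open>valJ_less\<close>).\<close>

type_synonym idata = "nat list \<times> (nat \<times> nat) list \<times> nat list list \<times> nat \<times> nat \<times>
 (bool \<times> bool list \<times> bool list) \<times> nat \<times> nat \<times> (nat \<times> nat \<times> nat \<times> nat list) list"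

abbreviation "jol J \<equiv> fst J"
abbreviation "jel J \<equiv> fst (snd J)"
abbreviation "jtl J \<equiv> fst (snd (snd J))"
abbreviation "jL J \<equiv> fst (snd (snd (snd J)))"
abbreviation "jv J \<equiv> fst (snd (snd (snd (snd J))))"
abbreviation "jth J \<equiv> fst (snd (snd (snd (snd (snd J)))))"
abbreviation "jnm J \<equiv> fst (snd (snd (snd (snd (snd (snd J))))))"
abbreviation "jms J \<equiv> fst (snd (snd (snd (snd (snd (snd (snd J)))))))"
abbreviation "jtr J \<equiv> snd (snd (snd (snd (snd (snd (snd (snd J)))))))"

definition opt :: "nat list => nat option" where
 "opt l = (if l = [] then None else Some (hd0 l))"

definition tr_of :: "nat \<times> nat \<times> nat \<times> nat list => nat \<times> nat \<times> nat \<times> nat option" where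
 "tr_of r = (fst r, fst (snd r), fst (snd (snd r)), opt (snd (snd (snd r))))"

definition th_of :: "bool \<times> bool list \<times> bool list => rat" where
 "th_of r = Fract ((if fst r then -1 else 1) * int (bval (fst (snd r)))) (int (bval (snd (snd r))))"

definition inst :: "idata => reach_instance" where
 "inst J = \<lparr>owner_list = jol J, edge_list = jel J, target_lists = jtl J, leader = jL J,
   init_vertex = jv J, threshold = th_of (jth J), num_mstates = jnm J, mstart_state = jms J,
   mtrans_list = map tr_of (jtr J)\<rparr>"

lemma inst_sel [simp]:
 "leader (inst J) = jL J" "init_vertex (inst J) = jv J" "threshold (inst J) = th_of (jth J)"
 by (simp_all add: inst_def)

definition numb :: "bool list => bool list" where
 "numb b = [True, False] @ concat (map (%b. [False, b]) b) @ [True, True]"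

definition nd :: "bool list list => bool list" where
 "nd l = [True, False] @ concat l @ [True, True]"

definition wrs :: "nat list => bool list" where
 "wrs l = nd (map (%i. numb (binary i)) l)"

lemma numb_Num: "serialize (Num n) = numb (binary n)"
 by (simp add: numb_def)

lemma nd_Node: "serialize (Node ts) = nd (map serialize ts)"
 by (simp add: nd_def)

lemma wrs_tree: "serialize (nats_tree l) = wrs l"
 by (simp add: nats_tree_def nd_Node wrs_def numb_Num comp_def del: serialize.simps)

lemma fp_numb [fp_intros]: "fp f ==> fp (%x. numb (f x))"
 unfolding numb_def append.simps by (intro fp_intros)

lemma fp_nd [fp_intros]: "fp f ==> fp (%x. nd (f x))"
 unfolding nd_def append.simps by (intro fp_intros)

lemma fp_wrs [fp_intros]: "fp f ==> fp (%x. wrs (f x))"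
 unfolding wrs_def append.simps by (intro fp_intros)

definition encJ :: "idata => bool list" where
 "encJ J = nd [wrs (jol J), nd (map (%e. wrs [fst e, snd e]) (jel J)), nd (map wrs (jtl J)),
   numb (binary (jL J)), numb (binary (jv J)),
   nd [numb [fst (jth J)], numb (fst (snd (jth J))), numb (snd (snd (jth J)))],
   numb (binary (jnm J)), numb (binary (jms J)),
   nd (map (%r. wrs ([fst r, fst (snd r), fst (snd (snd r))] @ snd (snd (snd r)))) (jtr J))]"

lemma fp_encJ [fp_intros]: "fp f ==> fp (%x. encJ (f x))"
proof -
 have "fp (%J. encJ J)"
  unfolding encJ_def append.simps by (intro fp_intros)
 thus "fp f ==> fp (%x. encJ (f x))" by (rule fp_comp)
qed

text \<open>No leading zeros, no zero denominator, no negative zero. With coprimality this leaves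
  exactly the representation written by \<open>rat_tree\<close>.\<close>

definition th_ok :: "bool \<times> bool list \<times> bool list => bool" where
 "th_ok r \<longleftrightarrow> canon (fst (snd r)) & canon (snd (snd r)) & snd (snd r) ~= [False] &
   (fst r --> fst (snd r) ~= [False])"

lemma rat_tree_th:
 assumes ok: "th_ok r" and cop: "coprime (bval (fst (snd r))) (bval (snd (snd r)))"
 shows "serialize (rat_tree (th_of r)) = nd [numb [fst r], numb (fst (snd r)), numb (snd (snd r))]"
proof -
 let ?a = "bval (fst (snd r))" and ?b = "bval (snd (snd r))"
 let ?n = "(if fst r then -1 else 1) * int ?a"
 have b: "?b > 0"
 proof (rule ccontr)
  assume "\<not> ?b > 0"
  hence "binary 0 = snd (snd r)" using canon_binary[of "snd (snd r)"] ok by (simp add: th_ok_def)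
  thus False using ok by (simp add: th_ok_def binary.simps)
 qed
 have a: "fst r ==> ?a > 0"
 proof (rule ccontr)
  assume "fst r" "\<not> ?a > 0"
  hence "binary 0 = fst (snd r)" using canon_binary[of "fst (snd r)"] ok by (simp add: th_ok_def)
  thus False using ok \<open>fst r\<close> by (simp add: th_ok_def binary.simps)
 qed
 have "quotient_of (th_of r) = (?n, int ?b)"
  unfolding th_of_def by (subst quotient_of_Fract) (use b cop in \<open>auto simp: Rat.normalize_def Let_def\<close>)
 moreover have "binary 0 = [False]" "binary 1 = [True]" by (simp_all add: binary.simps)
 ultimately show ?thesis using a canon_binary[of "fst (snd r)"] canon_binary[of "snd (snd r)"] ok
  by (cases "fst r") (auto simp: rat_tree_def wrs_tree wrs_def th_ok_def)
qed

definition jok :: "idata => bool" where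
 "jok J \<longleftrightarrow> th_ok (jth J) & (\<forall>r\<in>set (jtr J). length (snd (snd (snd r))) \<le> 1)"

lemma encJ:
 assumes "jok J" "coprime (bval (fst (snd (jth J)))) (bval (snd (snd (jth J))))"
 shows "encode (inst J) = encJ J"
proof -
 have tr: "serialize (trans_tree (tr_of r)) = wrs ([fst r, fst (snd r), fst (snd (snd r))] @ snd (snd (snd r)))"
  if "r \<in> set (jtr J)" for r
 proof -
  have "length (snd (snd (snd r))) \<le> 1" using that assms(1) by (simp add: jok_def)
  then consider "snd (snd (snd r)) = []" | v where "snd (snd (snd r)) = [v]"
   by (cases "snd (snd (snd r))") auto
  thus ?thesis by cases (simp_all add: tr_of_def opt_def trans_tree_def wrs_tree)
 qed
 show ?thesis
  using rat_tree_th[of "jth J"] assms tr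
  by (simp add: encode_def instance_tree_def inst_def nd_Node numb_Num wrs_tree encJ_def comp_def case_prod_unfold jok_def
   del: serialize.simps cong: map_cong)
qed

definition trok :: "idata => nat \<times> nat \<times> nat \<times> nat list => bool" where
 "trok J r \<longleftrightarrow> fst r < jnm J & fst (snd r) < length (jol J) & fst (snd (snd r)) < jnm J &
    (if lk (jol J) (fst (snd r)) = jL J
     then snd (snd (snd r)) ~= [] & (fst (snd r), hd0 (snd (snd (snd r)))) \<in> set (jel J)
     else snd (snd (snd r)) = [])"

definition valJ :: "idata => bool" where
 "valJ J \<longleftrightarrow>
   (\<forall>e\<in>set (jel J). fst e < length (jol J) & snd e < length (jol J)) &
   (\<forall>v\<in>set [0..<length (jol J)]. \<exists>e\<in>set (jel J). fst e = v) &
   (\<forall>i\<in>set (jol J). i < length (jtl J)) &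
   (\<forall>l\<in>set (jtl J). \<forall>v\<in>set l. v < length (jol J)) &
   jL J < length (jtl J) & jv J < length (jol J) & jms J < jnm J &
   (\<forall>r\<in>set (jtr J). trok J r) &
   (\<forall>p\<in>set [0..<jnm J]. \<forall>u\<in>set [0..<length (jol J)]. \<exists>r\<in>set (jtr J). fst r = p & fst (snd r) = u)"

lemma fp_valJ [fp_intros]: "fp f ==> fp (%x. valJ (f x))"
proof -
 have "fp (%J. valJ J)" unfolding valJ_def trok_def by (intro fp_intros)
 thus "fp f ==> fp (%x. valJ (f x))" by (rule fp_comp)
qed

lemma valJ: "valJ J \<longleftrightarrow> valid_instance (inst J)"
proof -
 let ?G = "game_of (inst J)" and ?M = "mealy_of (inst J)"
 have c: "controlled ?G i = {v. v < length (jol J) & jol J ! v = i}" "edges ?G = set (jel J)"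
  "players ?G = {..<length (jtl J)}" "verts ?G = {..<length (jol J)}" for i
  by (simp_all add: game_of_def inst_def)
 have m: "mstates ?M = {..<jnm J}" "mstart ?M = jms J" "mtrans ?M = tr_of ` set (jtr J)"
  by (simp_all add: mealy_of_def inst_def)
 have qr: "quantitative_reachability_game ?G (targets (inst J)) \<longleftrightarrow>
  (\<forall>e\<in>set (jel J). fst e < length (jol J) & snd e < length (jol J)) &
   (\<forall>v<length (jol J). \<exists>e\<in>set (jel J). fst e = v) &
   (\<forall>i\<in>set (jol J). i < length (jtl J)) &
   (\<forall>l\<in>set (jtl J). \<forall>v\<in>set l. v < length (jol J))"
  (is "?qr \<longleftrightarrow> ?e & ?v & ?i & ?l")
 proof -
  have 1: "set (jel J) \<subseteq> {..<length (jol J)} \<times> {..<length (jol J)} \<longleftrightarrow> ?e"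
   by (auto simp: subset_iff mem_Times_iff)
  have 2: "(\<forall>v\<in>{..<length (jol J)}. \<exists>w. (v, w) \<in> set (jel J)) \<longleftrightarrow> ?v" by force
  have 3: "(\<Union>i\<in>{..<length (jtl J)}. {v. v < length (jol J) & jol J ! v = i}) = {..<length (jol J)} \<longleftrightarrow> ?i"
   by (auto simp: set_conv_nth set_eq_iff)
  have 4: "(\<forall>i\<in>{..<length (jtl J)}. set (jtl J ! i) \<subseteq> {..<length (jol J)}) \<longleftrightarrow> ?l"
   by (auto simp: all_set_conv_all_nth[of "jtl J"] subset_iff)
  have p: "payoff ?G = (%i. reach_payoff (targets (inst J) i))" by (simp add: game_of_def)
  have t: "targets (inst J) i = set (jtl J ! i)" for i by (simp add: targets_def inst_def)
  show ?thesis
   unfolding quantitative_reachability_game_def wf_game_def c p t 1 2 3 4[symmetric] by auto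
 qed
 have s: "(\<forall>i\<in>set [0..<n]. P i) \<longleftrightarrow> (\<forall>i<n. P i)" for n P by auto
 have "valJ J \<longleftrightarrow> quantitative_reachability_game ?G (targets (inst J)) & jL J < length (jtl J) & jv J < length (jol J) &
  wf_mealy ?G (jL J) ?M"
 proof (cases "?e & ?v & ?i & ?l")
  case True
  have e: "v < length (jol J)" if "(u, v) \<in> set (jel J)" for u v using True that by fastforce
  have 1: "tr_of r \<in> {(p, u, q, None) |p u q. p \<in> {..<jnm J} & u \<in> {..<length (jol J)} - {v. v < length (jol J) & jol J ! v = jL J} & q \<in> {..<jnm J}} \<union>
    {(p, u, q, Some v) |p u q v. p \<in> {..<jnm J} & u \<in> {v. v < length (jol J) & jol J ! v = jL J} & q \<in> {..<jnm J} &
     v \<in> {..<length (jol J)} & (u, v) \<in> set (jel J)} \<longleftrightarrow> trok J r" for r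
   by (auto simp: tr_of_def opt_def trok_def e)
  have 2: "(\<exists>q a. (p, u, q, a) \<in> tr_of ` set (jtr J)) \<longleftrightarrow>
   (\<exists>r\<in>set (jtr J). fst r = p & fst (snd r) = u)" for p u
   by (auto simp: tr_of_def image_iff Bex_def)
  have "wf_mealy ?G (jL J) ?M \<longleftrightarrow> jms J < jnm J & (\<forall>r\<in>set (jtr J). trok J r) &
   (\<forall>p<jnm J. \<forall>u<length (jol J). \<exists>r\<in>set (jtr J). fst r = p & fst (snd r) = u)"
   unfolding wf_mealy_def c m image_subset_iff 1 2 by auto
  thus ?thesis unfolding qr valJ_def s using True by (simp only: simp_thms) blast
 qed (unfold qr valJ_def s, blast)
 thus ?thesis unfolding valid_instance_def inst_sel c by blast
qed

abbreviation above :: "reach_instance => bool" where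
 "above I \<equiv> all_fixed_SPE_above (game_of I) (init_vertex I) (leader I) (threshold I) (mealy_of I)"

text \<open>Existence of transitions belongs to \<open>valJ\<close>, so only uniqueness remains.
  Option lists of length at most 1 make \<open>opt\<close> injective, hence comparing list entries
  is enough.\<close>

definition detJ :: "idata => bool" where
 "detJ J \<longleftrightarrow> (\<forall>r\<in>set (jtr J). \<forall>r'\<in>set (jtr J). fst r = fst r' & fst (snd r) = fst (snd r') --> r = r')"

lemma fp_detJ [fp_intros]: "fp f ==> fp (%x. detJ (f x))"
proof -
 have "fp (%J. detJ J)" unfolding detJ_def by (intro fp_intros)
 thus "fp f ==> fp (%x. detJ (f x))" by (rule fp_comp)
qed

lemma detJ:
 assumes "jok J" "valJ J"
 shows "detJ J \<longleftrightarrow> deterministic_mealy (game_of (inst J)) (mealy_of (inst J))"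
proof -
 have opt: "l = l'" if "opt l = opt l'" "(p, u, q, l) \<in> set (jtr J)" "(p', u', q', l') \<in> set (jtr J)"
  for l l' p u q p' u' q'
 proof -
  have "\<forall>r\<in>set (jtr J). length (snd (snd (snd r))) \<le> 1" using assms(1) by (simp add: jok_def)
  from this[rule_format, OF that(2)] this[rule_format, OF that(3)]
  have "length l \<le> 1" "length l' \<le> 1" by simp_all
  thus ?thesis using that(1) by (cases l; cases l') (simp_all add: opt_def)
 qed
 have tr: "(p, u, q, a) \<in> tr_of ` set (jtr J) \<longleftrightarrow> (\<exists>l. (p, u, q, l) \<in> set (jtr J) & a = opt l)" for p u q a
  by (force simp: tr_of_def image_iff)
 have ex: "\<exists>q l. (p, u, q, l) \<in> set (jtr J)" if "p < jnm J" "u < length (jol J)" for p u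
 proof -
  have "\<forall>p\<in>set [0..<jnm J]. \<forall>u\<in>set [0..<length (jol J)]. \<exists>r\<in>set (jtr J). fst r = p & fst (snd r) = u"
   using assms(2) unfolding valJ_def by blast
  hence "\<exists>r\<in>set (jtr J). fst r = p & fst (snd r) = u" using that by (simp del: Bex_def)
  then obtain r where "r \<in> set (jtr J)" "fst r = p" "fst (snd r) = u" by blast
  thus ?thesis by (metis prod.collapse)
 qed
 have dom: "p < jnm J & u < length (jol J)" if "(p, u, q, l) \<in> set (jtr J)" for p u q l
 proof -
  have "\<forall>r\<in>set (jtr J). fst r < jnm J & fst (snd r) < length (jol J)"
   using assms(2) unfolding valJ_def trok_def by blast
  from this[rule_format, OF that] show ?thesis by simp
 qed
 show ?thesis
 proof
  assume d: "detJ J"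
  show "deterministic_mealy (game_of (inst J)) (mealy_of (inst J))"
   unfolding deterministic_mealy_def
  proof (intro ballI)
   fix p u assume "p \<in> mstates (mealy_of (inst J))" "u \<in> verts (game_of (inst J))"
   then obtain q l where ql: "(p, u, q, l) \<in> set (jtr J)"
    using ex[of p u] by (auto simp: mealy_of_def game_of_def inst_def)
   have "(q', a) = (q, opt l)" if "(p, u, q', a) \<in> tr_of ` set (jtr J)" for q' a
    using that d ql unfolding tr detJ_def by fastforce
   thus "\<exists>!(q, a). (p, u, q, a) \<in> mtrans (mealy_of (inst J))"
    using ql by (intro ex1I[of _ "(q, opt l)"]) (auto simp: mealy_of_def inst_def tr)
  qed
 next
  assume d: "deterministic_mealy (game_of (inst J)) (mealy_of (inst J))"
  have "(q, l) = (q', l')" if "(p, u, q, l) \<in> set (jtr J)" "(p, u, q', l') \<in> set (jtr J)" for p u q l q' l'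
  proof -
   have "\<exists>!(q, a). (p, u, q, a) \<in> tr_of ` set (jtr J)"
    using d dom[OF that(1)] by (auto simp: deterministic_mealy_def mealy_of_def game_of_def inst_def)
   moreover have "(p, u, q, opt l) \<in> tr_of ` set (jtr J)" "(p, u, q', opt l') \<in> tr_of ` set (jtr J)"
    using that unfolding tr by blast+
   ultimately have "q = q' & opt l = opt l'" by auto
   thus ?thesis using opt that by blast
  qed
  thus "detJ J" unfolding detJ_def by fastforce
 qed
qed

section \<open>The verification game between Prover and Challenger\<close>

text \<open>A flag for infinity, and a number in binary.\<close>

type_synonym val = "bool \<times> bool list"
type_synonym node = "nat \<times> nat"

text \<open>An entry \<open>(l, r, c)\<close> of a table claims that an equilibrium play leads from \<open>l\<close> to \<open>r\<close>
 in \<open>2 ^ m\<close> steps with arrival times \<open>c\<close>. A position is given by a phase (0: lost, 1: won,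
 2: a table is due, 3: a segment of a play is challenged, 4: the first table is due), the reached
 players, a table, an entry, the starting time of the segment in units of its length, and a
 deviation.\<close>

type_synonym ent = "node \<times> node \<times> val list"
type_synonym pos = "nat \<times> nat list \<times> ent list \<times> ent \<times> bool list \<times> nat"

definition ev :: "val => enat" where
 "ev v = (if fst v then \<infinity> else enat (bval (snd v)))"

definition cf :: "val list => nat => enat" where
 "cf c i = ev (lk c i)"

definition lev :: "val => bool list => bool" where
 "lev v b \<longleftrightarrow> \<not> fst v & ble (snd v) b"

lemma lev: "lev v b \<longleftrightarrow> ev v \<le> enat (bval b)"
 by (simp add: lev_def ev_def ble)

definition vle :: "val => bool list => val => bool" where
 "vle v b v' \<longleftrightarrow> fst v' \<or> \<not> fst v & ble (snd v) (badd (snd v') b)"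

lemma vle: "vle v b v' \<longleftrightarrow> ev v - enat (bval b) \<le> ev v'"
 by (auto simp: vle_def ev_def ble bval_badd)

text \<open>Payoff at most the threshold, without division: \<open>1 / (1 + v) \<le> a / b\<close>
  is \<open>b \<le> a * (v + 1)\<close>. The payoff of infinity is 0, so it passes any threshold
  that is not negative, and a negative threshold is never met.\<close>

definition thr :: "idata => val => bool" where
 "thr J v \<longleftrightarrow> \<not> fst (jth J) &
   (fst v \<or> ble (snd (snd (jth J))) (bmul (fst (snd (jth J))) (badd (snd v) [True])))"

definition zr :: "idata => val list => bool list => nat list" where
 "zr J c b = filter (%i. lev (lk c i) b) [0..<length (jtl J)]"

definition zd :: "idata => val list => bool list => nat => nat list" where
 "zd J c b w = filter (%i. lev (lk c i) b \<or> w \<in> set (lk (jtl J) i)) [0..<length (jtl J)]"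

definition z0 :: "idata => nat list" where
 "z0 J = filter (%i. jv J \<in> set (lk (jtl J) i)) [0..<length (jtl J)]"

definition mvJ :: "idata => node => node => bool" where
 "mvJ J l r \<longleftrightarrow> (snd l, snd r) \<in> set (jel J) &
   (fst l, snd l, fst r, if lk (jol J) (snd l) = jL J then [snd r] else []) \<in> set (jtr J)"

text \<open>Large enough for \<open>2 ^ (mJ J - 1)\<close> to exceed \<open>Cb\<close> and to be at
  least the number of nodes: a path of length \<open>2 ^ mJ J\<close> repeats a node after the last
  finite arrival.\<close>

definition mJ :: "idata => nat" where
 "mJ J = (let P = length (jtl J); n = jnm J * length (jol J) in
   Suc (P + n + (2 + P * (n + 1)) * (Suc P * (n * P))))"

definition leaf_ok :: "idata => ent => bool list => bool" where
 "leaf_ok J e t \<longleftrightarrow> mvJ J (fst e) (fst (snd e)) &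
   zr J (snd (snd e)) (badd t [True]) = zd J (snd (snd e)) t (snd (fst (snd e)))"

definition covers :: "idata => ent => bool list => nat => ent => bool" where
 "covers J e t w e' \<longleftrightarrow> fst e' = (fst (fst (snd e)), w) &
   vle (lk (snd (snd e)) (lk (jol J) (snd (fst e)))) (badd t [True]) (lk (snd (snd e')) (lk (jol J) (snd (fst e))))"

text \<open>\<open>zr J c []\<close> is the set reached at time 0. Fewer than \<open>mJ J\<close>
  bits mean that finite arrivals lie in the first half of the claimed path, so the second half has
  room for a loop.\<close>

definition ent_ok :: "idata => nat list => ent => bool" where
 "ent_ok J Z e \<longleftrightarrow> zr J (snd (snd e)) [] = Z &
   (\<forall>i\<in>set [0..<length (jtl J)]. fst (lk (snd (snd e)) i) \<or> length (snd (lk (snd (snd e)) i)) < mJ J)"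

abbreviation "pZ p \<equiv> fst (snd p)"
abbreviation "ptab p \<equiv> fst (snd (snd p))"
abbreviation "pe p \<equiv> fst (snd (snd (snd p)))"
abbreviation "pt p \<equiv> fst (snd (snd (snd (snd p))))"
abbreviation "pw p \<equiv> snd (snd (snd (snd (snd p))))"

definition tab_ok :: "idata => nat => ent list => pos => bool" where
 "tab_ok J K tab p \<longleftrightarrow> length tab \<le> K & (\<forall>e\<in>set tab. ent_ok J (pZ p) e) &
   (\<exists>e\<in>set tab. if fst p = 4 then fst e = (jms J, jv J) & thr J (lk (snd (snd e)) (jL J))
    else covers J (pe p) (pt p) (pw p) e)"

definition segs :: "ent => node => nat => ent" where
 "segs e mid z = (if z = 0 then (fst e, mid, snd (snd e)) else (mid, snd e))"

text \<open>All rounds have the same format: Prover offers a table and a midpoint, Challenger a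
  number, and the phase decides what is used. The number is the index of an entry, the choice of a
  half, or the target of a deviation. A chosen half is prepended to the starting time, since
  refining a segment doubles its start in the new unit. A deviation that reaches no new target is
  settled by the current table at once.\<close>

definition nxt :: "idata \<times> nat => ent list \<times> node => nat => pos => pos" where
 "nxt x a z p =
  (if fst p = 2 \<or> fst p = 4 then
    (if tab_ok (fst x) (snd x) (fst a) p
    then (if z < length (fst a)
     then (3, pZ p, fst a, lk (fst a) z, [], pw p)
     else (1, snd p))
    else (0, snd p))
   else if fst p = 3 then
    (if length (pt p) < mJ (fst x)
    then (3, pZ p, ptab p, segs (pe p) (snd a) z,
     (z ~= 0) # pt p, pw p)
    else if leaf_ok (fst x) (pe p) (pt p)
    then (if (snd (fst (pe p)), z) \<in> set (jel (fst x)) &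
        lk (jol (fst x)) (snd (fst (pe p))) ~= jL (fst x)
     then (if zd (fst x) (snd (snd (pe p))) (pt p) z = pZ p
      then (if \<exists>e\<in>set (ptab p). covers (fst x) (pe p) (pt p) z e
       then (1, snd p) else (0, snd p))
      else (2, zd (fst x) (snd (snd (pe p))) (pt p) z,
       ptab p, pe p, pt p, z))
     else (1, snd p))
    else (0, snd p))
   else p)"

lemma nxt_table:
 "u = 2 \<or> u = 4 ==> nxt (J, K) (tab, mid) z (u, Z, tb, e, t, w) =
  (if tab_ok J K tab (u, Z, tb, e, t, w)
   then (if z < length tab then (3, Z, tab, lk tab z, [], w) else (1, Z, tb, e, t, w))
   else (0, Z, tb, e, t, w))"
 by (auto simp: nxt_def)

lemma nxt_segs:
 "length t < mJ J ==> nxt (J, K) (tab, mid) z (3, Z, tb, e, t, w) = (3, Z, tb, segs e mid z, (z ~= 0) # t, w)"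
 by (simp add: nxt_def)

lemma nxt_leaf:
 "\<not> length t < mJ J ==> nxt (J, K) (tab, mid) z (3, Z, tb, (l, r, c), t, w) =
   (if leaf_ok J (l, r, c) t then
    (if (snd l, z) \<in> set (jel J) & lk (jol J) (snd l) ~= jL J then
      (if zd J c t z = Z then
       (if \<exists>e\<in>set tb. covers J (l, r, c) t z e then (1, Z, tb, (l, r, c), t, w) else (0, Z, tb, (l, r, c), t, w))
      else (2, zd J c t z, tb, (l, r, c), t, z))
     else (1, Z, tb, (l, r, c), t, w))
   else (0, Z, tb, (l, r, c), t, w))"
 by (simp add: nxt_def)

lemma nxt_over: "u = 0 \<or> u = 1 ==> nxt x a z (u, q) = (u, q)"
 by (auto simp: nxt_def)

lemma fp_nxt:
 "fp (%y. nxt (fst y) (fst (fst (snd y))) (snd (fst (snd y))) (snd (snd y)))"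
proof -
 have lev: "fp f ==> fp g ==> fp (%x. lev (f x) (g x))" for f :: "'x::rep => val" and g
  unfolding lev_def by (intro fp_intros)
 have vle: "fp f ==> fp g ==> fp h ==> fp (%x. vle (f x) (g x) (h x))" for f h :: "'x::rep => val" and g
  unfolding vle_def by (intro fp_intros)
 have thr: "fp (%x. thr (fst x) (snd x))"
  unfolding thr_def by (intro fp_intros)
 have zr: "fp (%x. zr (fst x) (fst (snd x)) (snd (snd x)))"
  unfolding zr_def by (intro fp_intros lev)
 have zd: "fp (%x. zd (fst x) (fst (snd x)) (fst (snd (snd x))) (snd (snd (snd x))))"
  unfolding zd_def by (intro fp_intros lev)
 have mv: "fp (%x. mvJ (fst x) (fst (snd x)) (snd (snd x)))"
  unfolding mvJ_def by (intro fp_intros)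
 have mJ: "fp f ==> fp (%x. mJ (f x))" for f :: "'x::rep => idata"
  unfolding mJ_def Let_def by (intro fp_intros)
 note zr' = fp_comp[OF zr fp_Pair[OF _ fp_Pair], simplified fst_conv snd_conv]
 note zd' = fp_comp[OF zd fp_Pair[OF _ fp_Pair[OF _ fp_Pair]], simplified fst_conv snd_conv]
 note mv' = fp_comp[OF mv fp_Pair[OF _ fp_Pair], simplified fst_conv snd_conv]
 note thr' = fp_comp[OF thr fp_Pair, simplified fst_conv snd_conv]
 have leaf: "fp (%x. leaf_ok (fst x) (fst (snd x)) (snd (snd x)))"
  unfolding leaf_ok_def by (intro fp_intros zr' zd' mv')
 have cov: "fp (%x. covers (fst x) (fst (snd x)) (fst (snd (snd x))) (fst (snd (snd (snd x)))) (snd (snd (snd (snd x)))))"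
  unfolding covers_def by (intro fp_intros vle)
 note leaf' = fp_comp[OF leaf fp_Pair[OF _ fp_Pair], simplified fst_conv snd_conv]
 note cov' = fp_comp[OF cov fp_Pair[OF _ fp_Pair[OF _ fp_Pair[OF _ fp_Pair]]], simplified fst_conv snd_conv]
 have ent: "fp (%x. ent_ok (fst x) (fst (snd x)) (snd (snd x)))"
  unfolding ent_ok_def by (intro fp_intros zr' mJ)
 note ent' = fp_comp[OF ent fp_Pair[OF _ fp_Pair], simplified fst_conv snd_conv]
 have tab: "fp (%x. tab_ok (fst x) (fst (snd x)) (fst (snd (snd x))) (snd (snd (snd x))))"
  unfolding tab_ok_def by (intro fp_intros ent' cov' thr')
 note tab' = fp_comp[OF tab fp_Pair[OF _ fp_Pair[OF _ fp_Pair]], simplified fst_conv snd_conv]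
 have segs: "fp (%x. segs (fst x) (fst (snd x)) (snd (snd x)))"
  unfolding segs_def by (intro fp_intros)
 note segs' = fp_comp[OF segs fp_Pair[OF _ fp_Pair], simplified fst_conv snd_conv]
 show ?thesis
  unfolding nxt_def by (intro fp_intros tab' leaf' cov' segs' zd' mJ)
qed

lemma vs_filter: "vs (filter P l) \<le> vs l"
 by (induction l) auto

lemma vs_lk: "vs (lk l i) \<le> vs l + vs (dec N :: 'a)" for l :: "'a::rep list"
proof (cases "i < length l")
 case True
 thus ?thesis using vs_list_mem[of "l ! i" l] by simp
qed (simp add: lk_def hd0_def)

text \<open>New material in a position comes from the moves of the round or from the instance, so
  sizes grow additively and many rounds still form a fold of bounded growth.\<close>

lemma vs_nxt:
 "vs (nxt x a z p) \<le> vs p + (60 + 2 * vs a + 2 * z + vs [0..<length (jtl (fst x))] + vs (dec N :: ent))"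
proof -
 obtain u Z tb l r c t w where p: "p = (u, Z, tb, (l, r, c), t, w)" by (cases p) auto
 obtain tab mid where a: "a = (tab, mid)" by (cases a)
 obtain J K where x: "x = (J, K)" by (cases x)
 have b: "vs (b :: bool) \<le> 3" for b by (rule vs_bool)
 consider "u = 0 \<or> u = 1" | "u = 2 \<or> u = 4" | "u = 3" "length t < mJ J" | "u = 3" "\<not> length t < mJ J" | "u > 4"
  by linarith
 thus ?thesis
 proof cases
  case 1
  thus ?thesis by (simp add: p nxt_over)
 next
  case 2
  show ?thesis using vs_lk[of tab z] 2 unfolding p a x nxt_table[OF 2] by auto
 next
  case 3
  show ?thesis using b[of True] b[of False] 3(1) unfolding p a x 3(1) nxt_segs[OF 3(2)] by (simp add: segs_def)
 next
  case 4
  have "vs (zd J c t z) \<le> vs [0..<length (jtl J)]" unfolding zd_def by (rule vs_filter)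
  thus ?thesis unfolding p a x 4(1) nxt_leaf[OF 4(2)] by auto
 next
  case 5
  thus ?thesis by (simp add: p nxt_def)
 qed
qed

text \<open>A safety game: Prover loses only in phase 0. Running out of rounds counts in favour of
  Prover, so soundness needs a lower bound on their number; excess rounds are idle because phases 0
  and 1 are absorbing.\<close>

primrec Wn :: "nat => idata \<times> nat => nat => pos => bool" where
 "Wn k x 0 p \<longleftrightarrow> fst p ~= 0"
| "Wn k x (Suc n) p \<longleftrightarrow> (\<exists>a\<in>B k. \<forall>z\<in>B k. Wn k x n (nxt x a z p))"

lemma Wn_lost: "\<not> Wn k x n (0, q)"
proof (induction n)
 case (Suc n)
 have "vs (0 :: nat) \<le> k \<or> k = 0" by (cases k) auto
 moreover have "B 0 ~= ({} :: 'a::rep set)" by (auto simp: B_def)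
 ultimately have "B k ~= ({} :: nat set)" using B_mem by blast
 thus ?case using Suc nxt_over[of 0] by auto
qed simp

definition blocks :: "nat => nat => bool list => ((ent list \<times> node) \<times> nat) list" where
 "blocks k R w = map (%i. (dec (pD (take k (drop (i * (k + k)) w))), dec (pD (take k (drop (i * (k + k) + k) w))))) [0..<R]"

definition final :: "nat => idata \<times> nat => nat => bool list => pos => pos" where
 "final k x R w p = fold (%b p. nxt x (fst b) (snd b) p) (blocks k R w) p"

lemma blocks_Suc:
 assumes "length u = k" "length v = k"
 shows "blocks k (Suc R) (u @ v @ w) = (dec (pD u), dec (pD v)) # blocks k R w"
proof -
 have "[0..<Suc R] = 0 # map Suc [0..<R]" by (simp add: map_Suc_upt upt_conv_Cons)
 thus ?thesis using assms by (simp add: blocks_def ac_simps)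
qed

lemma B_ex: "(\<exists>a\<in>B k. P a) \<longleftrightarrow> (\<exists>w. length w = k & P (dec (pD w)))"
 and B_all: "(\<forall>a\<in>B k. P a) \<longleftrightarrow> (\<forall>w. length w = k --> P (dec (pD w)))"
 unfolding B_def by blast+

text \<open>Prover establishes a violating equilibrium, whereas the problem asks that there is none.
  Therefore the moves of Prover are quantified universally and those of Challenger
  existentially.\<close>

lemma Wn_Qp:
 "Qp (concat (replicate R (replicate k False @ replicate k True))) (%w. fst (final k x R w p) = 0) \<longleftrightarrow> \<not> Wn k x R p"
proof (induction R arbitrary: p)
 case (Suc R)
 have "Qp (concat (replicate (Suc R) (replicate k False @ replicate k True))) (%w. fst (final k x (Suc R) w p) = 0) \<longleftrightarrow>
  (\<forall>u. length u = k --> (\<exists>v. length v = k & Qp (concat (replicate R (replicate k False @ replicate k True)))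
   (%w. fst (final k x (Suc R) (u @ v @ w) p) = 0)))"
  by (simp add: Qp_append)
 also have "\<dots> \<longleftrightarrow> (\<forall>u. length u = k --> (\<exists>v. length v = k & \<not> Wn k x R (nxt x (dec (pD u)) (dec (pD v)) p)))"
 proof -
  have "final k x (Suc R) (u @ v @ w) p = final k x R w (nxt x (dec (pD u)) (dec (pD v)) p)"
   if "length u = k" "length v = k" for u v w
   using that by (simp add: final_def blocks_Suc)
  thus ?thesis by (simp add: Suc.IH cong: conj_cong)
 qed
 also have "\<dots> \<longleftrightarrow> \<not> Wn k x (Suc R) p"
  unfolding Wn.simps B_ex B_all by blast
 finally show ?case .
qed (simp add: final_def blocks_def)

lemma fp_final:
 "fp (%y. final (fst y) (fst (snd y)) (fst (snd (snd y))) (fst (snd (snd (snd y)))) (snd (snd (snd (snd y)))))"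
proof -
 have "fp (%y. blocks (fst y) (fst (snd (snd y))) (fst (snd (snd (snd y)))))"
  unfolding blocks_def by (intro fp_intros)
 thus ?thesis unfolding final_def
 proof (rule fp_fold_add[where g = "%y. 60 + 2 * vs (fst (snd y)) + 2 * vs (snd (snd y)) +
   vs [0..<length (jtl (fst (fst (snd (fst y)))))] + vs (dec N :: ent)", rotated])
  fix y :: "nat \<times> (idata \<times> nat) \<times> nat \<times> bool list \<times> pos" and b :: "(ent list \<times> node) \<times> nat" and p
  show "vs (nxt (fst (snd y)) (fst b) (snd b) p) \<le> vs p + (60 + 2 * vs (fst (snd (y, b))) + 2 * vs (snd (snd (y, b))) +
   vs [0..<length (jtl (fst (fst (snd (fst (y, b))))))] + vs (dec N :: ent))"
   using vs_nxt[of "fst (snd y)" "fst b" "snd b" p] by simp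
  show "fp (%y :: (nat \<times> (idata \<times> nat) \<times> nat \<times> bool list \<times> pos) \<times> ((ent list \<times> node) \<times> nat) \<times> pos.
    nxt (fst (snd (fst y))) (fst (fst (snd y))) (snd (fst (snd y))) (snd (snd y)))"
   using fp_comp[OF fp_nxt fp_Pair[OF fp_fst[OF fp_snd[OF fp_fst[OF fp_id]]] fp_snd[OF fp_id]]] by simp
 qed (intro fp_intros bnd_intros)+
qed

subsection \<open>The game characterizes equilibria\<close>

text \<open>Bounds the codes of all moves that matter: \<open>X * X * X\<close> entries, one for
  each state, vertex and player, each with two nodes and at most \<open>X\<close> arrival times of
  at most \<open>X\<close> bits.\<close>

definition kk :: "nat => nat" where
 "kk X = 20 + X * X * X * (12 * X + 20 + X * (4 * X + 10)) + 8 * X"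

locale vgame =
 fixes J :: idata and X bs :: nat
 assumes jok: "jok J" and val: "valJ J"
  and bounds: "jnm J \<le> X" "length (jol J) \<le> X" "length (jtl J) \<le> X" "mJ J \<le> X" and bs: "kk X \<le> bs"
begin

sublocale rgame "game_of (inst J)" "targets (inst J)" "jL J" "mealy_of (inst J)"
 using val unfolding valJ by unfold_locales (auto simp: valid_instance_def inst_def)

abbreviation "np \<equiv> length (jtl J)"
abbreviation "nv \<equiv> length (jol J)"
abbreviation "m \<equiv> mJ J"
abbreviation "K \<equiv> X * X * X"
abbreviation "W \<equiv> Wn bs (J, K)"

lemma sets: "players (game_of (inst J)) = {..<np}" "verts (game_of (inst J)) = {..<nv}"
 "edges (game_of (inst J)) = set (jel J)" "mstart (mealy_of (inst J)) = jms J"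
 by (simp_all add: game_of_def inst_def mealy_of_def)

lemma Tg_iff: "i \<in> Tg w \<longleftrightarrow> i < np & w \<in> set (lk (jtl J) i)"
 unfolding Tg_def mem_Collect_eq sets by (auto simp: targets_def inst_def)

lemma ow_lk:
 assumes u: "u < nv" shows "ow u = lk (jol J) u"
proof -
 have "lk (jol J) u \<in> set (jol J)" using u by simp
 hence "lk (jol J) u < np" using val unfolding valJ_def by blast
 thus ?thesis using u by (intro ow_eq) (auto simp: game_of_def inst_def)
qed

lemma controlled_iff: "u < nv ==> u \<in> controlled (game_of (inst J)) i \<longleftrightarrow> lk (jol J) u = i"
 by (simp add: game_of_def inst_def)

lemma edge_less: "(u, w) \<in> set (jel J) ==> u < nv & w < nv"
 using edge_verts by (simp add: sets)

lemma mv_iff: "mv l r \<longleftrightarrow> mvJ J l r"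
proof (cases "(snd l, snd r) \<in> set (jel J)")
 case True
 hence u: "snd l < nv" using edge_less by blast
 let ?o = "if lk (jol J) (snd l) = jL J then [snd r] else []"
 have "(fst l, snd l, fst r, opt ?o) \<in> tr_of ` set (jtr J) \<longleftrightarrow> (fst l, snd l, fst r, ?o) \<in> set (jtr J)"
 proof
  assume "(fst l, snd l, fst r, opt ?o) \<in> tr_of ` set (jtr J)"
  then obtain o' where o': "(fst l, snd l, fst r, o') \<in> set (jtr J)" "opt ?o = opt o'"
   by (auto simp: tr_of_def)
  have "\<forall>r\<in>set (jtr J). length (snd (snd (snd r))) \<le> 1" using jok by (simp add: jok_def)
  from this[rule_format, OF o'(1)] have "length o' \<le> 1" by simp
  hence "o' = ?o" using o'(2) by (cases o') (auto simp: opt_def split: if_splits)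
  thus "(fst l, snd l, fst r, ?o) \<in> set (jtr J)" using o'(1) by simp
 next
  assume "(fst l, snd l, fst r, ?o) \<in> set (jtr J)"
  thus "(fst l, snd l, fst r, opt ?o) \<in> tr_of ` set (jtr J)"
   by (rule rev_image_eqI) (simp add: tr_of_def)
 qed
 moreover have "opt ?o = (if snd l \<in> controlled (game_of (inst J)) (jL J) then Some (snd r) else None)"
  using controlled_iff[OF u] by (simp add: opt_def)
 moreover have "mtrans (mealy_of (inst J)) = tr_of ` set (jtr J)" by (simp add: mealy_of_def inst_def)
 ultimately show ?thesis using True unfolding mv_def mvJ_def sets by simp
qed (simp add: mv_def mvJ_def sets)

text \<open>Sets of players are written in increasing order, which makes equality of sets the
  equality of lists.\<close>

definition isZ :: "nat list => bool" where
 "isZ Z \<longleftrightarrow> (\<exists>P. Z = filter P [0..<np])"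

lemma isZ_eq:
 assumes "isZ Z" "isZ Z'" shows "Z = Z' \<longleftrightarrow> set Z = set Z'"
proof -
 obtain P Q where Z: "Z = filter P [0..<np]" "Z' = filter Q [0..<np]" using assms unfolding isZ_def by blast
 have "Z = Z'" if "set Z = set Z'"
  unfolding Z by (rule filter_cong) (use that in \<open>auto simp: Z set_eq_iff\<close>)
 thus ?thesis by blast
qed

lemma isZ_zs: "isZ (zr J c b)" "isZ (zd J c b w)" "isZ (z0 J)"
 unfolding isZ_def zr_def zd_def z0_def by (rule exI, rule HOL.refl)+

lemma set_zs: "set (zr J c b) = zero (cf c) (bval b)" "set (zd J c b w) = zero (cf c) (bval b) \<union> Tg w"
 "set (z0 J) = Tg (jv J)"
 unfolding set_eq_iff Un_iff Tg_iff zero_def sets by (auto simp: zr_def zd_def z0_def lev cf_def)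

lemma leaf: "leaf_ok J (l, r, c) t \<longleftrightarrow>
  mv l r & zero (cf c) (Suc (bval t)) = zero (cf c) (bval t) \<union> Tg (snd r)"
 using isZ_eq[OF isZ_zs(1,2)] by (simp add: leaf_ok_def mv_iff set_zs bval_badd)

lemma covers: "snd l < nv ==> covers J (l, r, c) t w e' \<longleftrightarrow>
  fst e' = (fst r, w) & cf c (ow (snd l)) - enat (Suc (bval t)) \<le> cf (snd (snd e')) (ow (snd l))"
 by (simp add: covers_def vle bval_badd ow_lk cf_def)

lemma card_nodes: "card nodes = jnm J * nv" and card_players: "card (players (game_of (inst J))) = np"
 by (simp_all add: nodes_def sets card_cartesian_product) (simp add: mealy_of_def inst_def)

lemma m_bound: "Cb < 2 ^ (m - 1)" "card nodes \<le> 2 ^ (m - 1)" "0 < m"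
proof -
 have l: "n < 2 ^ n" for n :: nat by (rule less_exp)
 let ?e = "Suc np * (card nodes * np)"
 have "Kb ^ ?e \<le> (2 ^ Kb) ^ ?e" by (intro power_mono) (use l[of Kb] in auto)
 hence b: "Bd \<le> 2 ^ (Kb * ?e)" unfolding Bd_def card_players by (simp add: power_mult)
 have m: "m - 1 = np + (card nodes + Kb * ?e)"
  by (simp add: mJ_def Let_def card_nodes Kb_def card_players algebra_simps)
 have "card nodes * 1 \<le> card nodes * 2 ^ (Kb * ?e)" by (intro mult_le_mono2) simp
 hence "card nodes + Bd \<le> (card nodes + 1) * 2 ^ (Kb * ?e)"
  unfolding add_mult_distrib mult_1 using b by (simp only: mult_1_right add_mono)
 also have "\<dots> \<le> 2 ^ card nodes * 2 ^ (Kb * ?e)" using l[of "card nodes"] by (intro mult_le_mono1) (simp add: Suc_leI)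
 finally have c: "card nodes + Bd \<le> 2 ^ (card nodes + Kb * ?e)" by (simp add: power_add)
 have "Cb \<le> np * 2 ^ (card nodes + Kb * ?e)" unfolding Cb_def card_players using c by simp
 also have "\<dots> < 2 ^ np * 2 ^ (card nodes + Kb * ?e)" using l[of np] by simp
 finally show "Cb < 2 ^ (m - 1)" unfolding m power_add .
 have "card nodes \<le> 2 ^ (card nodes + Kb * ?e)" using c by simp
 also have "\<dots> \<le> 2 ^ (m - 1)" unfolding m by (intro power_increasing) auto
 finally show "card nodes \<le> 2 ^ (m - 1)" .
 show "0 < m" by (simp add: mJ_def Let_def)
qed

lemma B_kk: "vs a \<le> kk X ==> a \<in> B bs"
 using bs by (intro B_mem) simp

lemma B_nat: "z \<le> K \<or> z \<le> 1 \<or> z < nv ==> z \<in> B bs"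
proof (rule B_kk)
 assume z: "z \<le> K \<or> z \<le> 1 \<or> z < nv"
 have "X * X * X * 2 \<le> X * X * X * (12 * X + 20 + X * (4 * X + 10))" by (intro mult_le_mono2) simp
 thus "vs z \<le> kk X" using z bounds(2) unfolding kk_def vs_nat by linarith
qed

lemma W_table:
 assumes "W (Suc n) (u, Z, tb, e, t, w)" "u = 2 \<or> u = 4"
 shows "\<exists>tab. tab_ok J K tab (u, Z, tb, e, t, w) & (\<forall>e\<in>set tab. W n (3, Z, tab, e, [], w))"
proof -
 obtain tab mid where a: "!!z. z \<in> B bs ==> W n (nxt (J, K) (tab, mid) z (u, Z, tb, e, t, w))"
  using assms(1) by auto
 have ok: "tab_ok J K tab (u, Z, tb, e, t, w)"
  using a[OF B_nat[of 0]] Wn_lost[of bs "(J, K)" n] unfolding nxt_table[OF assms(2)] by (auto split: if_splits)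
 have "W n (3, Z, tab, e', [], w)" if "e' \<in> set tab" for e'
 proof -
  obtain i where "i < length tab" "e' = tab ! i" using \<open>e' \<in> set tab\<close> by (auto simp: in_set_conv_nth)
  moreover have "length tab \<le> K" using ok by (simp add: tab_ok_def)
  ultimately show ?thesis using a[OF B_nat[of i]] ok unfolding nxt_table[OF assms(2)] by simp
 qed
 with ok show ?thesis by blast
qed

lemma W_leaf:
 assumes "W (Suc n) (3, Z, tb, (l, r, c), t, w)" "length t = m"
 shows "leaf_ok J (l, r, c) t" "!!v. (snd l, v) \<in> set (jel J) ==> lk (jol J) (snd l) ~= jL J ==>
  if zd J c t v = Z then \<exists>e\<in>set tb. covers J (l, r, c) t v e
  else W n (2, zd J c t v, tb, (l, r, c), t, v)"
proof -
 have t: "\<not> length t < m" using assms(2) by simp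
 obtain tab mid where a: "!!z. z \<in> B bs ==> W n (nxt (J, K) (tab, mid) z (3, Z, tb, (l, r, c), t, w))"
  using assms(1) by auto
 show ok: "leaf_ok J (l, r, c) t"
  using a[OF B_nat[of 0]] Wn_lost[of bs "(J, K)" n] unfolding nxt_leaf[OF t] by (auto split: if_splits)
 fix v assume v: "(snd l, v) \<in> set (jel J)" "lk (jol J) (snd l) ~= jL J"
 hence "v \<in> B bs" using edge_less by (intro B_nat) blast
 from a[OF this] v show "if zd J c t v = Z then \<exists>e\<in>set tb. covers J (l, r, c) t v e
  else W n (2, zd J c t v, tb, (l, r, c), t, v)"
  using ok Wn_lost[of bs "(J, K)" n] unfolding nxt_leaf[OF t] by (auto split: if_splits)
qed

text \<open>The paths of the two halves are glued at the midpoint. Different leaves may be reached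
  by different answers of Prover, but they all refer to the arrival times \<open>c\<close> of the
  original entry, so the local checks fit together.\<close>

lemma W_path:
 "W (h + n) (3, Z, tb, (l, r, c), t, w) ==> length t + h = m ==>
  \<exists>\<rho>. \<rho> 0 = l & \<rho> (2 ^ h) = r & (\<forall>i<2^h. \<exists>t'. length t' = m & bval t' = bval t * 2 ^ h + i &
   W n (3, Z, tb, (\<rho> i, \<rho> (Suc i), c), t', w))"
proof (induction h arbitrary: l r t)
 case 0
 thus ?case by (intro exI[of _ "%i. if i = 0 then l else r"]) auto
next
 case (Suc h)
 hence t: "length t < m" by simp
 obtain tab mid where a: "!!z. z \<in> B bs ==> W (h + n) (nxt (J, K) (tab, mid) z (3, Z, tb, (l, r, c), t, w))"
  using Suc.prems(1) by auto
 have "W (h + n) (3, Z, tb, (l, mid, c), False # t, w)" "W (h + n) (3, Z, tb, (mid, r, c), True # t, w)"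
  using a[OF B_nat[of 0]] a[OF B_nat[of 1]] unfolding nxt_segs[OF t] by (simp_all add: segs_def)
 from Suc.IH[OF this(1)] Suc.IH[OF this(2)] Suc.prems(2)
 obtain \<rho>1 \<rho>2 where r: "\<rho>1 0 = l" "\<rho>1 (2 ^ h) = mid" "\<rho>2 0 = mid" "\<rho>2 (2 ^ h) = r"
  "!!i. i < 2 ^ h ==> \<exists>t'. length t' = m & bval t' = bval (False # t) * 2 ^ h + i & W n (3, Z, tb, (\<rho>1 i, \<rho>1 (Suc i), c), t', w)"
  "!!i. i < 2 ^ h ==> \<exists>t'. length t' = m & bval t' = bval (True # t) * 2 ^ h + i & W n (3, Z, tb, (\<rho>2 i, \<rho>2 (Suc i), c), t', w)"
  by auto
 define \<rho> where "\<rho> i = (if i \<le> 2 ^ h then \<rho>1 i else \<rho>2 (i - 2 ^ h))" for i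
 have "\<exists>t'. length t' = m & bval t' = bval t * 2 ^ Suc h + i & W n (3, Z, tb, (\<rho> i, \<rho> (Suc i), c), t', w)"
  if i: "i < 2 ^ Suc h" for i
 proof (cases "i < 2 ^ h")
  case True
  hence "\<rho> i = \<rho>1 i" "\<rho> (Suc i) = \<rho>1 (Suc i)" by (auto simp: \<rho>_def)
  thus ?thesis using r(5)[OF True] by (simp add: ac_simps)
 next
  case False
  hence "\<rho> i = \<rho>2 (i - 2 ^ h)" "\<rho> (Suc i) = \<rho>2 (Suc (i - 2 ^ h))" "i - 2 ^ h < 2 ^ h"
   using i r(2,3) by (auto simp: \<rho>_def Suc_diff_le)
  moreover have "bval (True # t) * 2 ^ h + (i - 2 ^ h) = bval t * 2 ^ Suc h + i"
   using False by (simp add: algebra_simps)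
  ultimately show ?thesis using r(6)[of "i - 2 ^ h"] by metis
 qed
 moreover have "\<rho> 0 = l" "\<rho> (2 ^ Suc h) = r" using r by (auto simp: \<rho>_def)
 ultimately show ?case by blast
qed

end

context vgame
begin

lemma thr_iff: "thr J v \<longleftrightarrow> pay (ev v) \<le> of_rat (th_of (jth J))"
proof -
 obtain s a b where th: "jth J = (s, a, b)" by (cases "jth J")
 have ok: "canon a" "canon b" "b ~= [False]" "s ==> a ~= [False]"
  using jok by (auto simp: jok_def th_ok_def th)
 have 0: "binary 0 = [False]" by (simp add: binary.simps)
 have b: "bval b > 0" using canon_binary[OF ok(2)] ok(3) 0 by (cases "bval b") auto
 have a: "s ==> bval a > 0" using canon_binary[OF ok(1)] ok(4) 0 by (cases "bval a") auto
 have t: "of_rat (th_of (jth J)) = (if s then -1 else 1) * real (bval a) / real (bval b)"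
  using b by (simp add: th_of_def th of_rat_rat)
 show ?thesis
 proof (cases s)
  case True
  hence "of_rat (th_of (jth J)) < (0 :: real)" using a b unfolding t by (simp add: divide_neg_pos)
  moreover have "0 \<le> pay (ev v)" by (cases "ev v") (auto simp: pay_def)
  ultimately have "\<not> pay (ev v) \<le> of_rat (th_of (jth J))" by linarith
  thus ?thesis using True by (simp add: thr_def th)
 next
  case False
  show ?thesis
  proof (cases "fst v")
   case True
   thus ?thesis using False unfolding t by (simp add: thr_def th ev_def pay_def)
  next
   case fin: False
   have "pay (ev v) \<le> of_rat (th_of (jth J)) \<longleftrightarrow> 1 / (1 + real (bval (snd v))) \<le> real (bval a) / real (bval b)"
    using fin False unfolding t by (simp add: ev_def pay_def)
   also have "\<dots> \<longleftrightarrow> real (bval b) \<le> real (bval a) * (1 + real (bval (snd v)))"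
    using b by (simp add: field_simps)
   also have "\<dots> \<longleftrightarrow> bval b \<le> bval a * (bval (snd v) + 1)"
   proof -
    have "real (bval a) * (1 + real (bval (snd v))) = real (bval a * (bval (snd v) + 1))"
     by (simp add: algebra_simps)
    thus ?thesis by (simp only: of_nat_le_iff)
   qed
   finally show ?thesis using fin False by (simp add: thr_def th ble bval_bmul bval_badd)
  qed
 qed
qed

subsection \<open>Soundness\<close>

text \<open>The promises that Prover can defend. With a table on hand, \<open>m\<close> halvings and
  a leaf cost \<open>m + 1\<close> rounds; every player still missing may cause a new table, and
  with it \<open>m + 2\<close> rounds.\<close>

definition Dw :: "node => nat set => nat => enat => bool" where
 "Dw s Z j k \<longleftrightarrow> (\<exists>Zl tab n w. isZ Zl & set Zl = Z & (\<forall>e\<in>set tab. ent_ok J Zl e) &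
   card ({..<np} - Z) * (m + 2) + m + 1 \<le> n & (\<forall>e\<in>set tab. W n (3, Zl, tab, e, [], w)) &
   (\<exists>e\<in>set tab. fst e = s & k \<le> cf (snd (snd e)) j))"

lemma ent_ok_bound:
 assumes "ent_ok J Z (l, r, c)" "i < np"
 shows "cf c i \<le> enat (2 ^ (m - 1)) \<or> cf c i = \<infinity>"
proof (cases "fst (lk c i)")
 case False
 hence "length (snd (lk c i)) \<le> m - 1" using assms by (auto simp: ent_ok_def)
 hence "(2::nat) ^ length (snd (lk c i)) \<le> 2 ^ (m - 1)" by (intro power_increasing) auto
 with bval_less[of "snd (lk c i)"] have "bval (snd (lk c i)) \<le> 2 ^ (m - 1)" by linarith
 thus ?thesis using False by (simp add: cf_def ev_def)
qed (simp add: cf_def ev_def)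

text \<open>A deviation reaching no new target is answered by the current table, which is still
  defensible with the full budget. Otherwise the number of missing players drops, which pays for the
  new table.\<close>

lemma Dw_stepc:
 assumes Z: "isZ Zl" "\<forall>e\<in>set tab. ent_ok J Zl e" "\<forall>e\<in>set tab. W (m + Suc n) (3, Zl, tab, e, [], w0)"
  and n: "card ({..<np} - set Zl) * (m + 2) \<le> n"
  and W: "W (Suc n) (3, Zl, tab, (\<rho> i, \<rho> (Suc i), c), t, w)" "length t = m" "bval t = i"
  and Z0: "zero (cf c) 0 = set Zl"
 shows "stepc Dw \<rho> (cf c) i"
 unfolding stepc_def
proof (intro conjI allI impI)
 note l = W_leaf[OF W(1,2)]
 show mv: "mv (\<rho> i) (\<rho> (Suc i))" and "zero (cf c) (Suc i) = zero (cf c) i \<union> Tg (snd (\<rho> (Suc i)))"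
  using l(1) unfolding leaf W(3) by blast+
 have u: "snd (\<rho> i) < nv" using mv_nodes[OF mv] by (simp add: sets)
 fix v assume v: "snd (\<rho> i) \<notin> controlled (game_of (inst J)) (jL J)" "(snd (\<rho> i), v) \<in> edges (game_of (inst J))"
 let ?Z = "zero (cf c) i \<union> Tg v"
 have Z': "set (zd J c t v) = ?Z" by (simp add: set_zs W(3))
 have *: "if zd J c t v = Zl then \<exists>e\<in>set tab. covers J (\<rho> i, \<rho> (Suc i), c) t v e
  else W n (2, zd J c t v, tab, (\<rho> i, \<rho> (Suc i), c), t, v)"
  using v u by (intro l(2)) (auto simp: sets controlled_iff)
 show "Dw (fst (\<rho> (Suc i)), v) ?Z (ow (snd (\<rho> i))) (cf c (ow (snd (\<rho> i))) - enat (Suc i))"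
 proof (cases "zd J c t v = Zl")
  case True
  then obtain e where e: "e \<in> set tab" "covers J (\<rho> i, \<rho> (Suc i), c) t v e" using * by auto
  have s: "set Zl = ?Z" using Z' True by simp
  show ?thesis unfolding Dw_def s[symmetric]
   by (rule exI[of _ Zl], rule exI[of _ tab], rule exI[of _ "m + Suc n"], rule exI[of _ w0])
    (use Z n e in \<open>auto simp: covers[OF u] W(3)\<close>)
 next
  case False
  hence "set (zd J c t v) ~= set Zl" using isZ_eq[OF isZ_zs(2) Z(1)] by blast
  moreover have "set Zl \<subseteq> ?Z" unfolding Z0[symmetric] by (auto simp: zero_def zero_enat_def[symmetric])
  ultimately have sub: "{..<np} - ?Z \<subset> {..<np} - set Zl"
   using Z' by (auto simp: zero_def sets Tg_iff)
  have "card ({..<np} - ?Z) < card ({..<np} - set Zl)" by (rule psubset_card_mono[OF _ sub]) simp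
  hence "Suc (card ({..<np} - ?Z)) * (m + 2) \<le> card ({..<np} - set Zl) * (m + 2)"
   by (intro mult_le_mono1) simp
  hence "Suc (card ({..<np} - ?Z)) * (m + 2) \<le> n" using n by (rule order_trans)
  then obtain n' where n': "n = Suc n'" "card ({..<np} - ?Z) * (m + 2) + m + 1 \<le> n'" by (cases n) auto
  have "W (Suc n') (2, zd J c t v, tab, (\<rho> i, \<rho> (Suc i), c), t, v)" using * False n'(1) by simp
  from W_table[OF this] obtain tab' where t': "tab_ok J K tab' (2, zd J c t v, tab, (\<rho> i, \<rho> (Suc i), c), t, v)"
   "\<forall>e\<in>set tab'. W n' (3, zd J c t v, tab', e, [], v)" by auto
  show ?thesis unfolding Dw_def Z'[symmetric]
   by (rule exI[of _ "zd J c t v"], rule exI[of _ tab'], rule exI[of _ n'], rule exI[of _ v])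
    (use t' n'(2) Z' isZ_zs(2) in \<open>auto simp: covers[OF u] W(3) tab_ok_def\<close>)
 qed
qed

text \<open>The checked path has length \<open>2 ^ m\<close>. All finite arrivals are at most
  \<open>2 ^ (m - 1)\<close>, and the remaining half is long enough to repeat a node, so
  \<open>lasso\<close> turns the path into an infinite play.\<close>

lemma closed_Dw: "closed Dw"
 unfolding closed_def
proof (intro allI impI)
 fix s Z j k assume "Dw s Z j k"
 then obtain Zl tab n w e where D: "isZ Zl" "set Zl = Z" "\<forall>e\<in>set tab. ent_ok J Zl e"
  "card ({..<np} - Z) * (m + 2) + m + 1 \<le> n" "\<forall>e\<in>set tab. W n (3, Zl, tab, e, [], w)"
  "e \<in> set tab" "fst e = s" "k \<le> cf (snd (snd e)) j" unfolding Dw_def by blast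
 obtain r c where e: "e = (s, r, c)" using D(7) by (cases e) auto
 define n' where "n' = n - (m + 1)"
 have n: "n = m + Suc n'" "card ({..<np} - set Zl) * (m + 2) \<le> n'" using D(2,4) by (auto simp: n'_def)
 have "W (m + Suc n') (3, Zl, tab, (s, r, c), [], w)" using D(5,6) n(1) e by simp
 from W_path[OF this] obtain \<rho> where \<rho>: "\<rho> 0 = s"
  "!!i. i < 2 ^ m ==> \<exists>t'. length t' = m & bval t' = i & W (Suc n') (3, Zl, tab, (\<rho> i, \<rho> (Suc i), c), t', w)"
  by auto
 have c: "ent_ok J Zl (s, r, c)" using D(3,6) e by blast
 have Z0: "zero (cf c) 0 = set Zl" using c set_zs(1)[of c "[]"] by (simp add: ent_ok_def)
 have st: "stepc Dw \<rho> (cf c) i" if "i < 2 ^ m" for i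
  using \<rho>(2)[OF that] Dw_stepc[OF D(1,3) _ n(2) _ _ _ Z0] D(5) unfolding n(1) by blast
 have m2: "(2::nat) ^ m = 2 ^ (m - 1) + 2 ^ (m - 1)" using m_bound(3) by (cases m) auto
 have nodes: "\<rho> i \<in> nodes" if "0 < i" "i \<le> 2 ^ m" for i
 proof -
  have "\<exists>i'. i = Suc i'" using that(1) by (cases i) auto
  then obtain i' where "i = Suc i'" by blast
  hence "mv (\<rho> i') (\<rho> i)" using st[of i'] that(2) by (simp add: stepc_def)
  from mv_nodes[OF this] show ?thesis by blast
 qed
 have "\<rho> n \<in> nodes" if "n \<le> 2 ^ (m - 1) + card nodes" "2 ^ (m - 1) \<le> n" for n
 proof (rule nodes)
  have "(0::nat) < 2 ^ (m - 1)" by simp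
  thus "0 < n" using that(2) by (rule less_le_trans)
  show "n \<le> 2 ^ m" using that(1) m_bound(2) m2 by linarith
 qed
 then obtain a b where ab: "2 ^ (m - 1) \<le> a" "a < b" "b \<le> 2 ^ (m - 1) + card nodes" "\<rho> a = \<rho> b"
  using repeated_node[of "2 ^ (m - 1)" \<rho>] by blast
 have "\<exists>\<rho>'. \<rho>' 0 = \<rho> 0 & cons Dw \<rho>' (cf c)"
 proof (rule lasso[OF ab(2,4)])
  show "stepc Dw \<rho> (cf c) i" if "i < b" for i
   using that ab(3) m_bound(2) m2 by (intro st) linarith
  show "cf c i \<le> enat a \<or> cf c i = \<infinity>" if "i \<in> players (game_of (inst J))" for i
   using ent_ok_bound[OF c, of i] that ab(1) by (auto simp: sets intro: order_trans)
 qed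
 thus "\<exists>\<rho> c. \<rho> 0 = s & zero c 0 = Z & k \<le> c j & cons Dw \<rho> c"
  using \<rho>(1) Z0 D(2,8) e by auto
qed

lemma W_sound:
 assumes "W R (4, z0 J, p)" "(np + 1) * (m + 2) \<le> R"
 shows "\<exists>v. thr J v & Dm (jms J, jv J) (Tg (jv J)) (jL J) (ev v)"
proof -
 obtain R' where R: "R = Suc R'" using assms(2) by (cases R) auto
 obtain tb e t w where p: "p = (tb, e, t, w)" by (cases p)
 obtain tab where tab: "tab_ok J K tab (4, z0 J, tb, e, t, w)" "\<forall>e\<in>set tab. W R' (3, z0 J, tab, e, [], w)"
  using W_table[OF assms(1)[unfolded R p]] by auto
 then obtain e' where e': "e' \<in> set tab" "fst e' = (jms J, jv J)" "thr J (lk (snd (snd e')) (jL J))"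
  by (auto simp: tab_ok_def)
 have "card ({..<np} - Tg (jv J)) \<le> np" using card_mono[of "{..<np}" "{..<np} - Tg (jv J)"] by simp
 hence "card ({..<np} - Tg (jv J)) * (m + 2) \<le> np * (m + 2)" by (rule mult_le_mono1)
 hence "card ({..<np} - Tg (jv J)) * (m + 2) + m + 1 \<le> R'" using assms(2) R by simp
 hence "Dw (jms J, jv J) (Tg (jv J)) (jL J) (ev (lk (snd (snd e')) (jL J)))"
  unfolding Dw_def using tab e' isZ_zs(3) set_zs(3)
  by (intro exI[of _ "z0 J"] exI[of _ tab] exI[of _ R'] exI[of _ w]) (auto simp: tab_ok_def cf_def)
 thus ?thesis using Dm_intro[OF closed_Dw] e'(3) by blast
qed

subsection \<open>Completeness\<close>

text \<open>Completeness of a table: it honours every promise of \<open>Dm\<close> for the set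
  \<open>Z\<close>.\<close>

definition tabG :: "nat set => ent list => bool" where
 "tabG Z tab \<longleftrightarrow> (\<forall>s\<in>nodes. \<forall>j<np. \<forall>k. Dm s Z j k --> (\<exists>e\<in>set tab. fst e = s & k \<le> cf (snd (snd e)) j))"

text \<open>An entry stands for a genuine segment, of length \<open>2 ^ h\<close>, of a consistent
  play that is fixed for all segments below the entry.\<close>

definition seg :: "nat set => ent => bool list => nat => bool" where
 "seg Z e t h \<longleftrightarrow> (\<exists>\<rho>. fst e = \<rho> (bval t * 2 ^ h) & fst (snd e) = \<rho> ((bval t + 1) * 2 ^ h) &
   cons Dm \<rho> (cf (snd (snd e))) & zero (cf (snd (snd e))) 0 = Z & \<rho> 0 \<in> nodes)"

lemma cons_cong:
 assumes "cons D \<rho> c" "!!i. i < np ==> c i = c' i"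
 shows "cons D \<rho> c'"
proof -
 have z: "zero c n = zero c' n" for n unfolding zero_def sets using assms(2) by auto
 have "ow (snd (\<rho> n)) < np" for n
  using assms(1) ow_mv[of "\<rho> n" "\<rho> (Suc n)"] by (simp add: cons_def sets)
 hence "c (ow (snd (\<rho> n))) = c' (ow (snd (\<rho> n)))" for n by (rule assms(2))
 thus ?thesis using assms(1) unfolding cons_def z by simp
qed

lemma nodes_iff: "s \<in> nodes \<longleftrightarrow> fst s < jnm J & snd s < nv"
 unfolding nodes_def sets mem_Times_iff by (simp add: mealy_of_def inst_def)

lemma vs_node: "s \<in> nodes ==> vs s \<le> 4 * X + 3"
 using bounds by (cases s) (auto simp: nodes_iff)

lemma vs_bits: "length b \<le> n ==> vs (b :: bool list) \<le> 4 * n + 1"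
 using vs_list_le[of b 3] vs_bool by fastforce

lemma cons_nodes: "cons D \<rho> c ==> \<rho> 0 \<in> nodes ==> \<rho> n \<in> nodes"
 using mv_nodes[of "\<rho> (n - 1)" "\<rho> n"] by (cases n) (auto simp: cons_def)

text \<open>An entry realising the best promise to \<open>j\<close> serves all weaker ones, so one
  entry per node and player suffices. \<open>cons_bounded\<close> makes its arrival times fit into
  fewer than \<open>m\<close> bits.\<close>

lemma ex_ent:
 assumes Z: "isZ Zl" and s: "s \<in> nodes" "j < np" "Dm s (set Zl) j 0"
 shows "\<exists>e. ent_ok J Zl e & seg (set Zl) e [] m & fst e = s & vs e \<le> 8 * X + 9 + X * (4 * X + 6) &
  (\<forall>k. Dm s (set Zl) j k --> k \<le> cf (snd (snd e)) j)"
proof -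
 have Zp: "set Zl \<subseteq> players (game_of (inst J))" and j: "j \<in> players (game_of (inst J))"
  using Z s(2) by (auto simp: isZ_def sets)
 obtain k0 where k0: "promise (set Zl) (s, j) = Some k0" using promise_le[OF Zp s(1) j s(3)] by blast
 have k0': "k \<le> k0" if "Dm s (set Zl) j k" for k using promise_le[OF Zp s(1) j that] k0 by auto
 obtain \<rho>0 c0 where 0: "\<rho>0 0 = s" "zero c0 0 = set Zl" "k0 \<le> c0 j" "cons Dm \<rho>0 c0"
  using Dm_unfold[OF promise_Dm[OF Zp s(1) j k0]] by blast
 obtain \<rho> c where c: "\<rho> 0 = \<rho>0 0" "zero c 0 = zero c0 0" "cons Dm \<rho> c" "!!i. c0 i \<le> c i"
  "!!i. c i = \<infinity> \<or> c i \<le> enat Cb"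
  using cons_bounded[OF 0(4)] 0(1) s(1) by metis
 have "\<exists>v. ev v = c i & length (snd v) < m" for i
 proof (cases "c i")
  case (enat n)
  hence "n < 2 ^ (m - 1)" using c(5)[of i] m_bound(1) by simp
  then obtain b where "length b = m - 1" "bval b = n" using ex_bval by blast
  thus ?thesis using m_bound(3) enat by (intro exI[of _ "(False, b)"]) (simp add: ev_def)
 next
  case infinity
  thus ?thesis using m_bound(3) by (intro exI[of _ "(True, [])"]) (simp add: ev_def)
 qed
 then obtain f where f: "!!i. ev (f i) = c i" "!!i. length (snd (f i)) < m" by metis
 define cl where "cl = map f [0..<np]"
 have lk: "lk cl i = f i" if "i < np" for i using that by (simp add: cl_def)
 have cf: "c i = cf cl i" if "i < np" for i using that by (simp add: cf_def lk f(1))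
 have cons: "cons Dm \<rho> (cf cl)" by (rule cons_cong[OF c(3) cf])
 have z: "zero (cf cl) 0 = set Zl" unfolding c(2)[symmetric, unfolded 0(2)] zero_def sets using cf by auto
 have \<rho>: "\<rho> 0 \<in> nodes" using c(1) 0(1) s(1) by simp
 let ?e = "(s, \<rho> (2 ^ m), cl)"
 have "vs (f i) \<le> 4 * X + 5" for i
  using vs_bits[of "snd (f i)" X] f(2)[of i] bounds(4) vs_bool[of "fst (f i)"] by (cases "f i") simp
 hence "vs cl \<le> 1 + length cl * (4 * X + 5 + 1)" by (intro vs_list_le) (auto simp: cl_def)
 also have "\<dots> \<le> 1 + X * (4 * X + 6)" using bounds(3) mult_le_mono1[OF bounds(3), of "4 * X + 6"] by (simp add: cl_def ac_simps)
 finally have "vs ?e \<le> 8 * X + 9 + X * (4 * X + 6)"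
  using vs_node[OF s(1)] vs_node[OF cons_nodes[OF c(3) \<rho>], of "2 ^ m"] by simp
 moreover have "ent_ok J Zl ?e"
  using isZ_eq[OF isZ_zs(1) Z, of cl "[]"] set_zs(1)[of cl "[]"] z f(2) by (simp add: ent_ok_def lk)
 moreover have "seg (set Zl) ?e [] m"
  unfolding seg_def using cons z \<rho> c(1) 0(1) by (intro exI[of _ \<rho>]) simp
 moreover have "k \<le> cf cl j" if "Dm s (set Zl) j k" for k
  using k0'[OF that] 0(3) c(4)[of j] cf[OF s(2)] by (metis order_trans)
 ultimately show ?thesis by (intro exI[of _ ?e]) simp
qed

lemma ex_table:
 assumes Z: "isZ Zl"
 shows "\<exists>tab. length tab \<le> K & (tab, (0 :: nat, 0 :: nat)) \<in> B bs &
  (\<forall>e\<in>set tab. ent_ok J Zl e & seg (set Zl) e [] m) & tabG (set Zl) tab"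
proof -
 let ?b = "8 * X + 9 + X * (4 * X + 6)"
 obtain f where f: "!!s j. s \<in> nodes ==> j < np ==> Dm s (set Zl) j 0 ==>
  ent_ok J Zl (f s j) & seg (set Zl) (f s j) [] m & fst (f s j) = s & vs (f s j) \<le> ?b &
  (\<forall>k. Dm s (set Zl) j k --> k \<le> cf (snd (snd (f s j))) j)"
  using ex_ent[OF Z] by metis
 let ?l = "List.product (List.product [0..<jnm J] [0..<nv]) [0..<np]"
 define tab where "tab = map (%x. f (fst x) (snd x)) (filter (%x. Dm (fst x) (set Zl) (snd x) 0) ?l)"
 have mem: "e \<in> set tab \<longleftrightarrow> (\<exists>s j. s \<in> nodes & j < np & Dm s (set Zl) j 0 & e = f s j)" for e
  by (force simp: tab_def nodes_iff)
 have "length tab \<le> length ?l" unfolding tab_def length_map by (rule length_filter_le)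
 also have "\<dots> \<le> K" unfolding length_product length_upt diff_zero using bounds by (intro mult_le_mono) auto
 finally have len: "length tab \<le> K" .
 have "vs tab \<le> 1 + length tab * (?b + 1)" by (rule vs_list_le) (use f in \<open>auto simp: mem\<close>)
 also have "\<dots> \<le> 1 + K * (?b + 1)" using len by (rule add_left_mono[OF mult_le_mono1])
 also have "\<dots> \<le> 1 + K * (12 * X + 20 + X * (4 * X + 10))"
  by (rule add_left_mono, rule mult_le_mono2) (simp add: algebra_simps)
 finally have "(tab, (0 :: nat, 0 :: nat)) \<in> B bs" by (intro B_kk) (simp add: kk_def)
 moreover have "tabG (set Zl) tab" unfolding tabG_def
 proof (intro ballI allI impI)
  fix s j k assume s: "s \<in> nodes" "j < np" "Dm s (set Zl) j k"
  hence "Dm s (set Zl) j 0" using Dm_down by simp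
  with s f have "fst (f s j) = s & k \<le> cf (snd (snd (f s j))) j" "f s j \<in> set tab"
   unfolding mem by blast+
  thus "\<exists>e\<in>set tab. fst e = s & k \<le> cf (snd (snd e)) j" by blast
 qed
 moreover have "\<forall>e\<in>set tab. ent_ok J Zl e & seg (set Zl) e [] m" using f by (auto simp: mem)
 ultimately show ?thesis using len by blast
qed

text \<open>The invariant of an honest Prover: tables are complete, challenged segments are genuine,
  and a table is due only for a deviation to which \<open>Dm\<close> makes the required
  promise.\<close>

definition Good :: "pos => bool" where
 "Good p = (case p of (u, Z, tb, (l, r, c), t, w) => u = 1 \<or> isZ Z &
   (u = 4 & (\<exists>v. thr J v & Dm (jms J, jv J) (set Z) (jL J) (ev v)) \<or>
   u = 2 & snd l < nv & (fst r, w) \<in> nodes &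
    Dm (fst r, w) (set Z) (ow (snd l)) (cf c (ow (snd l)) - enat (Suc (bval t))) \<or>
   u = 3 & tabG (set Z) tb & (\<exists>h. length t + h = m & seg (set Z) (l, r, c) t h)))"

lemma init_node: "(jms J, jv J) \<in> nodes" "jL J < np"
 using val by (auto simp: valJ_def nodes_iff)

lemma Good_table:
 assumes "isZ Z" and ex: "!!tab. tabG (set Z) tab ==> length tab \<le> K ==> \<forall>e\<in>set tab. ent_ok J Z e ==>
   tab_ok J K tab (u, Z, tb, e, t, w)" and u: "u = 2 \<or> u = 4"
 shows "\<exists>a\<in>B bs. \<forall>z. Good (nxt (J, K) a z (u, Z, tb, e, t, w))"
proof -
 obtain tab where tab: "length tab \<le> K" "(tab, (0 :: nat, 0 :: nat)) \<in> B bs"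
  "\<forall>e\<in>set tab. ent_ok J Z e & seg (set Z) e [] m" "tabG (set Z) tab" using ex_table[OF assms(1)] by blast
 have ok: "tab_ok J K tab (u, Z, tb, e, t, w)" by (rule ex) (use tab in auto)
 have "Good (nxt (J, K) (tab, (0, 0)) z (u, Z, tb, e, t, w))" for z
 proof (cases "z < length tab")
  case True
  hence "lk tab z \<in> set tab" by simp
  hence "seg (set Z) (lk tab z) [] m" using tab(3) by blast
  thus ?thesis unfolding nxt_table[OF u] using ok True tab(4) assms(1)
   by (cases "tab ! z") (simp add: Good_def)
 next
  case False
  thus ?thesis unfolding nxt_table[OF u] using ok by (cases e) (simp add: Good_def)
 qed
 thus ?thesis by (rule_tac bexI[OF allI tab(2)])
qed

lemma Good_step:
 assumes "Good p" shows "\<exists>a\<in>B bs. \<forall>z. Good (nxt (J, K) a z p)"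
proof -
 obtain u Z tb l r c t w where p: "p = (u, Z, tb, (l, r, c), t, w)" by (cases p) auto
 have B0: "([], (0, 0)) \<in> (B bs :: (ent list \<times> node) set)" by (rule B_kk) (simp add: kk_def)
 from assms consider "u = 1"
  | v where "isZ Z" "u = 4" "thr J v" "Dm (jms J, jv J) (set Z) (jL J) (ev v)"
  | "isZ Z" "u = 2" "snd l < nv" "(fst r, w) \<in> nodes" "Dm (fst r, w) (set Z) (ow (snd l)) (cf c (ow (snd l)) - enat (Suc (bval t)))"
  | h where "isZ Z" "u = 3" "tabG (set Z) tb" "length t + Suc h = m" "seg (set Z) (l, r, c) t (Suc h)"
  | "isZ Z" "u = 3" "tabG (set Z) tb" "length t = m" "seg (set Z) (l, r, c) t 0"
 proof (cases "u = 3 & \<not> u = 1")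
  case True
  then obtain h where h: "isZ Z" "tabG (set Z) tb" "length t + h = m" "seg (set Z) (l, r, c) t h"
   using assms unfolding Good_def p by auto
  show thesis
  proof (cases h)
   case 0
   thus thesis using h True by (intro that(5)) auto
  next
   case (Suc h')
   thus thesis using h True by (intro that(4)[of h']) auto
  qed
 next
  case False
  thus thesis using assms that(1-3) unfolding Good_def p by auto
 qed
 thus ?thesis
 proof cases
  case 1
  thus ?thesis using B0 assms unfolding p by (intro bexI[OF _ B0]) (simp add: nxt_over)
 next
  case 2
  show ?thesis unfolding p
  proof (rule Good_table[OF 2(1)])
   fix tab assume t: "tabG (set Z) tab" "length tab \<le> K" "\<forall>e\<in>set tab. ent_ok J Z e"
   then obtain e where e: "e \<in> set tab" "fst e = (jms J, jv J)" "ev v \<le> cf (snd (snd e)) (jL J)"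
    using 2(4) init_node unfolding tabG_def by blast
   have "pay (cf (snd (snd e)) (jL J)) \<le> of_rat (th_of (jth J))"
    using 2(3) e(3) unfolding thr_iff pay_le_iff[symmetric] by (rule order_trans[rotated])
   hence "thr J (lk (snd (snd e)) (jL J))" by (simp add: thr_iff cf_def)
   thus "tab_ok J K tab (u, Z, tb, (l, r, c), t, w)" for t tb l r c w
    using t e 2(2) by (auto simp: tab_ok_def)
  qed (use 2 in simp)
 next
  case 3
  show ?thesis unfolding p
  proof (rule Good_table[OF 3(1)])
   fix tab assume t: "tabG (set Z) tab" "length tab \<le> K" "\<forall>e\<in>set tab. ent_ok J Z e"
   have "ow (snd l) < np" using ow[of "snd l"] 3(3) by (simp add: sets)
   then obtain e where "e \<in> set tab" "fst e = (fst r, w)"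
    "cf c (ow (snd l)) - enat (Suc (bval t)) \<le> cf (snd (snd e)) (ow (snd l))"
    using 3(4,5) t(1) unfolding tabG_def by blast
   thus "tab_ok J K tab (u, Z, tb, (l, r, c), t, w)"
    using t 3(2) by (auto simp: tab_ok_def covers[OF 3(3)])
  qed (use 3 in simp)
 next
  case 4
  hence t: "length t < m" by simp
  obtain \<rho> where \<rho>: "l = \<rho> (bval t * 2 ^ Suc h)" "r = \<rho> ((bval t + 1) * 2 ^ Suc h)"
   "cons Dm \<rho> (cf c)" "zero (cf c) 0 = set Z" "\<rho> 0 \<in> nodes"
   using 4(5) unfolding seg_def by auto
  let ?mid = "\<rho> ((2 * bval t + 1) * 2 ^ h)"
  have "vs ?mid \<le> 4 * X + 3" by (rule vs_node[OF cons_nodes[OF \<rho>(3,5)]])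
  hence a: "([], ?mid) \<in> (B bs :: (ent list \<times> node) set)" by (intro B_kk) (simp add: kk_def)
  have "seg (set Z) (segs (l, r, c) ?mid z) ((z ~= 0) # t) h" for z
   unfolding seg_def using \<rho> by (intro exI[of _ \<rho>]) (simp add: segs_def ac_simps)
  moreover have "length ((z ~= 0) # t) + h = m" for z using 4(4) by simp
  moreover have "Good (3, Z, tb, e, t, w)" if "length t + h = m" "seg (set Z) e t h" for e t
   using that 4(1,3) by (cases e) (auto simp: Good_def)
  ultimately show ?thesis unfolding p 4(2)
   by (intro bexI[OF _ a] allI) (unfold nxt_segs[OF t], blast)
 next
  case 5
  hence t: "\<not> length t < m" by simp
  obtain \<rho> where \<rho>: "l = \<rho> (bval t)" "r = \<rho> (Suc (bval t))"
   "cons Dm \<rho> (cf c)" "zero (cf c) 0 = set Z" "\<rho> 0 \<in> nodes"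
   using 5(5) unfolding seg_def by auto
  have st: "stepc Dm \<rho> (cf c) (bval t)" using \<rho>(3) by (simp add: cons_stepc)
  hence mv: "mv l r" and lf: "leaf_ok J (l, r, c) t" by (auto simp: leaf stepc_def \<rho>)
  have l: "snd l < nv" using mv_nodes[OF mv] by (simp add: sets)
  have "Good (nxt (J, K) ([], (0, 0)) z p)" for z
  proof (cases "(snd l, z) \<in> set (jel J) & lk (jol J) (snd l) ~= jL J")
   case True
   hence d: "Dm (fst r, z) (set (zd J c t z)) (ow (snd l)) (cf c (ow (snd l)) - enat (Suc (bval t)))"
    using st l unfolding stepc_def \<rho>(1,2)[symmetric] by (simp add: sets controlled_iff set_zs)
   have n: "(fst r, z) \<in> nodes" using mv_nodes[OF mv] edge_less[of "snd l" z] True by (simp add: nodes_iff)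
   show ?thesis
   proof (cases "zd J c t z = Z")
    case Z: True
    have "ow (snd l) < np" using ow[of "snd l"] l by (simp add: sets)
    then obtain e where "e \<in> set tb" "covers J (l, r, c) t z e"
     using 5(3) n d unfolding Z tabG_def covers[OF l] by blast
    thus ?thesis unfolding p 5(2) nxt_leaf[OF t] using lf True Z by (auto simp: Good_def)
   next
    case False
    thus ?thesis unfolding p 5(2) nxt_leaf[OF t] using lf True d n l isZ_zs(2) by (auto simp: Good_def)
   qed
  next
   case False
   thus ?thesis unfolding p 5(2) nxt_leaf[OF t] using lf by (auto simp: Good_def)
  qed
  thus ?thesis by (rule_tac bexI[OF allI B0])
 qed
qed

lemma W_complete: "Good p ==> W n p"
proof (induction n arbitrary: p)
 case 0
 thus ?case by (cases p) (auto simp: Good_def)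
next
 case (Suc n)
 from Good_step[OF Suc.prems] show ?case unfolding Wn.simps using Suc.IH by blast
qed

text \<open>The number of rounds allows for the initial table and one further table per player, with
  \<open>m + 2\<close> rounds each.\<close>

theorem W_iff:
 assumes "(np + 1) * (m + 2) \<le> R"
 shows "W R (4, z0 J, p) \<longleftrightarrow>
  \<not> above (inst J)"
proof -
 have v: "jv J \<in> verts (game_of (inst J))" using val by (simp add: valJ_def sets)
 have "\<not> above (inst J) \<longleftrightarrow>
  (\<exists>D \<rho> c. closed D & cons D \<rho> c & \<rho> 0 = (jms J, jv J) & zero c 0 = Tg (jv J) & pay (c (jL J)) \<le> of_rat (th_of (jth J)))"
  unfolding all_fixed_SPE_above_def inst_sel SPE_iff_closed[OF v, unfolded sets, symmetric] by (auto simp: not_less)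
 also have "\<dots> \<longleftrightarrow> (\<exists>v. thr J v & Dm (jms J, jv J) (Tg (jv J)) (jL J) (ev v))"
 proof
  assume "\<exists>D \<rho> c. closed D & cons D \<rho> c & \<rho> 0 = (jms J, jv J) & zero c 0 = Tg (jv J) & pay (c (jL J)) \<le> of_rat (th_of (jth J))"
  then obtain D \<rho> c where D: "closed D" "cons D \<rho> c" "\<rho> 0 = (jms J, jv J)" "zero c 0 = Tg (jv J)"
   "pay (c (jL J)) \<le> of_rat (th_of (jth J))" by blast
  have "cons Dm \<rho> c" by (rule cons_mono[OF D(2)]) (rule Dm_intro[OF D(1)])
  from Dm_fold[OF this, of "c (jL J)" "jL J"] have "Dm (jms J, jv J) (Tg (jv J)) (jL J) (c (jL J))"
   using D(3,4) by simp
  moreover have "\<exists>v. ev v = c (jL J)"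
  proof (cases "c (jL J)")
   case (enat n)
   thus ?thesis using bval_binary[of n] by (intro exI[of _ "(False, binary n)"]) (simp add: ev_def)
  qed (auto simp: ev_def)
  ultimately show "\<exists>v. thr J v & Dm (jms J, jv J) (Tg (jv J)) (jL J) (ev v)" using D(5) thr_iff by metis
 next
  assume "\<exists>v. thr J v & Dm (jms J, jv J) (Tg (jv J)) (jL J) (ev v)"
  then obtain v where v: "thr J v" "Dm (jms J, jv J) (Tg (jv J)) (jL J) (ev v)" by blast
  then obtain \<rho> c where c: "\<rho> 0 = (jms J, jv J)" "zero c 0 = Tg (jv J)" "ev v \<le> c (jL J)" "cons Dm \<rho> c"
   using Dm_unfold by blast
  have "pay (c (jL J)) \<le> of_rat (th_of (jth J))"
   using v(1) c(3) unfolding thr_iff pay_le_iff[symmetric] by (rule order_trans[rotated])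
  thus "\<exists>D \<rho> c. closed D & cons D \<rho> c & \<rho> 0 = (jms J, jv J) & zero c 0 = Tg (jv J) & pay (c (jL J)) \<le> of_rat (th_of (jth J))"
   using c closed_Dm by blast
 qed
 also have "\<dots> \<longleftrightarrow> W R (4, z0 J, p)"
 proof
  assume "\<exists>v. thr J v & Dm (jms J, jv J) (Tg (jv J)) (jL J) (ev v)"
  hence "Good (4, z0 J, p)"
   by (cases p) (auto simp: Good_def isZ_zs set_zs)
  thus "W R (4, z0 J, p)" by (rule W_complete)
 qed (rule W_sound[OF _ assms])
 finally show ?thesis by simp
qed

end

section \<open>Membership in PSPACE\<close>

lemma len_nd: "length (nd l) = 4 + sum_list (map length l)"
 by (simp add: nd_def length_concat)

lemma len_numb: "length (numb b) = 4 + 2 * length b"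
 by (simp add: numb_def length_concat comp_def sum_list_triv)

lemma len_sum: "(!!x. x \<in> set l ==> 1 \<le> length (f x)) ==> length l \<le> sum_list (map (%x. length (f x)) l)"
 by (induction l) fastforce+

lemma len_wrs: "length l \<le> length (wrs l)" "1 \<le> length (wrs l)"
 using len_sum[of l "%i. numb (binary i)"] by (auto simp: wrs_def len_nd len_numb comp_def)

lemma encJ_length:
 "length (jol J) \<le> length (encJ J)" "length (jel J) \<le> length (encJ J)" "length (jtl J) \<le> length (encJ J)"
 "l \<in> set (jtl J) ==> length l \<le> length (encJ J)" "length (fst (snd (jth J))) \<le> length (encJ J)"
 "length (snd (snd (jth J))) \<le> length (encJ J)" "length (jtr J) \<le> length (encJ J)"
proof -
 note l = len_nd len_numb comp_def
 show "length (jol J) \<le> length (encJ J)" using len_wrs(1)[of "jol J"] by (simp add: encJ_def l)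
 show "length (jel J) \<le> length (encJ J)"
  using len_sum[of "jel J" "%e. wrs [fst e, snd e]"] len_wrs(2) by (simp add: encJ_def l)
 show "length (jtl J) \<le> length (encJ J)"
  using len_sum[of "jtl J" wrs] len_wrs(2) by (simp add: encJ_def l)
 show "length (jtr J) \<le> length (encJ J)"
  using len_sum[of "jtr J" "%r. wrs ([fst r, fst (snd r), fst (snd (snd r))] @ snd (snd (snd r)))"] len_wrs(2)
  by (simp add: encJ_def l)
 show "length (fst (snd (jth J))) \<le> length (encJ J)" "length (snd (snd (jth J))) \<le> length (encJ J)"
  by (simp_all add: encJ_def l)
 assume "l \<in> set (jtl J)"
 hence "length (wrs l) \<le> sum_list (map (%x. length (wrs x)) (jtl J))" by (intro member_le_sum_list) auto
 thus "length l \<le> length (encJ J)" using len_wrs(1)[of l] by (simp add: encJ_def l)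
qed

text \<open>The number of Mealy states is written in binary, but a valid instance lists a transition
  for each of them; so it does not exceed the length of the encoding, and unary arithmetic is
  affordable.\<close>

lemma valJ_less:
 assumes "valJ J" defines "n \<equiv> length (encJ J)"
 shows "jnm J \<le> n" "i \<in> set (jol J) ==> i < n" "e \<in> set (jel J) ==> fst e < n & snd e < n"
  "l \<in> set (jtl J) ==> v \<in> set l ==> v < n" "jL J < n" "jv J < n" "jms J < n"
  "r \<in> set (jtr J) ==> fst r < n & fst (snd r) < n & fst (snd (snd r)) < n & (\<forall>v\<in>set (take 1 (snd (snd (snd r)))). v < n)"
proof -
 have nv: "length (jol J) \<le> n" "length (jtl J) \<le> n" "length (jtr J) \<le> n" unfolding n_def by (rule encJ_length)+
 have v: "jv J < length (jol J)" "\<forall>p\<in>set [0..<jnm J]. \<forall>u\<in>set [0..<length (jol J)]. \<exists>r\<in>set (jtr J). fst r = p & fst (snd r) = u"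
  using assms(1) unfolding valJ_def by blast+
 have "p \<in> fst ` set (jtr J)" if "p < jnm J" for p
  using v(2)[rule_format, of p "jv J"] v(1) that by force
 hence "{..<jnm J} \<subseteq> fst ` set (jtr J)" by blast
 hence "card {..<jnm J} \<le> card (fst ` set (jtr J))" by (intro card_mono) auto
 also have "\<dots> \<le> length (jtr J)" using card_image_le[of "set (jtr J)" fst] card_length[of "jtr J"] by simp
 finally show nm: "jnm J \<le> n" using nv(3) by simp
 show "i \<in> set (jol J) ==> i < n" "l \<in> set (jtl J) ==> v \<in> set l ==> v < n" "jL J < n" "jv J < n" "jms J < n"
 proof -
  have "\<forall>i\<in>set (jol J). i < length (jtl J)" "\<forall>l\<in>set (jtl J). \<forall>v\<in>set l. v < length (jol J)"
   "jL J < length (jtl J)" "jms J < jnm J" using assms(1) unfolding valJ_def by blast+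
  thus "i \<in> set (jol J) ==> i < n" "l \<in> set (jtl J) ==> v \<in> set l ==> v < n" "jL J < n" "jv J < n" "jms J < n"
   using nv nm v(1) by fastforce+
 qed
 have e: "fst e < length (jol J) & snd e < length (jol J)" if "e \<in> set (jel J)" for e
  using assms(1) that unfolding valJ_def by blast
 thus "e \<in> set (jel J) ==> fst e < n & snd e < n" using nv(1) by fastforce
 assume "r \<in> set (jtr J)"
 hence "trok J r" using assms(1) unfolding valJ_def by blast
 hence r: "fst r < jnm J & fst (snd r) < length (jol J) & fst (snd (snd r)) < jnm J &
    (if lk (jol J) (fst (snd r)) = jL J
     then snd (snd (snd r)) ~= [] & (fst (snd r), hd0 (snd (snd (snd r)))) \<in> set (jel J)
     else snd (snd (snd r)) = [])" unfolding trok_def .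
 have "\<forall>v\<in>set (take 1 (snd (snd (snd r)))). v < n"
  using r e[of "(fst (snd r), hd0 (snd (snd (snd r))))"] nv(1)
  by (cases "snd (snd (snd r))") (auto split: if_splits)
 thus "fst r < n & fst (snd r) < n & fst (snd (snd r)) < n & (\<forall>v\<in>set (take 1 (snd (snd (snd r)))). v < n)"
  using r nm nv(1) by auto
qed

text \<open>\<open>mJ\<close> with the number of players replaced by \<open>a\<close> and the number
  of nodes by \<open>a * a\<close>, plus \<open>a\<close> to dominate the other parameters as
  well.\<close>

definition XX :: "nat => nat" where
 "XX a = a + Suc (a + a * a + (2 + a * (a * a + 1)) * (Suc a * (a * a * a)))"

text \<open>One block length for all guesses: the moves of the game, the instance itself
  (\<open>vs_idata\<close>) and the witnesses for \<open>reducible\<close>.\<close>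

definition Kx :: "nat => nat" where
 "Kx a = kk (XX a) + 100 + a * (100 + a * (100 + 10 * a))"

lemma vs_idata:
 assumes "jok J" "valJ J"
 shows "vs J \<le> Kx (length (encJ J))"
proof -
 let ?n = "length (encJ J)"
 obtain ol el tl L v s a b nm ms tr where J: "J = (ol, el, tl, L, v, (s, a, b), nm, ms, tr)"
  by (metis prod.collapse)
 note less = valJ_less[OF assms(2), unfolded J fst_conv snd_conv]
 note len = encJ_length[where J = J, unfolded J fst_conv snd_conv]
 define n where "n = length (encJ (ol, el, tl, L, v, (s, a, b), nm, ms, tr))"
 note less = less[folded n_def] and len = len[folded n_def]
 have list: "vs l \<le> 1 + n * (k + 1)" if "length l \<le> n" "!!a. a \<in> set l ==> vs a \<le> k" for l :: "'z::rep list" and k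
  using vs_list_le[OF that(2)] mult_le_mono1[OF that(1), of "k + 1"] by (meson add_left_mono order_trans)
 have "vs ol \<le> 1 + n * (2 * n + 1 + 1)" by (rule list[OF len(1)]) (use less(2) in fastforce)
 moreover have "vs el \<le> 1 + n * (4 * n + 3 + 1)"
  by (rule list[OF len(2)]) (use less(3) in fastforce)
 moreover have "vs tl \<le> 1 + n * (1 + n * (2 * n + 1 + 1) + 1)"
  by (rule list[OF len(3)], rule list[OF len(4)]) (use less(4) in fastforce)+
 moreover have "vs tr \<le> 1 + n * (8 * n + 12 + 1)"
 proof (rule list[OF len(7)])
  fix r assume r: "r \<in> set tr"
  obtain p u q l where r': "r = (p, u, q, l)" by (cases r) auto
  have "length l \<le> 1" using assms(1) r r' by (auto simp: jok_def J)
  hence "vs l \<le> 2 * n + 3" using less(8)[OF r] by (cases l) (auto simp: r')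
  thus "vs r \<le> 8 * n + 12" using less(8)[OF r] by (simp add: r')
 qed
 moreover have "vs a \<le> 1 + n * (3 + 1)" "vs b \<le> 1 + n * (3 + 1)"
  by (rule list[OF len(5)] list[OF len(6)], rule vs_bool)+
 ultimately have "vs J \<le> 100 + n * (100 + n * (100 + 10 * n))"
  using less(1,5,6,7) vs_bool[of s] unfolding J by (simp add: algebra_simps)
 thus ?thesis unfolding Kx_def J n_def by simp
qed

definition beq :: "bool list => bool list => bool" where
 "beq a b \<longleftrightarrow> ble a b & ble b a"

lemma beq: "beq a b \<longleftrightarrow> bval a = bval b"
 by (auto simp: beq_def ble)

text \<open>A witness \<open>(d, e, f)\<close> shows that the fraction is not in lowest terms.\<close>

definition reducible :: "bool \<times> bool list \<times> bool list => bool list \<times> bool list \<times> bool list => bool" where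
 "reducible r w \<longleftrightarrow> beq (bmul (fst w) (fst (snd w))) (fst (snd r)) &
   beq (bmul (fst w) (snd (snd w))) (snd (snd r)) & \<not> beq (fst w) [True]"

text \<open>A common divisor and the two quotients can be written with \<open>n\<close> bits each;
  three such strings in a triple have a code of size \<open>12 * n + 5\<close>.\<close>

lemma reducible_iff:
 assumes "th_ok r" "length (fst (snd r)) \<le> n" "length (snd (snd r)) \<le> n" "12 * n + 5 \<le> k"
 shows "(\<exists>w\<in>B k. reducible r w) \<longleftrightarrow> \<not> coprime (bval (fst (snd r))) (bval (snd (snd r)))"
proof
 assume "\<exists>w\<in>B k. reducible r w"
 then obtain w where w: "bval (fst w) * bval (fst (snd w)) = bval (fst (snd r))"
  "bval (fst w) * bval (snd (snd w)) = bval (snd (snd r))" "bval (fst w) ~= 1"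
  by (auto simp: reducible_def beq bval_bmul)
 hence "bval (fst w) dvd bval (fst (snd r))" "bval (fst w) dvd bval (snd (snd r))" by (metis dvd_triv_left)+
 thus "\<not> coprime (bval (fst (snd r))) (bval (snd (snd r)))" using w(3) coprime_common_divisor_nat by blast
next
 let ?a = "bval (fst (snd r))" and ?b = "bval (snd (snd r))"
 assume c: "\<not> coprime ?a ?b"
 have "?b ~= 0"
 proof
  assume "?b = 0"
  hence "binary 0 = snd (snd r)" using canon_binary[of "snd (snd r)"] assms(1) by (simp add: th_ok_def)
  thus False using assms(1) by (simp add: th_ok_def binary.simps)
 qed
 define g where "g = gcd ?a ?b"
 have g: "g dvd ?a" "g dvd ?b" "g ~= 1" using c by (auto simp: g_def coprime_iff_gcd_eq_1)
 have le: "y < 2 ^ n" if "y \<le> ?a \<or> y \<le> ?b" for y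
 proof -
  have "(2::nat) ^ length (fst (snd r)) \<le> 2 ^ n" "(2::nat) ^ length (snd (snd r)) \<le> 2 ^ n"
   using assms(2,3) by (auto intro: power_increasing)
  thus ?thesis using bval_less[of "fst (snd r)"] bval_less[of "snd (snd r)"] that by linarith
 qed
 have "g \<le> ?b" using g(2) \<open>?b ~= 0\<close> by (simp add: dvd_imp_le)
 then obtain d e f where d: "length d = n" "bval d = g" and e: "length e = n" "bval e = ?a div g"
  and f: "length f = n" "bval f = ?b div g"
  using ex_bval[OF le[of g]] ex_bval[OF le[of "?a div g"]] ex_bval[OF le[of "?b div g"]] by auto
 have l: "vs (l :: bool list) \<le> 1 + n * (3 + 1)" if "length l = n" for l
  using vs_list_le[of l 3] vs_bool that by simp
 have "(d, e, f) \<in> B k" by (rule B_mem) (use l[OF d(1)] l[OF e(1)] l[OF f(1)] assms(4) in simp)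
 moreover have "reducible r (d, e, f)" using d e f g by (simp add: reducible_def beq bval_bmul)
 ultimately show "\<exists>w\<in>B k. reducible r w" by blast
qed

lemma ex_idata:
 assumes "valid_instance I"
 shows "\<exists>J. inst J = I & jok J & valJ J & coprime (bval (fst (snd (jth J)))) (bval (snd (snd (jth J))))"
proof -
 obtain a b where q: "quotient_of (threshold I) = (a, b)" by (cases "quotient_of (threshold I)")
 have b: "b > 0" "coprime a b" using quotient_of_denom_pos[OF q] quotient_of_coprime[OF q] by auto
 have t: "threshold I = Fract a b" using quotient_of_div[OF q] by (simp add: Fract_of_int_quotient)
 let ?f = "%(p, u, q, o'). (p, u, q, case o' of None => [] | Some v => [v])"
 define J where "J = (owner_list I, edge_list I, target_lists I, leader I, init_vertex I,
  (a < 0, binary (nat \<bar>a\<bar>), binary (nat b)), num_mstates I, mstart_state I, map ?f (mtrans_list I))"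
 have "tr_of (?f r) = r" for r
  by (cases r) (auto simp: tr_of_def opt_def split: option.splits)
 hence tr: "map (%r. tr_of (?f r)) (mtrans_list I) = mtrans_list I" by (intro map_idI)
 have th: "th_of (a < 0, binary (nat \<bar>a\<bar>), binary (nat b)) = Fract a b"
  using b(1) by (simp add: th_of_def bval_binary)
 have inst: "inst J = I"
  unfolding inst_def J_def fst_conv snd_conv th map_map comp_def tr t[symmetric] by simp
 have ne: "binary n ~= [False]" if "n ~= 0" for n
  using binary_eq_iff[of n 0] that by (simp add: binary.simps[of 0])
 have "jok J"
  using b(1) by (auto simp: jok_def J_def th_ok_def canon_bin intro!: ne split: option.splits)
 moreover have "coprime (bval (fst (snd (jth J)))) (bval (snd (snd (jth J))))"
 proof -
  have "gcd (nat \<bar>a\<bar>) (nat b) = 1" using b by (metis abs_of_pos coprime_iff_gcd_eq_1 gcd_int_def nat_one_as_int nat_int)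
  thus ?thesis by (simp add: J_def bval_binary coprime_iff_gcd_eq_1)
 qed
 ultimately show ?thesis using inst assms valJ[of J] by blast
qed

lemma Qp_False: "\<not> Qp qs (%_. False)"
 by (induction qs) auto

lemma Qp_conj: "Qp qs (%w. A & P w) \<longleftrightarrow> A & Qp qs P"
 using Qp_False by (cases A) auto

definition leafR :: "bool => bool list \<times> bool list => bool" where
 "leafR e y = (let n = length (fst y); k = Kx n; J = dec (pD (take k (snd y))) in
   (encJ J = fst y & jok J & valJ J & (e --> detJ J) &
    \<not> reducible (jth J) (dec (pD (take k (drop k (snd y)))))) &
   fst (final k (J, XX n * XX n * XX n) ((n + 1) * (XX n + 2)) (drop (k + k) (snd y)) (4, z0 J, [], ((0, 0), (0, 0), []), [], 0)) = 0)"

definition prefixQ :: "nat => bool list" where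
 "prefixQ n = replicate (Kx n) True @ replicate (Kx n) False @
   concat (replicate ((n + 1) * (XX n + 2)) (replicate (Kx n) False @ replicate (Kx n) True))"

lemma leafR_Qp:
 "Qp (prefixQ (length x)) (%w. leafR e (x, w)) \<longleftrightarrow>
  (\<exists>I. x = encode I & valid_instance I & (e --> deterministic_mealy (game_of I) (mealy_of I)) &
   above I)"
proof -
 let ?n = "length x"
 let ?k = "Kx ?n" and ?X = "XX ?n" and ?R = "(?n + 1) * (XX ?n + 2)"
 let ?p = "%J. (4, z0 J, [], ((0, 0), (0, 0), []), [], 0) :: pos"
 have "Qp (prefixQ ?n) (%w. leafR e (x, w)) \<longleftrightarrow> (\<exists>J\<in>B ?k. \<forall>d\<in>B ?k. (encJ J = x & jok J & valJ J & (e --> detJ J) &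
    \<not> reducible (jth J) d) & \<not> Wn ?k (J, ?X * ?X * ?X) ?R (?p J))"
 proof -
  have l: "leafR e (x, u @ v @ w) \<longleftrightarrow> (encJ (dec (pD u)) = x & jok (dec (pD u)) & valJ (dec (pD u)) & (e --> detJ (dec (pD u))) &
    \<not> reducible (jth (dec (pD u) :: idata)) (dec (pD v))) & fst (final ?k (dec (pD u), ?X * ?X * ?X) ?R w (?p (dec (pD u)))) = 0"
   if "length u = ?k" "length v = ?k" for u v w
   using that unfolding leafR_def Let_def fst_conv snd_conv by simp
  have "Qp (concat (replicate ?R (replicate ?k False @ replicate ?k True))) (%w. leafR e (x, u @ v @ w)) \<longleftrightarrow>
    (encJ (dec (pD u)) = x & jok (dec (pD u)) & valJ (dec (pD u)) & (e --> detJ (dec (pD u))) &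
    \<not> reducible (jth (dec (pD u) :: idata)) (dec (pD v))) & \<not> Wn ?k (dec (pD u), ?X * ?X * ?X) ?R (?p (dec (pD u)))"
   if "length u = ?k" "length v = ?k" for u v
   unfolding l[OF that] Qp_conj Wn_Qp ..
  thus ?thesis unfolding prefixQ_def Qp_append if_True if_False B_ex B_all
   by (intro ex_cong1 conj_cong all_cong1 imp_cong HOL.refl)
 qed
 also have "\<dots> \<longleftrightarrow> (\<exists>J\<in>B ?k. encJ J = x & jok J & valJ J & (e --> detJ J) &
   (\<forall>d\<in>B ?k. \<not> reducible (jth J) d) & \<not> Wn ?k (J, ?X * ?X * ?X) ?R (?p J))"
 proof -
  \<comment> \<open>Since the range is nonempty, the universal quantifier can be moved past the
    conjuncts that do not mention the witness.\<close>
  have "B ?k ~= ({} :: (bool list \<times> bool list \<times> bool list) set)"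
   using B_mem[of "([], [], [])" ?k] by (auto simp: Kx_def)
  thus ?thesis by blast
 qed
 also have "\<dots> \<longleftrightarrow> (\<exists>J\<in>B ?k. (encJ J = x & jok J & valJ J & (e --> detJ J) &
   coprime (bval (fst (snd (jth J)))) (bval (snd (snd (jth J))))) &
   above (inst J))"
 proof (rule bex_cong[OF HOL.refl])
  fix J
  show "(encJ J = x & jok J & valJ J & (e --> detJ J) &
   (\<forall>d\<in>B ?k. \<not> reducible (jth J) d) & \<not> Wn ?k (J, ?X * ?X * ?X) ?R (?p J)) =
   ((encJ J = x & jok J & valJ J & (e --> detJ J) &
   coprime (bval (fst (snd (jth J)))) (bval (snd (snd (jth J))))) &
   above (inst J))"
  proof (cases "encJ J = x & jok J & valJ J")
   case True
   hence x: "encJ J = x" and ok: "jok J" "valJ J" by auto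
   note len = encJ_length[where J = J, unfolded x]
   have nm: "jnm J \<le> ?n" using valJ_less(1)[OF ok(2)] x by simp
   have "jnm J * length (jol J) \<le> ?n * ?n" by (rule mult_le_mono[OF nm len(1)])
   hence m: "mJ J \<le> Suc (?n + ?n * ?n + (2 + ?n * (?n * ?n + 1)) * (Suc ?n * (?n * ?n * ?n)))"
    unfolding mJ_def Let_def using len(1,3) nm by (intro Suc_le_mono[THEN iffD2] add_mono mult_le_mono) auto
   interpret vgame J ?X ?k
    using ok nm len m by unfold_locales (auto simp: XX_def Kx_def intro: trans_le_add1)
   have R: "(length (jtl J) + 1) * (mJ J + 2) \<le> ?R"
    using len(3) m by (intro mult_le_mono) (auto simp: XX_def)
   have "(\<exists>w\<in>B ?k. reducible (jth J) w) \<longleftrightarrow> \<not> coprime (bval (fst (snd (jth J)))) (bval (snd (snd (jth J))))"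
    by (rule reducible_iff[OF _ len(5,6)]) (use ok(1) in \<open>auto simp: jok_def Kx_def distrib_left\<close>)
   thus ?thesis using W_iff[OF R] by auto
  qed auto
 qed
 also have "\<dots> \<longleftrightarrow> (\<exists>I. x = encode I & valid_instance I & (e --> deterministic_mealy (game_of I) (mealy_of I)) &
   above I)" (is "?l \<longleftrightarrow> ?r")
 proof
  assume ?l
  then obtain J where J: "encJ J = x" "jok J" "valJ J" "e --> detJ J"
   "coprime (bval (fst (snd (jth J)))) (bval (snd (snd (jth J))))"
   "above (inst J)" by blast
  thus ?r using encJ[OF J(2,5)] valJ[of J] detJ[OF J(2,3)]
   by (intro exI[of _ "inst J"]) (simp add: inst_def)
 next
  assume ?r
  then obtain I where I: "x = encode I" "valid_instance I" "e --> deterministic_mealy (game_of I) (mealy_of I)"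
   "above I" by blast
  obtain J where J: "inst J = I" "jok J" "valJ J" "coprime (bval (fst (snd (jth J)))) (bval (snd (snd (jth J))))"
   using ex_idata[OF I(2)] by blast
  have x: "encJ J = x" using encJ[OF J(2,4)] J(1) I(1) by simp
  have "J \<in> B ?k" by (rule B_mem) (use vs_idata[OF J(2,3)] x in simp)
  thus ?l using x J I detJ[OF J(2,3)] by (intro bexI[of _ J]) (auto simp: inst_def)
 qed
 finally show ?thesis .
qed

lemma fp_Kx: "fp f ==> fp (%x. Kx (f x))" and fp_XX: "fp f ==> fp (%x. XX (f x))"
 unfolding Kx_def kk_def XX_def by (intro fp_intros; assumption)+

lemma fp_leafR: "fp (leafR e)"
proof -
 have z: "fp (%J. z0 J)" unfolding z0_def by (intro fp_intros)
 have j: "fp (%J. jok J)" unfolding jok_def th_ok_def by (intro fp_intros fp_const)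
 have r: "fp (%x. reducible (fst x) (snd x))" unfolding reducible_def beq_def by (intro fp_intros)
 note r' = fp_comp[OF r fp_Pair, simplified fst_conv snd_conv]
 note f' = fp_comp[OF fp_final fp_Pair[OF _ fp_Pair[OF _ fp_Pair[OF _ fp_Pair]]], simplified fst_conv snd_conv]
 show ?thesis unfolding leafR_def Let_def
  by (intro fp_intros fp_Kx fp_XX r' f' fp_comp[OF j] fp_comp[OF z] fp_const)
qed

lemma fp_prefixQ: "fp (%x :: bool list. prefixQ (length x))"
 unfolding prefixQ_def by (intro fp_intros fp_Kx fp_XX)

theorem verification_PSPACE: "reach_SP_verification \<in> PSPACE" "reach_det_SP_verification \<in> PSPACE"
proof -
 show "reach_SP_verification \<in> PSPACE"
  by (rule alternation_PSPACE[OF fp_prefixQ fp_leafR[of False]])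
   (unfold leafR_Qp, auto simp: reach_SP_verification_def)
 show "reach_det_SP_verification \<in> PSPACE"
  by (rule alternation_PSPACE[OF fp_prefixQ fp_leafR[of True]])
   (unfold leafR_Qp, auto simp: reach_det_SP_verification_def)
qed

section \<open>Quantified Boolean formulas as games\<close>

text \<open>With \<open>V\<close> variables, vertex \<open>r < V\<close> chooses the value of variable \<open>r\<close> and belongs to player 1 or 2, depending on
 the quantifier; the literals of \<open>r\<close> are \<open>V + r\<close> and \<open>2 V + r\<close>. Then clause \<open>j\<close>, owned by player
 \<open>3 + j\<close> who wants to see a literal of the clause or the exit, may leave for the exit.\<close>

definition qn :: "bool list => nat => nat" where
 "qn qs cn = length qs + length qs + length qs + cn + 2"

definition qex :: "bool list => nat => nat" where
 "qex qs cn = length qs + length qs + length qs + cn + 1"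

definition qown :: "bool list => nat => nat => nat" where
 "qown qs cn v = (if v < length qs then (if lk qs v then 1 else 2)
   else if v < length qs + length qs + length qs then 1
   else if v < length qs + length qs + length qs + cn then v - (length qs + length qs + length qs) + 3 else 1)"

definition qnx :: "bool list => nat => nat" where
 "qnx qs r = (if Suc r < length qs then Suc r else length qs + length qs + length qs)"

definition qsucc :: "bool list => nat => nat => nat list" where
 "qsucc qs cn v = (if v < length qs then [length qs + v, length qs + length qs + v]
   else if v < length qs + length qs then [qnx qs (v - length qs)]
   else if v < length qs + length qs + length qs then [qnx qs (v - (length qs + length qs))]
   else if v < length qs + length qs + length qs + cn then [Suc v, qex qs cn] else [v])"

definition qlit :: "bool list => nat => bool => nat" where
 "qlit qs r b = (if b then length qs + r else length qs + length qs + r)"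

text \<open>Leader owns no vertex, so a one-state machine that is deterministic suffices. The
  threshold is 0, so a violation means that the exit is never reached. Players 0 and 2 have the exit
  as target; player 1 has none and never gains by deviating.\<close>

definition qinst :: "bool list => (nat \<times> bool) list list => idata" where
 "qinst qs cls = (map (%v. qown qs (length cls) v) [0..<qn qs (length cls)],
   concat (map (%v. map (%w. (v, w)) (qsucc qs (length cls) v)) [0..<qn qs (length cls)]),
   [[qex qs (length cls)], [], [qex qs (length cls)]] @
    map (%cl. qex qs (length cls) # map (%l. qlit qs (fst l) (snd l)) cl) cls,
   0, 0, (False, [False], [True]), 1, 0, map (%v. (0, v, 0, [])) [0..<qn qs (length cls)])"

lemma fp_qinst: "fp f ==> fp g ==> fp (%x. qinst (f x) (g x))"
proof -
 have "fp (%y. qinst (fst y) (snd y))"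
  unfolding qinst_def qn_def qex_def qown_def qnx_def qsucc_def qlit_def append.simps
  by (intro fp_intros fp_const)
 from fp_comp[OF this fp_Pair, simplified fst_conv snd_conv] show "fp f ==> fp g ==> fp (%x. qinst (f x) (g x))" .
qed

locale qgame =
 fixes qs :: "bool list" and cls :: "(nat \<times> bool) list list"
 assumes vn: "qs ~= []" and vars: "!!cl l. cl \<in> set cls ==> l \<in> set cl ==> fst l < length qs"
begin

abbreviation "vn \<equiv> length qs"
abbreviation "cn \<equiv> length cls"
abbreviation "wn \<equiv> vn + vn + vn"
abbreviation "xt \<equiv> qex qs cn"
abbreviation "tn \<equiv> qn qs cn"
abbreviation "J \<equiv> qinst qs cls"
abbreviation "sc \<equiv> qsucc qs cn"
abbreviation "lit \<equiv> qlit qs"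

lemmas defs = qn_def qex_def qown_def qnx_def qsucc_def qlit_def

lemma sel: "jol J = map (qown qs cn) [0..<tn]" "jtl J = [[xt], [], [xt]] @ map (%cl. xt # map (%l. lit (fst l) (snd l)) cl) cls"
 "jL J = 0" "jv J = 0" "jth J = (False, [False], [True])" "jnm J = 1" "jms J = 0"
 "jtr J = map (%v. (0, v, 0, [])) [0..<tn]"
 by (simp_all add: qinst_def)

lemma edge: "(u, v) \<in> set (jel J) \<longleftrightarrow> u < tn & v \<in> set (sc u)"
 by (auto simp: qinst_def)

lemma sc_less: "u < tn ==> v \<in> set (sc u) ==> v < tn"
 using vn by (auto simp: defs split: if_splits)

lemma own: "qown qs cn u ~= 0" "qown qs cn u < cn + 3"
 by (auto simp: defs)

lemma jok: "jok J"
 by (auto simp: jok_def sel th_ok_def canon_def)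

lemma valJ: "valJ J"
 unfolding valJ_def
proof (intro conjI)
 show "\<forall>e\<in>set (jel J). fst e < length (jol J) & snd e < length (jol J)"
  using edge sc_less by (auto simp: sel)
 have "sc v ~= []" for v by (simp add: defs)
 hence "(v, hd (sc v)) \<in> set (jel J)" if "v < tn" for v using that by (simp add: edge)
 thus "\<forall>v\<in>set [0..<length (jol J)]. \<exists>e\<in>set (jel J). fst e = v" by (force simp: sel)
 have "qown qs cn i < Suc (Suc (Suc cn))" for i using own(2)[of i] by simp
 thus "\<forall>i\<in>set (jol J). i < length (jtl J)" by (auto simp: sel)
 have "lit (fst l) (snd l) < tn" if "cl \<in> set cls" "l \<in> set cl" for cl l
  using vars[OF that] by (auto simp: defs)
 thus "\<forall>l\<in>set (jtl J). \<forall>v\<in>set l. v < length (jol J)"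
  by (auto simp: sel) (auto simp: defs)
 show "jL J < length (jtl J)" "jv J < length (jol J)" "jms J < jnm J" by (simp_all add: sel) (simp add: defs)
 show "\<forall>r\<in>set (jtr J). trok J r"
  using own(1) by (auto simp: sel trok_def)
 show "\<forall>p\<in>set [0..<jnm J]. \<forall>u\<in>set [0..<length (jol J)]. \<exists>r\<in>set (jtr J). fst r = p & fst (snd r) = u"
  by (auto simp: sel)
qed

sublocale vgame J "length (jol J) + length (jtl J) + mJ J + 1" "kk (length (jol J) + length (jtl J) + mJ J + 1)"
 using jok valJ by unfold_locales (simp_all add: sel)

lemma detJ: "detJ J"
 by (auto simp: detJ_def sel)

lemma mv: "mv s s' \<longleftrightarrow> fst s = 0 & fst s' = 0 & snd s < tn & snd s' \<in> set (sc (snd s))"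
 unfolding mv_iff mvJ_def edge by (auto simp: sel own(1))

lemma ow_q: "v < tn ==> ow v = qown qs cn v"
 by (simp add: ow_lk sel)

lemma not_L: "u < tn ==> u \<notin> controlled (game_of (inst J)) (jL J)"
 using own(1) by (simp add: controlled_iff sel)

lemma TgI: "0 \<in> Tg w \<longleftrightarrow> w = xt" "Suc 0 \<notin> Tg w" "2 \<in> Tg w \<longleftrightarrow> w = xt"
 "3 + j \<in> Tg w \<longleftrightarrow> j < cn & (w = xt \<or> (\<exists>l\<in>set (cls ! j). w = lit (fst l) (snd l)))"
proof -
 show "0 \<in> Tg w \<longleftrightarrow> w = xt" "Suc 0 \<notin> Tg w" "2 \<in> Tg w \<longleftrightarrow> w = xt"
  unfolding Tg_iff by (auto simp: sel numeral_2_eq_2)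
 have "lk (jtl J) (3 + j) = xt # map (%l. lit (fst l) (snd l)) (cls ! j)" if "j < cn"
  using that by (simp add: sel numeral_3_eq_3)
 thus "3 + j \<in> Tg w \<longleftrightarrow> j < cn & (w = xt \<or> (\<exists>l\<in>set (cls ! j). w = lit (fst l) (snd l)))"
  unfolding Tg_iff by (cases "j < cn") (auto simp: sel)
qed

lemma Tg_none:
 assumes "w ~= xt" "!!j. 3 + j \<notin> Tg w" shows "Tg w = {}"
proof -
 have "i = 0 \<or> i = Suc 0 \<or> i = 2 \<or> (\<exists>j. i = 3 + j)" for i :: nat by presburger
 hence "i \<notin> Tg w" for i using assms TgI(1-3) by metis
 thus ?thesis by blast
qed

lemma Tg_cl: "wn \<le> w ==> w ~= xt ==> Tg w = {}"
proof (rule Tg_none)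
 fix j assume w: "wn \<le> w" "w ~= xt"
 show "3 + j \<notin> Tg w"
 proof
  assume "3 + j \<in> Tg w"
  then obtain l where j: "j < cn" and l: "l \<in> set (cls ! j)" "w = lit (fst l) (snd l)" using w(2) TgI(4) by blast
  thus False using vars[OF nth_mem[OF j] l(1)] w(1) by (auto simp: qlit_def split: if_splits)
 qed
qed

lemma lit_iff: "r < vn ==> r' < vn ==> lit r b = lit r' b' \<longleftrightarrow> r = r' & b = b'"
 by (auto simp: qlit_def)

lemma Tg_lit:
 assumes r: "r < vn" shows "3 + j \<in> Tg (lit r b) \<longleftrightarrow> j < cn & (r, b) \<in> set (cls ! j)"
proof (cases "j < cn")
 case True
 have "lit r b ~= xt" using r by (simp add: qex_def qlit_def)
 moreover have "(\<exists>l\<in>set (cls ! j). lit r b = lit (fst l) (snd l)) \<longleftrightarrow> (r, b) \<in> set (cls ! j)"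
 proof
  assume "\<exists>l\<in>set (cls ! j). lit r b = lit (fst l) (snd l)"
  then obtain l where l: "l \<in> set (cls ! j)" "lit r b = lit (fst l) (snd l)" by blast
  have "fst l < vn" by (rule vars[OF nth_mem[OF True] l(1)])
  hence "l = (r, b)" using l(2) lit_iff[OF r] by (cases l) auto
  thus "(r, b) \<in> set (cls ! j)" using l(1) by simp
 qed (rule bexI[of _ "(r, b)"], simp_all)
 ultimately show ?thesis using True by (simp only: TgI simp_thms)
qed (simp only: TgI simp_thms)

lemma Tg_choose: "r < vn ==> Tg r = {}"
 by (rule Tg_none) (auto simp: TgI qex_def qlit_def)

text \<open>The time to the exit from clause \<open>j\<close>: the first owner from \<open>j\<close>
  on that has not reached a target leaves. It is infinite if there is no such owner, as the play
  then ends in a loop behind the clauses.\<close>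

definition cv :: "nat => nat set => enat" where
 "cv j Z = (if \<forall>i<cn. j \<le> i --> 3 + i \<in> Z then \<infinity> else enat (Suc ((LEAST i. j \<le> i & i < cn & 3 + i \<notin> Z) - j)))"

lemma cv_step: "3 + j \<in> Z ==> cv j Z = eSuc (cv (Suc j) Z)"
proof (cases "\<forall>i<cn. j \<le> i --> 3 + i \<in> Z")
 case False
 assume j: "3 + j \<in> Z"
 have eq: "(j \<le> i & i < cn & 3 + i \<notin> Z) \<longleftrightarrow> (Suc j \<le> i & i < cn & 3 + i \<notin> Z)" for i
  using j by (cases "i = j") auto
 define l where "l = (LEAST i. Suc j \<le> i & i < cn & 3 + i \<notin> Z)"
 obtain i where "Suc j \<le> i & i < cn & 3 + i \<notin> Z" using False eq by blast
 hence l: "Suc j \<le> l & l < cn & 3 + l \<notin> Z" unfolding l_def by (rule LeastI)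
 hence "l - j = Suc (l - Suc j)" by linarith
 moreover have "\<not> (\<forall>i<cn. Suc j \<le> i --> 3 + i \<in> Z)" using l by blast
 ultimately show ?thesis using False unfolding cv_def eq l_def[symmetric] by (simp add: eSuc_enat)
next
 case True
 thus ?thesis by (simp add: cv_def)
qed

lemma cv_fail: "j < cn ==> 3 + j \<notin> Z ==> cv j Z = eSuc 0"
proof -
 assume j: "j < cn" "3 + j \<notin> Z"
 hence "(LEAST i. j \<le> i & i < cn & 3 + i \<notin> Z) = j" by (intro Least_equality) auto
 thus ?thesis using j by (auto simp: cv_def one_enat_def one_eSuc[symmetric])
qed

text \<open>The time until the exit is reached, if player 1 maximizes and player 2 minimizes it.\<close>

fun val :: "bool list => nat => nat set => enat" where
 "val [] r Z = cv 0 Z"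
| "val (q # l) r Z = eSuc (eSuc ((if q then max else min)
   (val l (Suc r) (Z \<union> Tg (lit r True))) (val l (Suc r) (Z \<union> Tg (lit r False)))))"

definition et :: "nat => nat set => enat" where
 "et v Z = (if v < vn then val (drop v qs) v Z
   else if v < vn + vn then eSuc (val (drop (Suc (v - vn)) qs) (Suc (v - vn)) Z)
   else if v < wn then eSuc (val (drop (Suc (v - (vn + vn))) qs) (Suc (v - (vn + vn))) Z)
   else if v < wn + cn then cv (v - wn) Z
   else if v = xt then 0 else \<infinity>)"

text \<open>The move on the canonical equilibrium play: optimal choices with respect to
  \<open>et\<close> at the variables, and the exit at a clause whose owner has reached no
  target.\<close>

definition F :: "nat => nat set => nat" where
 "F v Z = (if v < vn then lit v (if qs ! v then et (lit v False) (Z \<union> Tg (lit v False)) \<le> et (lit v True) (Z \<union> Tg (lit v True))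
    else et (lit v True) (Z \<union> Tg (lit v True)) \<le> et (lit v False) (Z \<union> Tg (lit v False)))
   else if wn \<le> v & v < wn + cn & 3 + (v - wn) \<notin> Z then xt else hd (sc v))"

lemma et_nx: "r < vn ==> et (qnx qs r) Z = val (drop (Suc r) qs) (Suc r) Z"
proof (cases "Suc r < vn")
 case False
 assume "r < vn"
 with False have "drop (Suc r) qs = []" by simp
 moreover have "et wn Z = cv 0 Z" by (auto simp: et_def cv_def qex_def)
 ultimately show ?thesis using False by (simp add: qnx_def)
qed (simp add: qnx_def et_def)

lemma et_lit: "r < vn ==> et (lit r b) Z = eSuc (val (drop (Suc r) qs) (Suc r) Z)"
 by (simp add: et_def qlit_def qex_def)

lemma et_choose: "r < vn ==> et r Z = eSuc ((if qs ! r then max else min)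
  (et (lit r True) (Z \<union> Tg (lit r True))) (et (lit r False) (Z \<union> Tg (lit r False))))"
 by (simp add: et_lit) (simp add: et_def Cons_nth_drop_Suc[symmetric] max_def min_def)

lemma sc_choose: "r < vn ==> set (sc r) = {lit r True, lit r False}"
 by (auto simp: defs)

lemma sc_lit: "r < vn ==> sc (lit r b) = [qnx qs r]"
 by (auto simp: qsucc_def qlit_def)

lemma vertex_cases:
 assumes "v < tn"
 obtains "v < vn" | r b where "r < vn" "v = lit r b" | j where "j < cn" "v = wn + j" | "v = wn + cn" | "v = xt"
proof -
 consider "v < vn" | "vn \<le> v" "v < vn + vn" | "vn + vn \<le> v" "v < wn" | "wn \<le> v" "v < wn + cn" | "v = wn + cn" | "v = Suc (wn + cn)"
  using assms unfolding qn_def by linarith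
 thus thesis
 proof cases
  case 1 thus thesis by (rule that(1))
 next
  case 2 thus thesis by (intro that(2)[of "v - vn" True]) (auto simp: qlit_def)
 next
  case 3 thus thesis by (intro that(2)[of "v - (vn + vn)" False]) (auto simp: qlit_def)
 next
  case 4 thus thesis by (intro that(3)[of "v - wn"]) auto
 next
  case 5 thus thesis by (rule that(4))
 next
  case 6 thus thesis by (intro that(5)) (simp add: qex_def)
 qed
qed

lemma sc_clause: "j < cn ==> sc (wn + j) = [Suc (wn + j), xt]" and sc_goal: "sc (wn + cn) = [wn + cn]" and sc_ex: "sc xt = [xt]"
 by (auto simp: qsucc_def qex_def)

lemma Tg_nx: "r < vn ==> Tg (qnx qs r) = {}"
 using Tg_choose[of "Suc r"] Tg_cl[of wn] by (auto simp: qnx_def qex_def)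

lemma et_ex: "et xt Z = 0" and et_goal: "et (wn + cn) Z = \<infinity>"
 by (auto simp: et_def qex_def)

lemma et_clause: "j \<le> cn ==> et (wn + j) Z = cv j Z"
 by (cases "j = cn") (auto simp: et_def qex_def cv_def)

lemma F_step:
 assumes "v < tn"
 shows "F v Z \<in> set (sc v)" "v ~= xt ==> et v Z = eSuc (et (F v Z) (Z \<union> Tg (F v Z)))"
proof -
 have "F v Z \<in> set (sc v) & (v ~= xt --> et v Z = eSuc (et (F v Z) (Z \<union> Tg (F v Z))))"
  using assms
 proof (cases rule: vertex_cases)
  case 1
  let ?e = "%b. et (lit v b) (Z \<union> Tg (lit v b))"
  define \<beta> where "\<beta> \<longleftrightarrow> (if qs ! v then ?e False \<le> ?e True else ?e True \<le> ?e False)"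
  have m: "(if qs ! v then max else min) (?e True) (?e False) = ?e \<beta>"
   unfolding \<beta>_def by (cases "qs ! v"; cases "?e True \<le> ?e False"; cases "?e False \<le> ?e True")
    (simp_all add: max_def min_def)
  have "F v Z = lit v \<beta>" using 1 unfolding F_def \<beta>_def by simp
  thus ?thesis unfolding et_choose[OF 1] m sc_choose[OF 1] by (cases \<beta>) auto
 next
  case (2 r b)
  hence "F v Z = qnx qs r" using sc_lit[OF 2(1), of b] by (auto simp: F_def qlit_def)
  thus ?thesis using 2 by (simp add: sc_lit Tg_nx et_nx et_lit)
 next
  case (3 j)
  hence F: "F v Z = (if 3 + j \<in> Z then Suc (wn + j) else xt)" by (simp add: F_def sc_clause)
  have t: "Tg (Suc (wn + j)) = {}" using 3(1) by (intro Tg_cl) (auto simp: qex_def)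
  have "et (Suc (wn + j)) Z = cv (Suc j) Z" using et_clause[of "Suc j" Z] 3(1) by simp
  thus ?thesis using 3 cv_step[of j Z] cv_fail[of j Z] t et_clause[of j Z] unfolding F by (auto simp: sc_clause et_ex)
 next
  case 4
  thus ?thesis by (auto simp: F_def sc_goal et_goal)
 next
  case 5
  thus ?thesis by (auto simp: F_def sc_ex) (auto simp: qex_def)
 qed
 thus "F v Z \<in> set (sc v)" "v ~= xt ==> et v Z = eSuc (et (F v Z) (Z \<union> Tg (F v Z)))" by auto
qed

lemma et_0: "v < tn ==> et v Z = 0 \<longleftrightarrow> v = xt"
 using F_step(2)[of v Z] et_ex by (cases "v = xt") simp_all

text \<open>A maximum is infinite if one argument is, a minimum if both are; so infinite values
  behave like truth under the quantifiers.\<close>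

lemma val_Qp: "r + length l = vn ==> val l r Z = \<infinity> \<longleftrightarrow>
 Qp l (%w. \<forall>j<cn. 3 + j \<in> Z \<or> (\<exists>i<length l. (r + i, w ! i) \<in> set (cls ! j)))"
proof (induction l arbitrary: r Z)
 case Nil
 thus ?case by (auto simp: cv_def)
next
 case (Cons q l)
 have eS: "eSuc x = \<infinity> \<longleftrightarrow> x = \<infinity>" for x by (cases x) (auto simp: eSuc_enat)
 have mm: "max x y = \<infinity> \<longleftrightarrow> x = \<infinity> \<or> y = \<infinity>" "min x y = \<infinity> \<longleftrightarrow> x = \<infinity> & y = \<infinity>" for x y :: enat
  by (auto simp: max_def min_def)
 have IH: "val l (Suc r) (Z \<union> Tg (lit r b)) = \<infinity> \<longleftrightarrow>
   Qp l (%w. \<forall>j<cn. 3 + j \<in> Z \<or> (\<exists>i<length (q # l). (r + i, (b # w) ! i) \<in> set (cls ! j)))" for b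
 proof -
  have "(3 + j \<in> Z \<union> Tg (lit r b) \<or> (\<exists>i<length l. (Suc r + i, w ! i) \<in> set (cls ! j))) \<longleftrightarrow>
   (3 + j \<in> Z \<or> (\<exists>i<length (q # l). (r + i, (b # w) ! i) \<in> set (cls ! j)))" if "j < cn" for j w
   using Tg_lit[of r j b] Cons.prems that by (simp add: Ex_less_Suc2)
  hence "(\<forall>j<cn. 3 + j \<in> Z \<union> Tg (lit r b) \<or> (\<exists>i<length l. (Suc r + i, w ! i) \<in> set (cls ! j))) \<longleftrightarrow>
   (\<forall>j<cn. 3 + j \<in> Z \<or> (\<exists>i<length (q # l). (r + i, (b # w) ! i) \<in> set (cls ! j)))" for w by blast
  moreover have "Suc r + length l = vn" using Cons.prems by simp
  ultimately show ?thesis using Cons.IH[of "Suc r" "Z \<union> Tg (lit r b)"] by (simp only:)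
 qed
 show ?case unfolding val.simps eS Qp.simps using mm IH by (cases q) (auto simp: ex_bool_eq all_bool_eq)
qed

definition stp :: "nat \<times> nat set => nat \<times> nat set" where
 "stp y = (F (fst y) (snd y), snd y \<union> Tg (F (fst y) (snd y)))"

definition arr :: "(nat => nat set) => nat => enat" where
 "arr S i = (if \<exists>n. i \<in> S n then enat (LEAST n. i \<in> S n) else \<infinity>)"

lemma arr_le:
 assumes "mono S" shows "arr S i \<le> enat n \<longleftrightarrow> i \<in> S n"
proof
 assume "i \<in> S n"
 thus "arr S i \<le> enat n" by (auto simp: arr_def intro: Least_le)
next
 assume a: "arr S i \<le> enat n"
 then obtain n' where "i \<in> S n'" by (auto simp: arr_def split: if_splits)
 hence "i \<in> S (LEAST n. i \<in> S n)" "(LEAST n. i \<in> S n) \<le> n"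
  using a by (auto intro: LeastI simp: arr_def split: if_splits)
 thus "i \<in> S n" using monoD[OF assms] by blast
qed

text \<open>A vertex with a possible set of reached players: it includes those whose target is at
  the vertex and excludes player 1, who has no target.\<close>

definition okp :: "nat \<times> nat set => bool" where
 "okp y \<longleftrightarrow> fst y < tn & snd y \<subseteq> players (game_of (inst J)) & Tg (fst y) \<subseteq> snd y & Suc 0 \<notin> snd y"

lemma okp_move: "okp y ==> w \<in> set (sc (fst y)) ==> okp (w, snd y \<union> Tg w)"
 using sc_less[of "fst y" w] TgI(2) by (auto simp: okp_def Tg_def)

lemma okp_stp: "okp y ==> okp ((stp ^^ i) y)"
proof -
 have "okp (stp y)" if "okp y" for y
  unfolding stp_def by (rule okp_move[OF that F_step(1)]) (use that in \<open>simp add: okp_def\<close>)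
 thus "okp y ==> okp ((stp ^^ i) y)" by (induction i) simp_all
qed

lemma stp_mono: "mono (%m. snd ((stp ^^ m) y))"
 by (rule mono_iff_le_Suc[THEN iffD2]) (auto simp: stp_def)

lemma arrival:
 "okp y ==> i = 0 \<or> i = 2 ==> i \<notin> snd y ==> i \<in> snd ((stp ^^ t) y) \<longleftrightarrow> et (fst y) (snd y) \<le> enat t"
proof (induction t arbitrary: y)
 case 0
 hence "fst y ~= xt" using TgI(1,3) by (auto simp: okp_def)
 thus ?case using 0 et_0[of "fst y" "snd y"] by (auto simp: okp_def zero_enat_def[symmetric])
next
 case (Suc t)
 let ?w = "F (fst y) (snd y)"
 have v: "fst y < tn" "fst y ~= xt" using Suc.prems TgI(1,3) by (auto simp: okp_def)
 have eq: "(stp ^^ Suc t) y = (stp ^^ t) (stp y)" by (simp add: funpow_swap1)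
 have et: "et (fst y) (snd y) = eSuc (et (fst (stp y)) (snd (stp y)))"
  using F_step(2)[OF v] by (simp add: stp_def)
 have ok: "okp (stp y)" using okp_stp[OF Suc.prems(1), of 1] by simp
 show ?case
 proof (cases "i \<in> snd (stp y)")
  case True
  hence "?w = xt" using Suc.prems(2,3) TgI(1,3) by (auto simp: stp_def)
  hence "et (fst (stp y)) (snd (stp y)) = 0" by (simp add: stp_def et_ex)
  moreover have "i \<in> snd ((stp ^^ t) (stp y))" using monoD[OF stp_mono[of "stp y"], of 0 t] True by auto
  ultimately show ?thesis unfolding eq et by (simp add: one_eSuc[symmetric] one_enat_def)
 next
  case False
  have "eSuc x \<le> enat (Suc t) \<longleftrightarrow> x \<le> enat t" for x by (simp flip: eSuc_enat)
  thus ?thesis unfolding eq et Suc.IH[OF ok Suc.prems(2) False] by simp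
 qed
qed

text \<open>Anything may be promised to player 1, who never arrives, and the time \<open>et\<close>
  to player 2. Nothing is promised to the clause owners: one that moves has arrived already or takes
  the exit in this very step.\<close>

definition Dq :: "nat \<times> nat => nat set => nat => enat => bool" where
 "Dq s Z j k \<longleftrightarrow> fst s = 0 & okp (snd s, Z) &
   (j = Suc 0 \<or> k \<le> 0 \<or> j = 2 & 2 \<notin> Z & k \<le> et (snd s) Z)"

text \<open>The canonical play is consistent: a deviation of player 2 leads to a position whose exit
  time is at least the remaining one, because player 2 minimises, and the deviator is promised
  exactly that time.\<close>

lemma canonical:
 assumes y: "okp y"
 defines "\<rho> \<equiv> %m. (0 :: nat, fst ((stp ^^ m) y))" and "c \<equiv> arr (%m. snd ((stp ^^ m) y))"
 shows "cons Dq \<rho> c" "zero c 0 = snd y" "c (Suc 0) = \<infinity>"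
  "!!i. i = 0 \<or> i = 2 ==> i \<notin> snd y ==> c i = et (fst y) (snd y)"
proof -
 let ?S = "%m. snd ((stp ^^ m) y)" and ?v = "%m. fst ((stp ^^ m) y)"
 have c: "c i \<le> enat m \<longleftrightarrow> i \<in> ?S m" for i m unfolding c_def by (rule arr_le[OF stp_mono])
 have ok: "okp ((stp ^^ m) y)" for m by (rule okp_stp[OF y])
 have z: "zero c m = ?S m" for m using ok[of m] unfolding zero_def c okp_def by blast
 show "zero c 0 = snd y" unfolding z by simp
 show "c (Suc 0) = \<infinity>"
  using ok unfolding okp_def c_def arr_def by auto
 show "c i = et (fst y) (snd y)" if "i = 0 \<or> i = 2" "i \<notin> snd y" for i
  by (rule enat_eqI) (unfold c arrival[OF y that], rule HOL.refl)
 have S: "(stp ^^ Suc m) y = (F (?v m) (?S m), ?S m \<union> Tg (F (?v m) (?S m)))" for m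
  by (simp add: stp_def)
 have v: "?v m < tn" for m using ok[of m] by (simp add: okp_def)
 show "cons Dq \<rho> c" unfolding cons_def z
 proof (intro allI conjI impI)
  fix m
  show "mv (\<rho> m) (\<rho> (Suc m))" unfolding mv \<rho>_def S fst_conv snd_conv using v F_step(1)[OF v] by simp
  show "?S (Suc m) = ?S m \<union> Tg (snd (\<rho> (Suc m)))" unfolding \<rho>_def S fst_conv snd_conv ..
  fix w assume "(snd (\<rho> m), w) \<in> edges (game_of (inst J))"
  hence w: "w \<in> set (sc (?v m))" by (simp add: sets edge \<rho>_def)
  let ?j = "ow (snd (\<rho> m))"
  have j: "?j = qown qs cn (?v m)" using ow_q[OF v] by (simp add: \<rho>_def)
  have okw: "okp (w, ?S m \<union> Tg w)" by (rule okp_move[OF ok w])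
  have zero: "c i - enat (Suc m) \<le> 0" if "c i \<le> enat (Suc m)" for i using that by (cases "c i") (auto simp: zero_enat_def)
  have "?j = Suc 0 \<or> c ?j - enat (Suc m) \<le> 0 \<or> ?j = 2 & 2 \<notin> ?S m \<union> Tg w & c ?j - enat (Suc m) \<le> et w (?S m \<union> Tg w)"
   using v[of m]
  proof (cases rule: vertex_cases)
   case 1
   show ?thesis
   proof (cases "qs ! ?v m")
    case True
    thus ?thesis unfolding j using 1 by (simp add: qown_def)
   next
    case False
    hence j2: "?j = 2" unfolding j using 1 by (simp add: qown_def)
    obtain b where b: "w = lit (?v m) b" using w 1 by (auto simp: sc_choose)
    have wx: "w ~= xt" using 1 b by (simp add: qlit_def qex_def)
    show ?thesis
    proof (cases "2 \<in> ?S m")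
     case True
     hence "c 2 \<le> enat (Suc m)" unfolding c by (simp add: stp_def)
     thus ?thesis unfolding j2 using zero[of 2] by blast
    next
     case 2: False
     have "c 2 - enat (Suc m) \<le> et w (?S m \<union> Tg w)"
     proof (rule enat_leI)
      fix n assume n: "et w (?S m \<union> Tg w) \<le> enat n"
      have "et (?v m) (?S m) \<le> eSuc (et w (?S m \<union> Tg w))"
       using et_choose[OF 1] False b by (cases b) (auto simp: min_def)
      also have "\<dots> \<le> enat (Suc n)" using n by (simp flip: eSuc_enat)
      finally have "2 \<in> snd ((stp ^^ Suc n) ((stp ^^ m) y))" using arrival[OF ok, of 2 m "Suc n"] 2 by blast
      also have "(stp ^^ Suc n) ((stp ^^ m) y) = (stp ^^ (Suc m + n)) y" unfolding funpow_add[THEN fun_cong, unfolded o_apply, symmetric]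
       by (simp add: add.commute)
      finally show "c 2 - enat (Suc m) \<le> enat n" unfolding enat_diff_le c .
     qed
     thus ?thesis using j2 2 wx TgI(3) by simp
    qed
   qed
  next
   case (2 r b)
   hence "?j = Suc 0" unfolding j by (auto simp: qown_def qlit_def)
   thus ?thesis by simp
  next
   case (3 i)
   hence j3: "?j = 3 + i" unfolding j by (simp add: qown_def)
   have "3 + i \<in> ?S (Suc m)"
   proof (cases "3 + i \<in> ?S m")
    case False
    hence "F (?v m) (?S m) = xt" using 3 by (simp add: F_def)
    thus ?thesis unfolding S using TgI(4)[of i xt] 3(1) by simp
   qed (simp add: stp_def)
   hence "c ?j \<le> enat (Suc m)" unfolding c j3 .
   thus ?thesis using zero by blast
  next
   case 4
   thus ?thesis unfolding j by (simp add: qown_def)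
  next
   case 5
   thus ?thesis unfolding j by (simp add: qown_def qex_def)
  qed
  moreover have "fst (\<rho> (Suc m)) = 0" by (simp add: \<rho>_def)
  ultimately show "Dq (fst (\<rho> (Suc m)), w) (?S m \<union> Tg w) ?j (c ?j - enat (Suc m))"
   using okw unfolding Dq_def by auto
 qed
qed

lemma closed_Dq: "closed Dq"
 unfolding closed_def
proof (intro allI impI)
 fix s Z j k assume d: "Dq s Z j k"
 hence y: "okp (snd s, Z)" by (simp add: Dq_def)
 let ?c = "arr (%m. snd ((stp ^^ m) (snd s, Z)))"
 note can = canonical[OF y, unfolded fst_conv snd_conv]
 have "k \<le> ?c j" using d can(3) can(4)[of 2] unfolding Dq_def by (auto intro: order_trans)
 thus "\<exists>\<rho> c. \<rho> 0 = s & zero c 0 = Z & k \<le> c j & cons Dq \<rho> c"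
  using can(1,2) d by (intro exI[of _ "%m. (0, fst ((stp ^^ m) (snd s, Z)))"] exI[of _ ?c]) (auto simp: Dq_def prod_eq_iff)
qed

text \<open>If the value were finite, an equilibrium play avoiding the exit would lead to one with a
  smaller finite value. At a universal variable player 2 would have to be promised infinity after
  the minimising move as well; at an existential one every move lowers the value; and at a clause
  without a chosen literal the owner would prefer to leave.\<close>

lemma never_exit:
 assumes D: "closed D"
 shows "cons D \<rho> c ==> c 2 = \<infinity> ==> et (snd (\<rho> 0)) (zero c 0) ~= enat k"
proof (induction k arbitrary: \<rho> c rule: less_induct)
 case (less k)
 let ?v = "snd (\<rho> 0)" and ?w = "snd (\<rho> (Suc 0))" and ?Z = "zero c 0"
 note st = less.prems(1)[unfolded cons_def, rule_format]
 have mv01: "mv (\<rho> m) (\<rho> (Suc m))" for m using st by blast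
 have v: "?v < tn" and w: "?w \<in> set (sc ?v)" using mv01[of 0] by (auto simp: mv)
 have z1: "zero c (Suc 0) = ?Z \<union> Tg ?w" using st[of 0] by blast
 have inf2: "2 \<notin> zero c m" for m using less.prems(2) by (simp add: zero_def)
 have notx: "snd (\<rho> (Suc m)) ~= xt" for m
  using st[of m] inf2[of "Suc m"] TgI(3)[of "snd (\<rho> (Suc m))"] by blast
 have step: "et ?w (?Z \<union> Tg ?w) ~= enat k'" if "k' < k" for k'
 proof -
  let ?c = "%i. c i - enat 1"
  have "cons D (%n. \<rho> (Suc n)) ?c" by (rule cons_shift[OF less.prems(1)])
  moreover have "zero ?c 0 = zero c (Suc 0)" unfolding zero_def enat_diff_le by simp
  ultimately show ?thesis using less.IH[OF that, of "%n. \<rho> (Suc n)" ?c] less.prems(2) z1 by simp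
 qed
 have dev: "D (fst (\<rho> (Suc 0)), u) (?Z \<union> Tg u) (ow ?v) (c (ow ?v) - enat (Suc 0))" if "u \<in> set (sc ?v)" for u
  using st[of 0] that not_L[OF v] v by (auto simp: sets edge)
 show ?case
 proof
  assume k: "et ?v ?Z = enat k"
  show False using v
  proof (cases rule: vertex_cases)
   case 1
   let ?u = "F ?v ?Z"
   have vx: "?v ~= xt" using 1 by (simp add: qex_def)
   have ek: "et ?v ?Z = eSuc (et ?u (?Z \<union> Tg ?u))" by (rule F_step(2)[OF v vx])
   obtain k' where k': "et ?u (?Z \<union> Tg ?u) = enat k'" "k' < k"
    using ek k by (cases "et ?u (?Z \<union> Tg ?u)") (auto simp: eSuc_enat)
   show False
   proof (cases "qs ! ?v")
    case True
    obtain b where b: "?w = lit ?v b" using w 1 by (auto simp: sc_choose)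
    have "eSuc (et ?w (?Z \<union> Tg ?w)) \<le> et ?v ?Z"
     using et_choose[OF 1, of ?Z] True b by (cases b) (auto simp: max_def)
    then obtain k'' where "et ?w (?Z \<union> Tg ?w) = enat k''" "k'' < k"
     using k by (cases "et ?w (?Z \<union> Tg ?w)") (auto simp: eSuc_enat)
    thus False using step by blast
   next
    case False
    hence "ow ?v = 2" using ow_q[OF v] 1 by (simp add: qown_def)
    hence "D (fst (\<rho> (Suc 0)), ?u) (?Z \<union> Tg ?u) 2 \<infinity>" using dev[OF F_step(1)[OF v]] less.prems(2) by simp
    then obtain \<rho>' c' where r: "\<rho>' 0 = (fst (\<rho> (Suc 0)), ?u)" "zero c' 0 = ?Z \<union> Tg ?u" "\<infinity> \<le> c' 2" "cons D \<rho>' c'"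
     using D unfolding closed_def by blast
    show False using less.IH[OF k'(2) r(4)] r(1,2,3) k'(1) by simp
   qed
  next
   case (2 r b)
   hence "?w = qnx qs r" using w by (simp add: sc_lit)
   hence "et ?v ?Z = eSuc (et ?w (?Z \<union> Tg ?w))" using 2 by (simp add: Tg_nx et_nx et_lit)
   then obtain k' where "et ?w (?Z \<union> Tg ?w) = enat k'" "k' < k"
    using k by (cases "et ?w (?Z \<union> Tg ?w)") (auto simp: eSuc_enat)
   thus False using step by blast
  next
   case (3 j)
   have w': "?w = Suc (wn + j)" using w 3 notx[of 0] by (auto simp: sc_clause)
   have t: "Tg ?w = {}" using w' notx[of 0] by (intro Tg_cl) auto
   show False
   proof (cases "3 + j \<in> ?Z")
    case True
    have "et ?w ?Z = cv (Suc j) ?Z" using et_clause[of "Suc j"] 3(1) w' by simp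
    hence "et ?v ?Z = eSuc (et ?w (?Z \<union> Tg ?w))"
     using cv_step[OF True] et_clause[of j ?Z] 3 t by simp
    then obtain k' where "et ?w (?Z \<union> Tg ?w) = enat k'" "k' < k"
     using k by (cases "et ?w (?Z \<union> Tg ?w)") (auto simp: eSuc_enat)
    thus False using step by blast
   next
    case False
    \<comment> \<open>After the variables no target except the exit is left, so on this play the
      owner never arrives and would gain by leaving.\<close>
    have late: "wn \<le> snd (\<rho> m)" for m
    proof (induction m)
     case (Suc m)
     have "snd (\<rho> m) < tn" "snd (\<rho> (Suc m)) \<in> set (sc (snd (\<rho> m)))" using mv01[of m] by (auto simp: mv)
     thus ?case using Suc by (auto simp: qsucc_def qex_def split: if_splits)
    qed (use 3 in simp)
    have "zero c m = ?Z" for m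
     by (induction m) (use st Tg_cl[OF late notx] in auto)
    moreover have "3 + j \<in> players (game_of (inst J))" using 3(1) by (simp add: sets sel)
    ultimately have "\<not> c (3 + j) \<le> enat m" for m using False by (auto simp: zero_def)
    hence "c (3 + j) = \<infinity>" by (cases "c (3 + j)") auto
    moreover have "ow ?v = 3 + j" using ow_q[OF v] 3 by (simp add: qown_def)
    ultimately have "D (fst (\<rho> (Suc 0)), xt) (?Z \<union> Tg xt) (3 + j) \<infinity>" using dev[of xt] 3 by (simp add: sc_clause)
    then obtain \<rho>' c' where r: "zero c' 0 = ?Z \<union> Tg xt" "\<infinity> \<le> c' (3 + j)"
     using D unfolding closed_def by blast
    have "3 + j \<in> zero c' 0" unfolding r(1) using TgI(4)[of j xt] 3(1) by simp
    thus False using r(2) by (simp add: zero_def)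
   qed
  next
   case 4
   thus False using k et_goal by simp
  next
   case 5
   hence "?w = xt" using w by (simp add: sc_ex)
   thus False using notx by blast
  qed
 qed
qed

theorem game_iff:
 "above (inst J) \<longleftrightarrow>
  \<not> Qp qs (%w. \<forall>cl\<in>set cls. \<exists>i<length qs. (i, w ! i) \<in> set cl)"
proof -
 have v0: "jv J \<in> verts (game_of (inst J))" using init_node by (simp add: nodes_iff sets)
 have t: "of_rat (th_of (jth J)) = (0 :: real)" by (simp add: sel th_of_def of_rat_rat)
 have vn0: "0 < vn" using vn by simp
 have T0: "Tg (jv J) = {}" using Tg_choose[OF vn0] by (simp add: sel)
 have p: "pay k \<le> 0 \<longleftrightarrow> k = \<infinity>" for k
 proof (cases k)
  case (enat n)
  have "0 < 1 / (1 + real n)" by simp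
  thus ?thesis using enat by (simp add: pay_def not_le)
 qed (simp add: pay_def)
 have "\<not> above (inst J) \<longleftrightarrow>
  (\<exists>D \<rho> c. closed D & cons D \<rho> c & \<rho> 0 = (0, 0) & zero c 0 = {} & c 0 = \<infinity>)"
  using SPE_iff_closed[OF v0, of 0] unfolding all_fixed_SPE_above_def inst_sel t not_less not_all not_imp T0 p
  by (simp add: sets sel not_less)
 also have "\<dots> \<longleftrightarrow> et 0 {} = \<infinity>"
 proof
  assume "et 0 {} = \<infinity>"
  have y: "okp (0, {})" using v0 T0 by (simp add: okp_def sets sel)
  note can = canonical[OF y, unfolded fst_conv snd_conv]
  show "\<exists>D \<rho> c. closed D & cons D \<rho> c & \<rho> 0 = (0, 0) & zero c 0 = {} & c 0 = \<infinity>"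
   using closed_Dq can(1,2) can(4)[of 0] \<open>et 0 {} = \<infinity>\<close>
   by (intro exI[of _ Dq] exI[of _ "%m. (0, fst ((stp ^^ m) (0, {})))"] exI) auto
 next
  assume "\<exists>D \<rho> c. closed D & cons D \<rho> c & \<rho> 0 = (0, 0) & zero c 0 = {} & c 0 = \<infinity>"
  then obtain D \<rho> c where D: "closed D" "cons D \<rho> c" "\<rho> 0 = (0, 0)" "zero c 0 = {}" "c 0 = \<infinity>" by blast
  note st = D(2)[unfolded cons_def, rule_format]
  have "0 \<notin> zero c m" for m using D(5) by (simp add: zero_def)
  hence x: "snd (\<rho> (Suc m)) ~= xt" for m using st[of m] TgI(1)[of "snd (\<rho> (Suc m))"] by blast
  have z2: "2 \<notin> zero c m" for m
   by (induction m) (use D(4) st TgI(3) x in auto)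
  \<comment> \<open>Player 2 has the same target as Leader.\<close>
  have "c 2 = \<infinity>"
  proof (cases "c 2")
   case (enat n)
   hence "2 \<in> zero c n" by (simp add: zero_def sets sel)
   thus ?thesis using z2 by blast
  qed
  thus "et 0 {} = \<infinity>" using never_exit[OF D(1,2)] D(3,4) by (cases "et 0 {}") auto
 qed
 also have "\<dots> \<longleftrightarrow> Qp qs (%w. \<forall>j<cn. \<exists>i<vn. (i, w ! i) \<in> set (cls ! j))"
  using val_Qp[of 0 qs "{}"] vn0 by (simp add: et_def)
 finally show ?thesis unfolding all_set_conv_all_nth by blast
qed

end

section \<open>Iterating Horn rules as a quantified Boolean formula\<close>

text \<open>A synchronous step: facts that are not derived anew are dropped. The operator is
  monotone but need not be inflationary, which lets its iterates follow changing
  configurations.\<close>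

definition horn :: "(nat list \<times> nat) list => nat set => nat set" where
 "horn rs X = {c. \<exists>ps. (ps, c) \<in> set rs & set ps \<subseteq> X}"

lemma horn_mono: "X \<subseteq> Y ==> horn rs X \<subseteq> horn rs Y"
 unfolding horn_def by blast

lemma horn_pow_mono: "X \<subseteq> Y ==> (horn rs ^^ k) X \<subseteq> (horn rs ^^ k) Y"
 by (induction k) (auto dest: horn_mono)

text \<open>A block of \<open>3 m + 1\<close> variables consists of three sets \<open>A\<close>, \<open>B\<close>, \<open>M\<close> and a bit \<open>u\<close>, where only \<open>u\<close>
 is universal. It claims that \<open>2 ^ d\<close> iterations lead from \<open>A\<close> into \<open>B\<close>, and \<open>M\<close> is the situation
 half way; \<open>u\<close> selects the half that the next block is about.\<close>

definition bA :: "nat => bool list => nat set" where "bA m v = {i. i < m & v ! i}"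
definition bB :: "nat => bool list => nat set" where "bB m v = {i. i < m & v ! (m + i)}"
definition bM :: "nat => bool list => nat set" where "bM m v = {i. i < m & v ! (m + m + i)}"

definition blk :: "nat => bool list" where
 "blk m = replicate (m + m + m) True @ [False]"

lemma Qp_cong: "(!!w. length w = length qs ==> P w = Q w) ==> Qp qs P \<longleftrightarrow> Qp qs Q"
proof (induction qs arbitrary: P Q)
 case (Cons q qs)
 have "Qp qs (%w. P (b # w)) \<longleftrightarrow> Qp qs (%w. Q (b # w))" for b
  by (rule Cons.IH) (use Cons.prems in simp)
 thus ?case by simp
qed simp

text \<open>Inclusions replace equations: by monotonicity the premises may be enlarged and the
  conclusions bounded from above. Every condition is then a family of implications between single
  variables or, at the bottom, of Horn rules.\<close>

primrec chain :: "(nat list \<times> nat) list => nat => nat => nat set => nat set => bool list => bool" where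
 "chain rs m 0 s t w \<longleftrightarrow> s \<subseteq> bA m w & bB m w \<subseteq> t & horn rs (bA m w) \<subseteq> bB m w"
| "chain rs m (Suc d) s t w \<longleftrightarrow> s \<subseteq> bA m w & bB m w \<subseteq> t &
   chain rs m d (if w ! (m + m + m) then bM m w else bA m w) (if w ! (m + m + m) then bB m w else bM m w) (drop (m + m + m + 1) w)"

lemma ex_sets:
 assumes "X \<subseteq> {..<m}" "Y \<subseteq> {..<m}" "Z \<subseteq> {..<m}"
 shows "\<exists>v. length v = m + m + m & bA m (v @ w) = X & bB m (v @ w) = Y & bM m (v @ w) = Z"
 by (rule exI[of _ "map (%i. i \<in> X) [0..<m] @ map (%i. i \<in> Y) [0..<m] @ map (%i. i \<in> Z) [0..<m]"])
  (use assms in \<open>auto simp: bA_def bB_def bM_def nth_append subset_iff\<close>)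

text \<open>Savitch's argument: the sets of a block are guessed, and the universal bit demands both
  halves while the formula mentions the next level only once.\<close>

lemma chain_Qp:
 assumes rs: "!!ps c. (ps, c) \<in> set rs ==> c < m"
 shows "s \<subseteq> {..<m} ==> t \<subseteq> {..<m} ==>
  Qp (concat (replicate (Suc d) (blk m))) (chain rs m d s t) \<longleftrightarrow> (horn rs ^^ (2 ^ d)) s \<subseteq> t"
proof (induction d arbitrary: s t)
 case 0
 have "Qp (concat (replicate (Suc 0) (blk m))) (chain rs m 0 s t) \<longleftrightarrow>
  (\<exists>v. length v = m + m + m & (\<forall>b. chain rs m 0 s t (v @ [b])))"
  by (simp add: blk_def Qp_append del: chain.simps)
 also have "\<dots> \<longleftrightarrow> horn rs s \<subseteq> t"
 proof
  assume "\<exists>v. length v = m + m + m & (\<forall>b. chain rs m 0 s t (v @ [b]))"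
  then obtain v where "chain rs m 0 s t (v @ [True])" by blast
  thus "horn rs s \<subseteq> t" using horn_mono[of s "bA m (v @ [True])" rs] by auto
 next
  assume h: "horn rs s \<subseteq> t"
  have "horn rs s \<subseteq> {..<m}" using rs by (auto simp: horn_def)
  then obtain v where v: "length v = m + m + m" "bA m (v @ []) = s" "bB m (v @ []) = horn rs s"
   using ex_sets[OF 0(1) _ 0(1), of "horn rs s" "[]"] by blast
  have "bA m (v @ w) = bA m v" "bB m (v @ w) = bB m v" for w using v(1) by (auto simp: bA_def bB_def nth_append)
  thus "\<exists>v. length v = m + m + m & (\<forall>b. chain rs m 0 s t (v @ [b]))"
   using v h by (intro exI[of _ v]) simp
 qed
 also have "horn rs s = (horn rs ^^ (2 ^ 0)) s" by simp
 finally show ?case .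
next
 case (Suc d)
 have app: "bA m (v @ w) = bA m v" "bB m (v @ w) = bB m v" "bM m (v @ w) = bM m v" "(v @ b # w) ! (m + m + m) = b"
   "drop (m + m + m + 1) (v @ b # w) = w"
  if "length v = m + m + m" for v w b using that by (auto simp: bA_def bB_def bM_def nth_append)
 have sub: "bA m v \<subseteq> {..<m}" "bB m v \<subseteq> {..<m}" "bM m v \<subseteq> {..<m}" for v
  by (auto simp: bA_def bB_def bM_def)
 have ch: "chain rs m (Suc d) s t (v @ b # w) \<longleftrightarrow> (s \<subseteq> bA m v & bB m v \<subseteq> t) &
   chain rs m d (if b then bM m v else bA m v) (if b then bB m v else bM m v) w" if "length v = m + m + m" for v b w
  unfolding chain.simps app[OF that] by blast
 have "Qp (concat (replicate (Suc (Suc d)) (blk m))) (chain rs m (Suc d) s t) \<longleftrightarrow>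
  (\<exists>v. length v = m + m + m & (\<forall>b. Qp (concat (replicate (Suc d) (blk m))) (%w. chain rs m (Suc d) s t (v @ b # w))))"
  unfolding replicate.simps(2)[of "Suc d"] concat.simps blk_def[of m] append_assoc Qp_append if_True by (simp del: chain.simps replicate.simps)
 also have "\<dots> \<longleftrightarrow> (\<exists>v. length v = m + m + m & (s \<subseteq> bA m v & bB m v \<subseteq> t) &
   (horn rs ^^ (2 ^ d)) (bM m v) \<subseteq> bB m v & (horn rs ^^ (2 ^ d)) (bA m v) \<subseteq> bM m v)"
 proof (intro ex_cong1 conj_cong HOL.refl)
  fix v :: "bool list" assume v: "length v = m + m + m"
  have "Qp (concat (replicate (Suc d) (blk m))) (%w. chain rs m (Suc d) s t (v @ b # w)) \<longleftrightarrow> (s \<subseteq> bA m v & bB m v \<subseteq> t) &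
   (horn rs ^^ (2 ^ d)) (if b then bM m v else bA m v) \<subseteq> (if b then bB m v else bM m v)" for b
   unfolding ch[OF v] Qp_conj using Suc.IH sub by simp
  thus "(\<forall>b. Qp (concat (replicate (Suc d) (blk m))) (%w. chain rs m (Suc d) s t (v @ b # w))) \<longleftrightarrow> (s \<subseteq> bA m v & bB m v \<subseteq> t) &
   (horn rs ^^ (2 ^ d)) (bM m v) \<subseteq> bB m v & (horn rs ^^ (2 ^ d)) (bA m v) \<subseteq> bM m v" by (simp add: all_bool_eq)
 qed
 also have "\<dots> \<longleftrightarrow> (horn rs ^^ (2 ^ d)) ((horn rs ^^ (2 ^ d)) s) \<subseteq> t"
 proof
  assume "\<exists>v. length v = m + m + m & (s \<subseteq> bA m v & bB m v \<subseteq> t) &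
   (horn rs ^^ (2 ^ d)) (bM m v) \<subseteq> bB m v & (horn rs ^^ (2 ^ d)) (bA m v) \<subseteq> bM m v"
  then obtain v where v: "s \<subseteq> bA m v" "bB m v \<subseteq> t" "(horn rs ^^ (2 ^ d)) (bM m v) \<subseteq> bB m v"
   "(horn rs ^^ (2 ^ d)) (bA m v) \<subseteq> bM m v" by blast
  have "(horn rs ^^ (2 ^ d)) s \<subseteq> bM m v" using horn_pow_mono[OF v(1)] v(4) by blast
  thus "(horn rs ^^ (2 ^ d)) ((horn rs ^^ (2 ^ d)) s) \<subseteq> t" using horn_pow_mono v(2,3) by blast
 next
  assume h: "(horn rs ^^ (2 ^ d)) ((horn rs ^^ (2 ^ d)) s) \<subseteq> t"
  have pw: "(horn rs ^^ k) X \<subseteq> {..<m}" if "X \<subseteq> {..<m}" for k X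
   using that rs by (cases k) (auto simp: horn_def)
  obtain v where v: "length v = m + m + m" "bA m (v @ []) = s" "bB m (v @ []) = (horn rs ^^ (2 ^ d)) ((horn rs ^^ (2 ^ d)) s)"
   "bM m (v @ []) = (horn rs ^^ (2 ^ d)) s"
   using ex_sets[OF Suc.prems(1) pw[OF pw[OF Suc.prems(1)]] pw[OF Suc.prems(1)]] by blast
  thus "\<exists>v. length v = m + m + m & (s \<subseteq> bA m v & bB m v \<subseteq> t) &
   (horn rs ^^ (2 ^ d)) (bM m v) \<subseteq> bB m v & (horn rs ^^ (2 ^ d)) (bA m v) \<subseteq> bM m v"
   using h by (intro exI[of _ v]) simp
 qed
 also have "\<dots> \<longleftrightarrow> (horn rs ^^ (2 ^ Suc d)) s \<subseteq> t"
  by (simp add: mult_2 funpow_add)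
 finally show ?case .
qed

text \<open>The inclusions between a block at \<open>p\<close> and the next one at \<open>q\<close>,
  under the universal bit \<open>u\<close>: if it is false the next block concerns the way from
  \<open>A\<close> to \<open>M\<close>, if true the way from \<open>M\<close> to
  \<open>B\<close>.\<close>

definition links :: "nat => nat => (nat \<times> bool) list list" where
 "links m b = (let p = b * (m + m + m + 1); q = p + (m + m + m + 1); u = p + (m + m + m) in
   concat (map (%i. [[(u, True), (p + i, False), (q + i, True)],
    [(u, True), (q + m + i, False), (p + m + m + i, True)],
    [(u, False), (p + m + m + i, False), (q + i, True)],
    [(u, False), (q + m + i, False), (p + m + i, True)]]) [0..<m]))"

text \<open>The formula bounds the facts after \<open>2 ^ m\<close> steps from above by all facts
  except \<open>f\<close>, which is what inclusions can express. It thus states that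
  \<open>f\<close> is not derived; this fits the game, where verification succeeds if the formula is
  false.\<close>

definition formula :: "(nat list \<times> nat) list => nat => nat list => nat => (nat \<times> bool) list list" where
 "formula rs m a f = map (%i. [(i, True)]) a @ [[(m + f, False)]] @ concat (map (links m) [0..<m]) @
   map (%r. map (%i. (m * (m + m + m + 1) + i, False)) (fst r) @ [(m * (m + m + m + 1) + m + snd r, True)]) rs"

definition prefix_of :: "nat => bool list" where
 "prefix_of m = concat (replicate (Suc m) (blk m))"

definition satc :: "(nat \<times> bool) list list => bool list => bool" where
 "satc cls w \<longleftrightarrow> (\<forall>cl\<in>set cls. \<exists>l\<in>set cl. w ! fst l = snd l)"

lemma satc_append: "satc (a @ b) w \<longleftrightarrow> satc a w & satc b w"
 and satc_concat: "satc (concat (map g l)) w \<longleftrightarrow> (\<forall>x\<in>set l. satc (g x) w)"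
 by (auto simp: satc_def)

lemma satc_links:
 assumes w: "w = u @ v" "length u = b * (m + m + m + 1)" "length v \<ge> m + m + m + 1 + (m + m + m + 1)"
 shows "satc (links m b) w \<longleftrightarrow>
  (if v ! (m + m + m) then bM m v else bA m v) \<subseteq> bA m (drop (m + m + m + 1) v) &
  bB m (drop (m + m + m + 1) v) \<subseteq> (if v ! (m + m + m) then bB m v else bM m v)"
proof -
 define L where "L = m + m + m + 1"
 define p where "p = b * L"
 have n1: "w ! (p + i) = v ! i" for i using w(1,2) unfolding p_def L_def by (metis nth_append_length_plus)
 have d: "drop L v ! i = v ! (L + i)" if "i < L" for i using w(3) by (simp add: that L_def)
 have dA: "bA m (drop L v) = {i. i < m & v ! (L + i)}"
  unfolding bA_def using d by (auto simp: L_def)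
 have dB: "bB m (drop L v) = {i. i < m & v ! (L + m + i)}"
  unfolding bB_def add.assoc[of L] using d[of "m + i" for i] by (auto simp: L_def)
 have "satc (links m b) w \<longleftrightarrow> (\<forall>i<m. (v ! (m + m + m) \<or> \<not> v ! i \<or> v ! (L + i)) &
   (v ! (m + m + m) \<or> \<not> v ! (L + m + i) \<or> v ! (m + m + i)) &
   (\<not> v ! (m + m + m) \<or> \<not> v ! (m + m + i) \<or> v ! (L + i)) &
   (\<not> v ! (m + m + m) \<or> \<not> v ! (L + m + i) \<or> v ! (m + i)))"
  unfolding links_def Let_def satc_concat L_def[symmetric] p_def[symmetric] satc_def
  by (auto simp: n1 add.assoc)
 also have "\<dots> \<longleftrightarrow> (if v ! (m + m + m) then bM m v else bA m v) \<subseteq> bA m (drop L v) &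
  bB m (drop L v) \<subseteq> (if v ! (m + m + m) then bB m v else bM m v)"
  unfolding dA dB by (cases "v ! (m + m + m)") (auto simp: bA_def bB_def bM_def)
 finally show ?thesis unfolding L_def .
qed

lemma chain_satc:
 assumes rs: "!!ps c. (ps, c) \<in> set rs ==> c < m & set ps \<subseteq> {..<m}"
 shows "w = u @ v ==> length u = b * (m + m + m + 1) ==> length v = Suc d * (m + m + m + 1) ==>
  chain rs m d s t v \<longleftrightarrow> s \<subseteq> bA m v & bB m v \<subseteq> t & (\<forall>i\<in>{b..<b+d}. satc (links m i) w) &
   satc (map (%r. map (%i. ((b + d) * (m + m + m + 1) + i, False)) (fst r) @ [((b + d) * (m + m + m + 1) + m + snd r, True)]) rs) w"
proof (induction d arbitrary: u v b s t)
 case 0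
 have n1: "w ! (b * (m + m + m + 1) + i) = v ! i" for i using 0(1,2) by (metis nth_append_length_plus)
 have "satc (map (%r. map (%i. (b * (m + m + m + 1) + i, False)) (fst r) @ [(b * (m + m + m + 1) + m + snd r, True)]) rs) w \<longleftrightarrow>
  (\<forall>r\<in>set rs. (\<exists>i\<in>set (fst r). \<not> v ! i) \<or> v ! (m + snd r))"
  unfolding satc_def using n1 n1[of "m + i" for i] by (auto simp: add.assoc)
 also have "\<dots> \<longleftrightarrow> horn rs (bA m v) \<subseteq> bB m v"
  using rs unfolding horn_def bA_def bB_def by fastforce
 finally show ?case by simp
next
 case (Suc d)
 let ?L = "m + m + m + 1"
 let ?v = "drop ?L v"
 have w: "w = (u @ take ?L v) @ ?v" "length (u @ take ?L v) = Suc b * ?L" "length ?v = Suc d * ?L"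
  using Suc.prems by auto
 have l: "satc (links m b) w \<longleftrightarrow>
  (if v ! (m + m + m) then bM m v else bA m v) \<subseteq> bA m ?v &
  bB m ?v \<subseteq> (if v ! (m + m + m) then bB m v else bM m v)"
  by (rule satc_links[OF Suc.prems(1,2)]) (use Suc.prems(3) in simp)
 have "{b..<b + Suc d} = insert b {Suc b..<Suc b + d}" by auto
 hence s: "(\<forall>i\<in>{b..<b + Suc d}. satc (links m i) w) \<longleftrightarrow> satc (links m b) w & (\<forall>i\<in>{Suc b..<Suc b + d}. satc (links m i) w)"
  by simp
 have e: "b + Suc d = Suc b + d" by simp
 show ?case unfolding chain.simps Suc.IH[OF w] s l unfolding e by blast
qed

theorem horn_Qp:
 assumes rs: "!!ps c. (ps, c) \<in> set rs ==> c < m & set ps \<subseteq> {..<m}" and a: "set a \<subseteq> {..<m}" and f: "f < m"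
 shows "Qp (prefix_of m) (satc (formula rs m a f)) \<longleftrightarrow> f \<notin> (horn rs ^^ (2 ^ m)) (set a)"
proof -
 have len: "length (prefix_of m) = Suc m * (m + m + m + 1)"
  unfolding prefix_of_def by (simp add: length_concat blk_def sum_list_replicate)
 have "satc (formula rs m a f) w \<longleftrightarrow> chain rs m m (set a) ({..<m} - {f}) w" if w: "length w = length (prefix_of m)" for w
 proof -
  have 1: "satc (map (%i. [(i, True)]) a) w \<longleftrightarrow> set a \<subseteq> bA m w" using a by (auto simp: satc_def bA_def)
  have 2: "satc [[(m + f, False)]] w \<longleftrightarrow> bB m w \<subseteq> {..<m} - {f}" using f by (auto simp: satc_def bB_def)
  show ?thesis
   using chain_satc[OF rs, where w = w and u = "[]" and v = w and b = 0 and d = m and s = "set a" and t = "{..<m} - {f}"] w[unfolded len]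
   unfolding formula_def satc_append satc_concat 1 2 by auto
 qed
 hence "Qp (prefix_of m) (satc (formula rs m a f)) \<longleftrightarrow> Qp (prefix_of m) (chain rs m m (set a) ({..<m} - {f}))"
  by (rule Qp_cong)
 also have "\<dots> \<longleftrightarrow> (horn rs ^^ (2 ^ m)) (set a) \<subseteq> {..<m} - {f}"
  unfolding prefix_of_def by (rule chain_Qp) (use rs a in auto)
 also have "\<dots> \<longleftrightarrow> f \<notin> (horn rs ^^ (2 ^ m)) (set a)"
 proof -
  have "(horn rs ^^ (2 ^ m)) (set a) \<subseteq> {..<m}"
  proof (cases "(2::nat) ^ m")
   case (Suc k)
   thus ?thesis using rs by (auto simp: horn_def)
  qed simp
  thus ?thesis by blast
 qed
 finally show ?thesis .
qed

lemma fp_formula: "fp (%x. formula (fst x) (fst (snd x)) (fst (snd (snd x))) (snd (snd (snd x))))"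
 unfolding formula_def links_def Let_def append.simps by (intro fp_intros)

lemma fp_prefix_of: "fp f ==> fp (%x. prefix_of (f x))"
 unfolding prefix_of_def blk_def by (intro fp_intros)

section \<open>Machine computations as Horn rules\<close>

lemma digit_inj:
 fixes x :: nat
 assumes "x * g + a = x' * g + a'" "a < g" "a' < g"
 shows "x = x' & a = a'"
proof -
 have "(x * g + a) div g = x" "(x * g + a) mod g = a" "(x' * g + a') div g = x'" "(x' * g + a') mod g = a'"
  using assms(2,3) by auto
 thus ?thesis using assms(1) by metis
qed

text \<open>Nothing is known about the size of \<open>n\<close>. But among the first
  \<open>2 ^ m + 1\<close> iterates two coincide, the sequence is periodic from the first of them
  on, and the period contains the stable value; so it is reached by then.\<close>

lemma iterate_stable:
 fixes h :: "nat set => nat set"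
 assumes X: "!!t. (h ^^ t) a \<subseteq> {..<m}" and st: "!!t. n \<le> t ==> (h ^^ t) a = (h ^^ n) a"
 shows "(h ^^ (2 ^ m)) a = (h ^^ n) a"
proof -
 let ?X = "%t. (h ^^ t) a"
 have "\<not> inj_on ?X {..2 ^ m}"
 proof
  assume "inj_on ?X {..2 ^ m}"
  hence "card {..(2::nat) ^ m} \<le> card (Pow {..<m})" using X by (intro card_inj_on_le) auto
  thus False by (simp add: card_Pow)
 qed
 then obtain i0 j0 where "i0 \<in> {..2 ^ m}" "j0 \<in> {..2 ^ m}" "?X i0 = ?X j0" "i0 ~= j0" unfolding inj_on_def by blast
 then obtain i j where ij: "i < j" "j \<le> 2 ^ m" "?X i = ?X j" by (cases i0 j0 rule: linorder_cases) auto
 have shift: "?X (u + t) = (h ^^ t) (?X u)" for u t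
  by (metis add.commute comp_apply funpow_add)
 have per: "?X (i + t * (j - i)) = ?X i" for t
 proof (induction t)
  case (Suc t)
  have "i + Suc t * (j - i) = i + t * (j - i) + (j - i)" by simp
  hence "?X (i + Suc t * (j - i)) = (h ^^ (j - i)) (?X (i + t * (j - i)))" by (metis shift)
  also have "\<dots> = (h ^^ (j - i)) (?X i)" by (simp only: Suc.IH)
  also have "\<dots> = ?X (i + (j - i))" by (rule shift[symmetric])
  finally show ?case using ij by simp
 qed simp
 have "n \<le> n * (j - i)" using ij(1) by (cases "j - i") auto
 hence "n \<le> i + n * (j - i)" by (rule trans_le_add2)
 hence "?X i = ?X n" using per[of n] st by metis
 moreover have "?X (i + (2 ^ m - i)) = (h ^^ (2 ^ m - i)) (?X i)" by (rule shift)
 moreover have "(h ^^ (2 ^ m - i)) (?X n) = ?X (n + (2 ^ m - i))" by (rule shift[symmetric])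
 moreover have "i + (2 ^ m - i) = 2 ^ m" using ij by simp
 ultimately show ?thesis using st[of "n + (2 ^ m - i)"] by simp
qed

text \<open>State \<open>q\<close> is number \<open>q\<close>; then come the facts that the cell of tape \<open>\<tau>\<close> at distance \<open>i - S\<close> from the
 head contains \<open>a\<close>. Working relative to the heads keeps the number of rules polynomial.\<close>

definition cell :: "nat => nat => nat => nat => nat => nat => nat" where
 "cell nq g S \<tau> i a = nq + ((\<tau> * (S + S + 1) + i) * g + a)"

lemma cell_inj:
 assumes "cell nq g S \<tau> i a = cell nq g S \<tau>' i' a'" "i < S + S + 1" "i' < S + S + 1" "a < g" "a' < g"
 shows "\<tau> = \<tau>' & i = i' & a = a'"
proof -
 have "(\<tau> * (S + S + 1) + i) * g + a = (\<tau>' * (S + S + 1) + i') * g + a'" using assms(1) by (simp add: cell_def)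
 from digit_inj[OF this assms(4,5)] digit_inj[of \<tau> "S + S + 1" i \<tau>' i'] assms(2,3) show ?thesis by auto
qed

text \<open>Halting becomes a transition that changes nothing, so every step is given by the same
  table.\<close>

definition act :: "machine => nat => nat list => nat \<times> (nat \<times> int) list" where
 "act M q ss = (if q = 1 \<or> q = 2 then (q, map (%a. (a, 0)) ss) else delta M q ss)"

lemma step_act: "step M c = (case act M (fst c) (map (%(tp, z). tp z) (snd c)) of (q', acts) =>
    (q', map2 (%(tp, z) (s, d). (tp(z := s), z + d)) (snd c) acts))"
proof (cases "halted c")
 case True
 have "map2 (%(tp, z) (s, d). (tp(z := s), z + d)) l (map (%a. (a, 0)) (map (%(tp, z). tp z) l)) = l"
  for l :: "((int => nat) \<times> int) list"
  by (induction l) auto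
 thus ?thesis using True by (auto simp: step_def act_def halted_def)
qed (auto simp: step_def act_def halted_def)

type_synonym entry = "nat \<times> nat list \<times> nat \<times> (nat \<times> nat) list"

text \<open>The program as data, moves being shifted by one.\<close>

definition entries :: "machine => entry list" where
 "entries M = map (%x. (fst x, snd x, fst (act M (fst x) (snd x)), map (%y. (fst y, nat (snd y + 1))) (snd (act M (fst x) (snd x)))))
   (List.product [0..<num_states M] (List.n_lists (num_tapes M) [0..<num_symbols M]))"

definition base :: "nat => nat => nat => nat => entry => nat list" where
 "base nq g k S e = fst e # map (%\<tau>. cell nq g S \<tau> S (lk (fst (snd e)) \<tau>)) [0..<k]"

text \<open>The window moves with the head: position \<open>i\<close> after the step was position
  \<open>p - 1\<close> before, where \<open>p\<close> is one larger in order to stay natural.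
  Outside the old window the cell is blank, at \<open>p = Suc S\<close> it has just been written,
  and otherwise its symbol is copied.\<close>

definition mrules :: "entry list => nat => nat => nat => nat => (nat list \<times> nat) list" where
 "mrules E nq g k S = concat (map (%e. (base nq g k S e, fst (snd (snd e))) #
   concat (map (%\<tau>. concat (map (%i. let p = i + snd (lk (snd (snd (snd e))) \<tau>) in
    if p = 0 \<or> S + S + 1 < p then [(base nq g k S e, cell nq g S \<tau> i 0)]
    else if p = Suc S then [(base nq g k S e, cell nq g S \<tau> i (fst (lk (snd (snd (snd e))) \<tau>)))]
    else map (%a. (cell nq g S \<tau> (p - 1) a # base nq g k S e, cell nq g S \<tau> i a)) [0..<g])
   [0..<S + S + 1])) [0..<k])) E)"

lemma fp_mrules:
 assumes "fp f" shows "fp (%x. mrules E nq g k (f x))"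
proof -
 have "fp (%y. base nq g k (fst y) (snd y))"
  unfolding base_def cell_def by (intro fp_intros fp_const)
 note b = fp_comp[OF this fp_Pair, simplified fst_conv snd_conv]
 have "fp (%S. mrules E nq g k S)"
  unfolding mrules_def Let_def cell_def by (intro fp_intros fp_const b)
 from fp_comp[OF this assms] show ?thesis .
qed

definition mstarts :: "nat => nat => nat => nat => bool list => nat list" where
 "mstarts nq g k S x = 0 # concat (map (%\<tau>. map (%i. cell nq g S \<tau> i
   (if \<tau> = 0 & S \<le> i & i - S < length x then (if lk x (i - S) then 2 else 1) else 0)) [0..<S + S + 1]) [0..<k])"

lemma fp_mstarts: "fp f ==> fp g' ==> fp (%x. mstarts nq g k (f x) (g' x))"
proof -
 have "fp (%y. mstarts nq g k (fst y) (snd y))"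
  unfolding mstarts_def cell_def by (intro fp_intros fp_const)
 from fp_comp[OF this fp_Pair, simplified fst_conv snd_conv] show "fp f ==> fp g' ==> fp (%x. mstarts nq g k (f x) (g' x))" .
qed

locale computation =
 fixes M :: machine and x :: "bool list" and s :: nat
 assumes M: "wf_machine M" and space: "uses_space M x s"
begin

abbreviation "k \<equiv> num_tapes M"
abbreviation "g \<equiv> num_symbols M"
abbreviation "nq \<equiv> num_states M"

text \<open>Nonblank cells are within \<open>s + length x\<close> of the origin and heads within
  \<open>s\<close>, so a cell that enters the window is blank.\<close>

definition S :: nat where "S = s + s + length x + 1"

abbreviation "ce \<equiv> cell nq g S"
abbreviation "nbits \<equiv> nq + k * (S + S + 1) * g"
abbreviation "E \<equiv> entries M"

lemma pos: "1 \<le> k" "3 \<le> g" "3 \<le> nq"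
 using M by (auto simp: wf_machine_def)

lemma act_wf:
 assumes "q < nq" "length ss = k" "set ss \<subseteq> {..<g}"
 shows "fst (act M q ss) < nq" "length (snd (act M q ss)) = k"
  "!!i. i < k ==> fst (snd (act M q ss) ! i) < g & snd (snd (act M q ss) ! i) \<in> {-1, 0, 1}"
proof -
 have d: "case delta M q ss of (q', acts) => q' < nq & length acts = k & set acts \<subseteq> {..<g} \<times> {- 1, 0, 1}"
  using M assms by (simp only: wf_machine_def)
 show "fst (act M q ss) < nq" "length (snd (act M q ss)) = k" using d assms by (auto simp: act_def case_prod_unfold)
 fix i assume i: "i < k"
 show "fst (snd (act M q ss) ! i) < g & snd (snd (act M q ss) ! i) \<in> {-1, 0, 1}"
 proof (cases "q = 1 \<or> q = 2")
  case True
  have "ss ! i \<in> set ss" using i assms(2) by simp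
  hence "ss ! i < g" using assms(3) by blast
  thus ?thesis using True i assms(2) by (auto simp: act_def)
 next
  case False
  hence "snd (act M q ss) ! i \<in> {..<g} \<times> {-1, 0, 1}"
   using d i nth_mem[of i "snd (act M q ss)"] by (auto simp: act_def case_prod_unfold)
  thus ?thesis by (auto simp: mem_Times_iff)
 qed
qed

definition enc_conf :: "config => nat set" where
 "enc_conf c = insert (fst c) {ce \<tau> i (fst (snd c ! \<tau>) (snd (snd c ! \<tau>) + int i - int S)) | \<tau> i. \<tau> < k & i < S + S + 1}"

definition inv :: "config => bool" where
 "inv c \<longleftrightarrow> fst c < nq & length (snd c) = k & (\<forall>\<tau><k. (\<forall>p. fst (snd c ! \<tau>) p < g) &
   (\<forall>p. \<bar>p\<bar> > int (s + length x) --> fst (snd c ! \<tau>) p = 0) & \<bar>snd (snd c ! \<tau>)\<bar> \<le> int s)"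

lemma mem_enc_conf: "y \<in> enc_conf c \<longleftrightarrow>
  y = fst c \<or> (\<exists>\<tau><k. \<exists>i<S + S + 1. y = ce \<tau> i (fst (snd c ! \<tau>) (snd (snd c ! \<tau>) + int i - int S)))"
 unfolding enc_conf_def by blast

abbreviation "syms c \<equiv> map (%(tp, z). tp z) (snd c)"

lemma syms:
 assumes "inv c" shows "length (syms c) = k" "set (syms c) \<subseteq> {..<g}"
  "!!\<tau>. \<tau> < k ==> syms c ! \<tau> = fst (snd c ! \<tau>) (snd (snd c ! \<tau>))"
proof -
 show l: "length (syms c) = k" using assms by (simp add: inv_def)
 show n: "!!\<tau>. \<tau> < k ==> syms c ! \<tau> = fst (snd c ! \<tau>) (snd (snd c ! \<tau>))"
  using assms by (simp add: inv_def case_prod_unfold)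
 have "syms c ! \<tau> < g" if "\<tau> < k" for \<tau> unfolding n[OF that] using assms that by (simp add: inv_def)
 thus "set (syms c) \<subseteq> {..<g}" using l by (metis in_set_conv_nth lessThan_iff subsetI)
qed

lemma step_nth:
 assumes "inv c" "\<tau> < k" defines "a \<equiv> snd (act M (fst c) (syms c)) ! \<tau>"
 shows "snd (step M c) ! \<tau> = ((fst (snd c ! \<tau>))(snd (snd c ! \<tau>) := fst a), snd (snd c ! \<tau>) + snd a)"
  "length (snd (step M c)) = k" "fst (step M c) = fst (act M (fst c) (syms c))"
proof -
 have l: "length (snd (act M (fst c) (syms c))) = k" "length (snd c) = k"
  using act_wf(2) syms[OF assms(1)] assms(1) by (auto simp: inv_def)
 thus "snd (step M c) ! \<tau> = ((fst (snd c ! \<tau>))(snd (snd c ! \<tau>) := fst a), snd (snd c ! \<tau>) + snd a)"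
  "length (snd (step M c)) = k" "fst (step M c) = fst (act M (fst c) (syms c))"
  using assms(2) unfolding step_act a_def by (auto simp: case_prod_unfold)
qed

lemma head_bound: "\<tau> < k ==> length (snd (run M x t)) = k ==> \<bar>snd (snd (run M x t) ! \<tau>)\<bar> \<le> int s"
 using space nth_mem[of \<tau> "snd (run M x t)"] unfolding uses_space_def by fastforce

lemma inv_run: "inv (run M x t)"
proof (induction t)
 case 0
 have "snd (init_config M x) ! \<tau> = (if \<tau> = 0 then (tape_of x, 0) else ((%_. 0), 0))" if "\<tau> < k" for \<tau>
  using that by (cases \<tau>) (auto simp: init_config_def)
 thus ?case using pos by (auto simp: run_def inv_def init_config_def tape_of_def)
next
 case (Suc t)
 let ?c = "run M x t"
 have r: "run M x (Suc t) = step M ?c" by (simp add: run_def)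
 note a = act_wf[OF _ syms(1,2)[OF Suc]]
 have q: "fst ?c < nq" using Suc by (simp add: inv_def)
 have l: "length (snd (step M ?c)) = k" using step_nth(2)[OF Suc, of 0] pos by simp
 show ?case unfolding inv_def
 proof (intro conjI allI impI)
  show "fst (run M x (Suc t)) < nq" unfolding r using step_nth(3)[OF Suc, of 0] pos a(1)[OF q] by simp
  show "length (snd (run M x (Suc t))) = k" unfolding r by (rule l)
  fix \<tau> assume t: "\<tau> < k"
  show "\<bar>snd (snd (run M x (Suc t)) ! \<tau>)\<bar> \<le> int s" by (rule head_bound[OF t]) (unfold r, rule l)
  show "fst (snd (run M x (Suc t)) ! \<tau>) p < g" for p
   unfolding r step_nth(1)[OF Suc t] using a(3)[OF q t] Suc t by (auto simp: inv_def)
  fix p :: int assume p: "\<bar>p\<bar> > int (s + length x)"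
  moreover have "\<bar>snd (snd ?c ! \<tau>)\<bar> \<le> int s" using Suc t by (simp add: inv_def)
  ultimately have "p ~= snd (snd ?c ! \<tau>)" by auto
  thus "fst (snd (run M x (Suc t)) ! \<tau>) p = 0"
   unfolding r step_nth(1)[OF Suc t] using Suc t p by (simp add: inv_def)
 qed
qed

lemma cell_less: "\<tau> < k ==> i < S + S + 1 ==> a < g ==> ce \<tau> i a < nbits"
proof -
 assume a: "\<tau> < k" "i < S + S + 1" "a < g"
 have "\<tau> * (S + S + 1) + i < k * (S + S + 1)"
  using a(1,2) mult_le_mono1[of "Suc \<tau>" k "S + S + 1"] by simp
 hence "(\<tau> * (S + S + 1) + i) * g + a < k * (S + S + 1) * g"
  using a(3) mult_le_mono1[of "Suc (\<tau> * (S + S + 1) + i)" "k * (S + S + 1)" g] by simp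
 thus ?thesis by (simp add: cell_def)
qed

lemma mem_enc:
 assumes "inv c"
 shows "q < nq ==> q \<in> enc_conf c \<longleftrightarrow> q = fst c"
  "\<tau> < k ==> i < S + S + 1 ==> a < g ==>
   ce \<tau> i a \<in> enc_conf c \<longleftrightarrow> a = fst (snd c ! \<tau>) (snd (snd c ! \<tau>) + int i - int S)"
proof -
 show "q < nq ==> q \<in> enc_conf c \<longleftrightarrow> q = fst c" by (auto simp: enc_conf_def cell_def)
 assume t: "\<tau> < k" "i < S + S + 1" "a < g"
 have "fst c < nq" using assms by (simp add: inv_def)
 hence ne: "ce \<tau> i a ~= fst c" by (auto simp: cell_def)
 show "ce \<tau> i a \<in> enc_conf c \<longleftrightarrow> a = fst (snd c ! \<tau>) (snd (snd c ! \<tau>) + int i - int S)"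
 proof
  assume "ce \<tau> i a \<in> enc_conf c"
  then obtain \<tau>' i' where e: "\<tau>' < k" "i' < S + S + 1"
   "ce \<tau> i a = ce \<tau>' i' (fst (snd c ! \<tau>') (snd (snd c ! \<tau>') + int i' - int S))"
   using ne unfolding enc_conf_def by blast
  thus "a = fst (snd c ! \<tau>) (snd (snd c ! \<tau>) + int i - int S)"
   using cell_inj[OF e(3) t(2) e(2) t(3)] assms by (auto simp: inv_def)
 qed (use t in \<open>auto simp: enc_conf_def\<close>)
qed

lemma base_enc:
 assumes "inv c" "q < nq" "length ss = k" "set ss \<subseteq> {..<g}"
 shows "set (base nq g k S (q, ss, r)) \<subseteq> enc_conf c \<longleftrightarrow> q = fst c & ss = syms c"
proof -
 have "set (base nq g k S (q, ss, r)) \<subseteq> enc_conf c \<longleftrightarrow> q \<in> enc_conf c & (\<forall>\<tau><k. ce \<tau> S (ss ! \<tau>) \<in> enc_conf c)"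
  using assms(3) by (auto simp: base_def)
 also have "\<dots> \<longleftrightarrow> q = fst c & (\<forall>\<tau><k. ss ! \<tau> = syms c ! \<tau>)"
 proof -
  have "ce \<tau> S (ss ! \<tau>) \<in> enc_conf c \<longleftrightarrow> ss ! \<tau> = syms c ! \<tau>" if "\<tau> < k" for \<tau>
  proof -
   have "ss ! \<tau> \<in> set ss" using that assms(3) by simp
   hence "ss ! \<tau> < g" using assms(4) by blast
   thus ?thesis using mem_enc(2)[OF assms(1) that, of S "ss ! \<tau>"] syms(3)[OF assms(1) that] by simp
  qed
  thus ?thesis using mem_enc(1)[OF assms(1,2)] by blast
 qed
 also have "\<dots> \<longleftrightarrow> q = fst c & ss = syms c"
  using assms(3) syms(1)[OF assms(1)] by (auto intro: nth_equalityI)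
 finally show ?thesis .
qed

lemma mem_entries:
 "e \<in> set E \<longleftrightarrow> (\<exists>q<nq. \<exists>ss. length ss = k & set ss \<subseteq> {..<g} &
   e = (q, ss, fst (act M q ss), map (%y. (fst y, nat (snd y + 1))) (snd (act M q ss))))"
 by (auto simp: entries_def set_n_lists subset_iff image_iff)

lemma content:
 assumes c: "inv c" "\<tau> < k" "i < S + S + 1"
 defines "a \<equiv> snd (act M (fst c) (syms c)) ! \<tau>"
 defines "v \<equiv> fst (snd (step M c) ! \<tau>) (snd (snd (step M c) ! \<tau>) + int i - int S)"
  and "p \<equiv> i + nat (snd a + 1)"
 shows "p = 0 \<or> S + S + 1 < p ==> v = 0" "p = Suc S ==> v = fst a"
  "\<not> (p = 0 \<or> S + S + 1 < p) ==> p ~= Suc S ==>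
    v = fst (snd c ! \<tau>) (snd (snd c ! \<tau>) + int (p - 1) - int S) & p - 1 < S + S + 1"
proof -
 have q: "fst c < nq" using c(1) by (simp add: inv_def)
 have d: "snd a \<in> {-1, 0, 1}" unfolding a_def using act_wf(3)[OF q syms(1,2)[OF c(1)] c(2)] by blast
 let ?z = "snd (snd c ! \<tau>)"
 have v: "v = ((fst (snd c ! \<tau>))(?z := fst a)) (?z + snd a + int i - int S)"
  unfolding v_def step_nth(1)[OF c(1,2)] a_def by simp
 have p: "int p = int i + snd a + 1" using d by (auto simp: p_def)
 have z: "\<bar>?z\<bar> \<le> int s" and bl: "\<bar>y\<bar> > int (s + length x) ==> fst (snd c ! \<tau>) y = 0" for y
  using c(1,2) by (auto simp: inv_def)
 have y: "?z + snd a + int i - int S = ?z + (int p - 1) - int S" using p by simp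
 show "v = 0" if "p = 0 \<or> S + S + 1 < p"
 proof -
  have o: "int p = 0 \<or> int p = 2 * int S + 2" using that c(3) d p by auto
  hence "\<bar>?z + (int p - 1) - int S\<bar> > int (s + length x)" using z by (auto simp: S_def)
  moreover have "?z + (int p - 1) - int S ~= ?z" using o by auto
  ultimately show ?thesis unfolding v y using bl by simp
 qed
 show "v = fst a" if "p = Suc S" unfolding v y that by simp
 show "v = fst (snd c ! \<tau>) (?z + int (p - 1) - int S) & p - 1 < S + S + 1"
  if "\<not> (p = 0 \<or> S + S + 1 < p)" "p ~= Suc S"
 proof -
  have "int (p - 1) = int p - 1" using that(1) by simp
  moreover have "?z + (int p - 1) - int S ~= ?z" using that(2) by auto
  ultimately show ?thesis unfolding v y using that(1) by auto
 qed
qed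

abbreviation "rules \<equiv> mrules E nq g k S"
abbreviation "bas \<equiv> base nq g k S"

definition rule :: "entry => nat => nat => nat list => nat => bool" where
 "rule e \<tau> i ps h \<longleftrightarrow> (let p = i + snd (lk (snd (snd (snd e))) \<tau>) in
   if p = 0 \<or> S + S + 1 < p then ps = bas e & h = ce \<tau> i 0
   else if p = Suc S then ps = bas e & h = ce \<tau> i (fst (lk (snd (snd (snd e))) \<tau>))
   else \<exists>a<g. ps = ce \<tau> (p - 1) a # bas e & h = ce \<tau> i a)"

lemma mem_rules:
 "(ps, h) \<in> set rules \<longleftrightarrow> (\<exists>e\<in>set E. ps = bas e & h = fst (snd (snd e)) \<or>
   (\<exists>\<tau><k. \<exists>i<S + S + 1. rule e \<tau> i ps h))"
proof -
 have u: "(\<exists>i\<in>set [0..<n]. P i) \<longleftrightarrow> (\<exists>i<n. P i)" for n P by auto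
 have m: "y \<in> set (concat (map f l)) \<longleftrightarrow> (\<exists>a\<in>set l. y \<in> set (f a))" for y f l by simp
 have i: "y \<in> set (if b then l else l') \<longleftrightarrow> (if b then y \<in> set l else y \<in> set l')" for b y l l' by simp
 have l: "(ps, h) \<in> set (map (%a. (ce \<tau> (p - 1) a # bas e, ce \<tau> i a)) [0..<g]) \<longleftrightarrow>
  (\<exists>a<g. ps = ce \<tau> (p - 1) a # bas e & h = ce \<tau> i a)" for \<tau> p i e by auto
 show ?thesis unfolding mrules_def rule_def Let_def m i u l
  by (simp only: list.set insert_iff empty_iff prod.inject m i u l simp_thms)
qed

lemma rule_base: "rule e \<tau> i ps h ==> set (bas e) \<subseteq> set ps"
 by (auto simp: rule_def Let_def split: if_splits)

lemma ex_premises: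
 assumes "set l \<subseteq> X"
 shows "(\<exists>ps. set ps \<subseteq> X & (\<exists>a<n. ps = f a # l & Q a)) \<longleftrightarrow> (\<exists>a<(n::nat). f a \<in> X & Q a)"
proof
 assume "\<exists>a<n. f a \<in> X & Q a"
 then obtain a where "a < n" "f a \<in> X" "Q a" by blast
 thus "\<exists>ps. set ps \<subseteq> X & (\<exists>a<n. ps = f a # l & Q a)"
  using assms by (intro exI[of _ "f a # l"]) auto
qed auto

text \<open>The facts of a configuration satisfy the base premises of exactly one entry, the one for
  the current state and symbols. Its rules derive one symbol for each tape and window
  position.\<close>

lemma horn_step:
 assumes c: "inv c"
 shows "horn rules (enc_conf c) = enc_conf (step M c)"
proof -
 let ?q = "fst c" and ?ss = "syms c"
 define acts where "acts = snd (act M ?q ?ss)"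
 define e0 where "e0 = (?q, ?ss, fst (act M ?q ?ss), map (%y. (fst y, nat (snd y + 1))) acts)"
 have q: "?q < nq" using c by (simp add: inv_def)
 note s = syms[OF c] and a = act_wf[OF q syms(1,2)[OF c], folded acts_def]
 have e0: "e0 \<in> set E" unfolding mem_entries e0_def acts_def using q s by blast
 have uniq: "set (bas e) \<subseteq> enc_conf c \<longleftrightarrow> e = e0" if e: "e \<in> set E" for e
 proof -
  obtain q ss where qs: "q < nq" "length ss = k" "set ss \<subseteq> {..<g}"
   "e = (q, ss, fst (act M q ss), map (%y. (fst y, nat (snd y + 1))) (snd (act M q ss)))"
   using e unfolding mem_entries by blast
  show ?thesis unfolding qs(4) base_enc[OF c qs(1-3)] e0_def acts_def by auto
 qed
 have b: "set (bas e0) \<subseteq> enc_conf c" using uniq[OF e0] by blast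
 have lk0: "lk (snd (snd (snd e0))) \<tau> = (fst (acts ! \<tau>), nat (snd (acts ! \<tau>) + 1))" if "\<tau> < k" for \<tau>
  using that a(2) by (simp add: e0_def)
 let ?v = "%\<tau> i. fst (snd (step M c) ! \<tau>) (snd (snd (step M c) ! \<tau>) + int i - int S)"
 have key: "(\<exists>ps. set ps \<subseteq> enc_conf c & rule e0 \<tau> i ps h) \<longleftrightarrow> h = ce \<tau> i (?v \<tau> i)"
  if t: "\<tau> < k" "i < S + S + 1" for \<tau> i h
 proof -
  note con = content[OF c t, folded acts_def]
  let ?p = "i + nat (snd (acts ! \<tau>) + 1)"
  have lt: "fst (snd c ! \<tau>) y < g" for y using c t(1) by (simp add: inv_def)
  consider "?p = 0 \<or> S + S + 1 < ?p" | "\<not> (?p = 0 \<or> S + S + 1 < ?p)" "?p = Suc S"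
   | "\<not> (?p = 0 \<or> S + S + 1 < ?p)" "?p ~= Suc S" by blast
  thus ?thesis
  proof cases
   case 1
   thus ?thesis using b unfolding rule_def Let_def lk0[OF t(1)] fst_conv snd_conv con(1)[OF 1]
    by (simp only: if_True) blast
  next
   case 2
   thus ?thesis using b unfolding rule_def Let_def lk0[OF t(1)] fst_conv snd_conv con(2)[OF 2(2)]
    by (simp only: if_True if_False simp_thms) blast
  next
   case 3
   have v: "?v \<tau> i = fst (snd c ! \<tau>) (snd (snd c ! \<tau>) + int (?p - 1) - int S)" and p: "?p - 1 < S + S + 1"
    using con(3)[OF 3] by blast+
   have "rule e0 \<tau> i ps h \<longleftrightarrow> (\<exists>a<g. ps = ce \<tau> (?p - 1) a # bas e0 & h = ce \<tau> i a)" for ps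
    using 3 unfolding rule_def Let_def lk0[OF t(1)] fst_conv snd_conv by (simp only: if_False)
   hence "(\<exists>ps. set ps \<subseteq> enc_conf c & rule e0 \<tau> i ps h) \<longleftrightarrow> (\<exists>a<g. ce \<tau> (?p - 1) a \<in> enc_conf c & h = ce \<tau> i a)"
    by (simp only: ex_premises[OF b])
   also have "\<dots> \<longleftrightarrow> h = ce \<tau> i (?v \<tau> i)"
    unfolding v using mem_enc(2)[OF c t(1) p] lt by blast
   finally show ?thesis .
  qed
 qed
 have "h \<in> horn rules (enc_conf c) \<longleftrightarrow> h = fst (act M ?q ?ss) \<or> (\<exists>\<tau><k. \<exists>i<S + S + 1. h = ce \<tau> i (?v \<tau> i))" for h
 proof -
  have "h \<in> horn rules (enc_conf c) \<longleftrightarrow> (\<exists>ps. set ps \<subseteq> enc_conf c & (ps, h) \<in> set rules)"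
   unfolding horn_def by blast
  also have "\<dots> \<longleftrightarrow> h = fst (snd (snd e0)) \<or> (\<exists>\<tau><k. \<exists>i<S + S + 1. \<exists>ps. set ps \<subseteq> enc_conf c & rule e0 \<tau> i ps h)"
   (is "?l \<longleftrightarrow> ?r")
  proof
   assume ?l
   then obtain ps e where ps: "set ps \<subseteq> enc_conf c" "e \<in> set E"
    "ps = bas e & h = fst (snd (snd e)) \<or> (\<exists>\<tau><k. \<exists>i<S + S + 1. rule e \<tau> i ps h)"
    unfolding mem_rules by blast
   hence "set (bas e) \<subseteq> set ps" using rule_base by blast
   hence "e = e0" using ps(1) uniq[OF ps(2)] by blast
   thus ?r using ps(1,3) by blast
  next
   assume ?r
   thus ?l unfolding mem_rules using e0 b by blast
  qed
  also have "\<dots> \<longleftrightarrow> h = fst (act M ?q ?ss) \<or> (\<exists>\<tau><k. \<exists>i<S + S + 1. h = ce \<tau> i (?v \<tau> i))"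
  proof -
   have gen: "(!!\<tau> i. \<tau> < k ==> i < n ==> P \<tau> i \<longleftrightarrow> Q \<tau> i) ==>
    (A \<or> (\<exists>\<tau><k. \<exists>i<n. P \<tau> i)) \<longleftrightarrow> (A \<or> (\<exists>\<tau><k. \<exists>i<n. Q \<tau> i))" for A P Q and n :: nat by blast
   have e: "fst (snd (snd e0)) = fst (act M ?q ?ss)" by (simp add: e0_def)
   show ?thesis unfolding e by (rule gen, rule key)
  qed
  finally show ?thesis .
 qed
 moreover have "fst (step M c) = fst (act M ?q ?ss)" using step_nth(3)[OF c, of 0] pos by simp
 ultimately show ?thesis unfolding set_eq_iff mem_enc_conf by (simp only: simp_thms)
qed

lemma rules_bound:
 assumes "(ps, h) \<in> set rules"
 shows "h < nbits & set ps \<subseteq> {..<nbits}"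
proof -
 obtain e where e: "e \<in> set E" "ps = bas e & h = fst (snd (snd e)) \<or> (\<exists>\<tau><k. \<exists>i<S + S + 1. rule e \<tau> i ps h)"
  using assms unfolding mem_rules by blast
 obtain q ss where qs: "q < nq" "length ss = k" "set ss \<subseteq> {..<g}"
   "e = (q, ss, fst (act M q ss), map (%y. (fst y, nat (snd y + 1))) (snd (act M q ss)))"
  using e(1) unfolding mem_entries by blast
 note a = act_wf[OF qs(1-3)]
 have g0: "0 < g" using pos by simp
 have "ce \<tau> S (ss ! \<tau>) < nbits" if "\<tau> < k" for \<tau>
 proof -
  have "ss ! \<tau> \<in> set ss" using that qs(2) by simp
  thus ?thesis using qs(3) that by (intro cell_less) auto
 qed
 hence b: "set (bas e) \<subseteq> {..<nbits}" using qs(1,2) unfolding qs(4) by (auto simp: base_def)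
 have lk: "fst (lk (snd (snd (snd e))) \<tau>) < g" if "\<tau> < k" for \<tau> using a(2,3) that unfolding qs(4) by simp
 have 1: "fst (snd (snd e)) < nbits" using a(1) unfolding qs(4) by simp
 from e(2) show ?thesis
 proof (elim disjE exE conjE)
  fix \<tau> i assume t: "\<tau> < k" "i < S + S + 1" "rule e \<tau> i ps h"
  let ?p = "i + snd (lk (snd (snd (snd e))) \<tau>)"
  consider "ps = bas e" "h = ce \<tau> i 0" | "ps = bas e" "h = ce \<tau> i (fst (lk (snd (snd (snd e))) \<tau>))"
   | a where "a < g" "?p - 1 < S + S + 1" "ps = ce \<tau> (?p - 1) a # bas e" "h = ce \<tau> i a"
   using t(3) unfolding rule_def Let_def by (auto split: if_splits)
  thus ?thesis using b cell_less[OF t(1,2)] cell_less[OF t(1)] lk[OF t(1)] g0 by cases auto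
 qed (use b 1 in simp)
qed

lemma set_mstarts: "set (mstarts nq g k S x) = enc_conf (run M x 0)"
proof -
 have n: "snd (init_config M x) ! \<tau> = (if \<tau> = 0 then (tape_of x, 0) else ((%_. 0), 0))" if "\<tau> < k" for \<tau>
  using that by (cases \<tau>) (auto simp: init_config_def)
 have v: "(if \<tau> = 0 & S \<le> i & i - S < length x then (if lk x (i - S) then 2 else 1) else 0) =
   fst (snd (init_config M x) ! \<tau>) (snd (snd (init_config M x) ! \<tau>) + int i - int S)" if "\<tau> < k" for \<tau> i
 proof (cases "\<tau> = 0 & S \<le> i")
  case True
  hence e: "int i - int S = int (i - S)" by simp
  have "tape_of x (int i - int S) = (if i - S < length x then (if x ! (i - S) then 2 else 1) else 0)"
   unfolding e tape_of_def by (simp only: nat_int of_nat_less_iff of_nat_0_le_iff simp_thms)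
  thus ?thesis using True that by (simp add: n)
 next
  case False
  hence "\<tau> ~= 0 \<or> int i - int S < 0" by auto
  thus ?thesis using False that by (auto simp: n tape_of_def)
 qed
 have "fst (init_config M x) = 0" by (simp add: init_config_def)
 moreover have "y \<in> set (mstarts nq g k S x) \<longleftrightarrow> y = 0 \<or> (\<exists>\<tau><k. \<exists>i<S + S + 1. y = ce \<tau> i
   (if \<tau> = 0 & S \<le> i & i - S < length x then (if lk x (i - S) then 2 else 1) else 0))" for y
 proof -
  have u: "(\<exists>i\<in>set [0..<n]. P i) \<longleftrightarrow> (\<exists>i<n. P i)" "z \<in> set (map f [0..<n]) \<longleftrightarrow> (\<exists>i<n. z = f i)"
   for n P and f :: "nat => nat" and z by auto
  have m: "z \<in> set (concat (map f l)) \<longleftrightarrow> (\<exists>a\<in>set l. z \<in> set (f a))" for z f l by simp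
  show ?thesis unfolding mstarts_def by (simp only: set_simps insert_iff u m)
 qed
 moreover have "y = 0 \<or> (\<exists>\<tau><k. \<exists>i<S + S + 1. y = ce \<tau> i
   (if \<tau> = 0 & S \<le> i & i - S < length x then (if lk x (i - S) then 2 else 1) else 0)) \<longleftrightarrow>
  y = 0 \<or> (\<exists>\<tau><k. \<exists>i<S + S + 1. y = ce \<tau> i (fst (snd (init_config M x) ! \<tau>) (snd (snd (init_config M x) ! \<tau>) + int i - int S)))" for y
  by (simp only: v cong: conj_cong)
 ultimately show ?thesis unfolding run_def funpow_0 set_eq_iff mem_enc_conf by (simp only: simp_thms)
qed

lemma enc_conf_bound: "enc_conf (run M x t) \<subseteq> {..<nbits}"
proof -
 have 1: "fst (run M x t) < nbits" using inv_run[of t] by (simp add: inv_def)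
 have "fst (snd (run M x t) ! \<tau>) p < g" if "\<tau> < k" for \<tau> p using inv_run[of t] that by (simp add: inv_def)
 hence "ce \<tau> i (fst (snd (run M x t) ! \<tau>) p) < nbits" if "\<tau> < k" "i < S + S + 1" for \<tau> i p
  using that by (intro cell_less)
 thus ?thesis using 1 unfolding enc_conf_def by auto
qed

text \<open>Fact 1 is the accepting state. Halted configurations repeat, so the exact number of
  iterations is irrelevant once it is large enough.\<close>

theorem accepts_iff:
 assumes "halted (run M x n)"
 shows "1 \<in> (horn rules ^^ (2 ^ nbits)) (set (mstarts nq g k S x)) \<longleftrightarrow> fst (run M x n) = 1"
proof -
 have pw: "(horn rules ^^ t) (enc_conf (run M x 0)) = enc_conf (run M x t)" for t
 proof (induction t)
  case (Suc t)
  have "run M x (Suc t) = step M (run M x t)" by (simp add: run_def)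
  thus ?case using Suc by (simp add: horn_step[OF inv_run])
 qed simp
 have stab: "run M x t = run M x n" if "n \<le> t" for t
  using that
 proof (induction t rule: dec_induct)
  case (step t)
  thus ?case using assms by (simp add: run_def step_def)
 qed simp
 have "(horn rules ^^ (2 ^ nbits)) (enc_conf (run M x 0)) = (horn rules ^^ n) (enc_conf (run M x 0))"
 proof (rule iterate_stable)
  show "(horn rules ^^ t) (enc_conf (run M x 0)) \<subseteq> {..<nbits}" for t unfolding pw by (rule enc_conf_bound)
  show "(horn rules ^^ t) (enc_conf (run M x 0)) = (horn rules ^^ n) (enc_conf (run M x 0))" if "n \<le> t" for t
   unfolding pw stab[OF that] ..
 qed
 hence "(horn rules ^^ (2 ^ nbits)) (enc_conf (run M x 0)) = enc_conf (run M x n)" using pw by simp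
 thus ?thesis unfolding set_mstarts using mem_enc(1)[OF inv_run, of 1 n] pos by auto
qed

end

section \<open>Hardness\<close>

lemma length_prefix_of: "length (prefix_of m) = Suc m * (m + m + m + 1)"
 unfolding prefix_of_def by (simp add: length_concat blk_def sum_list_replicate)

lemma formula_vars:
 assumes rs: "!!ps c. (ps, c) \<in> set rs ==> c < m & set ps \<subseteq> {..<m}" and a: "set a \<subseteq> {..<m}" and f: "f < m"
  and cl: "cl \<in> set (formula rs m a f)" "l \<in> set cl"
 shows "fst l < length (prefix_of m)"
proof -
 let ?L = "m + m + m + 1"
 have blk: "b * ?L + i < Suc m * ?L" if "b \<le> m" "i < ?L" for b i
  using mult_le_mono1[OF that(1), of ?L] that(2) by simp
 from cl(1) consider i where "i \<in> set a" "cl = [(i, True)]" | "cl = [(m + f, False)]"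
  | b where "b < m" "cl \<in> set (links m b)"
  | r where "r \<in> set rs" "cl = map (%i. (m * ?L + i, False)) (fst r) @ [(m * ?L + m + snd r, True)]"
  unfolding formula_def by auto
 thus ?thesis
 proof cases
  case 1
  hence "i < m" "l = (i, True)" using a cl(2) by auto
  thus ?thesis using blk[of 0 i] by (simp add: length_prefix_of)
 next
  case 2
  thus ?thesis using blk[of 0 "m + f"] f cl(2) by (simp add: length_prefix_of)
 next
  case (3 b)
  have q: "b * ?L + ?L + i < Suc m * ?L" "b * ?L + i < Suc m * ?L" if "i < ?L" for i
   using blk[of "Suc b" i] blk[of b i] 3(1) that by (simp_all add: algebra_simps)
  obtain i where i: "i < m" "fst l \<in> {b * ?L + (m + m + m), b * ?L + i, b * ?L + ?L + i, b * ?L + ?L + (m + i),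
   b * ?L + (m + m + i), b * ?L + (m + i)}"
   using 3(2) cl(2) unfolding links_def Let_def by (auto simp: add.assoc)
  thus ?thesis unfolding length_prefix_of
   using q[of "m + m + m"] q[of i] q[of "m + i"] q[of "m + m + i"] by auto
 next
  case (4 r)
  have "snd r < m" "set (fst r) \<subseteq> {..<m}" using rs[of "fst r" "snd r"] 4(1) by auto
  hence "\<exists>i<m + m. fst l = m * ?L + i" using cl(2) unfolding 4(2)
   by (auto simp: add.assoc intro: trans_less_add1)
  then obtain i where "i < m + m" "fst l = m * ?L + i" by blast
  thus ?thesis using blk[of m i] unfolding length_prefix_of by simp
 qed
qed

definition reduction :: "machine => nat poly => bool list => idata" where
 "reduction M p x = (let nq = num_states M; g = num_symbols M; k = num_tapes M;
   S = poly p (length x) + poly p (length x) + length x + 1; m = nq + k * (S + S + 1) * g in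
   qinst (prefix_of m) (formula (mrules (entries M) nq g k S) m (mstarts nq g k S x) 1))"

lemma fp_reduction: "fp (reduction M p)"
proof -
 note f = fp_comp[OF fp_formula fp_Pair[OF _ fp_Pair[OF _ fp_Pair]], simplified fst_conv snd_conv]
 show ?thesis unfolding reduction_def Let_def
  by (intro fp_qinst fp_prefix_of f fp_mrules fp_mstarts fp_intros fp_const)
qed

lemma reduction:
 assumes M: "wf_machine M" "uses_space M x (poly p (length x))" "halted (run M x n)"
 defines "I \<equiv> inst (reduction M p x)"
 shows "encode I = encJ (reduction M p x)"
  "valid_instance I"
  "deterministic_mealy (game_of I) (mealy_of I)"
  "above I \<longleftrightarrow>
   fst (run M x n) = 1"
proof -
 interpret c: computation M x "poly p (length x)" using M(1,2) by unfold_locales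
 let ?m = "num_states M + num_tapes M * (c.S + c.S + 1) * num_symbols M"
 let ?a = "mstarts (num_states M) (num_symbols M) (num_tapes M) c.S x"
 let ?f = "formula c.rules ?m ?a 1"
 have red: "reduction M p x = qinst (prefix_of ?m) ?f"
  unfolding reduction_def Let_def c.S_def[symmetric] ..
 have a: "set ?a \<subseteq> {..<?m}"
  unfolding c.set_mstarts by (rule c.enc_conf_bound)
 have f1: "1 < ?m" using c.pos by simp
 have vars: "cl \<in> set ?f ==> l \<in> set cl ==> fst l < length (prefix_of ?m)" for cl l
  by (rule formula_vars[OF c.rules_bound a f1])
 have ne: "prefix_of ?m ~= []" using length_prefix_of[of ?m] by auto
 interpret q: qgame "prefix_of ?m" ?f using vars ne by unfold_locales
 have th: "fst (snd (jth (reduction M p x))) = [False]" "snd (snd (jth (reduction M p x))) = [True]"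
  unfolding red q.sel by simp_all
 show "encode I = encJ (reduction M p x)"
  by (unfold I_def, rule encJ) (use q.jok th red in simp_all)
 show "valid_instance I" using q.valJ valJ red by (simp add: I_def)
 show "deterministic_mealy (game_of I) (mealy_of I)"
  using q.detJ detJ[OF q.jok q.valJ] red by (simp add: I_def)
 have s: "satc ?f w \<longleftrightarrow> (\<forall>cl\<in>set ?f. \<exists>i<length (prefix_of ?m). (i, w ! i) \<in> set cl)" for w
 proof -
  have "(\<exists>l\<in>set cl. w ! fst l = snd l) \<longleftrightarrow> (\<exists>i<length (prefix_of ?m). (i, w ! i) \<in> set cl)" if "cl \<in> set ?f" for cl
   using vars[OF that] by force
  thus ?thesis unfolding satc_def by blast
 qed
 have "above I \<longleftrightarrow>
  \<not> Qp (prefix_of ?m) (satc ?f)"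
  using q.game_iff unfolding I_def red s by (simp add: inst_def)
 also have "\<dots> \<longleftrightarrow> 1 \<in> (horn c.rules ^^ (2 ^ ?m)) (set ?a)"
  using horn_Qp[OF c.rules_bound a f1] by blast
 also have "\<dots> \<longleftrightarrow> fst (run M x n) = 1" by (rule c.accepts_iff[OF M(3)])
 finally show "above I \<longleftrightarrow>
   fst (run M x n) = 1" .
qed

text \<open>The constructed instances are deterministic, so one map reduces to both problems;
  injectivity of \<open>encode\<close> identifies the instance behind an encoding.\<close>

lemma verification_hard: "PSPACE_hard reach_SP_verification" "PSPACE_hard reach_det_SP_verification"
proof -
 have "\<exists>f. polytime_computable f & (\<forall>x. (x \<in> A \<longleftrightarrow> f x \<in> reach_SP_verification) & (x \<in> A \<longleftrightarrow> f x \<in> reach_det_SP_verification))"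
  if "A \<in> PSPACE" for A
 proof -
  obtain M p where M: "wf_machine M" "!!x. uses_space M x (poly p (length x))"
   "!!x. \<exists>n. halted (run M x n) & (fst (run M x n) = 1 \<longleftrightarrow> x \<in> A)"
   using \<open>A \<in> PSPACE\<close> unfolding PSPACE_def by blast
  have "polytime_computable (%x. encJ (reduction M p x))"
   by (rule fp_polytime) (rule fp_encJ[OF fp_reduction])
  moreover have "(x \<in> A \<longleftrightarrow> encJ (reduction M p x) \<in> reach_SP_verification) &
   (x \<in> A \<longleftrightarrow> encJ (reduction M p x) \<in> reach_det_SP_verification)" for x
  proof -
   obtain n where n: "halted (run M x n)" "fst (run M x n) = 1 \<longleftrightarrow> x \<in> A" using M(3) by blast
   note r = reduction[OF M(1) M(2) n(1)]
   have i: "encode I = encode I' \<longleftrightarrow> I = I'" for I I' using inj_encode by (auto simp: inj_def)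
   show ?thesis unfolding reach_SP_verification_def reach_det_SP_verification_def r(1)[symmetric] mem_Collect_eq i
    using r(2-4) n(2) by blast
  qed
  ultimately show ?thesis by blast
 qed
 thus "PSPACE_hard reach_SP_verification" "PSPACE_hard reach_det_SP_verification"
  unfolding PSPACE_hard_def polytime_reducible_def by blast+
qed

theorem theorem16:
 shows "PSPACE_complete reach_SP_verification & PSPACE_complete reach_det_SP_verification"
 using verification_PSPACE verification_hard by (simp add: PSPACE_complete_def)

end
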